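(* There is a natural transformation of functors (from braided vector spaces to braided Hopf algebras) $$\mathcal S\colon\mathcal A\to\mathcal C,$$ the quantum symmetrizer, such that for every $V$ $$\mathcal B(V)\cong\mathcal A(V)/\ker(\mathcal S)\cong\operatorname{im}\mathcal S\subset\mathcal C(V)$$ is the Nichols algebra of $V$, and $Q\mathcal B(V)\cong V\cong P\mathcal B(V)$. In particular, the Hopf ideal of $\mathcal A(V)$ generated by the primitives of degree $\ge2$ is contained in $\ker\mathcal S$.
   Context: $k$ is a field (algebraically closed of characteristic $0$). $\mathcal V_c$ is the category of braided vector spaces of finite abelian group type: crossed (Yetter–Drinfeld) modules over $kG$, $G$ a finite abelian group, with braiding $c(v\otimes w)=v_{-1}w\otimes v_0$. Braided algebras, coalgebras and Hopf algebras are taken in this braided monoidal category; in a braided Hopf algebra $\Delta m=(m\otimes m)(1\otimes c\otimes1)(\Delta\otimes\Delta)$. For a braided Hopf algebra $A$: $P(A)=\{y\in A:\Delta(y)=y\otimes1+1\otimes y\}$ is the space of primitives and $Q(A)=JA/(JA)^2$, $JA=\ker\varepsilon$, the space of indecomposables. $\mathcal A(V)$ is the free connected graded braided Hopf algebra on $V$: the tensor algebra $T(V)$ with its usual multiplication and with the unique comultiplication that is a morphism of braided algebras and satisfies $\Delta(v)=v\otimes1+1\otimes v$ for $v\in V$. $\mathcal C(V)$ is the cofree connected graded braided Hopf algebra on $V$: $T(V)$ with its usual (deconcatenation) tensor coalgebra structure and with the unique multiplication $m_{\mathcal C}$ that is a morphism of braided coalgebras $T(V)\otimes T(V)\to T(V)$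 whose composition with the projection $T(V)\to V$ is the sum of the two obvious projections $T(V)\otimes T(V)\to V\otimes k\oplus k\otimes V\to V$ (the braided shuffle multiplication). The Nichols algebra of $V$ is the connected graded braided Hopf algebra $R=\bigoplus_{n\ge 0}R_n$ with $R_1\cong V$, generated as an algebra by $R_1$, and with $P(R)=R_1$. *)

theory Defs
  imports "HOL-Algebra.Module" "HOL-Algebra.QuotRing" "HOL-Algebra.Ideal_Product"
    "HOL-Library.Poly_Mapping" "HOL-Computational_Algebra.Polynomial"
begin

section \<open>Vector spaces given by generators and relations\<close>

text \<open>Vector spaces over the field \<open>'k\<close> are modules, in the sense of HOL-Algebra, over the following
  ring. In a module record which is not an algebra the fields \<open>mult\<close> and \<open>one\<close> carry no meaning.\<close>

definition scalars :: "'k::field ring" where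
  "scalars = \<lparr>carrier = UNIV, monoid.mult = (*), one = 1, zero = 0, add = (+)\<rparr>"

definition klinear ::
    "('k::field, 'a, 'm) module_scheme \<Rightarrow> ('k, 'b, 'n) module_scheme \<Rightarrow> ('a \<Rightarrow> 'b) \<Rightarrow> bool" where
  "klinear M N f \<longleftrightarrow> f \<in> carrier M \<rightarrow> carrier N \<and>
     (\<forall>x\<in>carrier M. \<forall>y\<in>carrier M. f (x \<oplus>\<^bsub>M\<^esub> y) = f x \<oplus>\<^bsub>N\<^esub> f y) \<and>
     (\<forall>a. \<forall>x\<in>carrier M. f (a \<odot>\<^bsub>M\<^esub> x) = a \<odot>\<^bsub>N\<^esub> f x)"

definition lspan :: "('k::field, 'a, 'm) module_scheme \<Rightarrow> 'a set \<Rightarrow> 'a set" where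
  "lspan M X = \<Inter>{H. submodule H scalars M \<and> X \<subseteq> H}"

text \<open>The type \<open>'x \<Rightarrow>\<^sub>0 'k\<close> is the free vector space on \<open>'x\<close>.\<close>

definition fscale :: "'k::field \<Rightarrow> ('x \<Rightarrow>\<^sub>0 'k) \<Rightarrow> ('x \<Rightarrow>\<^sub>0 'k)" where
  "fscale a p = Poly_Mapping.map ((*) a) p"

definition pcls :: "('x \<Rightarrow>\<^sub>0 'k::field) set \<Rightarrow> ('x \<Rightarrow>\<^sub>0 'k) \<Rightarrow> ('x \<Rightarrow>\<^sub>0 'k) set" where
  "pcls Rel p = {q. q - p \<in> Modules.module.span fscale Rel}"

text \<open>The vector space with generators \<open>X\<close> and relations \<open>Rel\<close> (which must be supported in \<open>X\<close>).\<close>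

definition presented :: "'x set \<Rightarrow> ('x \<Rightarrow>\<^sub>0 'k::field) set \<Rightarrow> ('k, ('x \<Rightarrow>\<^sub>0 'k) set) module" where
  "presented X Rel =
    \<lparr>carrier = {pcls Rel p |p. Poly_Mapping.keys p \<subseteq> X}, monoid.mult = undefined, one = undefined,
     zero = pcls Rel 0, add = (\<lambda>c d. \<Union>p\<in>c. \<Union>q\<in>d. pcls Rel (p + q)),
     module.smult = (\<lambda>a c. \<Union>p\<in>c. pcls Rel (fscale a p))\<rparr>"

text \<open>The linear map from a presented vector space to \<open>M\<close> with prescribed values \<open>f\<close> on the
  generators; meaningful if \<open>f\<close> respects the relations.\<close>

definition lin_ext ::
    "('k::field, 'b, 'm) module_scheme \<Rightarrow> ('x \<Rightarrow> 'b) \<Rightarrow> ('x \<Rightarrow>\<^sub>0 'k) set \<Rightarrow> 'b" where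
  "lin_ext M f c = the_elem ((\<lambda>p. \<Oplus>\<^bsub>M\<^esub>x\<in>Poly_Mapping.keys p. Poly_Mapping.lookup p x \<odot>\<^bsub>M\<^esub> f x) ` c)"


section \<open>Tensor products of vector spaces\<close>

type_synonym ('k, 'a, 'b) tens = "('a \<times> 'b \<Rightarrow>\<^sub>0 'k) set"

definition tens_rel ::
    "('k::field, 'a, 'm) module_scheme \<Rightarrow> ('k, 'b, 'n) module_scheme \<Rightarrow> ('a \<times> 'b \<Rightarrow>\<^sub>0 'k) set" where
  "tens_rel U W =
    {Poly_Mapping.single (u \<oplus>\<^bsub>U\<^esub> u', w) 1 - Poly_Mapping.single (u, w) 1 - Poly_Mapping.single (u', w) 1
       |u u' w. u \<in> carrier U \<and> u' \<in> carrier U \<and> w \<in> carrier W} \<union>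
    {Poly_Mapping.single (u, w \<oplus>\<^bsub>W\<^esub> w') 1 - Poly_Mapping.single (u, w) 1 - Poly_Mapping.single (u, w') 1
       |u w w'. u \<in> carrier U \<and> w \<in> carrier W \<and> w' \<in> carrier W} \<union>
    {Poly_Mapping.single (a \<odot>\<^bsub>U\<^esub> u, w) 1 - Poly_Mapping.single (u, w) a
       |a u w. u \<in> carrier U \<and> w \<in> carrier W} \<union>
    {Poly_Mapping.single (u, a \<odot>\<^bsub>W\<^esub> w) 1 - Poly_Mapping.single (u, w) a
       |a u w. u \<in> carrier U \<and> w \<in> carrier W}"

definition tensor_mod ::
    "('k::field, 'a, 'm) module_scheme \<Rightarrow> ('k, 'b, 'n) module_scheme \<Rightarrow> ('k, ('k, 'a, 'b) tens) module" where
  "tensor_mod U W = presented (carrier U \<times> carrier W) (tens_rel U W)"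

definition pure ::
    "('k::field, 'a, 'm) module_scheme \<Rightarrow> ('k, 'b, 'n) module_scheme \<Rightarrow> 'a \<Rightarrow> 'b \<Rightarrow> ('k, 'a, 'b) tens" where
  "pure U W u w = pcls (tens_rel U W) (Poly_Mapping.single (u, w) 1)"

text \<open>\<open>tmap U W f g\<close> is the map \<open>f \<otimes> g\<close> with values in \<open>U \<otimes> W\<close>.\<close>

definition tmap ::
    "('k::field, 'c, 'm) module_scheme \<Rightarrow> ('k, 'd, 'n) module_scheme \<Rightarrow> ('a \<Rightarrow> 'c) \<Rightarrow> ('b \<Rightarrow> 'd) \<Rightarrow>
      ('k, 'a, 'b) tens \<Rightarrow> ('k, 'c, 'd) tens" where
  "tmap U W f g = lin_ext (tensor_mod U W) (\<lambda>(x, y). pure U W (f x) (g y))"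

definition tassoc ::
    "('k::field, 'a, 'l) module_scheme \<Rightarrow> ('k, 'b, 'm) module_scheme \<Rightarrow> ('k, 'c, 'n) module_scheme \<Rightarrow>
      ('k, ('k, 'a, 'b) tens, 'c) tens \<Rightarrow> ('k, 'a, ('k, 'b, 'c) tens) tens" where
  "tassoc U V W = (let VW = tensor_mod V W; M = tensor_mod U VW in
     lin_ext M (\<lambda>(t, w). lin_ext M (\<lambda>(u, v). pure U VW u (pure V W v w)) t))"


section \<open>Crossed modules over the group algebra\<close>

text \<open>\<open>coact V g v\<close> is the coefficient of \<open>g\<close> in the coaction, that is,
  \<open>\<delta>(v) = \<Sum>g\<in>G. g \<otimes> coact V g v\<close> in \<open>kG \<otimes> V\<close>, where \<open>G\<close> is finite.\<close>

record ('k, 'g, 'a) crossed_module = "('k, 'a) module" +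
  act :: "'g \<Rightarrow> 'a \<Rightarrow> 'a"
  coact :: "'g \<Rightarrow> 'a \<Rightarrow> 'a"

text \<open>The conditions on \<open>coact\<close> are linearity, coassociativity, counitality and the
  Yetter-Drinfeld condition \<open>\<delta>(gv) = g v\<^sub>-\<^sub>1 g\<^sup>-\<^sup>1 \<otimes> g v\<^sub>0\<close>.\<close>

definition crossed_module ::
    "('g, 'x) monoid_scheme \<Rightarrow> ('k::field, 'g, 'a, 'm) crossed_module_scheme \<Rightarrow> bool" where
  "crossed_module G V \<longleftrightarrow> Module.module scalars V \<and>
     (\<forall>g\<in>carrier G. klinear V V (act V g)) \<and>
     (\<forall>v\<in>carrier V. act V \<one>\<^bsub>G\<^esub> v = v) \<and>
     (\<forall>g\<in>carrier G. \<forall>h\<in>carrier G. \<forall>v\<in>carrier V. act V (g \<otimes>\<^bsub>G\<^esub> h) v = act V g (act V h v)) \<and>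
     (\<forall>g\<in>carrier G. klinear V V (coact V g)) \<and>
     (\<forall>g\<in>carrier G. \<forall>h\<in>carrier G. \<forall>v\<in>carrier V.
        coact V g (coact V h v) = (if g = h then coact V g v else \<zero>\<^bsub>V\<^esub>)) \<and>
     (\<forall>v\<in>carrier V. (\<Oplus>\<^bsub>V\<^esub>g\<in>carrier G. coact V g v) = v) \<and>
     (\<forall>g\<in>carrier G. \<forall>h\<in>carrier G. \<forall>v\<in>carrier V.
        coact V (g \<otimes>\<^bsub>G\<^esub> h \<otimes>\<^bsub>G\<^esub> inv\<^bsub>G\<^esub> g) (act V g v) = act V g (coact V h v))"

definition crossed_hom ::
    "('g, 'x) monoid_scheme \<Rightarrow> ('k::field, 'g, 'a, 'm) crossed_module_scheme \<Rightarrow>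
      ('k, 'g, 'b, 'n) crossed_module_scheme \<Rightarrow> ('a \<Rightarrow> 'b) \<Rightarrow> bool" where
  "crossed_hom G V W f \<longleftrightarrow> klinear V W f \<and>
     (\<forall>g\<in>carrier G. \<forall>v\<in>carrier V. f (act V g v) = act W g (f v) \<and> f (coact V g v) = coact W g (f v))"

definition crossed_iso ::
    "('g, 'x) monoid_scheme \<Rightarrow> ('k::field, 'g, 'a, 'm) crossed_module_scheme \<Rightarrow>
      ('k, 'g, 'b, 'n) crossed_module_scheme \<Rightarrow> bool" where
  "crossed_iso G V W \<longleftrightarrow> (\<exists>f. crossed_hom G V W f \<and> bij_betw f (carrier V) (carrier W))"

definition crossed_submodule ::
    "('g, 'x) monoid_scheme \<Rightarrow> ('k::field, 'g, 'a, 'm) crossed_module_scheme \<Rightarrow> 'a set \<Rightarrow> bool" where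
  "crossed_submodule G V U \<longleftrightarrow> submodule U scalars V \<and>
     (\<forall>g\<in>carrier G. \<forall>u\<in>U. act V g u \<in> U \<and> coact V g u \<in> U)"

definition crossed_quotient ::
    "('k::field, 'g, 'a, 'm) crossed_module_scheme \<Rightarrow> 'a set \<Rightarrow> ('k, 'g, 'a set) crossed_module" where
  "crossed_quotient V U =
    \<lparr>carrier = carrier (V Quot U), monoid.mult = monoid.mult (V Quot U), one = one (V Quot U),
     zero = zero (V Quot U), add = add (V Quot U),
     module.smult = (\<lambda>a c. \<Union>v\<in>c. U +>\<^bsub>V\<^esub> (a \<odot>\<^bsub>V\<^esub> v)),
     act = (\<lambda>g c. \<Union>v\<in>c. U +>\<^bsub>V\<^esub> act V g v),
     coact = (\<lambda>g c. \<Union>v\<in>c. U +>\<^bsub>V\<^esub> coact V g v)\<rparr>"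

definition unit_object :: "('g, 'x) monoid_scheme \<Rightarrow> ('k::field, 'g, 'k) crossed_module" where
  "unit_object G =
    \<lparr>carrier = UNIV, monoid.mult = (*), one = 1, zero = 0, add = (+), module.smult = (*),
     act = (\<lambda>g a. a), coact = (\<lambda>g a. if g = \<one>\<^bsub>G\<^esub> then a else 0)\<rparr>"

definition tensor ::
    "('g, 'x) monoid_scheme \<Rightarrow> ('k::field, 'g, 'a, 'm) crossed_module_scheme \<Rightarrow>
      ('k, 'g, 'b, 'n) crossed_module_scheme \<Rightarrow> ('k, 'g, ('k, 'a, 'b) tens) crossed_module" where
  "tensor G U W = module.extend (tensor_mod U W) (crossed_module.fields
     (\<lambda>g. tmap U W (act U g) (act W g))
     (\<lambda>h. lin_ext (tensor_mod U W)
        (\<lambda>(u, w). \<Oplus>\<^bsub>tensor_mod U W\<^esub>g\<in>carrier G. pure U W (coact U g u) (coact W (inv\<^bsub>G\<^esub> g \<otimes>\<^bsub>G\<^esub> h) w))))"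

text \<open>The braiding \<open>c(v \<otimes> w) = v\<^sub>-\<^sub>1 w \<otimes> v\<^sub>0\<close>.\<close>

definition braiding ::
    "('g, 'x) monoid_scheme \<Rightarrow> ('k::field, 'g, 'a, 'm) crossed_module_scheme \<Rightarrow>
      ('k, 'g, 'b, 'n) crossed_module_scheme \<Rightarrow> ('k, 'a, 'b) tens \<Rightarrow> ('k, 'b, 'a) tens" where
  "braiding G V W = lin_ext (tensor_mod W V)
     (\<lambda>(v, w). \<Oplus>\<^bsub>tensor_mod W V\<^esub>g\<in>carrier G. pure W V (act W g w) (coact V g v))"

text \<open>The map \<open>1 \<otimes> c \<otimes> 1\<close> from \<open>(A \<otimes> B) \<otimes> (C \<otimes> D)\<close> to \<open>(A \<otimes> C) \<otimes> (B \<otimes> D)\<close>.\<close>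

definition mid_braiding ::
    "('g, 'x) monoid_scheme \<Rightarrow>
      ('k::field, 'g, 'a, 'l) crossed_module_scheme \<Rightarrow> ('k, 'g, 'b, 'm) crossed_module_scheme \<Rightarrow>
      ('k, 'g, 'c, 'n) crossed_module_scheme \<Rightarrow> ('k, 'g, 'd, 'o) crossed_module_scheme \<Rightarrow>
      ('k, ('k, 'a, 'b) tens, ('k, 'c, 'd) tens) tens \<Rightarrow>
      ('k, ('k, 'a, 'c) tens, ('k, 'b, 'd) tens) tens" where
  "mid_braiding G A B C D = (let AC = tensor_mod A C; BD = tensor_mod B D; M = tensor_mod AC BD in
     lin_ext M (\<lambda>(s, t). lin_ext M (\<lambda>(a, b). lin_ext M (\<lambda>(c, d).
       lin_ext M (\<lambda>(x, y). pure AC BD (pure A C a x) (pure B D y d)) (braiding G B C (pure B C b c)))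
     t) s))"


section \<open>Braided algebras, coalgebras and Hopf algebras\<close>

definition mult_map :: "('k::field, 'a, 'm) module_scheme \<Rightarrow> ('k, 'a, 'a) tens \<Rightarrow> 'a" where
  "mult_map A = lin_ext A (\<lambda>(x, y). x \<otimes>\<^bsub>A\<^esub> y)"

definition braided_algebra ::
    "('g, 'x) monoid_scheme \<Rightarrow> ('k::field, 'g, 'a, 'm) crossed_module_scheme \<Rightarrow> bool" where
  "braided_algebra G A \<longleftrightarrow> crossed_module G A \<and> ring A \<and>
     (\<forall>a. \<forall>x\<in>carrier A. \<forall>y\<in>carrier A.
        (a \<odot>\<^bsub>A\<^esub> x) \<otimes>\<^bsub>A\<^esub> y = a \<odot>\<^bsub>A\<^esub> (x \<otimes>\<^bsub>A\<^esub> y) \<and> x \<otimes>\<^bsub>A\<^esub> (a \<odot>\<^bsub>A\<^esub> y) = a \<odot>\<^bsub>A\<^esub> (x \<otimes>\<^bsub>A\<^esub> y)) \<and>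
     crossed_hom G (tensor G A A) A (mult_map A) \<and>
     crossed_hom G (unit_object G) A (\<lambda>a. a \<odot>\<^bsub>A\<^esub> \<one>\<^bsub>A\<^esub>)"

definition algebra_hom ::
    "('g, 'x) monoid_scheme \<Rightarrow> ('k::field, 'g, 'a, 'm) crossed_module_scheme \<Rightarrow>
      ('k, 'g, 'b, 'n) crossed_module_scheme \<Rightarrow> ('a \<Rightarrow> 'b) \<Rightarrow> bool" where
  "algebra_hom G A B f \<longleftrightarrow> crossed_hom G A B f \<and> f \<one>\<^bsub>A\<^esub> = \<one>\<^bsub>B\<^esub> \<and>
     (\<forall>x\<in>carrier A. \<forall>y\<in>carrier A. f (x \<otimes>\<^bsub>A\<^esub> y) = f x \<otimes>\<^bsub>B\<^esub> f y)"

text \<open>The tensor product of braided algebras, with multiplication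
  \<open>(m \<otimes> m)(1 \<otimes> c \<otimes> 1)\<close>.\<close>

definition tensor_algebra ::
    "('g, 'x) monoid_scheme \<Rightarrow> ('k::field, 'g, 'a, 'm) crossed_module_scheme \<Rightarrow>
      ('k, 'g, 'b, 'n) crossed_module_scheme \<Rightarrow> ('k, 'g, ('k, 'a, 'b) tens) crossed_module" where
  "tensor_algebra G A B = (tensor G A B)
     \<lparr>monoid.mult := \<lambda>s t. tmap A B (mult_map A) (mult_map B)
         (mid_braiding G A B A B (pure (tensor_mod A B) (tensor_mod A B) s t)),
      one := pure A B \<one>\<^bsub>A\<^esub> \<one>\<^bsub>B\<^esub>\<rparr>"

record (overloaded) ('k::zero, 'g, 'a) braided_coalgebra = "('k, 'g, 'a) crossed_module" +
  comult :: "'a \<Rightarrow> ('k, 'a, 'a) tens"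
  counit :: "'a \<Rightarrow> 'k"

definition braided_coalgebra ::
    "('g, 'x) monoid_scheme \<Rightarrow> ('k::field, 'g, 'a, 'm) braided_coalgebra_scheme \<Rightarrow> bool" where
  "braided_coalgebra G C \<longleftrightarrow> crossed_module G C \<and>
     crossed_hom G C (tensor G C C) (comult C) \<and>
     crossed_hom G C (unit_object G) (counit C) \<and>
     (\<forall>x\<in>carrier C.
        tassoc C C C (tmap (tensor_mod C C) C (comult C) (\<lambda>y. y) (comult C x)) =
        tmap C (tensor_mod C C) (\<lambda>y. y) (comult C) (comult C x)) \<and>
     (\<forall>x\<in>carrier C. lin_ext C (\<lambda>(y, z). counit C y \<odot>\<^bsub>C\<^esub> z) (comult C x) = x) \<and>
     (\<forall>x\<in>carrier C. lin_ext C (\<lambda>(y, z). counit C z \<odot>\<^bsub>C\<^esub> y) (comult C x) = x)"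

definition coalgebra_hom ::
    "('g, 'x) monoid_scheme \<Rightarrow> ('k::field, 'g, 'a, 'm) braided_coalgebra_scheme \<Rightarrow>
      ('k, 'g, 'b, 'n) braided_coalgebra_scheme \<Rightarrow> ('a \<Rightarrow> 'b) \<Rightarrow> bool" where
  "coalgebra_hom G C D f \<longleftrightarrow> crossed_hom G C D f \<and>
     (\<forall>x\<in>carrier C. comult D (f x) = tmap D D f f (comult C x) \<and> counit D (f x) = counit C x)"

text \<open>The tensor product of braided coalgebras, with comultiplication
  \<open>(1 \<otimes> c \<otimes> 1)(\<Delta> \<otimes> \<Delta>)\<close>.\<close>

definition tensor_coalgebra ::
    "('g, 'x) monoid_scheme \<Rightarrow> ('k::field, 'g, 'a, 'm) braided_coalgebra_scheme \<Rightarrow>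
      ('k, 'g, 'b, 'n) braided_coalgebra_scheme \<Rightarrow> ('k, 'g, ('k, 'a, 'b) tens) braided_coalgebra" where
  "tensor_coalgebra G C D = crossed_module.extend (tensor G C D) (braided_coalgebra.fields
     (\<lambda>t. mid_braiding G C C D D (tmap (tensor_mod C C) (tensor_mod D D) (comult C) (comult D) t))
     (lin_ext (unit_object G) (\<lambda>(x, y). counit C x * counit D y)))"

definition braided_bialgebra ::
    "('g, 'x) monoid_scheme \<Rightarrow> ('k::field, 'g, 'a, 'm) braided_coalgebra_scheme \<Rightarrow> bool" where
  "braided_bialgebra G A \<longleftrightarrow> braided_algebra G A \<and> braided_coalgebra G A \<and>
     algebra_hom G A (tensor_algebra G A A) (comult A) \<and>
     algebra_hom G A (unit_object G) (counit A)"

definition is_antipode ::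
    "('g, 'x) monoid_scheme \<Rightarrow> ('k::field, 'g, 'a, 'm) braided_coalgebra_scheme \<Rightarrow> ('a \<Rightarrow> 'a) \<Rightarrow> bool" where
  "is_antipode G A s \<longleftrightarrow> crossed_hom G A A s \<and>
     (\<forall>x\<in>carrier A.
        mult_map A (tmap A A s (\<lambda>y. y) (comult A x)) = counit A x \<odot>\<^bsub>A\<^esub> \<one>\<^bsub>A\<^esub> \<and>
        mult_map A (tmap A A (\<lambda>y. y) s (comult A x)) = counit A x \<odot>\<^bsub>A\<^esub> \<one>\<^bsub>A\<^esub>)"

record (overloaded) ('k::zero, 'g, 'a) braided_hopf_algebra = "('k, 'g, 'a) braided_coalgebra" +
  antipode :: "'a \<Rightarrow> 'a"

definition braided_hopf_algebra ::
    "('g, 'x) monoid_scheme \<Rightarrow> ('k::field, 'g, 'a, 'm) braided_hopf_algebra_scheme \<Rightarrow> bool" where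
  "braided_hopf_algebra G A \<longleftrightarrow> braided_bialgebra G A \<and> is_antipode G A (antipode A)"

text \<open>A morphism of braided Hopf algebras is a morphism of braided algebras and coalgebras; it
  commutes with the antipodes automatically.\<close>

definition hopf_hom ::
    "('g, 'x) monoid_scheme \<Rightarrow> ('k::field, 'g, 'a, 'm) braided_hopf_algebra_scheme \<Rightarrow>
      ('k, 'g, 'b, 'n) braided_hopf_algebra_scheme \<Rightarrow> ('a \<Rightarrow> 'b) \<Rightarrow> bool" where
  "hopf_hom G A B f \<longleftrightarrow> braided_hopf_algebra G A \<and> braided_hopf_algebra G B \<and>
     algebra_hom G A B f \<and> coalgebra_hom G A B f"

definition primitives :: "('k::field, 'g, 'a, 'm) braided_coalgebra_scheme \<Rightarrow> 'a set" where
  "primitives A =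
    {y \<in> carrier A. comult A y = pure A A y \<one>\<^bsub>A\<^esub> \<oplus>\<^bsub>tensor_mod A A\<^esub> pure A A \<one>\<^bsub>A\<^esub> y}"

definition primitive_space ::
    "('k::field, 'g, 'a, 'm) braided_coalgebra_scheme \<Rightarrow> ('k, 'g, 'a, 'm) braided_coalgebra_scheme" where
  "primitive_space A = A\<lparr>carrier := primitives A\<rparr>"

definition augmentation_ideal :: "('k::field, 'g, 'a, 'm) braided_coalgebra_scheme \<Rightarrow> 'a set" where
  "augmentation_ideal A = {x \<in> carrier A. counit A x = 0}"

definition indecomposables ::
    "('k::field, 'g, 'a, 'm) braided_coalgebra_scheme \<Rightarrow> ('k, 'g, 'a set) crossed_module" where
  "indecomposables A = (let J = augmentation_ideal A in
     crossed_quotient (A\<lparr>carrier := J\<rparr>) (ideal_prod A J J))"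

definition hopf_ideal ::
    "('g, 'x) monoid_scheme \<Rightarrow> ('k::field, 'g, 'a, 'm) braided_hopf_algebra_scheme \<Rightarrow> 'a set \<Rightarrow> bool" where
  "hopf_ideal G A I \<longleftrightarrow> crossed_submodule G A I \<and> ideal I A \<and>
     (\<forall>x\<in>I. comult A x \<in> lspan (tensor_mod A A)
        ({pure A A y z |y z. y \<in> I \<and> z \<in> carrier A} \<union> {pure A A y z |y z. y \<in> carrier A \<and> z \<in> I})) \<and>
     (\<forall>x\<in>I. counit A x = 0) \<and> (\<forall>x\<in>I. antipode A x \<in> I)"

definition hopf_ideal_generated ::
    "('g, 'x) monoid_scheme \<Rightarrow> ('k::field, 'g, 'a, 'm) braided_hopf_algebra_scheme \<Rightarrow>
      'a set \<Rightarrow> 'a set \<Rightarrow> bool" where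
  "hopf_ideal_generated G A X I \<longleftrightarrow> hopf_ideal G A I \<and> X \<subseteq> I \<and>
     (\<forall>J. hopf_ideal G A J \<and> X \<subseteq> J \<longrightarrow> I \<subseteq> J)"

definition quotient_hopf ::
    "('k::field, 'g, 'a, 'm) braided_hopf_algebra_scheme \<Rightarrow> 'a set \<Rightarrow>
      ('k, 'g, 'a set) braided_hopf_algebra" where
  "quotient_hopf A I = (let Q = crossed_quotient A I; p = (\<lambda>x. I +>\<^bsub>A\<^esub> x) in
     crossed_module.extend Q
       \<lparr>comult = (\<lambda>c. the_elem ((\<lambda>x. tmap Q Q p p (comult A x)) ` c)),
        counit = (\<lambda>c. the_elem (counit A ` c)),
        antipode = (\<lambda>c. the_elem ((\<lambda>x. p (antipode A x)) ` c))\<rparr>)"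

definition hopf_subalgebra ::
    "('g, 'x) monoid_scheme \<Rightarrow> ('k::field, 'g, 'a, 'm) braided_hopf_algebra_scheme \<Rightarrow> 'a set \<Rightarrow> bool" where
  "hopf_subalgebra G A B \<longleftrightarrow> crossed_submodule G A B \<and>
     \<one>\<^bsub>A\<^esub> \<in> B \<and> (\<forall>x\<in>B. \<forall>y\<in>B. x \<otimes>\<^bsub>A\<^esub> y \<in> B) \<and>
     (\<forall>x\<in>B. comult A x \<in> lspan (tensor_mod A A) {pure A A y z |y z. y \<in> B \<and> z \<in> B}) \<and>
     (\<forall>x\<in>B. antipode A x \<in> B)"

text \<open>The comultiplication of a Hopf subalgebra \<open>B\<close> takes values in \<open>B \<otimes> B\<close>, which is a
  different quotient of a free vector space than \<open>A \<otimes> A\<close>, and embeds into the latter.\<close>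

definition sub_hopf ::
    "('k::field, 'g, 'a, 'm) braided_hopf_algebra_scheme \<Rightarrow> 'a set \<Rightarrow>
      ('k, 'g, 'a, 'm) braided_hopf_algebra_scheme" where
  "sub_hopf A B = (let B' = A\<lparr>carrier := B\<rparr> in
     B'\<lparr>comult := \<lambda>x. THE t. t \<in> carrier (tensor_mod B' B') \<and>
                         tmap A A (\<lambda>y. y) (\<lambda>y. y) t = comult A x\<rparr>)"


section \<open>Gradings and Nichols algebras\<close>

definition connected_graded_hopf ::
    "('g, 'x) monoid_scheme \<Rightarrow> ('k::field, 'g, 'a, 'm) braided_hopf_algebra_scheme \<Rightarrow>
      (nat \<Rightarrow> 'a set) \<Rightarrow> bool" where
  "connected_graded_hopf G A R \<longleftrightarrow> braided_hopf_algebra G A \<and>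
     (\<forall>n. crossed_submodule G A (R n)) \<and>
     (\<forall>x\<in>carrier A. \<exists>!f. (\<forall>n. f n \<in> R n) \<and> finite {n. f n \<noteq> \<zero>\<^bsub>A\<^esub>} \<and>
        x = (\<Oplus>\<^bsub>A\<^esub>n\<in>{n. f n \<noteq> \<zero>\<^bsub>A\<^esub>}. f n)) \<and>
     (\<forall>m n. \<forall>x\<in>R m. \<forall>y\<in>R n. x \<otimes>\<^bsub>A\<^esub> y \<in> R (m + n)) \<and>
     (\<forall>n. \<forall>x\<in>R n. comult A x \<in> lspan (tensor_mod A A)
        {pure A A y z |y z. \<exists>i j. i + j = n \<and> y \<in> R i \<and> z \<in> R j}) \<and>
     (\<forall>n>0. \<forall>x\<in>R n. counit A x = 0) \<and>
     (\<forall>n. \<forall>x\<in>R n. antipode A x \<in> R n) \<and>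
     R 0 = {a \<odot>\<^bsub>A\<^esub> \<one>\<^bsub>A\<^esub> |a. True}"

definition generated_as_algebra_by :: "('k::field, 'a, 'm) module_scheme \<Rightarrow> 'a set \<Rightarrow> bool" where
  "generated_as_algebra_by A X \<longleftrightarrow>
     (\<forall>B. submodule B scalars A \<and> \<one>\<^bsub>A\<^esub> \<in> B \<and> (\<forall>x\<in>B. \<forall>y\<in>B. x \<otimes>\<^bsub>A\<^esub> y \<in> B) \<and> X \<subseteq> B \<longrightarrow>
        B = carrier A)"

definition nichols_algebra ::
    "('g, 'x) monoid_scheme \<Rightarrow> ('k::field, 'g, 'v, 'm) crossed_module_scheme \<Rightarrow>
      ('k, 'g, 'a, 'n) braided_hopf_algebra_scheme \<Rightarrow> (nat \<Rightarrow> 'a set) \<Rightarrow> bool" where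
  "nichols_algebra G V A R \<longleftrightarrow> connected_graded_hopf G A R \<and>
     crossed_iso G (A\<lparr>carrier := R 1\<rparr>) V \<and>
     generated_as_algebra_by A (R 1) \<and> primitives A = R 1"

definition graded_hopf_iso ::
    "('g, 'x) monoid_scheme \<Rightarrow>
      ('k::field, 'g, 'a, 'm) braided_hopf_algebra_scheme \<Rightarrow> (nat \<Rightarrow> 'a set) \<Rightarrow>
      ('k, 'g, 'b, 'n) braided_hopf_algebra_scheme \<Rightarrow> (nat \<Rightarrow> 'b set) \<Rightarrow> bool" where
  "graded_hopf_iso G A R B R' \<longleftrightarrow>
     (\<exists>f. hopf_hom G A B f \<and> bij_betw f (carrier A) (carrier B) \<and> (\<forall>n. f ` R n = R' n))"


section \<open>The free and the cofree connected graded braided Hopf algebra\<close>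

text \<open>\<open>T(V)\<close> is presented by words in the elements of \<open>V\<close>, subject to multilinearity;
  \<open>word V [v\<^sub>1, \<dots>, v\<^sub>n]\<close> is \<open>v\<^sub>1 \<otimes> \<dots> \<otimes> v\<^sub>n\<close>.\<close>

definition word_rel :: "('k::field, 'v, 'm) module_scheme \<Rightarrow> ('v list \<Rightarrow>\<^sub>0 'k) set" where
  "word_rel V =
    {Poly_Mapping.single (xs @ [v \<oplus>\<^bsub>V\<^esub> v'] @ ys) 1 - Poly_Mapping.single (xs @ [v] @ ys) 1
       - Poly_Mapping.single (xs @ [v'] @ ys) 1
       |xs v v' ys. xs \<in> lists (carrier V) \<and> v \<in> carrier V \<and> v' \<in> carrier V \<and> ys \<in> lists (carrier V)} \<union>
    {Poly_Mapping.single (xs @ [a \<odot>\<^bsub>V\<^esub> v] @ ys) 1 - Poly_Mapping.single (xs @ [v] @ ys) a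
       |xs a v ys. xs \<in> lists (carrier V) \<and> v \<in> carrier V \<and> ys \<in> lists (carrier V)}"

type_synonym ('k, 'v) tens_pow = "('v list \<Rightarrow>\<^sub>0 'k) set"

definition word :: "('k::field, 'v, 'm) module_scheme \<Rightarrow> 'v list \<Rightarrow> ('k, 'v) tens_pow" where
  "word V vs = pcls (word_rel V) (Poly_Mapping.single vs 1)"

definition word_mod :: "('k::field, 'v, 'm) module_scheme \<Rightarrow> ('k, ('k, 'v) tens_pow) module" where
  "word_mod V = presented (lists (carrier V)) (word_rel V)"

definition tens_degree :: "('k::field, 'v, 'm) module_scheme \<Rightarrow> nat \<Rightarrow> ('k, 'v) tens_pow set" where
  "tens_degree V n = lspan (word_mod V) {word V vs |vs. vs \<in> lists (carrier V) \<and> length vs = n}"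

text \<open>\<open>T(V)\<close> as a crossed module, with the multiplication of the tensor algebra.\<close>

definition TV ::
    "('g, 'x) monoid_scheme \<Rightarrow> ('k::field, 'g, 'v, 'm) crossed_module_scheme \<Rightarrow>
      ('k, 'g, ('k, 'v) tens_pow) crossed_module" where
  "TV G V = (let M = word_mod V in
    \<lparr>carrier = carrier M,
     monoid.mult = (\<lambda>s t. lin_ext M (\<lambda>xs. lin_ext M (\<lambda>ys. word V (xs @ ys)) t) s),
     one = word V [], zero = zero M, add = add M, module.smult = module.smult M,
     act = (\<lambda>g. lin_ext M (\<lambda>vs. word V (map (act V g) vs))),
     coact = (\<lambda>h. lin_ext M (\<lambda>vs.
       \<Oplus>\<^bsub>M\<^esub>gs\<in>{gs. set gs \<subseteq> carrier G \<and> length gs = length vs \<and> foldr (\<lambda>g g'. g \<otimes>\<^bsub>G\<^esub> g') gs \<one>\<^bsub>G\<^esub> = h}.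
         word V (map2 (coact V) gs vs)))\<rparr>)"

definition deconcatenation ::
    "('k::field, 'v, 'm) module_scheme \<Rightarrow> ('k, 'v) tens_pow \<Rightarrow>
      ('k, ('k, 'v) tens_pow, ('k, 'v) tens_pow) tens" where
  "deconcatenation V = (let M = word_mod V in lin_ext (tensor_mod M M)
     (\<lambda>vs. \<Oplus>\<^bsub>tensor_mod M M\<^esub>i\<in>{..length vs}. pure M M (word V (take i vs)) (word V (drop i vs))))"

definition TV_counit ::
    "('g, 'x) monoid_scheme \<Rightarrow> ('k::field, 'g, 'v, 'm) crossed_module_scheme \<Rightarrow>
      ('k, 'v) tens_pow \<Rightarrow> 'k" where
  "TV_counit G V = lin_ext (unit_object G) (\<lambda>vs. if vs = [] then 1 else 0)"

definition TV_proj :: "('k::field, 'v, 'm) module_scheme \<Rightarrow> ('k, 'v) tens_pow \<Rightarrow> 'v" where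
  "TV_proj V = lin_ext V (\<lambda>vs. if length vs = 1 then hd vs else \<zero>\<^bsub>V\<^esub>)"

definition TV_map ::
    "('k::field, 'v, 'm) module_scheme \<Rightarrow> ('k, 'w, 'n) module_scheme \<Rightarrow> ('v \<Rightarrow> 'w) \<Rightarrow>
      ('k, 'v) tens_pow \<Rightarrow> ('k, 'w) tens_pow" where
  "TV_map V W f = lin_ext (word_mod W) (\<lambda>vs. word W (map f vs))"

text \<open>In the definite descriptions below, maps are normalised to be \<open>undefined\<close> off their
  domain.\<close>

definition add_antipode ::
    "('g, 'x) monoid_scheme \<Rightarrow> ('k::field, 'g, 'a) braided_coalgebra \<Rightarrow> ('k, 'g, 'a) braided_hopf_algebra" where
  "add_antipode G A = braided_coalgebra.extend A (braided_hopf_algebra.fields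
     (THE s. s \<in> extensional (carrier A) \<and> is_antipode G A s))"

definition free_comult ::
    "('g, 'x) monoid_scheme \<Rightarrow> ('k::field, 'g, 'v, 'm) crossed_module_scheme \<Rightarrow>
      ('k, 'v) tens_pow \<Rightarrow> ('k, ('k, 'v) tens_pow, ('k, 'v) tens_pow) tens" where
  "free_comult G V = (let T = TV G V in THE d. d \<in> extensional (carrier T) \<and>
     algebra_hom G T (tensor_algebra G T T) d \<and>
     (\<forall>v\<in>carrier V. d (word V [v]) =
        pure T T (word V [v]) \<one>\<^bsub>T\<^esub> \<oplus>\<^bsub>tensor_mod T T\<^esub> pure T T \<one>\<^bsub>T\<^esub> (word V [v])))"

definition free_hopf ::
    "('g, 'x) monoid_scheme \<Rightarrow> ('k::field, 'g, 'v, 'm) crossed_module_scheme \<Rightarrow>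
      ('k, 'g, ('k, 'v) tens_pow) braided_hopf_algebra" where
  "free_hopf G V = add_antipode G (crossed_module.extend (TV G V)
     (braided_coalgebra.fields (free_comult G V) (TV_counit G V)))"

definition cofree_coalgebra ::
    "('g, 'x) monoid_scheme \<Rightarrow> ('k::field, 'g, 'v, 'm) crossed_module_scheme \<Rightarrow>
      ('k, 'g, ('k, 'v) tens_pow) braided_coalgebra" where
  "cofree_coalgebra G V = crossed_module.extend (TV G V)
     (braided_coalgebra.fields (deconcatenation V) (TV_counit G V))"

definition cofree_mult ::
    "('g, 'x) monoid_scheme \<Rightarrow> ('k::field, 'g, 'v, 'm) crossed_module_scheme \<Rightarrow>
      ('k, ('k, 'v) tens_pow, ('k, 'v) tens_pow) tens \<Rightarrow> ('k, 'v) tens_pow" where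
  "cofree_mult G V = (let C = cofree_coalgebra G V in THE m. m \<in> extensional (carrier (tensor_mod C C)) \<and>
     coalgebra_hom G (tensor_coalgebra G C C) C m \<and>
     (\<forall>x\<in>carrier C. \<forall>y\<in>carrier C. TV_proj V (m (pure C C x y)) =
        counit C y \<odot>\<^bsub>V\<^esub> TV_proj V x \<oplus>\<^bsub>V\<^esub> counit C x \<odot>\<^bsub>V\<^esub> TV_proj V y))"

definition cofree_hopf ::
    "('g, 'x) monoid_scheme \<Rightarrow> ('k::field, 'g, 'v, 'm) crossed_module_scheme \<Rightarrow>
      ('k, 'g, ('k, 'v) tens_pow) braided_hopf_algebra" where
  "cofree_hopf G V = (let C = cofree_coalgebra G V in
     add_antipode G (C\<lparr>monoid.mult := \<lambda>x y. cofree_mult G V (pure C C x y)\<rparr>))"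


section \<open>Functors and natural transformations\<close>

text \<open>Functors from crossed modules with elements of type \<open>'v\<close> to braided Hopf algebras. The type
  \<open>'v\<close> is arbitrary, and any set of crossed modules can be realised inside one type.\<close>

definition hopf_functor ::
    "('g, 'x) monoid_scheme \<Rightarrow>
      (('k::field, 'g, 'v) crossed_module \<Rightarrow> ('k, 'g, 'a) braided_hopf_algebra) \<Rightarrow>
      (('k, 'g, 'v) crossed_module \<Rightarrow> ('k, 'g, 'v) crossed_module \<Rightarrow> ('v \<Rightarrow> 'v) \<Rightarrow> 'a \<Rightarrow> 'a) \<Rightarrow> bool" where
  "hopf_functor G F Fm \<longleftrightarrow>
     (\<forall>V. crossed_module G V \<longrightarrow> braided_hopf_algebra G (F V)) \<and>
     (\<forall>V W f. crossed_module G V \<and> crossed_module G W \<and> crossed_hom G V W f \<longrightarrow>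
        hopf_hom G (F V) (F W) (Fm V W f)) \<and>
     (\<forall>V. crossed_module G V \<longrightarrow> (\<forall>x\<in>carrier (F V). Fm V V (\<lambda>v. v) x = x)) \<and>
     (\<forall>U V W f g. crossed_module G U \<and> crossed_module G V \<and> crossed_module G W \<and>
        crossed_hom G U V f \<and> crossed_hom G V W g \<longrightarrow>
        (\<forall>x\<in>carrier (F U). Fm U W (\<lambda>u. g (f u)) x = Fm V W g (Fm U V f x)))"

definition natural_transformation ::
    "('g, 'x) monoid_scheme \<Rightarrow>
      (('k::field, 'g, 'v) crossed_module \<Rightarrow> ('k, 'g, 'a) braided_hopf_algebra) \<Rightarrow>
      (('k, 'g, 'v) crossed_module \<Rightarrow> ('k, 'g, 'v) crossed_module \<Rightarrow> ('v \<Rightarrow> 'v) \<Rightarrow> 'a \<Rightarrow> 'a) \<Rightarrow>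
      (('k, 'g, 'v) crossed_module \<Rightarrow> ('k, 'g, 'b) braided_hopf_algebra) \<Rightarrow>
      (('k, 'g, 'v) crossed_module \<Rightarrow> ('k, 'g, 'v) crossed_module \<Rightarrow> ('v \<Rightarrow> 'v) \<Rightarrow> 'b \<Rightarrow> 'b) \<Rightarrow>
      (('k, 'g, 'v) crossed_module \<Rightarrow> 'a \<Rightarrow> 'b) \<Rightarrow> bool" where
  "natural_transformation G F Fm H Hm S \<longleftrightarrow>
     hopf_functor G F Fm \<and> hopf_functor G H Hm \<and>
     (\<forall>V. crossed_module G V \<longrightarrow> hopf_hom G (F V) (H V) (S V)) \<and>
     (\<forall>V W f. crossed_module G V \<and> crossed_module G W \<and> crossed_hom G V W f \<longrightarrow>
        (\<forall>x\<in>carrier (F V). S W (Fm V W f x) = Hm V W f (S V x)))"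

end

theory Submission
  imports Defs
begin

text \<open>Everything takes place on T(V), \<open>TV G V\<close>. A coaction of kG is a grading by
  G, and since G is abelian the Yetter-Drinfeld condition says that action and coaction commute. For
  v of degree g the braiding is v\<otimes>w -> gw\<otimes>v. A linear map on T(V) is determined by
  its value at 1 and its behaviour when a homogeneous letter is prepended (\<open>TV_recI\<close>,
  \<open>TV_rec\<close>), and most identities are inductions along letters.

  The free algebra A(V): its coproduct is the recursion t -> (v\<otimes>1 + 1\<otimes>v) t
  (\<open>free_comult_exists\<close>). A crossed map from V into the primitives of a braided
  bialgebra R extends to a bialgebra map A(V) -> R (\<open>free_hom\<close>), and algebra maps out
  of A(V) are determined by letters (\<open>free_hom_unique\<close>). The cofree algebra C(V): every
  y is its counit times 1 plus the product of its first letter with the rest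
  (\<open>TV_reconstruct\<close>), so a coalgebra map into C(V) is governed by its projection to V.
  For the multiplication this yields a fixed-point equation, which is equivalent to the braided
  shuffle recursion (\<open>is_shuffle_iff\<close>). The recursion has exactly one solution on
  T(V)\<otimes>T(V) (\<open>shuffle_exists\<close>, \<open>shuffle_unique\<close>), and it is
  associative and compatible with deconcatenation (\<open>shuffle_assoc\<close>,
  \<open>shuffle_deconcatenation\<close>). Both algebras have antipodes because the identity is
  locally unipotent for convolution along the length filtration (\<open>TV_antipode\<close>).

  The symmetrizer S: letters are primitive in C(V), so \<open>free_hom\<close> produces S : A(V) ->
  C(V), the identity on letters. It is graded, and it is natural because both composites in question
  are algebra maps agreeing on letters. Let Q be A(V)/ker S or im S. As a quotient of A(V), Q is
  generated by V; it is embedded in C(V) compatibly with degrees. A primitive of C(V) lies in V by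
  the reconstruction formula (\<open>cofree_primitive\<close>), hence P(Q) = V
  (\<open>image_primitives\<close>), and Q is a Nichols algebra (\<open>image_nichols\<close>). The
  projection to V kills products of elements of the augmentation ideal J, and modulo the square of J
  every element of J is a letter, so Q(Q) = V as well (\<open>image_indecomposables\<close>).

  If R is any Nichols algebra of V, \<open>free_hom\<close> gives a surjection \<Phi> : A(V) -> R.
  Its kernel is ker S by \<open>hom_kernel_mono\<close>, used in both directions: in the lowest
  degree n \<ge> 2 where one map fails to vanish on the kernel of the other, the value is primitive
  of degree n, hence zero. This is \<open>nichols_unique\<close>.

  Finally S maps a primitive of degree n \<ge> 2 to a primitive of C(V) of degree n, which is 0. The
  Hopf ideal generated by such elements exists (\<open>primitive_hopf_ideal\<close>) and lies in ker
  S, since the kernel of a Hopf map is a Hopf ideal (\<open>hopf_ideal_kernel\<close>). The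
  exactness of tensor products over a field enters through \<open>generalized_inverse\<close>: a
  linear f has a linear s with f s f = f.\<close>

type_synonym ('k, 'a, 'm) vect = "('k, 'a, 'm) module_scheme"
type_synonym ('k, 'g, 'a, 'm) cmod = "('k, 'g, 'a, 'm) crossed_module_scheme"
type_synonym ('k, 'g, 'a, 'm) bcoalg = "('k, 'g, 'a, 'm) braided_coalgebra_scheme"
type_synonym ('k, 'g, 'a, 'm) bhopf = "('k, 'g, 'a, 'm) braided_hopf_algebra_scheme"

text \<open>Compact notation for the operations of rings and modules, and for membership in the carrier.\<close>

abbreviation ring_mult ("_ *._ _" [70, 1000, 71] 70) where "x *.R y \<equiv> x \<otimes>\<^bsub>R\<^esub> y"
abbreviation ring_add ("_ +._ _" [65, 1000, 66] 65) where "x +.R y \<equiv> x \<oplus>\<^bsub>R\<^esub> y"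
abbreviation module_smult ("_ .*_ _" [70, 1000, 71] 70) where "a .*M x \<equiv> a \<odot>\<^bsub>M\<^esub> x"
abbreviation ring_zero ("0@_" [1000] 1000) where "0@R \<equiv> \<zero>\<^bsub>R\<^esub>"
abbreviation ring_one ("1@_" [1000] 1000) where "1@R \<equiv> \<one>\<^bsub>R\<^esub>"
abbreviation in_lists ("_ .:: _" [51, 51] 50) where "xs .:: S \<equiv> xs \<in> lists (carrier S)"
abbreviation tensor_product (infixr "**" 75) where "U ** W \<equiv> tensor_mod U W"
abbreviation in_carrier ("_ .: _" [51, 51] 50) where "x .: S \<equiv> x \<in> carrier S"

section \<open>Linear algebra\<close>

abbreviation kspace :: "('k::field, 'a, 'm) vect => bool" where
 "kspace M \<equiv> Module.module scalars M"

lemma scalars_simps [simp]: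
 "carrier scalars = UNIV" "a *.scalars b = a * b" "1@scalars = 1" "0@scalars = 0"
 "a +.scalars b = a + b"
 by (simp_all add: scalars_def)

lemma cring_scalars: "cring (scalars :: 'k::field ring)"
proof (rule cringI)
 show "abelian_group (scalars :: 'k ring)"
  by (rule abelian_groupI) (auto simp: algebra_simps intro: exI[of _ "- x" for x])
 show "Group.comm_monoid (scalars :: 'k ring)"
  by (rule comm_monoidI) (auto simp: algebra_simps)
qed (auto simp: algebra_simps)

lemma ks_abelian: "kspace M ==> abelian_group M"
 by (rule Module.module.axioms(2))

lemma ks_closed [simp]:
 assumes "kspace M"
 shows "0@M .: M" (is ?g1)
  and "[|x .: M; y .: M|] ==> x +.M y .: M" (is "PROP ?g2")
  and "x .: M ==> a .*M x .: M" (is "PROP ?g3")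
proof -
 interpret Module.module scalars M by fact
 show ?g1 "PROP ?g2"
  "PROP ?g3" by auto
qed

lemma ks_ac:
 assumes "kspace M" "x .: M" "y .: M"
 shows "z .: M ==> (x +.M y) +.M z = x +.M (y +.M z)" (is "PROP ?g1")
  and "x +.M y = y +.M x" (is ?g2)
  and "z .: M ==> x +.M (y +.M z) = y +.M (x +.M z)" (is "PROP ?g3")
proof -
 interpret Module.module scalars M by fact
 show "PROP ?g1" ?g2
  "PROP ?g3"
  using assms by (auto simp: M.a_ac)
qed

lemma ks_simps [simp]:
 assumes "kspace M"
 shows "x .: M ==> x +.M 0@M = x" (is "PROP ?g1") "x .: M ==> 0@M +.M x = x" (is "PROP ?g2")
  and "x .: M ==> 1 .*M x = x" (is "PROP ?g3") and "x .: M ==> 0 .*M x = 0@M" (is "PROP ?g4")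
  and "a .*M 0@M = 0@M" (is ?g5)
  and "x .: M ==> a .*M (b .*M x) = (a * b) .*M x" (is "PROP ?g6")
proof -
 interpret Module.module scalars M by fact
 show "PROP ?g1" "PROP ?g2"
  "PROP ?g3" "PROP ?g4" ?g5
  "PROP ?g6"
  using smult_one smult_l_null smult_r_null smult_assoc1[of a b] by auto
qed

lemma ks_distrib:
 assumes "kspace M"
 shows "[|x .: M; y .: M|] ==> a .*M (x +.M y) = a .*M x +.M a .*M y" (is "PROP ?g1")
  and "x .: M ==> (a + b) .*M x = a .*M x +.M b .*M x" (is "PROP ?g2")
proof -
 interpret Module.module scalars M by fact
 show "PROP ?g1"
  "PROP ?g2"
  using smult_r_distr[of a] smult_l_distr[of a b] by auto
qed

lemma ks_neg:
 assumes "kspace M" "x .: M"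
 shows "x +.M (-1) .*M x = 0@M" "(-1) .*M x +.M x = 0@M"
 using ks_distrib(2)[OF assms, of 1 "-1"] ks_distrib(2)[OF assms, of "-1" 1] assms by auto

text \<open>Subtraction is written throughout as adding \<open>(-1) .*M y\<close>; this is the
  bridge to the additive inverse that the notion \<open>submodule\<close> refers to.\<close>

lemma ks_a_inv:
 assumes "kspace M" "x .: M"
 shows "\<ominus>\<^bsub>M\<^esub> x = (-1) .*M x"
proof -
 interpret Module.module scalars M by fact
 show ?thesis using assms ks_neg[OF assms] M.minus_equality by auto
qed

lemma ks_cancel:
 assumes "kspace M" "x .: M" "y .: M" "z .: M"
 shows "x +.M y = x +.M z \<longleftrightarrow> y = z" (is ?g1) "y +.M x = z +.M x \<longleftrightarrow> y = z" (is ?g2)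
proof -
 interpret Module.module scalars M by fact
 show ?g1 ?g2
  using assms by auto
qed

lemma ks_diff_zero:
 assumes "kspace M" "x .: M" "y .: M"
 shows "x +.M (-1) .*M y = 0@M \<longleftrightarrow> x = y"
 using ks_cancel(2)[of M "(-1) .*M y" x y] assms by (simp add: ks_neg)

lemma ks_add_diff:
 assumes "kspace M" "x .: M" "y .: M"
 shows "y +.M (x +.M (-1) .*M y) = x" "(x +.M (-1) .*M y) +.M y = x"
 using assms by (simp_all add: ks_ac(3)[of M y x] ks_ac(1) ks_neg)

lemma kspaceI:
 fixes M :: "('k::field, 'a, 'm) vect"
 assumes "0@M .: M"
  and "!!x y. [|x .: M; y .: M|] ==> x +.M y .: M"
  and "!!a x. x .: M ==> a .*M x .: M"
  and "!!x y z. [|x .: M; y .: M; z .: M|] ==> (x +.M y) +.M z = x +.M (y +.M z)"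
  and "!!x y. [|x .: M; y .: M|] ==> x +.M y = y +.M x"
  and "!!x. x .: M ==> 0@M +.M x = x"
  and "!!x. x .: M ==> 1 .*M x = x"
  and "!!x. x .: M ==> (-1) .*M x +.M x = 0@M"
  and "!!a b x. x .: M ==> (a + b) .*M x = a .*M x +.M b .*M x"
  and "!!a x y. [|x .: M; y .: M|] ==> a .*M (x +.M y) = a .*M x +.M a .*M y"
  and "!!a b x. x .: M ==> a .*M (b .*M x) = (a * b) .*M x"
 shows "kspace M"
proof (rule moduleI)
 show "abelian_group M"
 proof (rule abelian_groupI)
  show "\<exists>y\<in>carrier M. y +.M x = 0@M" if "x .: M" for x
   using assms(3)[OF that] assms(8)[OF that] by blast
 qed (fact assms)+
qed (use assms(3,7,9,10,11) cring_scalars in simp_all)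

lemma ks_finsum_closed [simp]:
 assumes "kspace M" "f : A \<rightarrow> carrier M"
 shows "finsum M f A .: M"
proof -
 interpret Module.module scalars M by fact
 show ?thesis using assms by auto
qed

lemma ks_finsum_insert:
 assumes "kspace M" "finite A" "i \<notin> A" "f : A \<rightarrow> carrier M" "f i .: M"
 shows "finsum M f (insert i A) = f i +.M finsum M f A"
proof -
 interpret Module.module scalars M by fact
 show ?thesis using assms by (auto intro: M.finsum_insert)
qed

lemma ks_finsum_empty [simp]: "kspace M ==> finsum M f {} = 0@M"
 by (rule abelian_monoid.finsum_empty) (simp add: ks_abelian abelian_group.axioms(1))

lemma ks_finsum_cong:
 assumes "kspace M" "A = B" "!!i. i : B ==> f i = g i" "g : B \<rightarrow> carrier M"
 shows "finsum M f A = finsum M g B"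
proof -
 interpret Module.module scalars M by fact
 show ?thesis using assms by (intro M.finsum_cong') auto
qed

lemma ks_finsum_zero:
 assumes "kspace M" "!!i. i : A ==> f i = 0@M"
 shows "finsum M f A = 0@M"
proof -
 interpret Module.module scalars M by fact
 have "finsum M f A = finsum M (%_. 0@M) A" using assms by (intro M.finsum_cong') auto
 then show ?thesis by (simp add: M.finsum_zero)
qed

lemma ks_finsum_single:
 assumes "kspace M" "finite A" "i : A" "f i = x" "x .: M" "!!j. j : A ==> j \<noteq> i ==> f j = 0@M"
 shows "finsum M f A = x"
proof -
 have "finsum M f (insert i (A - {i})) = x +.M finsum M f (A - {i})"
  using assms by (subst ks_finsum_insert) auto
 moreover have "finsum M f (A - {i}) = 0@M" using assms by (intro ks_finsum_zero) auto
 ultimately show ?thesis using assms by (simp add: insert_absorb)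
qed

lemma ks_finsum_add:
 assumes "kspace M" "f : A \<rightarrow> carrier M" "g : A \<rightarrow> carrier M"
 shows "finsum M (%i. f i +.M g i) A = finsum M f A +.M finsum M g A"
proof -
 interpret Module.module scalars M by fact
 show ?thesis using assms by (auto intro: M.finsum_addf)
qed

lemma ks_finsum_mono_neutral:
 assumes "kspace M" "finite B" "A \<subseteq> B" "f : A \<rightarrow> carrier M" "!!i. i : B - A ==> f i = 0@M"
 shows "finsum M f B = finsum M f A"
proof -
 have A: "finite A" using assms finite_subset by blast
 have "finite C ==> C \<subseteq> B - A ==> finsum M f (C \<union> A) = finsum M f A" for C
 proof (induction C rule: finite_induct)
  case (insert c C)
  have "finsum M f (insert c (C \<union> A)) = f c +.M finsum M f (C \<union> A)"
   using insert assms A by (intro ks_finsum_insert) auto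
  then show ?case using insert assms by auto
 qed simp
 from this[of "B - A"] show ?thesis using assms by (simp add: Un_absorb2)
qed

section \<open>Linear maps\<close>

lemma klI:
 assumes "!!x. x .: M ==> f x .: N"
  and "!!x y. [|x .: M; y .: M|] ==> f (x +.M y) = f x +.N f y"
  and "!!a x. x .: M ==> f (a .*M x) = a .*N f x"
 shows "klinear M N f"
 using assms by (auto simp: klinear_def)

lemma klD:
 assumes "klinear M N f"
 shows "x .: M ==> f x .: N"
  and "[|x .: M; y .: M|] ==> f (x +.M y) = f x +.N f y" (is "PROP ?g1")
  and "x .: M ==> f (a .*M x) = a .*N f x"
  and "[|kspace M; kspace N|] ==> f 0@M = 0@N" (is "PROP ?g2")
proof -
 show 1: "x .: M ==> f x .: N" for x using assms by (auto simp: klinear_def)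
 show "PROP ?g1" using assms by (auto simp: klinear_def)
 show 2: "x .: M ==> f (a .*M x) = a .*N f x" for a x using assms by (auto simp: klinear_def)
 show "PROP ?g2"
  using 2[of "0@M" 0] 1[of "0@M"] by simp
qed

lemma kl_finsum:
 assumes "klinear M N f" "kspace M" "kspace N" "h : A \<rightarrow> carrier M" "finite A"
 shows "f (finsum M h A) = finsum N (%i. f (h i)) A"
 using assms(5,4)
proof (induction A rule: finite_induct)
 case empty then show ?case using assms by (simp add: klD)
next
 case (insert a A)
 then show ?case using assms
  by (simp add: ks_finsum_insert klD[OF assms(1)] Pi_def)
qed

lemma kl_id: "klinear M M (%x. x)" by (simp add: klinear_def)

lemma kl_zero: "kspace N ==> klinear M N (%x. 0@N)" by (simp add: klinear_def)

lemma kl_comp: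
 assumes "klinear M N f" "klinear N L g"
 shows "klinear M L (%x. g (f x))"
 using assms by (simp add: klinear_def Pi_iff)

lemma kl_add:
 assumes "klinear M N f" "klinear M N g" "kspace N"
 shows "klinear M N (%x. f x +.N g x)"
 using assms by (auto intro!: klI simp: klD[OF assms(1)] klD[OF assms(2)] ks_ac ks_distrib)

lemma kl_scale:
 assumes "klinear M N f" "kspace N"
 shows "klinear M N (%x. a .*N f x)"
 using assms by (auto intro!: klI simp: klD[OF assms(1)] ks_distrib mult.commute)

lemma kl_cong:
 assumes "klinear M N f" "kspace M" "!!x. x .: M ==> g x = f x"
 shows "klinear M N g"
 using assms by (auto intro!: klI simp: klD[OF assms(1)])

lemma klinear_finsum_fun:
 assumes "!!i. i : A ==> klinear M N (f i)" "kspace M" "kspace N" "finite A"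
 shows "klinear M N (%x. finsum N (%i. f i x) A)"
 using assms(4,1)
proof (induction A rule: finite_induct)
 case empty then show ?case using assms by (simp add: kl_zero)
next
 case (insert a A)
 have *: "klinear M N (%x. f a x +.N finsum N (%i. f i x) A)"
  using insert by (intro kl_add) (auto simp: assms)
 show ?case
  by (rule kl_cong[OF * \<open>kspace M\<close>], rule ks_finsum_insert)
   (use insert assms klD(1) in fastforce)+
qed

section \<open>Subspaces and spans\<close>

lemma submodule_iff:
 assumes "kspace M"
 shows "submodule H scalars M \<longleftrightarrow> H \<subseteq> carrier M \<and> 0@M : H \<and> (\<forall>x\<in>H. \<forall>y\<in>H. x +.M y : H) \<and> (\<forall>a. \<forall>x\<in>H. a .*M x : H)"
  (is "_ \<longleftrightarrow> ?R")
proof -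
 interpret Module.module scalars M by fact
 show ?thesis
 proof
  assume *: "submodule H scalars M"
  note E = submoduleE[OF *]
  obtain h where h: "h : H" using E(2) by auto
  with E(1) have "0 .*M h = 0@M" by (intro ks_simps(4)[OF assms]) auto
  with h E(4)[of 0 h] have "0@M : H" by simp
  with E(1,4,5) show ?R by simp
 next
  assume R: ?R
  then have "\<ominus>\<^bsub>M\<^esub> a : H" if "a : H" for a using that ks_a_inv[OF assms, of a] by (metis subsetD)
  with R show "submodule H scalars M" by (intro submoduleI) blast+
 qed
qed

lemma submodule_kspace:
 assumes "kspace M" "submodule H scalars M"
 shows "kspace (M\<lparr>carrier := H\<rparr>)"
proof -
 have *: "!!x. x : H ==> x .: M" "0@M : H" "!!x y. x : H ==> y : H ==> x +.M y : H"
  "!!a x. x : H ==> a .*M x : H"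
  using assms(2) unfolding submodule_iff[OF assms(1)] by auto
 show ?thesis
  by (intro kspaceI) (use * assms(1) in \<open>simp_all add: ks_ac ks_distrib ks_neg\<close>)
qed

context
 fixes M :: "('k::field, 'a, 'm) vect" and X
 assumes M: "kspace M" and X: "X \<subseteq> carrier M"
begin

lemma submodule_lspan: "submodule (lspan M X) scalars M"
proof -
 have "submodule (carrier M) scalars M" using M by (auto simp: submodule_iff)
 with X show ?thesis
  unfolding submodule_iff[OF M] lspan_def by blast
qed

lemma lspan_closed:
 "lspan M X \<subseteq> carrier M" "0@M : lspan M X" "[|x : lspan M X; y : lspan M X|] ==> x +.M y : lspan M X"
 "x : lspan M X ==> a .*M x : lspan M X"
 using submodule_lspan unfolding submodule_iff[OF M] by auto

text \<open>Minimality of the span, applied to the subspace of those elements of the carrier that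
  satisfy \<open>P\<close>.\<close>

lemma lspan_induct [consumes 1, case_names zero base add scale]:
 assumes "t : lspan M X" "P 0@M" "!!x. x : X ==> P x"
  "!!x y. [|x .: M; y .: M; P x; P y|] ==> P (x +.M y)" "!!a x. [|x .: M; P x|] ==> P (a .*M x)"
 shows "P t"
proof -
 have "submodule {x : carrier M. P x} scalars M"
  unfolding submodule_iff[OF M] using assms M by auto
 moreover have "X \<subseteq> {x : carrier M. P x}" using X assms by auto
 ultimately have "lspan M X \<subseteq> {x : carrier M. P x}" unfolding lspan_def by blast
 with assms(1) show ?thesis by auto
qed

end

lemma lspan_base: "x : X ==> x : lspan M X"
 by (auto simp: lspan_def)

lemma lspan_mono: "X \<subseteq> Y ==> lspan M X \<subseteq> lspan M Y"
 by (auto simp: lspan_def)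

lemma lspan_minimal: "submodule H scalars M ==> X \<subseteq> H ==> lspan M X \<subseteq> H"
 by (auto simp: lspan_def)

lemma klinear_lspan:
 assumes "klinear M N f" "kspace M" "kspace N" "X \<subseteq> carrier M" "Y \<subseteq> carrier N"
  "!!x. x : X ==> f x : lspan N Y" "t : lspan M X"
 shows "f t : lspan N Y"
 using assms(7)
 by (induction rule: lspan_induct[OF assms(2,4), consumes 1])
  (simp_all add: klD[OF assms(1)] assms lspan_closed[OF assms(3,5)])

subsection \<open>Presented vector spaces\<close>

lemma lookup_fscale [simp]: "Poly_Mapping.lookup (fscale a p) x = a * Poly_Mapping.lookup p x"
 by (simp add: fscale_def Poly_Mapping.map.rep_eq when_def)

lemma vector_space_fscale: "vector_space (fscale :: 'k::field => ('x \<Rightarrow>\<^sub>0 'k) => _)"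
 by unfold_locales (auto intro!: poly_mapping_eqI simp: lookup_add algebra_simps)

interpretation fs: vector_space "fscale :: 'k::field => ('x \<Rightarrow>\<^sub>0 'k) => _"
 by (rule vector_space_fscale)

lemma keys_fscale: "Poly_Mapping.keys (fscale a p) \<subseteq> Poly_Mapping.keys p"
 by (auto simp: in_keys_iff)

lemma fscale_single: "fscale a (Poly_Mapping.single x b) = Poly_Mapping.single x (a * b)"
 by (rule poly_mapping_eqI) (simp add: lookup_single when_def)

text \<open>The map inside \<open>lin_ext\<close>: the linear extension to formal combinations,
  considered before it is known to be constant on classes.\<close>

definition lin_eval :: "('k::field, 'b, 'm) vect => ('x => 'b) => ('x \<Rightarrow>\<^sub>0 'k) => 'b" where
 "lin_eval M f p = (\<Oplus>\<^bsub>M\<^esub>x\<in>Poly_Mapping.keys p. Poly_Mapping.lookup p x .*M f x)"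

lemma keys_add_sub: "Poly_Mapping.keys p \<subseteq> X ==> Poly_Mapping.keys q \<subseteq> X ==> Poly_Mapping.keys (p + q) \<subseteq> X"
 by (meson Poly_Mapping.keys_add Un_least subset_trans)

lemma keys_fscale_sub: "Poly_Mapping.keys p \<subseteq> X ==> Poly_Mapping.keys (fscale a p) \<subseteq> X"
 by (rule order_trans[OF keys_fscale])

lemma diff_fscale: "p - q = p + fscale (-1) (q :: 'x \<Rightarrow>\<^sub>0 'k::field)"
 by (rule poly_mapping_eqI) (simp add: lookup_add lookup_minus)

context
 fixes M :: "('k::field, 'b, 'm) vect" and f :: "'x => 'b" and X
 assumes M: "kspace M" and f: "f : X \<rightarrow> carrier M"
begin

lemma lin_eval_superset:
 assumes "finite S" "Poly_Mapping.keys p \<subseteq> S" "S \<subseteq> X"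
 shows "lin_eval M f p = (\<Oplus>\<^bsub>M\<^esub>x\<in>S. Poly_Mapping.lookup p x .*M f x)"
 unfolding lin_eval_def using assms f M
 by (intro ks_finsum_mono_neutral[symmetric]) (auto simp: in_keys_iff Pi_def subset_iff)

lemma lin_eval_closed: "Poly_Mapping.keys p \<subseteq> X ==> lin_eval M f p .: M"
 unfolding lin_eval_def using f M by (intro ks_finsum_closed) (auto simp: Pi_def subset_iff)

lemma lin_eval_add:
 assumes "Poly_Mapping.keys p \<subseteq> X" "Poly_Mapping.keys q \<subseteq> X"
 shows "lin_eval M f (p + q) = lin_eval M f p +.M lin_eval M f q"
proof -
 let ?S = "Poly_Mapping.keys p \<union> Poly_Mapping.keys q"
 have S: "finite ?S" "?S \<subseteq> X" "Poly_Mapping.keys (p + q) \<subseteq> ?S" using assms Poly_Mapping.keys_add[of p q] by auto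
 have "lin_eval M f (p + q) = (\<Oplus>\<^bsub>M\<^esub>x\<in>?S. Poly_Mapping.lookup p x .*M f x +.M Poly_Mapping.lookup q x .*M f x)"
  unfolding lin_eval_superset[OF S(1,3,2)]
  by (rule ks_finsum_cong[OF M]) (use S f M in \<open>auto simp: lookup_add ks_distrib Pi_def subset_iff\<close>)
 also have "\<dots> = lin_eval M f p +.M lin_eval M f q"
  by (subst ks_finsum_add) (use S f M in \<open>auto simp: lin_eval_superset[of ?S] Pi_def subset_iff\<close>)
 finally show ?thesis .
qed

lemma lin_eval_scale:
 assumes "Poly_Mapping.keys p \<subseteq> X"
 shows "lin_eval M f (fscale a p) = a .*M lin_eval M f p"
proof -
 have S: "Poly_Mapping.keys (fscale a p) \<subseteq> Poly_Mapping.keys p" by (rule keys_fscale)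
 have "a .*M lin_eval M f p = (\<Oplus>\<^bsub>M\<^esub>x\<in>Poly_Mapping.keys p. a .*M (Poly_Mapping.lookup p x .*M f x))"
  unfolding lin_eval_def using assms f M
  by (intro kl_finsum[of M M "%x. a .*M x"] kl_scale kl_id) (auto simp: Pi_def subset_iff)
 also have "\<dots> = lin_eval M f (fscale a p)"
  unfolding lin_eval_superset[OF finite_keys S assms]
  by (rule ks_finsum_cong[OF M]) (use assms f M in \<open>auto simp: Pi_def subset_iff\<close>)
 finally show ?thesis by simp
qed

lemma lin_eval_single: "x : X ==> lin_eval M f (Poly_Mapping.single x a) = a .*M f x"
 using f M by (subst lin_eval_superset[of "{x}"])
  (auto simp: ks_finsum_insert ks_finsum_empty Pi_def)

lemma lin_eval_zero: "lin_eval M f 0 = 0@M"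
 using M by (simp add: lin_eval_def)

end

context
 fixes X :: "'x set" and Rel :: "('x \<Rightarrow>\<^sub>0 'k::field) set"
 assumes Rel: "\<forall>r\<in>Rel. Poly_Mapping.keys r \<subseteq> X"
begin

lemma keys_span_rel: "r : fs.span Rel ==> Poly_Mapping.keys r \<subseteq> X"
 by (induction rule: fs.span_induct_alt) (auto simp: Rel keys_add_sub keys_fscale_sub)

lemma pcls_self: "p : pcls Rel p"
 by (simp add: pcls_def fs.span_zero)

lemma pcls_eq_iff: "pcls Rel p = pcls Rel q \<longleftrightarrow> p - q : fs.span Rel"
proof
 assume "pcls Rel p = pcls Rel q" then have "p : pcls Rel q" using pcls_self by blast
 then show "p - q : fs.span Rel" by (simp add: pcls_def)
next
 assume *: "p - q : fs.span Rel"
 have "r - p : fs.span Rel \<longleftrightarrow> r - q : fs.span Rel" for r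
  using fs.span_add[OF _ *, of "r - p"] fs.span_diff[OF _ *, of "r - q"] by auto
 then show "pcls Rel p = pcls Rel q" by (auto simp: pcls_def)
qed

lemma pcls_add_cong:
 "p' : pcls Rel p ==> q' : pcls Rel q ==> pcls Rel (p' + q') = pcls Rel (p + q)"
proof -
 assume "p' : pcls Rel p" "q' : pcls Rel q"
 then have "(p' - p) + (q' - q) : fs.span Rel" by (intro fs.span_add) (auto simp: pcls_def)
 then show ?thesis by (simp add: pcls_eq_iff algebra_simps)
qed

lemma pcls_scale_cong: "p' : pcls Rel p ==> pcls Rel (fscale a p') = pcls Rel (fscale a p)"
proof -
 assume "p' : pcls Rel p"
 then have "fscale a (p' - p) : fs.span Rel" by (intro fs.span_scale) (auto simp: pcls_def)
 then show ?thesis by (simp add: pcls_eq_iff fs.scale_right_diff_distrib)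
qed

text \<open>The record defines its operations as unions over representatives; all members of such a
  union are the same class, so it collapses.\<close>

lemma presented_ops:
 "pcls Rel p +.(presented X Rel) pcls Rel q = pcls Rel (p + q)"
 "a .*(presented X Rel) pcls Rel p = pcls Rel (fscale a p)"
 "0@(presented X Rel) = pcls Rel 0"
proof -
 have ne: "pcls Rel r \<noteq> {}" for r using pcls_self by blast
 have "(\<Union>p'\<in>pcls Rel p. \<Union>q'\<in>pcls Rel q. pcls Rel (p' + q')) = (\<Union>p'\<in>pcls Rel p. \<Union>q'\<in>pcls Rel q. pcls Rel (p + q))"
  by (intro SUP_cong refl pcls_add_cong)
 then show "pcls Rel p +.(presented X Rel) pcls Rel q = pcls Rel (p + q)"
  by (simp add: presented_def ne)
 have "(\<Union>p'\<in>pcls Rel p. pcls Rel (fscale a p')) = (\<Union>p'\<in>pcls Rel p. pcls Rel (fscale a p))"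
  by (intro SUP_cong refl pcls_scale_cong)
 then show "a .*(presented X Rel) pcls Rel p = pcls Rel (fscale a p)"
  by (simp add: presented_def ne)
qed (simp add: presented_def)

lemma presented_carrier: "carrier (presented X Rel) = {pcls Rel p |p. Poly_Mapping.keys p \<subseteq> X}"
 by (simp add: presented_def)

lemma presented_cases:
 assumes "x .: (presented X Rel)"
 obtains p where "x = pcls Rel p" "Poly_Mapping.keys p \<subseteq> X"
 using assms by (auto simp: presented_carrier)

lemma pcls_carrier [simp]: "Poly_Mapping.keys p \<subseteq> X ==> pcls Rel p .: (presented X Rel)"
 by (auto simp: presented_carrier)

lemma kspace_presented: "kspace (presented X Rel)"
 by (rule kspaceI; (elim presented_cases)?)
  (simp_all add: presented_ops add_ac fs.scale_left_distrib fs.scale_right_distrib keys_add_sub keys_fscale_sub)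

text \<open>A representative is built up key by key; updating it at a new key adds a multiple of one
  generator.\<close>

lemma presented_induct [consumes 1, case_names zero gen]:
 assumes "c .: (presented X Rel)" "P 0@(presented X Rel)"
  "!!a x c. [|x : X; c .: (presented X Rel); P c|] ==>
   P (a .*(presented X Rel) pcls Rel (Poly_Mapping.single x 1) +.(presented X Rel) c)"
 shows "P c"
proof -
 obtain p where p: "c = pcls Rel p" "Poly_Mapping.keys p \<subseteq> X" using assms(1) by (auto simp: presented_carrier)
 have "P (pcls Rel p)" using p(2)
 proof (induction p rule: update_induct)
  case const
  then show ?case using assms(2) by (simp add: presented_ops)
 next
  case (update q x a)
  have eq: "Poly_Mapping.update x a q = Poly_Mapping.single x a + q"
   by (rule poly_mapping_eqI) (use update in \<open>auto simp: lookup_update lookup_add lookup_single in_keys_iff when_def\<close>)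
  have "x : X" "Poly_Mapping.keys q \<subseteq> X" using update by (auto simp: keys_update)
  with update have "P (a .*(presented X Rel) pcls Rel (Poly_Mapping.single x 1) +.(presented X Rel) pcls Rel q)"
   by (intro assms(3)) simp_all
  then show ?case by (simp add: eq presented_ops fscale_single)
 qed
 with p show ?thesis by simp
qed

end

context
 fixes X :: "'x set" and Rel :: "('x \<Rightarrow>\<^sub>0 'k::field) set"
  and M :: "('k, 'b, 'm) vect" and f :: "'x => 'b"
 assumes Rel: "\<forall>r\<in>Rel. Poly_Mapping.keys r \<subseteq> X"
  and M: "kspace M" and f: "\<forall>x\<in>X. f x .: M"
  and resp: "\<forall>r\<in>Rel. lin_eval M f r = 0@M"
begin

lemma lin_eval_span: "r : fs.span Rel ==> lin_eval M f r = 0@M"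
proof -
 have fX: "f : X \<rightarrow> carrier M" using f by auto
 assume "r : fs.span Rel"
 then have "Poly_Mapping.keys r \<subseteq> X \<and> lin_eval M f r = 0@M"
 proof (induction rule: fs.span_induct_alt)
  case base then show ?case by (simp add: lin_eval_zero[OF M fX])
 next
  case (step c x y)
  then show ?case using Rel resp M
   by (simp add: lin_eval_add[OF M fX] lin_eval_scale[OF M fX] keys_add_sub keys_fscale_sub)
 qed
 then show ?thesis by simp
qed

text \<open>\<open>lin_eval\<close> kills the span of the relations and is therefore constant on
  each class, so \<open>the_elem\<close> in \<open>lin_ext\<close> returns exactly this
  value.\<close>

lemma lin_ext_pcls:
 assumes "Poly_Mapping.keys p \<subseteq> X"
 shows "lin_ext M f (pcls Rel p) = lin_eval M f p"
proof -
 have fX: "f : X \<rightarrow> carrier M" using f by auto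
 have "lin_eval M f q = lin_eval M f p" if "q : pcls Rel p" for q
 proof -
  have s: "q - p : fs.span Rel" using that by (simp add: pcls_def)
  have "lin_eval M f (p + (q - p)) = lin_eval M f p +.M lin_eval M f (q - p)"
   by (intro lin_eval_add[OF M fX] assms keys_span_rel[OF Rel s])
  then show ?thesis using lin_eval_span[OF s] lin_eval_closed[OF M fX assms] M by simp
 qed
 then have "lin_eval M f ` pcls Rel p = (%_. lin_eval M f p) ` pcls Rel p" by (intro image_cong refl)
 moreover have "pcls Rel p \<noteq> {}" using pcls_self[OF Rel, where p = p] by blast
 ultimately have "lin_eval M f ` pcls Rel p = {lin_eval M f p}" by (simp add: image_constant_conv)
 then show ?thesis unfolding lin_ext_def lin_eval_def[abs_def] by simp
qed

lemma lin_ext_gen: "x : X ==> lin_ext M f (pcls Rel (Poly_Mapping.single x 1)) = f x"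
 using f M by (simp add: lin_ext_pcls lin_eval_single[of M f X] Pi_def)

lemma klinear_lin_ext: "klinear (presented X Rel) M (lin_ext M f)"
proof -
 have fX: "f : X \<rightarrow> carrier M" using f by auto
 show ?thesis
  by (rule klI; (elim presented_cases[OF Rel])?)
   (simp_all add: presented_ops[OF Rel] lin_ext_pcls keys_add_sub keys_fscale_sub lin_eval_closed[OF M fX]
    lin_eval_add[OF M fX] lin_eval_scale[OF M fX])
qed

end

text \<open>The identity f s f = f puts every x - s (f x) into the kernel of f, and it can be
  tensored with itself. This gives all later exactness: the kernel of f\<otimes>f, the factorisation
  of maps through f\<otimes>f, and the injectivity of tensored inclusions. The construction takes
  place in the free vector spaces on the two element types, where an independent set can be extended
  to a spanning one.\<close>

lemma generalized_inverse:
 fixes M :: "('k::field, 'a, 'm) vect" and N :: "('k, 'b, 'n) vect"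
 assumes M: "kspace M" and N: "kspace N" and f: "klinear M N f"
 obtains s where "klinear N M s" "!!x. x .: M ==> f (s (f x)) = f x"
proof -
 note fD = klD[OF f]
 \<comment> \<open>Elements off the carrier are evaluated to zero, so that the evaluation is defined
   and linear on the whole free space.\<close>
 define eM where "eM = lin_eval M (%x. if x .: M then x else 0@M)"
 define eN where "eN = lin_eval N (%x. if x .: N then x else 0@N)"
 have M': "(%x. if x .: M then x else 0@M) : UNIV \<rightarrow> carrier M" using M by auto
 have N': "(%x. if x .: N then x else 0@N) : UNIV \<rightarrow> carrier N" using N by auto
 have eM: "eM (p + q) = eM p +.M eM q" "eM (fscale a p) = a .*M eM p" "eM 0 = 0@M" "eM p .: M"
  "x .: M ==> eM (Poly_Mapping.single x a) = a .*M x" for p q a x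
  unfolding eM_def using lin_eval_add[OF M M'] lin_eval_scale[OF M M'] lin_eval_zero[OF M M']
   lin_eval_closed[OF M M'] lin_eval_single[OF M M'] by simp_all
 have eN: "eN (p + q) = eN p +.N eN q" "eN (fscale a p) = a .*N eN p" "eN 0 = 0@N" "eN p .: N"
  "x .: N ==> eN (Poly_Mapping.single x a) = a .*N x" for p q a x
  unfolding eN_def using lin_eval_add[OF N N'] lin_eval_scale[OF N N'] lin_eval_zero[OF N N']
   lin_eval_closed[OF N N'] lin_eval_single[OF N N'] by simp_all
 \<comment> \<open>\<open>W0\<close> is the kernel of the evaluation onto N and \<open>W1\<close>
   the preimage of the image of f. A basis of the former is extended to one of the latter.\<close>
 define W0 where "W0 = {q. eN q = 0@N}"
 define W1 where "W1 = {q. \<exists>p. eN q = f (eM p)}"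
 have sub0: "fs.subspace W0" unfolding fs.subspace_def W0_def using N by (simp add: eN)
 have f0: "f 0@M = 0@N" using fD(4)[OF M N] .
 have W01: "W0 \<subseteq> W1" unfolding W0_def W1_def using eM(3) f0 by (metis (mono_tags) Collect_mono)
 obtain B0 where B0: "B0 \<subseteq> W0" "fs.independent B0" "W0 \<subseteq> fs.span B0"
  using fs.maximal_independent_subset[of W0] by blast
 obtain B1 where B1: "B0 \<subseteq> B1" "B1 \<subseteq> W1" "fs.independent B1" "W1 \<subseteq> fs.span B1"
  using fs.maximal_independent_subset_extend[of B0 W1] B0 W01 by blast
 \<comment> \<open>Each basis vector gets a lift through f; those in \<open>B0\<close> are lifted to
   0, so that the resulting map vanishes on \<open>W0\<close> and descends to N.\<close>
 have "\<forall>b\<in>B1. \<exists>p. (b : B0 \<longrightarrow> p = 0) \<and> eN b = f (eM p)"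
 proof
  fix b assume b: "b : B1"
  show "\<exists>p. (b : B0 \<longrightarrow> p = 0) \<and> eN b = f (eM p)"
  proof (cases "b : B0")
   case True
   then have "eN b = f (eM 0)" using B0 f0 eM(3) by (auto simp: W0_def)
   then show ?thesis by blast
  next
   case False
   then show ?thesis using b B1(2) by (auto simp: W1_def)
  qed
 qed
 then obtain h where h: "!!b. b : B1 ==> (b : B0 \<longrightarrow> h b = 0) \<and> eN b = f (eM (h b))" by metis
 interpret fsp: vector_space_pair "fscale :: 'k => ('b \<Rightarrow>\<^sub>0 'k) => _" "fscale :: 'k => ('a \<Rightarrow>\<^sub>0 'k) => _"
  by unfold_locales
 obtain g where g: "Vector_Spaces.linear fscale fscale g" "!!b. b : B1 ==> g b = h b"
  using fsp.linear_independent_extend[OF B1(3), of h] by blast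
 note gl = fsp.linear_add[OF g(1)] fsp.linear_scale[OF g(1)] fsp.linear_0[OF g(1)]
 have g0: "g w = 0" if "w : W0" for w
 proof -
  have "w : fs.span B0" using that B0 by blast
  then show ?thesis
   by (induction rule: fs.span_induct_alt) (use B1(1) g(2) h gl in \<open>auto simp: subset_iff\<close>)
 qed
 have g1: "f (eM (g w)) = eN w" if "w : W1" for w
 proof -
  have "w : fs.span B1" using that B1 by blast
  then show ?thesis
   by (induction rule: fs.span_induct_alt) (simp_all add: gl eM eN f0 fD M g(2) h)
 qed
 \<comment> \<open>The vector y is represented by its formal generator; the next fact shows that any
   representative gives the same lift, whence linearity.\<close>
 define s where "s = (%y. eM (g (Poly_Mapping.single y 1)))"
 have eq: "g p = g q" if "eN p = eN q" for p q
 proof -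
  have "eN (p - q) = 0@N" unfolding diff_fscale eN using that N by (simp add: ks_neg eN)
  then have "g (p - q) = 0" by (intro g0) (simp add: W0_def)
  then show ?thesis by (simp add: fsp.linear_diff[OF g(1)])
 qed
 have "klinear N M s"
 proof (rule klI)
  fix x y a assume xy: "x .: N" "y .: N"
  show "s x .: M" by (simp add: s_def eM)
  have "g (Poly_Mapping.single (x +.N y) 1) = g (Poly_Mapping.single x 1 + Poly_Mapping.single y 1)"
   by (rule eq) (use xy N in \<open>simp add: eN\<close>)
  then show "s (x +.N y) = s x +.M s y" by (simp add: s_def gl eM)
  have "g (Poly_Mapping.single (a .*N x) 1) = g (fscale a (Poly_Mapping.single x 1))"
   by (rule eq) (use xy N in \<open>simp add: eN\<close>)
  then show "s (a .*N x) = a .*M s x" by (simp add: s_def gl eM)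
 qed
 moreover have "f (s (f x)) = f x" if x: "x .: M" for x
 proof -
  have "eN (Poly_Mapping.single (f x) 1) = f (eM (Poly_Mapping.single x 1))"
   using x fD(1)[OF x] M N by (simp add: eN eM)
  then have "Poly_Mapping.single (f x) 1 : W1" by (auto simp: W1_def)
  from g1[OF this] show ?thesis using fD(1)[OF x] N by (simp add: s_def eN)
 qed
 ultimately show ?thesis by (rule that)
qed

subsection \<open>Tensor products\<close>

definition kbilinear ::
  "('k::field, 'a, 'm) vect => ('k, 'b, 'n) vect => ('k, 'c, 'o) vect =>
   ('a => 'b => 'c) => bool" where
 "kbilinear U W M f \<longleftrightarrow> (\<forall>u\<in>carrier U. klinear W M (f u)) \<and> (\<forall>w\<in>carrier W. klinear U M (%u. f u w))"

lemma kbilI: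
 assumes "!!u. u .: U ==> klinear W M (f u)" "!!w. w .: W ==> klinear U M (%u. f u w)"
 shows "kbilinear U W M f"
 using assms by (simp add: kbilinear_def)

lemma kbilD:
 assumes "kbilinear U W M f"
 shows "u .: U ==> klinear W M (f u)" "w .: W ==> klinear U M (%u. f u w)"
 using assms by (simp_all add: kbilinear_def)

lemma tens_rel_keys:
 assumes "kspace U" "kspace W"
 shows "\<forall>r\<in>tens_rel U W. Poly_Mapping.keys r \<subseteq> carrier U \<times> carrier W"
proof
 fix r assume r: "r : tens_rel U W"
 have *: "Poly_Mapping.keys (Poly_Mapping.single (u, w) a) \<subseteq> carrier U \<times> carrier W"
  if "u .: U" "w .: W" for u w and a :: 'a
  using that by auto
 show "Poly_Mapping.keys r \<subseteq> carrier U \<times> carrier W"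
  using r unfolding tens_rel_def diff_fscale
  by (elim UnE CollectE exE conjE; simp only:)
   (intro keys_add_sub keys_fscale_sub * ks_closed assms; assumption)+
qed

context
 fixes U :: "('k::field, 'a, 'm) vect" and W :: "('k, 'b, 'n) vect"
 assumes U: "kspace U" and W: "kspace W"
begin

lemma kspace_tensor [simp]: "kspace (U ** W)"
 unfolding tensor_mod_def by (rule kspace_presented) (rule tens_rel_keys[OF U W])

lemma pure_closed [simp]: "u .: U ==> w .: W ==> pure U W u w .: (U ** W)"
 unfolding tensor_mod_def pure_def by (rule pcls_carrier[OF tens_rel_keys[OF U W]]) auto

lemma pure_bilinear:
 assumes "u .: U" "w .: W"
 shows "u' .: U ==> pure U W (u +.U u') w = pure U W u w +.(U ** W) pure U W u' w"
  and "w' .: W ==> pure U W u (w +.W w') = pure U W u w +.(U ** W) pure U W u w'"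
  and "pure U W (a .*U u) w = a .*(U ** W) pure U W u w" (is ?g1)
  and "pure U W u (a .*W w) = a .*(U ** W) pure U W u w" (is ?g2)
proof -
 note ops = presented_ops[OF tens_rel_keys[OF U W]]
 note eqI = pcls_eq_iff[OF tens_rel_keys[OF U W], THEN iffD2, OF fs.span_base]
 show "pure U W (u +.U u') w = pure U W u w +.(U ** W) pure U W u' w" if "u' .: U"
  unfolding pure_def tensor_mod_def ops
  by (rule eqI, unfold diff_diff_eq[symmetric] tens_rel_def) (use assms that in blast)
 show "pure U W u (w +.W w') = pure U W u w +.(U ** W) pure U W u w'" if "w' .: W"
  unfolding pure_def tensor_mod_def ops
  by (rule eqI, unfold diff_diff_eq[symmetric] tens_rel_def) (use assms that in blast)
 show ?g1
  unfolding pure_def tensor_mod_def ops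
  by (rule eqI, unfold fscale_single mult_1_right tens_rel_def) (use assms in blast)
 show ?g2
  unfolding pure_def tensor_mod_def ops
  by (rule eqI, unfold fscale_single mult_1_right tens_rel_def) (use assms in blast)
qed

lemma kl_pure:
 shows "u .: U ==> klinear W (U ** W) (pure U W u)"
  and "w .: W ==> klinear U (U ** W) (%u. pure U W u w)"
 by (auto intro!: klI simp: pure_bilinear)

lemma pure_zero [simp]:
 shows "u .: U ==> pure U W u 0@W = 0@(U ** W)"
  and "w .: W ==> pure U W 0@U w = 0@(U ** W)"
 using klD(4)[OF kl_pure(1)] klD(4)[OF kl_pure(2)] U W by simp_all

text \<open>Pure tensors cover zero, and a scalar is absorbed into the first factor, so sums are the
  only other case.\<close>

lemma tensor_induct [consumes 1, case_names pure add]: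
 assumes "t .: (U ** W)"
  and pure: "!!u w. [|u .: U; w .: W|] ==> P (pure U W u w)"
  and add: "!!s t. [|s .: (U ** W); t .: (U ** W); P s; P t|] ==> P (s +.(U ** W) t)"
 shows "P t"
 using assms(1) unfolding tensor_mod_def
proof (induction rule: presented_induct[OF tens_rel_keys[OF U W], consumes 1])
 case 1
 have "P (pure U W 0@U 0@W)" by (rule pure) (simp_all add: U W)
 then show ?case by (simp add: U W tensor_mod_def[symmetric])
next
 case (2 a x c)
 then obtain u w where x: "x = (u, w)" "u .: U" "w .: W" by auto
 have "P (pure U W (a .*U u) w +.(U ** W) c)"
  using x 2 by (intro add pure) (simp_all add: U W tensor_mod_def[symmetric])
 then show ?case using x by (simp add: pure_bilinear tensor_mod_def[symmetric] pure_def[symmetric])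
qed

lemma tensor_eq:
 assumes "klinear (U ** W) M f" "klinear (U ** W) M g"
  and "!!u w. [|u .: U; w .: W|] ==> f (pure U W u w) = g (pure U W u w)"
  and "t .: (U ** W)"
 shows "f t = g t"
 using assms(4)
 by (induction rule: tensor_induct) (simp_all add: assms(3) klD(2)[OF assms(1)] klD(2)[OF assms(2)])

text \<open>The universal property of the tensor product: a bilinear map kills the four families of
  \<open>tens_rel\<close>.\<close>

lemma tens_ext:
 assumes f: "kbilinear U W M f" and M: "kspace M"
 shows "klinear (U ** W) M (lin_ext M (%(u, w). f u w))" (is ?g1)
  and "u .: U ==> w .: W ==> lin_ext M (%(u, w). f u w) (pure U W u w) = f u w" (is "PROP ?g2")
proof -
 note f1 = klD[OF kbilD(1)[OF f]] and f2 = klD[OF kbilD(2)[OF f]]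
 let ?f = "%(u, w). f u w"
 have c: "\<forall>x\<in>carrier U \<times> carrier W. ?f x .: M" using f1(1) by auto
 then have fX: "?f : carrier U \<times> carrier W \<rightarrow> carrier M" by auto
 have ev: "lin_eval M ?f (p - q) = lin_eval M ?f p +.M (-1) .*M lin_eval M ?f q"
  if "Poly_Mapping.keys p \<subseteq> carrier U \<times> carrier W" "Poly_Mapping.keys q \<subseteq> carrier U \<times> carrier W" for p q
  using lin_eval_add[OF M fX that(1) keys_fscale_sub[OF that(2), of "-1"]] lin_eval_scale[OF M fX that(2)]
  unfolding diff_fscale[of p q] by (simp only:)
 have ks: "Poly_Mapping.keys (p - q) \<subseteq> carrier U \<times> carrier W"
  if "Poly_Mapping.keys p \<subseteq> carrier U \<times> carrier W" "Poly_Mapping.keys q \<subseteq> carrier U \<times> carrier W" for p q :: "_ \<Rightarrow>\<^sub>0 'k"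
  unfolding diff_fscale using that by (intro keys_add_sub keys_fscale_sub)
 have sgl: "lin_eval M ?f (Poly_Mapping.single (u, w) a) = a .*M f u w"
  "Poly_Mapping.keys (Poly_Mapping.single (u, w) a) \<subseteq> carrier U \<times> carrier W"
  if "u .: U" "w .: W" for u w a
  using that by (simp_all add: lin_eval_single[OF M fX])
 have resp: "lin_eval M ?f r = 0@M" if "r : tens_rel U W" for r
 proof -
  have *: "((x +.M y) +.M (-1) .*M x) +.M (-1) .*M y = 0@M"
   if "x .: M" "y .: M" for x y
   using M that by (simp add: ks_ac(2)[OF M that] ks_ac(1) ks_neg)
  have **: "a .*M x +.M (- a) .*M x = 0@M" if "x .: M" for a x
   using ks_neg[OF M ks_closed(3)[OF M that]] M that by simp
  from that show ?thesis
   unfolding tens_rel_def Un_iff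
  proof (elim disjE CollectE exE conjE)
   fix u u' w assume r: "r = Poly_Mapping.single (u +.U u', w) 1 - Poly_Mapping.single (u, w) 1 - Poly_Mapping.single (u', w) 1"
    "u .: U" "u' .: U" "w .: W"
   then show ?thesis unfolding r(1) by (simp add: ev ks sgl U W f1 f2 M *)
  next
   fix u w w' assume r: "r = Poly_Mapping.single (u, w +.W w') 1 - Poly_Mapping.single (u, w) 1 - Poly_Mapping.single (u, w') 1"
    "u .: U" "w' .: W" "w .: W"
   then show ?thesis unfolding r(1) by (simp add: ev ks sgl U W f1 f2 M *)
  next
   fix a u w assume r: "r = Poly_Mapping.single (a .*U u, w) 1 - Poly_Mapping.single (u, w) a" "u .: U" "w .: W"
   then show ?thesis unfolding r(1) by (simp add: ev ks sgl U W f1 f2 M **)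
  next
   fix a u w assume r: "r = Poly_Mapping.single (u, a .*W w) 1 - Poly_Mapping.single (u, w) a" "u .: U" "w .: W"
   then show ?thesis unfolding r(1) by (simp add: ev ks sgl U W f1 f2 M **)
  qed
 qed
 show ?g1
  unfolding tensor_mod_def by (rule klinear_lin_ext[OF tens_rel_keys[OF U W] M c ballI[OF resp]])
 show "PROP ?g2"
  unfolding pure_def using lin_ext_gen[OF tens_rel_keys[OF U W] M c ballI[OF resp], of "(u, w)"] by simp
qed

end

context
 fixes U :: "('k::field, 'a, 'm) vect" and W :: "('k, 'b, 'n) vect"
  and U' :: "('k::field, 'c, 'p) vect" and W' :: "('k, 'd, 'q) vect"
  and f g
 assumes U: "kspace U" and W: "kspace W" and U': "kspace U'" and W': "kspace W'"
  and f: "klinear U U' f" and g: "klinear W W' g"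
begin

lemma kl_tmap: "klinear (U ** W) (U' ** W') (tmap U' W' f g)"
 and tmap_pure: "u .: U ==> w .: W ==> tmap U' W' f g (pure U W u w) = pure U' W' (f u) (g w)"
proof -
 have "kbilinear U W (U' ** W') (%u w. pure U' W' (f u) (g w))"
  by (intro kbilI klI)
   (simp_all add: klD[OF f] klD[OF g] U' W' pure_bilinear[OF U' W'])
 from tens_ext[OF U W this kspace_tensor[OF U' W']]
 show "klinear (U ** W) (U' ** W') (tmap U' W' f g)"
  "u .: U ==> w .: W ==> tmap U' W' f g (pure U W u w) = pure U' W' (f u) (g w)"
  by (simp_all add: tmap_def)
qed

end

text \<open>\<open>tassoc\<close> nests one extension in another. Linearity of the inner one in w,
  for an arbitrary tensor in the first slot, comes by induction over that tensor; only then does the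
  outer extension make sense.\<close>

lemma tassoc_tensor:
 fixes U :: "('k::field, 'a, 'l) vect" and V :: "('k, 'b, 'm) vect" and W :: "('k, 'c, 'n) vect"
 assumes U: "kspace U" and V: "kspace V" and W: "kspace W"
 shows "klinear ((U ** V) ** W) (U ** (V ** W)) (tassoc U V W)"
  and "[|u .: U; v .: V; w .: W|] ==>
   tassoc U V W (pure (U ** V) W (pure U V u v) w) = pure U (V ** W) u (pure V W v w)" (is "PROP ?g1")
proof -
 let ?M = "U ** (V ** W)"
 let ?h = "%w. lin_ext ?M (%(u, v). pure U (V ** W) u (pure V W v w))"
 have M: "kspace ?M" using U V W by simp
 have b: "kbilinear U V ?M (%u v. pure U (V ** W) u (pure V W v w))" if "w .: W" for w
  using that U V W by (intro kbilI klI) (simp_all add: pure_bilinear)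
 note h = tens_ext[OF U V b M]
 have "klinear W ?M (%w. ?h w t)" if "t .: (U ** V)" for t
  using that
 proof (induction rule: tensor_induct[OF U V, consumes 1])
  case (1 u w)
  show ?case by (rule kl_cong[OF _ W, where f = "%w'. pure U (V ** W) u (pure V W w w')"])
   (use 1 U V W in \<open>simp_all add: h klI pure_bilinear\<close>)
 next
  case (2 s t)
  show ?case by (rule kl_cong[OF kl_add[OF 2(3,4) M] W])
   (use 2 in \<open>simp add: klD[OF h(1)]\<close>)
 qed
 then have "kbilinear (U ** V) W ?M (%t w. ?h w t)" using h(1) by (intro kbilI)
 note T = tens_ext[OF _ W this M]
 show "klinear ((U ** V) ** W) ?M (tassoc U V W)"
  using T(1) U V by (simp add: tassoc_def Let_def)
 show "PROP ?g1"
  using T(2)[of "pure U V u v" w] U V h(2)[of w u v] by (simp add: tassoc_def Let_def)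
qed

text \<open>Passes linearity in a parameter from pure tensors to all tensors, as the nested
  extensions of \<open>mid_braiding\<close> require.\<close>

lemma klinear_param:
 assumes "kspace A" "kspace B" "kspace U" "kspace M"
  and "!!u. u .: U ==> klinear (A ** B) M (F u)"
  and "!!a b. [|a .: A; b .: B|] ==> klinear U M (%u. F u (pure A B a b))"
  and "t .: (A ** B)"
 shows "klinear U M (%u. F u t)"
 using assms(7)
proof (induction rule: tensor_induct[OF assms(1,2), consumes 1])
 case (1 a b) then show ?case by (rule assms(6))
next
 case (2 s t)
 show ?case by (rule kl_cong[OF kl_add[OF 2(3,4) assms(4)] assms(3)])
  (use 2 in \<open>simp add: klD[OF assms(5)]\<close>)
qed

text \<open>The constructions of linear algebra read these four fields only. An algebra, its crossed
  module and its bare vector space have different record types, and facts move between them along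
  this relation.\<close>

definition same_space :: "('k::field, 'a, 'm) vect => ('k, 'a, 'n) vect => bool" where
 "same_space M N \<longleftrightarrow> carrier M = carrier N \<and> add M = add N \<and> zero M = zero N \<and> module.smult M = module.smult N"

lemma same_space_finsum: "same_space M N ==> finsum M = finsum N"
 by (intro ext) (simp add: same_space_def finsum_def finprod_def)

lemma same_space_lin_ext: "same_space M N ==> lin_ext M = lin_ext N"
 by (rule ext)+ (simp add: lin_ext_def same_space_finsum, simp add: same_space_def)

lemma same_space_klinear:
 "same_space M N ==> klinear M L f = klinear N L f" "same_space M N ==> klinear L' M f' = klinear L' N f'"
 by (simp_all add: klinear_def same_space_def)

lemma same_space_tensor:
 "same_space M N ==> M ** L = N ** L" "same_space M N ==> L ** M = L ** N"
 "same_space M N ==> pure M L = pure N L" "same_space M N ==> pure L M = pure L N"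
 by (simp_all add: same_space_def tensor_mod_def pure_def[abs_def] tens_rel_def)

lemma same_space_tmap:
 "same_space M N ==> tmap M L = tmap N L" "same_space M N ==> tmap L M = tmap L N"
 by (intro ext, simp add: tmap_def same_space_tensor)+

lemma same_space_sym: "same_space M N ==> same_space N M"
 by (simp add: same_space_def)

lemma same_space_kspaceD:
 assumes "same_space Q P" "kspace Q"
 shows "kspace P"
proof -
 have eqs: "carrier P = carrier Q" "add P = add Q" "zero P = zero Q" "module.smult P = module.smult Q"
  using assms(1) by (simp_all add: same_space_def)
 show ?thesis
  by (intro kspaceI; unfold eqs) (use assms(2) in \<open>simp_all add: ks_ac ks_distrib ks_neg\<close>)
qed

lemma same_space_kspace:
 assumes "same_space M N" shows "kspace M = kspace N"
 by (rule iffI, erule same_space_kspaceD[OF assms], erule same_space_kspaceD[OF same_space_sym[OF assms]])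

lemma same_space_submodule: "same_space M N ==> kspace M ==> submodule H scalars M = submodule H scalars N"
 using same_space_kspace[of M N] by (simp add: submodule_iff) (simp add: same_space_def)

lemmas same_space_simps =
 same_space_finsum same_space_lin_ext same_space_klinear same_space_tensor same_space_tmap same_space_kspace

lemma same_space_tensor_object:
 "same_space (tensor G U W) (U ** W)"
 "same_space (tensor_algebra G U W) (U ** W)"
 "same_space (tensor_coalgebra G C D) (C ** D)"
 by (simp_all add: same_space_def tensor_def tensor_algebra_def tensor_coalgebra_def module.defs
   crossed_module.defs braided_coalgebra.defs)

lemmas tensor_object_simps [simp] = same_space_simps[OF same_space_tensor_object(1)]
 same_space_simps[OF same_space_tensor_object(2)] same_space_simps[OF same_space_tensor_object(3)]
 same_space_tensor_object[unfolded same_space_def]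

section \<open>Crossed modules\<close>

locale finite_comm_group = comm_group G for G :: "('g, 'x) monoid_scheme" (structure) +
 assumes finite_carrier [simp]: "finite (carrier G)"
begin

abbreviation "TT V \<equiv> TV G V ** TV G V"
abbreviation "tpure V \<equiv> pure (TV G V) (TV G V)"

text \<open>The component of degree g in the grading by G that a coaction of kG amounts to.\<close>

definition homog :: "('k::field, 'g, 'a, 'm) cmod => 'g => 'a => bool" where
 "homog V g v \<longleftrightarrow> g .: G \<and> v .: V \<and> coact V g v = v"

lemma conj_cancel: "g .: G ==> h .: G ==> g \<otimes> h \<otimes> inv g = h"
 by (simp add: m_comm[of g h] m_assoc)

lemma inv_mult_eq: "[|g .: G; h .: G; k .: G|] ==> inv g \<otimes> k = h \<longleftrightarrow> k = g \<otimes> h"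
 by (metis inv_solve_left m_closed)

text \<open>Conjugation is trivial in an abelian group, which turns the Yetter-Drinfeld condition
  into the last item: action and coaction commute.\<close>

lemma crossedD:
 assumes "crossed_module G V"
 shows "kspace V" "g .: G ==> klinear V V (act V g)" "g .: G ==> klinear V V (coact V g)"
  "v .: V ==> act V \<one> v = v"
  "[|g .: G; h .: G; v .: V|] ==> act V (g \<otimes> h) v = act V g (act V h v)"
  "[|g .: G; h .: G; v .: V|] ==> coact V g (coact V h v) = (if g = h then coact V g v else 0@V)"
  "v .: V ==> (\<Oplus>\<^bsub>V\<^esub>g\<in>carrier G. coact V g v) = v"
  "[|g .: G; h .: G; v .: V|] ==> coact V h (act V g v) = act V g (coact V h v)"
 using assms conj_cancel by (auto simp: crossed_module_def)

lemma cm_kspace [simp]: "crossed_module G V ==> kspace V"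
 by (rule crossedD)

lemma act_closed [simp]: "crossed_module G V ==> g .: G ==> v .: V ==> act V g v .: V"
 by (rule klD(1)[OF crossedD(2)])

lemma coact_closed [simp]: "crossed_module G V ==> g .: G ==> v .: V ==> coact V g v .: V"
 by (rule klD(1)[OF crossedD(3)])

lemma homogD: "homog V g v ==> g .: G" "homog V g v ==> v .: V"
 by (simp_all add: homog_def)

lemma homog_coact:
 assumes "crossed_module G V" "homog V g v" "h .: G"
 shows "coact V h v = (if h = g then v else 0@V)"
 using crossedD(6)[OF assms(1,3), of g v] assms(2) by (auto simp: homog_def)

lemma homog_intros:
 assumes "crossed_module G V"
 shows "g .: G ==> v .: V ==> homog V g (coact V g v)"
  and "homog V g v ==> h .: G ==> homog V g (act V h v)"
  and "homog V g v ==> homog V g w ==> homog V g (v +.V w)"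
  and "homog V g v ==> homog V g (a .*V v)"
  and "g .: G ==> homog V g 0@V"
 using assms by (auto simp: homog_def crossedD(6,8) klD[OF crossedD(3)])

text \<open>Every v is the sum of its components \<open>coact V g v\<close>, a finite sum because G
  is finite.\<close>

lemma homog_induct [consumes 2, case_names homog add]:
 assumes "crossed_module G V" "v .: V"
  and "!!g v. homog V g v ==> P v"
  and "!!v w. [|v .: V; w .: V; P v; P w|] ==> P (v +.V w)"
 shows "P v"
proof -
 have "P (\<Oplus>\<^bsub>V\<^esub>g\<in>A. coact V g v)" if "finite A" "A \<subseteq> carrier G" for A
  using that
 proof (induction A rule: finite_induct)
  case empty
  then show ?case using assms(3)[OF homog_intros(5)[OF assms(1) one_closed]] assms(1) by simp
 next
  case (insert g A)
  then show ?case using assms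
   by (subst ks_finsum_insert) (auto intro!: assms(4) assms(3)[OF homog_intros(1)] ks_finsum_closed)
 qed
 from this[of "carrier G"] show ?thesis using assms by (simp add: crossedD(7))
qed

text \<open>All axioms are linear identities, so additive generators suffice, provided each is
  homogeneous together with all its translates. Generation is assumed in the form of an induction
  principle, the form in which it is at hand for tensors and for words.\<close>

lemma crossed_moduleI:
 assumes V: "kspace V" and act: "!!g. g .: G ==> klinear V V (act V g)"
  and coact: "!!g. g .: G ==> klinear V V (coact V g)"
  and gen: "!!P v. [|v .: V; !!x. x : X ==> P x;
   !!v w. [|v .: V; w .: V; P v; P w|] ==> P (v +.V w)|] ==> P v"
  and X: "X \<subseteq> carrier V"
  and X1: "!!x. x : X ==> act V \<one> x = x"
  and X2: "!!x g h. [|x : X; g .: G; h .: G|] ==> act V (g \<otimes> h) x = act V g (act V h x)"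
  and X3: "!!x. x : X ==> \<exists>g\<in>carrier G. \<forall>k\<in>carrier G. \<forall>h\<in>carrier G.
   coact V h (act V k x) = (if h = g then act V k x else 0@V)"
 shows "crossed_module G V"
proof -
 have eqI: "f v = f' v" if "klinear V V f" "klinear V V f'" "!!x. x : X ==> f x = f' x" "v .: V" for f f' v
  using that(4)
  by (rule gen[of v "%v. f v = f' v"]) (simp_all add: that(3) klD[OF that(1)] klD[OF that(2)])
 have X4: "\<exists>g\<in>carrier G. (\<forall>h\<in>carrier G. coact V h x = (if h = g then x else 0@V)) \<and> (\<forall>k\<in>carrier G. \<forall>h\<in>carrier G.
   coact V h (act V k x) = (if h = g then act V k x else 0@V))" if "x : X" for x
 proof -
  from X3[OF that] obtain g where "g .: G" and g: "!!k h. k .: G ==> h .: G ==>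
   coact V h (act V k x) = (if h = g then act V k x else 0@V)" by blast
  moreover have "coact V h x = (if h = g then x else 0@V)" if "h .: G" for h
   using g[OF one_closed that] X1[OF \<open>x : X\<close>] by simp
  ultimately show ?thesis by blast
 qed
 show ?thesis
  unfolding crossed_module_def
 proof (intro conjI ballI V act coact)
  fix v assume v: "v .: V"
  show "act V \<one> v = v" by (rule eqI[OF act kl_id]) (simp_all add: v X1)
  show "(\<Oplus>\<^bsub>V\<^esub>g\<in>carrier G. coact V g v) = v"
  proof (rule eqI[OF klinear_finsum_fun[OF coact V V finite_carrier] kl_id _ v])
   fix x assume x: "x : X"
   from X4[OF x] obtain g where "g .: G" "\<forall>h\<in>carrier G. coact V h x = (if h = g then x else 0@V)" by blast
   then show "(\<Oplus>\<^bsub>V\<^esub>g\<in>carrier G. coact V g x) = x" using x X by (intro ks_finsum_single[OF V, where i = g]) auto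
  qed
  fix g h assume g: "g .: G" and h: "h .: G"
  show "act V (g \<otimes> h) v = act V g (act V h v)"
   by (rule eqI[OF act kl_comp[OF act act]]) (simp_all add: v g h X2)
  have l: "klinear V V (%v. if g = h then coact V g v else 0@V)"
   by (cases "g = h") (simp_all add: coact h kl_zero V)
  show "coact V g (coact V h v) = (if g = h then coact V g v else 0@V)"
  proof (rule eqI[OF kl_comp[OF coact coact] l _ v])
   fix x assume x: "x : X"
   from X4[OF x] obtain k where "k .: G" "\<forall>h\<in>carrier G. coact V h x = (if h = k then x else 0@V)" by blast
   then show "coact V g (coact V h x) = (if g = h then coact V g x else 0@V)"
    using g h by (simp add: klD(4)[OF coact V V])
  qed (fact g h)+
  have "coact V h (act V g v) = act V g (coact V h v)"
  proof (rule eqI[OF kl_comp[OF act coact] kl_comp[OF coact act] _ v])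
   fix x assume x: "x : X"
   from X4[OF x] obtain k where "k .: G" "\<forall>h\<in>carrier G. coact V h x = (if h = k then x else 0@V)"
    "\<forall>j\<in>carrier G. \<forall>h\<in>carrier G. coact V h (act V j x) = (if h = k then act V j x else 0@V)" by blast
   then show "coact V h (act V g x) = act V g (coact V h x)"
    using g h by (simp add: klD(4)[OF act V V])
  qed (fact g h)+
  then show "coact V (g \<otimes> h \<otimes> inv g) (act V g v) = act V g (coact V h v)"
   using g h by (simp add: conj_cancel)
 qed
qed

lemma chomD:
 assumes "crossed_hom G V W f"
 shows "klinear V W f" "[|g .: G; v .: V|] ==> f (act V g v) = act W g (f v)" (is "PROP ?g1")
  "[|g .: G; v .: V|] ==> f (coact V g v) = coact W g (f v)" (is "PROP ?g2")
  "homog V g v ==> homog W g (f v)" (is "PROP ?g3")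
proof -
 show "klinear V W f" "PROP ?g1"
  and 3: "PROP ?g2"
  using assms by (simp_all add: crossed_hom_def)
 show "PROP ?g3"
  using 3 klD(1)[OF \<open>klinear V W f\<close>] by (metis homog_def)
qed

lemma crossed_homI_gen:
 assumes V: "crossed_module G V" and W: "crossed_module G W" and f: "klinear V W f"
  and gen: "!!P v. [|v .: V; !!x. x : X ==> P x;
   !!v w. [|v .: V; w .: V; P v; P w|] ==> P (v +.V w)|] ==> P v"
  and X: "!!x g. x : X ==> g .: G ==> f (act V g x) = act W g (f x)"
   "!!x. x : X ==> \<exists>g. homog V g x \<and> homog W g (f x)"
 shows "crossed_hom G V W f"
proof -
 note [simp] = klD[OF f] klD[OF crossedD(2)[OF V]] klD[OF crossedD(3)[OF V]]
  klD[OF crossedD(2)[OF W]] klD[OF crossedD(3)[OF W]]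
 have "f (act V g v) = act W g (f v)" if g: "g .: G" and v: "v .: V" for g v
  using v by (rule gen) (simp_all add: X(1) g)
 moreover have "f (coact V g v) = coact W g (f v)" if g: "g .: G" and v: "v .: V" for g v
  using v
 proof (rule gen)
  fix x assume "x : X"
  from X(2)[OF this] obtain h where "homog V h x" "homog W h (f x)" by blast
  then show "f (coact V g x) = coact W g (f x)"
   using g V W by (simp add: homog_coact)
 qed (simp_all add: g)
 ultimately show ?thesis using f by (simp add: crossed_hom_def)
qed

lemma crossed_homI:
 assumes V: "crossed_module G V" and W: "crossed_module G W" and f: "klinear V W f"
  and "!!v g h. homog V h v ==> g .: G ==> f (act V g v) = act W g (f v)"
  and "!!v h. homog V h v ==> homog W h (f v)"
 shows "crossed_hom G V W f"
proof (rule crossed_homI_gen[OF V W f, where X = "{v. \<exists>h. homog V h v}"])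
 fix P v assume v: "v .: V" and P: "!!x. x : {v. \<exists>h. homog V h v} ==> P x"
  "!!v w. [|v .: V; w .: V; P v; P w|] ==> P (v +.V w)"
 show "P v"
  by (rule homog_induct[OF V v]) (rule P(1), blast, rule P(2))
qed (use assms(4,5) in blast)+

lemma crossed_hom_comp: "crossed_hom G U V f ==> crossed_hom G V W g ==> crossed_hom G U W (%x. g (f x))"
 by (auto simp: crossed_hom_def kl_comp dest: klD(1))

lemma crossed_hom_id: "crossed_hom G V V (%x. x)"
 by (simp add: crossed_hom_def kl_id)

lemma tensor_homog_induct [consumes 3, case_names pure add]:
 assumes U: "crossed_module G U" and W: "crossed_module G W" and t: "t .: (U ** W)"
  and pure: "!!g h u w. [|homog U g u; homog W h w|] ==> P (pure U W u w)"
  and add: "!!s t. [|s .: (U ** W); t .: (U ** W); P s; P t|] ==> P (s +.(U ** W) t)"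
 shows "P t"
proof -
 note UW = cm_kspace[OF U] cm_kspace[OF W]
 show ?thesis using t
 proof (induction rule: tensor_induct[OF UW, consumes 1])
  case (1 u w)
  have 2: "P (pure U W u w)" if "homog U g u" "w .: W" for g u w
   using W that(2)
  proof (induction rule: homog_induct)
   case (add v w)
   then show ?case using that homogD(2)[OF that(1)] UW by (simp add: pure_bilinear assms(5))
  qed (use that pure in blast)
  show ?case using U 1(1)
  proof (induction rule: homog_induct)
   case (add v w)
   then show ?case using 1 UW by (simp add: pure_bilinear assms(5))
  qed (use 1 2 in blast)
 qed (use add in blast)
qed

lemma tensor_homog_eq:
 assumes U: "crossed_module G U" and W: "crossed_module G W"
  and f: "klinear (U ** W) M f" and f': "klinear (U ** W) M f'"
  and "!!g h u w. [|homog U g u; homog W h w|] ==> f (pure U W u w) = f' (pure U W u w)"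
  and "t .: (U ** W)"
 shows "f t = f' t"
 using U W assms(6)
 by (induction rule: tensor_homog_induct) (simp_all add: assms(5) klD[OF f] klD[OF f'])

lemma tensor_fields:
 "act (tensor G U W) = (%g. tmap U W (act U g) (act W g))"
 "coact (tensor G U W) = (%h. lin_ext (U ** W) (%(u, w).
  \<Oplus>\<^bsub>U ** W\<^esub>g\<in>carrier G. pure U W (coact U g u) (coact W (inv g \<otimes> h) w)))"
 by (simp_all add: tensor_def module.defs crossed_module.defs)

section \<open>The crossed structure of tensor products, and the braiding\<close>

context
 fixes U :: "('k::field, 'g, 'a, 'm) cmod" and W :: "('k, 'g, 'b, 'n) cmod"
 assumes U [simp]: "crossed_module G U" and W [simp]: "crossed_module G W"
begin

lemma tensor_act:
 "g .: G ==> klinear (U ** W) (U ** W) (act (tensor G U W) g)"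
 "g .: G ==> u .: U ==> w .: W ==> act (tensor G U W) g (pure U W u w) = pure U W (act U g u) (act W g w)"
 unfolding tensor_fields using kl_tmap[of U W U W] tmap_pure[of U W U W] crossedD(2)[OF U] crossedD(2)[OF W] by simp_all

lemma tensor_coact:
 "h .: G ==> klinear (U ** W) (U ** W) (coact (tensor G U W) h)"
 "h .: G ==> homog U g u ==> homog W g' w ==>
  coact (tensor G U W) h (pure U W u w) = (if h = g \<otimes> g' then pure U W u w else 0@(U ** W))"
proof -
 assume h: "h .: G"
 have b: "kbilinear U W (U ** W) (%u w. \<Oplus>\<^bsub>U ** W\<^esub>g\<in>carrier G. pure U W (coact U g u) (coact W (inv g \<otimes> h) w))"
 proof (intro kbilI klinear_finsum_fun)
  fix u g assume "u .: U" "g .: G"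
  then show "klinear W (U ** W) (%w. pure U W (coact U g u) (coact W (inv g \<otimes> h) w))"
   using h by (intro kl_comp[OF crossedD(3)[OF W]] kl_pure) simp_all
 next
  fix w g assume "w .: W" "g .: G"
  then show "klinear U (U ** W) (%u. pure U W (coact U g u) (coact W (inv g \<otimes> h) w))"
   using h by (intro kl_comp[OF crossedD(3)[OF U] kl_pure(2)]) simp_all
 qed simp_all
 note T = tens_ext[OF cm_kspace[OF U] cm_kspace[OF W] b kspace_tensor[OF cm_kspace[OF U] cm_kspace[OF W]]]
 show "klinear (U ** W) (U ** W) (coact (tensor G U W) h)"
  using T(1) by (simp add: tensor_fields)
 assume u: "homog U g u" and w: "homog W g' w"
 note uw = homogD[OF u] homogD[OF w]
 have "coact (tensor G U W) h (pure U W u w) = (\<Oplus>\<^bsub>U ** W\<^esub>k\<in>carrier G. pure U W (coact U k u) (coact W (inv k \<otimes> h) w))"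
  using T(2) uw by (simp add: tensor_fields)
 \<comment> \<open>The coaction on u leaves only the summand k = g, and the coaction on w is then
   nonzero only for h = g g'.\<close>
 also have "\<dots> = (if h = g \<otimes> g' then pure U W u w else 0@(U ** W))"
  by (rule ks_finsum_single[where i = g]) (use uw h in \<open>simp_all add: homog_coact[OF U u] homog_coact[OF W w] inv_mult_eq\<close>)
 finally show "coact (tensor G U W) h (pure U W u w) = (if h = g \<otimes> g' then pure U W u w else 0@(U ** W))" .
qed

lemma crossed_module_tensor [simp]: "crossed_module G (tensor G U W)"
proof (rule crossed_moduleI[where X = "{pure U W u w |u w. \<exists>g h. homog U g u \<and> homog W h w}"])
 fix P v assume "v .: (tensor G U W)" "!!x. x : {pure U W u w |u w. \<exists>g h. homog U g u \<and> homog W h w} ==> P x"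
  "!!v w. [|v .: (tensor G U W); w .: (tensor G U W); P v; P w|] ==> P (v +.(tensor G U W) w)"
 then show "P v" using tensor_homog_induct[OF U W, of v P] by (simp, blast)
next
 fix x assume "x : {pure U W u w |u w. \<exists>g h. homog U g u \<and> homog W h w}"
 then obtain u w g h where x: "x = pure U W u w" and u: "homog U g u" and w: "homog W h w" by blast
 note uw = homogD[OF u] homogD[OF w]
 show "act (tensor G U W) \<one> x = x" using uw by (simp add: x tensor_act crossedD(4))
 show "act (tensor G U W) (k \<otimes> l) x = act (tensor G U W) k (act (tensor G U W) l x)" if "k .: G" "l .: G" for k l
  using uw that by (simp add: x tensor_act crossedD(5))
 show "\<exists>g\<in>carrier G. \<forall>k\<in>carrier G. \<forall>h\<in>carrier G.
   coact (tensor G U W) h (act (tensor G U W) k x) = (if h = g then act (tensor G U W) k x else 0@(tensor G U W))"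
  by (rule bexI[of _ "g \<otimes> h"], intro ballI)
   (use uw in \<open>simp_all add: x tensor_act tensor_coact(2)[OF _ homog_intros(2)[OF U u] homog_intros(2)[OF W w]]\<close>)
qed (auto simp: tensor_act tensor_coact intro!: pure_closed intro: homogD(2))

lemma homog_pure:
 assumes "homog U g u" "homog W h w" shows "homog (tensor G U W) (g \<otimes> h) (pure U W u w)"
 using homogD[OF assms(1)] homogD[OF assms(2)] by (simp add: homog_def[of "tensor G U W"] tensor_coact(2)[OF _ assms])

lemma crossed_hom_tensorI:
 assumes M: "crossed_module G M" and f: "klinear (U ** W) M f"
  and "!!g h k u w. [|homog U g u; homog W h w; k .: G|] ==> f (pure U W (act U k u) (act W k w)) = act M k (f (pure U W u w))"
  and "!!g h u w. [|homog U g u; homog W h w|] ==> homog M (g \<otimes> h) (f (pure U W u w))"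
 shows "crossed_hom G (tensor G U W) M f"
proof (rule crossed_homI_gen[OF crossed_module_tensor M, where X = "{pure U W u w |u w. \<exists>g h. homog U g u \<and> homog W h w}"])
 fix P v assume "v .: (tensor G U W)" "!!x. x : {pure U W u w |u w. \<exists>g h. homog U g u \<and> homog W h w} ==> P x"
  "!!v w. [|v .: (tensor G U W); w .: (tensor G U W); P v; P w|] ==> P (v +.(tensor G U W) w)"
 then show "P v" using tensor_homog_induct[OF U W, of v P] by (simp, blast)
next
 fix x assume "x : {pure U W u w |u w. \<exists>g h. homog U g u \<and> homog W h w}"
 then obtain u w g h where x: "x = pure U W u w" and u: "homog U g u" and w: "homog W h w" by blast
 show "\<exists>g. homog (tensor G U W) g x \<and> homog M g (f x)" unfolding x using homog_pure[OF u w] assms(4)[OF u w] by blast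
 show "f (act (tensor G U W) k x) = act M k (f x)" if "k .: G" for k
  using that homogD[OF u] homogD[OF w] by (simp add: x tensor_act assms(3)[OF u w])
qed (simp add: f)

text \<open>For homogeneous u the sum over G collapses to the summand of its degree. The braiding
  enters later computations in this closed form.\<close>

lemma braiding_props:
 "klinear (U ** W) (W ** U) (braiding G U W)"
 "homog U g u ==> w .: W ==> braiding G U W (pure U W u w) = pure W U (act W g w) u"
proof -
 have b: "kbilinear U W (W ** U) (%u w. \<Oplus>\<^bsub>W ** U\<^esub>g\<in>carrier G. pure W U (act W g w) (coact U g u))"
 proof (intro kbilI klinear_finsum_fun)
  fix u g assume "u .: U" "g .: G"
  then show "klinear W (W ** U) (%w. pure W U (act W g w) (coact U g u))"
   by (intro kl_comp[OF crossedD(2)[OF W] kl_pure(2)]) simp_all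
 next
  fix w g assume "w .: W" "g .: G"
  then show "klinear U (W ** U) (%u. pure W U (act W g w) (coact U g u))"
   by (intro kl_comp[OF crossedD(3)[OF U] kl_pure(1)]) simp_all
 qed simp_all
 note T = tens_ext[OF cm_kspace[OF U] cm_kspace[OF W] b kspace_tensor[OF cm_kspace[OF W] cm_kspace[OF U]]]
 show "klinear (U ** W) (W ** U) (braiding G U W)" using T(1) by (simp add: braiding_def)
 assume u: "homog U g u" and w: "w .: W"
 have "braiding G U W (pure U W u w) = (\<Oplus>\<^bsub>W ** U\<^esub>k\<in>carrier G. pure W U (act W k w) (coact U k u))"
  using T(2) homogD[OF u] w by (simp add: braiding_def)
 also have "\<dots> = pure W U (act W g w) u"
  by (rule ks_finsum_single[where i = g]) (use homogD[OF u] w in \<open>simp_all add: homog_coact[OF U u]\<close>)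
 finally show "braiding G U W (pure U W u w) = pure W U (act W g w) u" .
qed

end

lemma crossed_hom_tmap:
 assumes U: "crossed_module G U" and W: "crossed_module G W" and U': "crossed_module G U'" and W': "crossed_module G W'"
  and f: "crossed_hom G U U' f" and g: "crossed_hom G W W' g"
 shows "crossed_hom G (tensor G U W) (tensor G U' W') (tmap U' W' f g)"
proof -
 note fl = chomD[OF f] and gl = chomD[OF g]
 note kk = cm_kspace[OF U] cm_kspace[OF W] cm_kspace[OF U'] cm_kspace[OF W']
 note t = kl_tmap[OF kk fl(1) gl(1)] tmap_pure[OF kk fl(1) gl(1)]
 show ?thesis
 proof (rule crossed_hom_tensorI[OF U W crossed_module_tensor[OF U' W']])
  fix k l h u w assume a: "homog U k u" "homog W l w"
  show "homog (tensor G U' W') (k \<otimes> l) (tmap U' W' f g (pure U W u w))"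
   using a homogD[OF a(1)] homogD[OF a(2)] by (simp add: t homog_pure[OF U' W'] fl(4) gl(4))
  show "tmap U' W' f g (pure U W (act U h u) (act W h w)) = act (tensor G U' W') h (tmap U' W' f g (pure U W u w))"
   if "h .: G"
   using a homogD[OF a(1)] homogD[OF a(2)] that U W klD(1)[OF fl(1)] klD(1)[OF gl(1)]
   by (simp add: t tensor_act[OF U' W'] fl(2) gl(2))
 qed (use t(1) in simp)
qed

text \<open>The nested extensions are shown to be linear from the inside out: \<open>L\<close>
  inserts the braided middle pair, \<open>K\<close> runs over C\<otimes>D and \<open>J\<close> over
  A\<otimes>B. When b has degree g, moving c in front of it replaces c by g c.\<close>

lemma mid_braiding_props:
 fixes A :: "('k::field, 'g, 'a, 'l) cmod" and B :: "('k, 'g, 'b, 'm) cmod"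
  and C :: "('k, 'g, 'c, 'n) cmod" and D :: "('k, 'g, 'd, 'o) cmod"
 assumes A: "crossed_module G A" and B: "crossed_module G B" and C: "crossed_module G C" and D: "crossed_module G D"
 shows "klinear ((A ** B) ** (C ** D)) ((A ** C) ** (B ** D)) (mid_braiding G A B C D)"
  and "[|a .: A; homog B g b; c .: C; d .: D|] ==>
   mid_braiding G A B C D (pure (A ** B) (C ** D) (pure A B a b) (pure C D c d)) =
   pure (A ** C) (B ** D) (pure A C a (act C g c)) (pure B D b d)"
proof -
 note [simp] = cm_kspace[OF A] cm_kspace[OF B] cm_kspace[OF C] cm_kspace[OF D]
 let ?AC = "A ** C" and ?BD = "B ** D"
 let ?M = "?AC ** ?BD"
 let ?p = "pure ?AC ?BD"
 have M [simp]: "kspace ?M" by simp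
 note c = braiding_props[OF B C]
 note cl [simp] = klD(1)[OF c(1)]
 define L where "L = (%a d. lin_ext ?M (%(x, y). ?p (pure A C a x) (pure B D y d)))"
 have bL: "kbilinear C B ?M (%x y. ?p (pure A C a x) (pure B D y d))" if "a .: A" "d .: D" for a d
  using that by (intro kbilI klI) (simp_all add: pure_bilinear)
 have L: "klinear (C ** B) ?M (L a d)"
   "!!x y. x .: C ==> y .: B ==> L a d (pure C B x y) = ?p (pure A C a x) (pure B D y d)"
  if "a .: A" "d .: D" for a d
  unfolding L_def using tens_ext[OF _ _ bL[OF that] M] by simp_all
 have Ld: "klinear D ?M (%d. L a d s)" if "a .: A" "s .: (C ** B)" for a s
  by (rule klinear_param[OF _ _ _ M L(1) _ that(2)])
   (use that in \<open>simp_all, intro klI, simp_all add: L(2) pure_bilinear\<close>)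
 have La: "klinear A ?M (%a. L a d s)" if "d .: D" "s .: (C ** B)" for d s
  by (rule klinear_param[OF _ _ _ M L(1) _ that(2)])
   (use that in \<open>simp_all, intro klI, simp_all add: L(2) pure_bilinear\<close>)
 define K where "K = (%a b. lin_ext ?M (%(c, d). L a d (braiding G B C (pure B C b c))))"
 have bK: "kbilinear C D ?M (%c d. L a d (braiding G B C (pure B C b c)))" if "a .: A" "b .: B" for a b
 proof (rule kbilI)
  show "klinear D ?M (%d. L a d (braiding G B C (pure B C b c)))" if "c .: C" for c
   using that \<open>b .: B\<close> \<open>a .: A\<close> by (intro Ld) simp_all
  show "klinear C ?M (%ca. L a d (braiding G B C (pure B C b ca)))" if "d .: D" for d
   using that \<open>b .: B\<close> \<open>a .: A\<close>
   by (intro kl_comp[OF kl_comp[OF kl_pure(1) c(1)] L(1)]) simp_all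
 qed
 have K: "klinear (C ** D) ?M (K a b)"
   "!!c d. c .: C ==> d .: D ==> K a b (pure C D c d) = L a d (braiding G B C (pure B C b c))"
  if "a .: A" "b .: B" for a b
  unfolding K_def using tens_ext[OF _ _ bK[OF that] M] by simp_all
 define J where "J = (%s t. lin_ext ?M (%(a, b). K a b t) s)"
 have bJ: "kbilinear A B ?M (%a b. K a b t)" if t: "t .: (C ** D)" for t
 proof (rule kbilI)
  show "klinear B ?M (%b. K a b t)" if a: "a .: A" for a
  proof (rule klinear_param[OF _ _ _ M K(1) _ t])
   fix c' d assume *: "c' .: C" "d .: D"
   have "klinear B ?M (%b. L a d (braiding G B C (pure B C b c')))"
    using a * by (intro kl_comp[OF kl_comp[OF kl_pure(2) c(1)] L(1)]) simp_all
   then show "klinear B ?M (%b. K a b (pure C D c' d))"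
    by (rule kl_cong) (use a * in \<open>simp_all add: K(2)\<close>)
  qed (use a in simp_all)
  show "klinear A ?M (%a. K a b t)" if b: "b .: B" for b
  proof (rule klinear_param[OF _ _ _ M K(1) _ t])
   fix c' d assume *: "c' .: C" "d .: D"
   have "klinear A ?M (%a. L a d (braiding G B C (pure B C b c')))"
    using b * by (intro La) simp_all
   then show "klinear A ?M (%a. K a b (pure C D c' d))"
    by (rule kl_cong) (use b * in \<open>simp_all add: K(2)\<close>)
  qed (use b in simp_all)
 qed
 have J: "klinear (A ** B) ?M (%s. J s t)"
   "!!a b. a .: A ==> b .: B ==> J (pure A B a b) t = K a b t"
  if "t .: (C ** D)" for t
  unfolding J_def using tens_ext[OF _ _ bJ[OF that] M] by simp_all
 have bM: "kbilinear (A ** B) (C ** D) ?M J"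
 proof (rule kbilI)
  fix s assume s: "s .: (A ** B)"
  show "klinear (C ** D) ?M (J s)"
  proof (rule klinear_param[OF _ _ _ M, where F = "%t s. J s t", OF _ _ _ J(1) _ s])
   fix a b assume *: "a .: A" "b .: B"
   show "klinear (C ** D) ?M (%t. J (pure A B a b) t)"
    by (rule kl_cong[OF K(1)[OF *]]) (use * in \<open>simp_all add: J(2)\<close>)
  qed simp_all
 qed (rule J(1))
 have eq: "mid_braiding G A B C D = lin_ext ?M (%(s, t). J s t)"
  by (simp add: mid_braiding_def Let_def J_def K_def L_def)
 note T = tens_ext[OF _ _ bM M, folded eq]
 show "klinear ((A ** B) ** (C ** D)) ?M (mid_braiding G A B C D)" by (rule T(1)) simp_all
 show "mid_braiding G A B C D (pure (A ** B) (C ** D) (pure A B a b) (pure C D c d)) =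
   ?p (pure A C a (act C g c)) (pure B D b d)"
  if "a .: A" "homog B g b" "c .: C" "d .: D"
  using that homogD[OF that(2)] C by (simp add: T(2) J(2) K(2) c(2) L(2))
qed

end

lemma klinear_lspan_eq:
 assumes "klinear M N f" "klinear M N g" "kspace M" "X \<subseteq> carrier M" "t : lspan M X" "!!x. x : X ==> f x = g x"
  "kspace N"
 shows "f t = g t"
 using assms(5)
 by (induction rule: lspan_induct[OF assms(3,4), consumes 1])
  (simp_all add: assms klD[OF assms(1)] klD[OF assms(2)])

lemma klinear_tensor3_eq:
 assumes U: "kspace U" and V: "kspace V" and W: "kspace W"
  and f: "klinear ((U ** V) ** W) M f" and g: "klinear ((U ** V) ** W) M g"
  and eq: "!!u v w. [|u .: U; v .: V; w .: W|] ==>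
   f (pure (U ** V) W (pure U V u v) w) = g (pure (U ** V) W (pure U V u v) w)"
  and t: "t .: ((U ** V) ** W)"
 shows "f t = g t"
proof (rule tensor_eq[OF kspace_tensor[OF U V] W f g _ t])
 fix s w assume s: "s .: (U ** V)" and w: "w .: W"
 note p = kl_pure(2)[OF kspace_tensor[OF U V] W w]
 show "f (pure (U ** V) W s w) = g (pure (U ** V) W s w)"
  by (rule tensor_eq[OF U V kl_comp[OF p f] kl_comp[OF p g] eq s]) (simp_all add: w)
qed

context finite_comm_group
begin

section \<open>Braided algebras and coalgebras\<close>

lemma unit_object_simps [simp]:
 "carrier (unit_object G) = UNIV" "a +.(unit_object G) b = a + b" "0@(unit_object G) = 0"
 "a .*(unit_object G) b = a * b" "1@(unit_object G) = 1" "a *.(unit_object G) b = a * b"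
 "act (unit_object G) g a = a" "coact (unit_object G) g a = (if g = \<one> then a else 0)"
 by (simp_all add: unit_object_def)

lemma kspace_unit [simp]: "kspace (unit_object G)"
 by (rule kspaceI) (auto simp: algebra_simps)

lemma crossed_module_unit [simp]: "crossed_module G (unit_object G :: ('k::field, 'g, 'k) crossed_module)"
proof -
 have 1: "klinear (unit_object G) (unit_object G) (act (unit_object G :: ('k, 'g, 'k) crossed_module) g)" for g
  by (rule klI) auto
 have 2: "klinear (unit_object G) (unit_object G) (coact (unit_object G :: ('k, 'g, 'k) crossed_module) g)" for g
  by (rule klI) auto
 have 3: "\<exists>g\<in>carrier G. \<forall>k\<in>carrier G. \<forall>h\<in>carrier G. coact (unit_object G) h (act (unit_object G) k x) =
   (if h = g then act (unit_object G) k x else 0@(unit_object G :: ('k, 'g, 'k) crossed_module))" for x :: 'k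
  by (rule bexI[of _ \<one>]) auto
 show ?thesis
  by (rule crossed_moduleI[where X = UNIV]) (use 1 2 3 in auto)
qed

lemma balgD:
 assumes "braided_algebra G A"
 shows "crossed_module G A" "ring A" "crossed_hom G (tensor G A A) A (mult_map A)"
  "crossed_hom G (unit_object G) A (%a. a .*A 1@A)"
 using assms by (simp_all add: braided_algebra_def)

lemma ba_simps [simp]:
 assumes "braided_algebra G A"
 shows "kspace A" "crossed_module G A" "1@A .: A" (is ?g1)
  and "x .: A ==> y .: A ==> x *.A y .: A" (is "PROP ?g2")
  and "x .: A ==> 1@A *.A x = x" (is "PROP ?g3") "x .: A ==> x *.A 1@A = x" (is "PROP ?g4")
  and "x .: A ==> 0@A *.A x = 0@A" (is "PROP ?g5") "x .: A ==> x *.A 0@A = 0@A" (is "PROP ?g6")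
  and "x .: A ==> y .: A ==> (a .*A x) *.A y = a .*A (x *.A y)" (is "PROP ?g7")
  and "x .: A ==> y .: A ==> x *.A (a .*A y) = a .*A (x *.A y)" (is "PROP ?g8")
proof -
 interpret A: ring A by (rule balgD[OF assms])
 show "crossed_module G A" by (rule balgD[OF assms])
 then show "kspace A" by simp
 show ?g1 "PROP ?g2"
  "PROP ?g3" "PROP ?g4"
  "PROP ?g5" "PROP ?g6" by simp_all
 show "PROP ?g7"
  "PROP ?g8"
  using assms by (simp_all add: braided_algebra_def)
qed

lemma ba_ring:
 assumes "braided_algebra G A" "x .: A" "y .: A" "z .: A"
 shows "(x *.A y) *.A z = x *.A (y *.A z)" (is ?g1)
  "(x +.A y) *.A z = x *.A z +.A y *.A z" (is ?g2) "x *.A (y +.A z) = x *.A y +.A x *.A z" (is ?g3)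
proof -
 interpret A: ring A by (rule balgD[OF assms(1)])
 show ?g1
  ?g2 ?g3
  using assms by (simp_all add: A.m_assoc A.l_distr A.r_distr)
qed

lemma ba_mult_linear:
 assumes "braided_algebra G A" "x .: A"
 shows "klinear A A (%y. x *.A y)" "klinear A A (%y. y *.A x)"
 using assms by (auto intro!: klI simp: ba_ring)

lemma mult_map_linear:
 assumes "kspace A" "kbilinear A A A (%x y. x *.A y)"
 shows "klinear (A ** A) A (mult_map A)"
  "x .: A ==> y .: A ==> mult_map A (pure A A x y) = x *.A y"
 using tens_ext[OF assms(1,1,2,1)] by (simp_all add: mult_map_def)

lemma mult_map_props:
 assumes "braided_algebra G A"
 shows "klinear (A ** A) A (mult_map A)"
  "x .: A ==> y .: A ==> mult_map A (pure A A x y) = x *.A y"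
 using mult_map_linear[OF ba_simps(1)[OF assms]] ba_mult_linear[OF assms] by (auto simp: kbilinear_def)

lemma ba_crossed:
 assumes A: "braided_algebra G A"
 shows "[|g .: G; x .: A; y .: A|] ==> act A g (x *.A y) = act A g x *.A act A g y" (is "PROP ?g1")
  "homog A g x ==> homog A h y ==> homog A (g \<otimes> h) (x *.A y)" (is "PROP ?g2")
  "g .: G ==> act A g 1@A = 1@A" (is "PROP ?g3") "homog A \<one> 1@A" (is ?g4)
proof -
 note [simp] = A
 note m = mult_map_props[OF A] and c = chomD[OF balgD(3)[OF A]]
 show "PROP ?g1"
  using c(2)[of g "pure A A x y"] by (simp add: tensor_act m)
 show "PROP ?g2"
  using c(4)[OF homog_pure, of g x h y] homogD(2)[of A g x] homogD(2)[of A h y] by (simp add: m)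
 note u = chomD[OF balgD(4)[OF A]]
 show "PROP ?g3" using u(2)[of g 1] by simp
 show ?g4 using u(4)[of \<one> 1] by (simp add: homog_def)
qed

lemma braided_algebraI:
 fixes A :: "('k::field, 'g, 'a, 'm) cmod"
 assumes A: "crossed_module G A" and "ring A"
  and s: "!!a x y. [|x .: A; y .: A|] ==> (a .*A x) *.A y = a .*A (x *.A y)"
   "!!a x y. [|x .: A; y .: A|] ==> x *.A (a .*A y) = a .*A (x *.A y)"
  and c: "!!g h k x y. [|k .: G; homog A g x; homog A h y|] ==> act A k (x *.A y) = act A k x *.A act A k y"
   "!!g h x y. [|homog A g x; homog A h y|] ==> homog A (g \<otimes> h) (x *.A y)"
  and u: "!!g. g .: G ==> act A g 1@A = 1@A" "homog A \<one> 1@A"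
 shows "braided_algebra G A"
proof -
 interpret A: ring A by fact
 note k = cm_kspace[OF A]
 have "kbilinear A A A (%x y. x *.A y)"
  by (intro kbilI klI) (simp_all add: s A.r_distr A.l_distr)
 note m = mult_map_linear[OF k this]
 have "crossed_hom G (tensor G A A) A (mult_map A)"
 proof (rule crossed_hom_tensorI[OF A A A m(1)])
  fix g h k x y assume xy: "homog A g x" "homog A h y"
  note [simp] = homogD(2)[OF xy(1)] homogD(2)[OF xy(2)]
  show "homog A (g \<otimes> h) (mult_map A (pure A A x y))" using xy by (simp add: m c)
  show "mult_map A (pure A A (act A k x) (act A k y)) = act A k (mult_map A (pure A A x y))" if "k .: G"
   using that A by (simp add: m c(1)[OF that xy])
 qed
 moreover have "crossed_hom G (unit_object G) A (%a. a .*A 1@A)"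
 proof (rule crossed_homI[OF crossed_module_unit A])
  show "klinear (unit_object G) A (%a. a .*A 1@A)" by (rule klI) (simp_all add: k ks_distrib)
  fix v :: 'k and g h assume *: "homog (unit_object G) h v"
  show "act (unit_object G) g v .*A 1@A = act A g (v .*A 1@A)" if "g .: G"
   using that by (simp add: klD[OF crossedD(2)[OF A]] u)
  show "homog A h (v .*A 1@A)"
  proof (cases "h = \<one>")
   case True then show ?thesis using homog_intros(4)[OF A u(2)] by simp
  next
   case False
   then have "v = 0" "h .: G" using * by (simp_all add: homog_def)
   then show ?thesis using homog_intros(5)[OF A] k by simp
  qed
 qed
 ultimately show ?thesis
  unfolding braided_algebra_def by (intro conjI allI ballI A \<open>ring A\<close> s)
qed

lemma crossed_hom_tensor_algebra [simp]:
 "crossed_hom G X (tensor_algebra G A B) f = crossed_hom G X (tensor G A B) f"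
 by (simp add: crossed_hom_def) (simp add: tensor_algebra_def)

lemma crossed_hom_tensor_coalgebra [simp]:
 "crossed_hom G (tensor_coalgebra G A B) X f = crossed_hom G (tensor G A B) X f"
 by (simp add: crossed_hom_def) (simp add: tensor_coalgebra_def crossed_module.defs tensor_def module.defs)

text \<open>In the braided product of A\<otimes>A the element c has to pass b, and passing an
  element of degree g means being acted on by g.\<close>

lemma ta_mult:
 assumes A: "braided_algebra G A"
 shows "kbilinear (A ** A) (A ** A) (A ** A) (%s t. s *.(tensor_algebra G A A) t)" (is ?g1)
  and "[|a .: A; homog A g b; c .: A; d .: A|] ==>
   pure A A a b *.(tensor_algebra G A A) pure A A c d = pure A A (a *.A act A g c) (b *.A d)"
  and "1@(tensor_algebra G A A) = pure A A 1@A 1@A" (is ?g2)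
proof -
 note [simp] = A
 note C = ba_simps(2)[OF A]
 note m = mult_map_props[OF A] and mid = mid_braiding_props[OF C C C C]
 have k [simp]: "kspace (A ** A)" by simp
 note t = kl_tmap[OF k k ba_simps(1)[OF A] ba_simps(1)[OF A] m(1) m(1)] tmap_pure[OF k k ba_simps(1)[OF A] ba_simps(1)[OF A] m(1) m(1)]
 have eq: "s *.(tensor_algebra G A A) t = tmap A A (mult_map A) (mult_map A)
    (mid_braiding G A A A A (pure (A ** A) (A ** A) s t))" for s t
  by (simp add: tensor_algebra_def)
 show ?g1
  unfolding eq
  by (intro kbilI kl_comp[OF kl_comp[OF kl_pure(1) mid(1)] t(1)]
   kl_comp[OF kl_comp[OF kl_pure(2) mid(1)] t(1)]) simp_all
 show "pure A A a b *.(tensor_algebra G A A) pure A A c d = pure A A (a *.A act A g c) (b *.A d)"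
  if "a .: A" "homog A g b" "c .: A" "d .: A"
  unfolding eq using that homogD[OF that(2)] by (simp add: mid(2) t(2) m(2))
 show ?g2 by (simp add: tensor_algebra_def)
qed

section \<open>Braided coalgebras and their counits\<close>

lemma coalgD:
 assumes "braided_coalgebra G C"
 shows "crossed_module G C" "crossed_hom G C (tensor G C C) (comult C)" (is ?g1) "crossed_hom G C (unit_object G) (counit C)" (is ?g2)
  "x .: C ==> tassoc C C C (tmap (C ** C) C (comult C) (%y. y) (comult C x)) =
    tmap C (C ** C) (%y. y) (comult C) (comult C x)" (is "PROP ?g3")
  "x .: C ==> lin_ext C (%(y, z). counit C y .*C z) (comult C x) = x" (is "PROP ?g4")
  "x .: C ==> lin_ext C (%(y, z). counit C z .*C y) (comult C x) = x" (is "PROP ?g5")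
  "klinear C (C ** C) (comult C)" (is ?g6) "x .: C ==> comult C x .: (C ** C)" (is "PROP ?g7")
  "klinear C (unit_object G) (counit C)" (is ?g8)
proof -
 show *: "crossed_module G C" ?g1 ?g2
  "PROP ?g3"
  "PROP ?g4"
  "PROP ?g5"
  using assms by (simp_all add: braided_coalgebra_def)
 show ?g6 using chomD(1)[OF *(2)] by simp
 then show "PROP ?g7" by (rule klD)
 show ?g8 by (rule chomD(1)[OF *(3)])
qed

lemma counit_props:
 assumes "braided_coalgebra G C"
 shows "x .: C ==> y .: C ==> counit C (x +.C y) = counit C x + counit C y" (is "PROP ?g1")
  "x .: C ==> counit C (a .*C x) = a * counit C x" (is "PROP ?g2") "counit C 0@C = 0" (is ?g3)
  "x .: C ==> g .: G ==> counit C (act C g x) = counit C x" (is "PROP ?g4")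
  "homog C g x ==> g \<noteq> \<one> ==> counit C x = 0"
proof -
 show "PROP ?g1"
  "PROP ?g2" ?g3
  "PROP ?g4"
  using klD[OF coalgD(9)[OF assms]] cm_kspace[OF coalgD(1)[OF assms]]
   chomD(2)[OF coalgD(3)[OF assms]] by simp_all
 assume "homog C g x" "g \<noteq> \<one>"
 then show "counit C x = 0"
  using chomD(4)[OF coalgD(3)[OF assms], of g x] by (simp add: homog_def[of "unit_object G"])
qed

lemma counit_ext:
 assumes k: "kspace C" and e: "klinear C (unit_object G) e"
 shows "klinear (C ** C) C (lin_ext C (%(y, z). e y .*C z))" (is ?g1)
  "x .: C ==> y .: C ==> lin_ext C (%(y, z). e y .*C z) (pure C C x y) = e x .*C y" (is "PROP ?g2")
  "klinear (C ** C) C (lin_ext C (%(y, z). e z .*C y))" (is ?g3)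
  "x .: C ==> y .: C ==> lin_ext C (%(y, z). e z .*C y) (pure C C x y) = e y .*C x" (is "PROP ?g4")
proof -
 have 1: "kbilinear C C C (%y z. e y .*C z)" "kbilinear C C C (%y z. e z .*C y)"
  by (intro kbilI klI; simp add: k klD[OF e] ks_distrib mult.commute)+
 show ?g1
  "PROP ?g2"
  ?g3
  "PROP ?g4"
  using tens_ext[OF k k 1(1) k] tens_ext[OF k k 1(2) k] by simp_all
qed

lemma counit_lin_ext:
 assumes "braided_coalgebra G C"
 shows "klinear (C ** C) C (lin_ext C (%(y, z). counit C y .*C z))"
  "x .: C ==> y .: C ==> lin_ext C (%(y, z). counit C y .*C z) (pure C C x y) = counit C x .*C y"
  "klinear (C ** C) C (lin_ext C (%(y, z). counit C z .*C y))"
  "x .: C ==> y .: C ==> lin_ext C (%(y, z). counit C z .*C y) (pure C C x y) = counit C y .*C x"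
 using counit_ext[OF cm_kspace[OF coalgD(1)[OF assms]] coalgD(9)[OF assms]] by simp_all

section \<open>Convolution and antipodes\<close>

text \<open>Convolution with the coproduct left open: the convolution of \<open>\<phi>\<close> and
  \<open>\<psi>\<close> at x is \<open>tconv A \<phi> \<psi> (comult D x)\<close>. With an arbitrary
  tensor as argument, identities can be checked on pure tensors.\<close>

definition tconv ::
  "('k::field, 'b, 'm) vect => ('a => 'b) => ('c => 'b) => ('k, 'a, 'c) tens => 'b" where
 "tconv A \<phi> \<psi> t = mult_map A (tmap A A \<phi> \<psi> t)"

lemma tconv_props:
 assumes A: "braided_algebra G A" and D: "kspace D" "kspace E" and f: "klinear D A \<phi>" "klinear E A \<psi>"
 shows "klinear (D ** E) A (tconv A \<phi> \<psi>)"
  "x .: D ==> y .: E ==> tconv A \<phi> \<psi> (pure D E x y) = \<phi> x *.A \<psi> y"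
 using kl_comp[OF kl_tmap[OF D ba_simps(1)[OF A] ba_simps(1)[OF A] f] mult_map_props(1)[OF A]]
  tmap_pure[OF D ba_simps(1)[OF A] ba_simps(1)[OF A] f] klD(1)[OF f(1)] klD(1)[OF f(2)] mult_map_props(2)[OF A]
 by (simp_all add: tconv_def[abs_def])

definition conv_unit ::
  "('k::field, 'g, 'a, 'm) bcoalg => ('k, 'b, 'n) vect => 'a => 'b" where
 "conv_unit D A x = counit D x .*A 1@A"

text \<open>With u the convolution unit, \<open>\<psi>\<close> is a right inverse of
  \<open>\<phi>\<close> iff \<open>\<psi>\<close> equals u minus the convolution of
  \<open>\<phi>\<close> - u with \<open>\<psi>\<close>. These are the iterates of that right-hand
  side from 0, the partial sums of the geometric series for the inverse.\<close>

fun inv_seq ::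
  "('k::field, 'g, 'a, 'm) bcoalg => ('k, 'b, 'n) vect => ('a => 'b) => nat => 'a => 'b" where
 "inv_seq D A \<phi> 0 x = 0@A"
| "inv_seq D A \<phi> (Suc n) x = conv_unit D A x +.A (-1) .*A
  tconv A (%x. \<phi> x +.A (-1) .*A conv_unit D A x) (inv_seq D A \<phi> n) (comult D x)"

context
 fixes D :: "('k::field, 'g, 'a, 'm) bcoalg" and A :: "('k, 'g, 'b, 'n) cmod"
 assumes D: "braided_coalgebra G D" and A: "braided_algebra G A"
begin

lemma conv_unit_crossed: "crossed_hom G D A (conv_unit D A)"
 unfolding conv_unit_def[abs_def]
 by (rule crossed_hom_comp[OF coalgD(3)[OF D] balgD(4)[OF A]])

lemma conv_left_unit:
 assumes "klinear D A \<psi>" "x .: D"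
 shows "tconv A (conv_unit D A) \<psi> (comult D x) = \<psi> x" (is ?g1) "tconv A \<psi> (conv_unit D A) (comult D x) = \<psi> x" (is ?g2)
proof -
 note [simp] = A
 note kD = cm_kspace[OF coalgD(1)[OF D]] and kA = ba_simps(1)[OF A]
 note u = chomD(1)[OF conv_unit_crossed]
 note p = klD[OF assms(1)]
 have 1: "tconv A (conv_unit D A) \<psi> t = \<psi> (lin_ext D (%(y, z). counit D y .*D z) t)"
  if "t .: (D ** D)" for t
  by (rule tensor_eq[OF kD kD tconv_props(1)[OF A kD kD u assms(1)] kl_comp[OF counit_lin_ext(1)[OF D] assms(1)] _ that])
   (simp add: tconv_props[OF A kD kD u assms(1)] counit_lin_ext[OF D] conv_unit_def p kD)
 have 2: "tconv A \<psi> (conv_unit D A) t = \<psi> (lin_ext D (%(y, z). counit D z .*D y) t)"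
  if "t .: (D ** D)" for t
  by (rule tensor_eq[OF kD kD tconv_props(1)[OF A kD kD assms(1) u] kl_comp[OF counit_lin_ext(3)[OF D] assms(1)] _ that])
   (simp add: tconv_props[OF A kD kD assms(1) u] counit_lin_ext[OF D] conv_unit_def p kD)
 show ?g1 ?g2
  using assms(2) coalgD(5,6,8)[OF D assms(2)] by (simp_all add: 1 2)
qed

text \<open>Both sides become threefold products applied to the two iterated coproducts;
  \<open>tassoc\<close> matches these by coassociativity, and the products by associativity of
  A.\<close>

lemma conv_assoc:
 assumes f: "klinear D A \<phi>" and g: "klinear D A \<psi>" and h: "klinear D A \<chi>" and x: "x .: D"
 shows "tconv A (%x. tconv A \<phi> \<psi> (comult D x)) \<chi> (comult D x) =
  tconv A \<phi> (%x. tconv A \<psi> \<chi> (comult D x)) (comult D x)"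
proof -
 note kD [simp] = cm_kspace[OF coalgD(1)[OF D]] and kA = ba_simps(1)[OF A]
 note d = coalgD(7)[OF D] and dc [simp] = coalgD(8)[OF D]
 note fg = tconv_props[OF A kD kD f g] and gh = tconv_props[OF A kD kD g h]
 note fgd = kl_comp[OF d fg(1)] and ghd = kl_comp[OF d gh(1)]
 have kDD [simp]: "kspace (D ** D)" by simp
 note [simp] = klD(1)[OF f] klD(1)[OF g] klD(1)[OF h] klD(1)[OF fgd] klD(1)[OF ghd]
 have 1: "tconv A (%x. tconv A \<phi> \<psi> (comult D x)) \<chi> t = tconv A (tconv A \<phi> \<psi>) \<chi> (tmap (D ** D) D (comult D) (%y. y) t)"
  if "t .: (D ** D)" for t
 proof (rule tensor_eq[OF kD kD _ _ _ that])
  show "klinear (D ** D) A (tconv A (%x. tconv A \<phi> \<psi> (comult D x)) \<chi>)"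
   by (rule tconv_props(1)[OF A kD kD fgd h])
  show "klinear (D ** D) A (%t. tconv A (tconv A \<phi> \<psi>) \<chi> (tmap (D ** D) D (comult D) (%y. y) t))"
   by (rule kl_comp[OF kl_tmap[OF kD kD kDD kD d kl_id] tconv_props(1)[OF A kDD kD fg(1) h]])
 qed (simp add: tconv_props[OF A kD kD fgd h] tmap_pure[OF kD kD kDD kD d kl_id] tconv_props[OF A kDD kD fg(1) h])
 have 2: "tconv A \<phi> (%x. tconv A \<psi> \<chi> (comult D x)) t = tconv A \<phi> (tconv A \<psi> \<chi>) (tmap D (D ** D) (%y. y) (comult D) t)"
  if "t .: (D ** D)" for t
 proof (rule tensor_eq[OF kD kD _ _ _ that])
  show "klinear (D ** D) A (tconv A \<phi> (%x. tconv A \<psi> \<chi> (comult D x)))"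
   by (rule tconv_props(1)[OF A kD kD f ghd])
  show "klinear (D ** D) A (%t. tconv A \<phi> (tconv A \<psi> \<chi>) (tmap D (D ** D) (%y. y) (comult D) t))"
   by (rule kl_comp[OF kl_tmap[OF kD kD kD kDD kl_id d] tconv_props(1)[OF A kD kDD f gh(1)]])
 qed (simp add: tconv_props[OF A kD kD f ghd] tmap_pure[OF kD kD kD kDD kl_id d] tconv_props[OF A kD kDD f gh(1)])
 have 3: "tconv A (tconv A \<phi> \<psi>) \<chi> t = tconv A \<phi> (tconv A \<psi> \<chi>) (tassoc D D D t)"
  if "t .: ((D ** D) ** D)" for t
 proof (rule klinear_tensor3_eq[OF kD kD kD _ _ _ that])
  show "klinear ((D ** D) ** D) A (tconv A (tconv A \<phi> \<psi>) \<chi>)"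
   by (rule tconv_props(1)[OF A kDD kD fg(1) h])
  show "klinear ((D ** D) ** D) A (%t. tconv A \<phi> (tconv A \<psi> \<chi>) (tassoc D D D t))"
   by (rule kl_comp[OF tassoc_tensor(1)[OF kD kD kD] tconv_props(1)[OF A kD kDD f gh(1)]])
 qed (simp add: tconv_props(2)[OF A kDD kD fg(1) h] tassoc_tensor(2) tconv_props(2)[OF A kD kDD f gh(1)]
   fg(2) gh(2) ba_ring[OF A])
 note dx = dc[OF x]
 have "tmap (D ** D) D (comult D) (%y. y) (comult D x) .: ((D ** D) ** D)"
  by (rule klD(1)[OF kl_tmap[OF kD kD kDD kD d kl_id] dx])
 then show ?thesis using coalgD(4)[OF D x] by (simp add: 1[OF dx] 2[OF dx] 3)
qed

lemma crossed_hom_conv: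
 assumes "crossed_hom G D A \<phi>" "crossed_hom G D A \<psi>"
 shows "crossed_hom G D A (%x. tconv A \<phi> \<psi> (comult D x))"
proof -
 note c = coalgD(1)[OF D] ba_simps(2)[OF A]
 show ?thesis unfolding tconv_def
  by (rule crossed_hom_comp[OF crossed_hom_comp[OF coalgD(2)[OF D]
    crossed_hom_tmap[OF c(1,1) c(2,2) assms]] balgD(3)[OF A]])
qed

lemma crossed_hom_diff:
 assumes "crossed_hom G D A \<phi>" "crossed_hom G D A \<psi>"
 shows "crossed_hom G D A (%x. \<phi> x +.A (-1) .*A \<psi> x)"
proof -
 note kA = ba_simps(1)[OF A] and C = ba_simps(2)[OF A]
 note f = chomD[OF assms(1)] and g = chomD[OF assms(2)]
 show ?thesis
 proof (rule crossed_homI[OF coalgD(1)[OF D] C kl_add[OF f(1) kl_scale[OF g(1) kA] kA]])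
  fix v k h assume v: "homog D h v"
  note vD = homogD(2)[OF v]
  show "homog A h (\<phi> v +.A (-1) .*A \<psi> v)"
   by (rule homog_intros(3)[OF C f(4)[OF v] homog_intros(4)[OF C g(4)[OF v]]])
  show "\<phi> (act D k v) +.A (-1) .*A \<psi> (act D k v) = act A k (\<phi> v +.A (-1) .*A \<psi> v)" if "k .: G"
   using that vD kA by (simp add: f(2) g(2) klD[OF crossedD(2)[OF C]] klD(1)[OF f(1)] klD(1)[OF g(1)])
 qed
qed

lemma inv_seq_linear:
 assumes "klinear D A \<phi>" shows "klinear D A (inv_seq D A \<phi> n)"
proof (induction n)
 case 0
 have "inv_seq D A \<phi> 0 = (%_. 0@A)" by (rule ext) simp
 then show ?case using kl_zero[OF ba_simps(1)[OF A]] by simp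
next
 case (Suc n)
 note kD = cm_kspace[OF coalgD(1)[OF D]] and kA = ba_simps(1)[OF A]
 note u = chomD(1)[OF conv_unit_crossed]
 have "klinear D A (%x. conv_unit D A x +.A (-1) .*A
  tconv A (%x. \<phi> x +.A (-1) .*A conv_unit D A x) (inv_seq D A \<phi> n) (comult D x))"
  by (intro kl_add u kl_scale kl_comp[OF coalgD(7)[OF D]] tconv_props(1)[OF A kD kD] assms Suc kA)
 then show ?case by (simp add: klinear_def)
qed

lemma inv_seq_crossed:
 assumes "crossed_hom G D A \<phi>" shows "crossed_hom G D A (inv_seq D A \<phi> n)"
proof (induction n)
 case 0
 have "inv_seq D A \<phi> 0 = (%_. 0@A)" by (rule ext) simp
 moreover have "crossed_hom G D A (%_. 0@A)"
  unfolding crossed_hom_def using kl_zero[OF ba_simps(1)[OF A]] klD(4)[OF crossedD(2)[OF ba_simps(2)[OF A]]]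
   klD(4)[OF crossedD(3)[OF ba_simps(2)[OF A]]] ba_simps(1)[OF A] by simp
 ultimately show ?case by simp
next
 case (Suc n)
 have "crossed_hom G D A (%x. conv_unit D A x +.A (-1) .*A
  tconv A (%x. \<phi> x +.A (-1) .*A conv_unit D A x) (inv_seq D A \<phi> n) (comult D x))"
  by (intro crossed_hom_diff conv_unit_crossed crossed_hom_conv assms Suc)
 then show ?case by (simp add: crossed_hom_def klinear_def)
qed

text \<open>Local nilpotency. J = \<open>\<phi>\<close> - u vanishes on \<open>F 0\<close>, and the
  coproduct of \<open>F n\<close> involves only pairs from \<open>F i\<close> and \<open>F j\<close>
  with i + j \<le> n. Pairs with i = 0 are killed by J, so on \<open>F n\<close> the convolution of
  J with \<open>\<psi>\<close> sees \<open>\<psi>\<close> only on \<open>F j\<close> with j < n.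
  Hence the iterates of \<open>inv_seq\<close> are constant on \<open>F n\<close> from index n + 1
  on. The stable value is a right inverse and inherits linearity and compatibility with G from the
  iterates.\<close>

lemma conv_inverse_exists:
 assumes f: "crossed_hom G D A \<phi>"
  and F: "!!n. submodule (F n) scalars D" "!!n. F n \<subseteq> F (Suc n)" "!!x. x .: D ==> \<exists>n. x : F n"
  and FD: "!!n x. x : F n ==> comult D x : lspan (D ** D) {pure D D y z |y z. \<exists>i j. i + j \<le> n \<and> y : F i \<and> z : F j}"
  and F0: "!!x. x : F 0 ==> \<phi> x = conv_unit D A x"
 shows "\<exists>\<psi>. crossed_hom G D A \<psi> \<and> (\<forall>x\<in>carrier D. tconv A \<phi> \<psi> (comult D x) = conv_unit D A x) \<and>
  (\<forall>n. \<forall>x\<in>F n. \<psi> x = inv_seq D A \<phi> (Suc n) x) \<and> (\<forall>x\<in>F 0. \<psi> x = conv_unit D A x)"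
proof -
 note cD = coalgD(1)[OF D]
 note kD = cm_kspace[OF cD] and kA = ba_simps(1)[OF A] and cA = ba_simps(2)[OF A]
 note fl = chomD(1)[OF f]
 note u = chomD(1)[OF conv_unit_crossed]
 define J where "J = (%x. \<phi> x +.A (-1) .*A conv_unit D A x)"
 have J: "klinear D A J" unfolding J_def by (intro kl_add fl kl_scale u kA)
 have J0: "J x = 0@A" if "x : F 0" for x
  using that F(1)[of 0] kA klD(1)[OF u] by (auto simp: J_def F0 ks_neg submodule_iff[OF kD])
 note I = inv_seq_linear[OF fl]
 have Fc: "x : F n ==> x .: D" for x n using F(1)[of n] by (auto simp: submodule_iff[OF kD])
 \<comment> \<open>The contraction property: convolving with J, values on \<open>F n\<close> depend
   on the other factor only through smaller pieces of the filtration.\<close>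
 have tc: "tconv A J \<psi> (comult D x) = tconv A J \<psi>' (comult D x)"
  if x: "x : F n" and p: "klinear D A \<psi>" "klinear D A \<psi>'" "!!j z. j < n ==> z : F j ==> \<psi> z = \<psi>' z" for x n \<psi> \<psi>'
 proof (rule klinear_lspan_eq[OF tconv_props(1)[OF A kD kD J p(1)] tconv_props(1)[OF A kD kD J p(2)] _ _ FD[OF x] _ kA])
  show "{pure D D y z |y z. \<exists>i j. i + j \<le> n \<and> y : F i \<and> z : F j} \<subseteq> carrier (D ** D)"
   using Fc kD by auto
  fix t assume "t : {pure D D y z |y z. \<exists>i j. i + j \<le> n \<and> y : F i \<and> z : F j}"
  then obtain y z i j where t: "t = pure D D y z" "i + j \<le> n" "y : F i" "z : F j" by blast
  note c = Fc[OF t(3)] Fc[OF t(4)]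
  show "tconv A J \<psi> t = tconv A J \<psi>' t"
  proof (cases "i = 0")
   case True
   then show ?thesis using c t J0[of y] klD(1)[OF p(1) c(2)] klD(1)[OF p(2) c(2)] A
    by (simp add: tconv_props[OF A kD kD J p(1)] tconv_props[OF A kD kD J p(2)])
  next
   case False
   then show ?thesis using c t p(3)[of j z]
    by (simp add: tconv_props[OF A kD kD J p(1)] tconv_props[OF A kD kD J p(2)])
  qed
 qed (simp add: kD)
 have step: "inv_seq D A \<phi> (Suc n) x = conv_unit D A x +.A (-1) .*A tconv A J (inv_seq D A \<phi> n) (comult D x)" for n x
  by (simp add: J_def)
 have stab: "inv_seq D A \<phi> m x = inv_seq D A \<phi> (Suc n) x" if "x : F n" "n < m" for m n x
  using that
 proof (induction n arbitrary: m x rule: less_induct)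
  case (less n)
  obtain m' where m: "m = Suc m'" "n \<le> m'" using less.prems by (cases m) auto
  have "tconv A J (inv_seq D A \<phi> m') (comult D x) = tconv A J (inv_seq D A \<phi> n) (comult D x)"
   by (rule tc[OF less.prems(1) I I]) (use less.IH m in \<open>metis order.strict_trans2\<close>)
  then show ?case by (simp only: m step)
 qed
 \<comment> \<open>The first stable iterate for the smallest piece containing x. By
   \<open>stab\<close>, any index above n gives the same value on \<open>F n\<close>.\<close>
 define \<psi> where "\<psi> = (%x. inv_seq D A \<phi> (Suc (LEAST n. x : F n)) x)"
 have psi: "\<psi> x = inv_seq D A \<phi> m x" if x: "x : F n" "n < m" for x n m
  unfolding \<psi>_def using stab[of x "LEAST n. x : F n" m] LeastI[of "%n. x : F n", OF x(1)] Least_le[of "%n. x : F n", OF x(1)] x(2)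
  by (metis order.strict_trans1)
 have mono: "x : F m" if "x : F n" "n \<le> m" for x n m
  using that(2,1) F(2) by (induction rule: dec_induct) auto
 have ex: "\<exists>n. x : F n \<and> y : F n" if xy: "x .: D" "y .: D" for x y
 proof -
  obtain n m where "x : F n" "y : F m" using F(3)[OF xy(1)] F(3)[OF xy(2)] by blast
  then show ?thesis by (intro exI[of _ "max n m"]) (auto intro: mono)
 qed
 have pl: "klinear D A \<psi>"
 proof (rule klI)
  fix x y a assume xy: "x .: D" "y .: D"
  then obtain n where n: "x : F n" "y : F n" using ex by blast
  then have "x +.D y : F n" using F(1)[of n] by (simp add: submodule_iff[OF kD])
  then show "\<psi> (x +.D y) = \<psi> x +.A \<psi> y"
   using n xy psi[of _ n "Suc n"] klD(2)[OF I[of "Suc n"]] by (simp del: inv_seq.simps)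
 next
  fix x a assume x: "x .: D"
  then obtain n where n: "x : F n" using F(3) by blast
  then have "a .*D x : F n" using F(1)[of n] by (simp add: submodule_iff[OF kD])
  then show "\<psi> (a .*D x) = a .*A \<psi> x" "\<psi> x .: A"
   using n x psi[of _ n "Suc n"] klD(1,3)[OF I[of "Suc n"]] by (simp_all del: inv_seq.simps)
 qed
 have "crossed_hom G D A \<psi>"
  unfolding crossed_hom_def
 proof (intro conjI pl ballI)
  fix g v assume gv: "g .: G" "v .: D"
  note c = chomD[OF inv_seq_crossed[OF f]]
  obtain n where n: "v : F n" "act D g v : F n" using ex[OF gv(2) act_closed[OF cD gv]] by blast
  then show "\<psi> (act D g v) = act A g (\<psi> v)" using gv psi[of _ n "Suc n"] c(2)[of g v "Suc n"] by (simp del: inv_seq.simps)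
  obtain n where n: "v : F n" "coact D g v : F n" using ex[OF gv(2) coact_closed[OF cD gv]] by blast
  then show "\<psi> (coact D g v) = coact A g (\<psi> v)" using gv psi[of _ n "Suc n"] c(3)[of g v "Suc n"] by (simp del: inv_seq.simps)
 qed
 moreover have "tconv A \<phi> \<psi> (comult D x) = conv_unit D A x" if x: "x .: D" for x
 proof -
  obtain n where n: "x : F n" using F(3)[OF x] by blast
  have *: "tconv A \<phi> \<psi> t = tconv A (conv_unit D A) \<psi> t +.A tconv A J \<psi> t" if t: "t .: (D ** D)" for t
  proof (rule tensor_eq[OF kD kD tconv_props(1)[OF A kD kD fl pl]
     kl_add[OF tconv_props(1)[OF A kD kD u pl] tconv_props(1)[OF A kD kD J pl] kA] _ t])
   fix y z assume yz: "y .: D" "z .: D"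
   note [simp] = klD(1)[OF fl] klD(1)[OF u] klD(1)[OF J] klD(1)[OF pl]
   have "\<phi> y = conv_unit D A y +.A J y" using yz kA by (simp add: J_def ks_add_diff)
   then show "tconv A \<phi> \<psi> (pure D D y z) = tconv A (conv_unit D A) \<psi> (pure D D y z) +.A tconv A J \<psi> (pure D D y z)"
    using yz by (simp add: tconv_props[OF A kD kD fl pl] tconv_props[OF A kD kD u pl] tconv_props[OF A kD kD J pl] ba_ring[OF A])
  qed
  note dx = coalgD(8)[OF D x]
  have "tconv A J \<psi> (comult D x) = tconv A J (inv_seq D A \<phi> (Suc n)) (comult D x)"
   by (rule tc[OF n pl I]) (rule psi, assumption, simp)
  moreover have "\<psi> x = conv_unit D A x +.A (-1) .*A tconv A J (inv_seq D A \<phi> (Suc n)) (comult D x)"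
   by (subst psi[OF n, of "Suc (Suc n)"], simp, rule step)
  ultimately show ?thesis
   using klD(1)[OF u x] klD(1)[OF tconv_props(1)[OF A kD kD J I] dx] kA
   by (simp add: *[OF dx] conv_left_unit[OF pl x] ks_add_diff del: inv_seq.simps)
 qed
 moreover have "\<psi> x = conv_unit D A x" if x: "x : F 0" for x
 proof -
  have z: "klinear D A (%_. 0@A)" by (rule kl_zero[OF kA])
  have "tconv A J (inv_seq D A \<phi> 0) (comult D x) = tconv A J (%_. 0@A) (comult D x)"
   by (rule tc[OF x I z]) simp
  also have "\<dots> = 0@A"
   by (rule tensor_eq[OF kD kD tconv_props(1)[OF A kD kD J z] kl_zero[OF kA] _ coalgD(8)[OF D Fc[OF x]]])
    (use A klD(1)[OF J] in \<open>simp add: tconv_props[OF A kD kD J z]\<close>)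
  finally show ?thesis
   using psi[OF x, of "Suc 0"] klD(1)[OF u Fc[OF x]] kA unfolding step by simp
 qed
 ultimately show ?thesis using psi by blast
qed

end

section \<open>Bialgebras: uniqueness and existence of antipodes\<close>

lemma bialgD:
 assumes "braided_bialgebra G A"
 shows "braided_algebra G A" "braided_coalgebra G A" "algebra_hom G A (tensor_algebra G A A) (comult A)"
  "algebra_hom G A (unit_object G) (counit A)"
 using assms by (simp_all add: braided_bialgebra_def)

lemma is_antipode_iff:
 "is_antipode G A s \<longleftrightarrow> crossed_hom G A A s \<and> (\<forall>x\<in>carrier A. tconv A s (%y. y) (comult A x) = conv_unit A A x \<and>
  tconv A (%y. y) s (comult A x) = conv_unit A A x)"
 by (simp add: is_antipode_def tconv_def conv_unit_def)

text \<open>The monoid argument: a left inverse \<open>\<phi>\<close> and a right inverse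
  \<open>\<chi>\<close> of \<open>\<psi>\<close> are both the threefold convolution of
  \<open>\<phi>\<close>, \<open>\<psi>\<close> and \<open>\<chi>\<close>.\<close>

lemma conv_inverse_unique:
 fixes D :: "('k::field, 'g, 'a, 'm) bcoalg" and A :: "('k, 'g, 'b, 'n) cmod"
 assumes D: "braided_coalgebra G D" and A: "braided_algebra G A"
  and f: "klinear D A \<phi>" and g: "klinear D A \<psi>" and h: "klinear D A \<chi>"
  and 1: "!!x. x .: D ==> tconv A \<phi> \<psi> (comult D x) = conv_unit D A x"
  and 2: "!!x. x .: D ==> tconv A \<psi> \<chi> (comult D x) = conv_unit D A x"
  and x: "x .: D"
 shows "\<phi> x = \<chi> x"
proof -
 note kD = cm_kspace[OF coalgD(1)[OF D]] and kA = ba_simps(1)[OF A] and dl = coalgD(7)[OF D]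
 note u = chomD(1)[OF conv_unit_crossed[OF D A]]
 note dx = coalgD(8)[OF D x]
 have fg: "klinear D A (%x. tconv A \<phi> \<psi> (comult D x))" and gh: "klinear D A (%x. tconv A \<psi> \<chi> (comult D x))"
  by (intro kl_comp[OF dl] tconv_props(1)[OF A kD kD] f g h)+
 have "tconv A (%x. tconv A \<phi> \<psi> (comult D x)) \<chi> (comult D x) = tconv A (conv_unit D A) \<chi> (comult D x)"
  by (rule tensor_eq[OF kD kD tconv_props(1)[OF A kD kD fg h] tconv_props(1)[OF A kD kD u h] _ dx])
   (simp add: tconv_props[OF A kD kD fg h] tconv_props[OF A kD kD u h] 1)
 moreover have "tconv A \<phi> (%x. tconv A \<psi> \<chi> (comult D x)) (comult D x) = tconv A \<phi> (conv_unit D A) (comult D x)"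
  by (rule tensor_eq[OF kD kD tconv_props(1)[OF A kD kD f gh] tconv_props(1)[OF A kD kD f u] _ dx])
   (simp add: tconv_props[OF A kD kD f gh] tconv_props[OF A kD kD f u] 2)
 ultimately show ?thesis
  using conv_assoc[OF D A f g h x] conv_left_unit[OF D A h x] conv_left_unit[OF D A f x] by simp
qed

lemma antipode_unique:
 assumes D: "braided_coalgebra G A" and A: "braided_algebra G A"
  and s: "is_antipode G A s" and s': "is_antipode G A s'" and x: "x .: A"
 shows "s x = s' x"
 using s s' by (intro conv_inverse_unique[OF D A _ kl_id _ _ _ x, where \<phi> = s])
  (auto simp: is_antipode_iff dest: chomD(1))

text \<open>A right convolution inverse \<open>\<psi>\<close> of \<open>id\<close> exists by local nilpotency, and it agrees with the
 convolution unit in degree \<open>0\<close>, so the same applies to \<open>\<psi>\<close>; its right inverse must be \<open>id\<close>.\<close>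

lemma antipode_exists:
 fixes A :: "('k::field, 'g, 'a, 'm) bcoalg"
 assumes D: "braided_coalgebra G A" and A: "braided_algebra G A"
  and F: "!!n. submodule (F n) scalars A" "!!n. F n \<subseteq> F (Suc n)" "!!x. x .: A ==> \<exists>n. x : F n"
  and FD: "!!n x. x : F n ==> comult A x : lspan (A ** A) {pure A A y z |y z. \<exists>i j. i + j \<le> n \<and> y : F i \<and> z : F j}"
  and F0: "!!x. x : F 0 ==> x = counit A x .*A 1@A"
 shows "\<exists>s. is_antipode G A s \<and> (\<forall>n. \<forall>x\<in>F n. s x = inv_seq A A (%y. y) (Suc n) x)"
proof -
 have F0': "x = conv_unit A A x" if "x : F 0" for x using F0[OF that] by (simp add: conv_unit_def)
 note inv = conv_inverse_exists[OF D A _ F FD]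
 obtain s where s: "crossed_hom G A A s" "!!x. x .: A ==> tconv A (%y. y) s (comult A x) = conv_unit A A x"
  "\<forall>n. \<forall>x\<in>F n. s x = inv_seq A A (%y. y) (Suc n) x" "!!x. x : F 0 ==> s x = conv_unit A A x"
  using inv[OF crossed_hom_id _ _ F0'] by blast
 obtain t where t: "crossed_hom G A A t" "!!x. x .: A ==> tconv A s t (comult A x) = conv_unit A A x"
  using inv[OF s(1) _ _ s(4)] by blast
 note kA = ba_simps(1)[OF A]
 have eq: "x = t x" if "x .: A" for x
  using conv_inverse_unique[OF D A kl_id chomD(1)[OF s(1)] chomD(1)[OF t(1)] s(2) t(2) that] .
 have "tconv A s (%y. y) (comult A x) = conv_unit A A x" if x: "x .: A" for x
 proof -
  note sl = chomD(1)[OF s(1)] and tl = chomD(1)[OF t(1)]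
  have "tconv A s (%y. y) (comult A x) = tconv A s t (comult A x)"
   by (rule tensor_eq[OF kA kA tconv_props(1)[OF A kA kA sl kl_id] tconv_props(1)[OF A kA kA sl tl] _
      coalgD(8)[OF D x]])
    (simp add: tconv_props[OF A kA kA sl kl_id] tconv_props[OF A kA kA sl tl] eq[symmetric])
  then show ?thesis using t(2)[OF x] by simp
 qed
 with s show ?thesis by (auto simp: is_antipode_iff)
qed

text \<open>An antipode that is pointwise an iterate of \<open>inv_seq\<close> maps a family of
  subspaces to itself as soon as the recursion step does. The family is later either the degrees of
  T(V) or constantly equal to an ideal.\<close>

lemma inv_seq_preserve:
 fixes A :: "('k::field, 'g, 'a, 'm) bcoalg"
 assumes D: "braided_coalgebra G A" and A: "braided_algebra G A"
  and X: "!!n. submodule (X n) scalars A" and u: "!!n x. x : X n ==> conv_unit A A x : X n"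
  and c: "!!n x \<psi>. [|x : X n; klinear A A \<psi>; !!i y. y : X i ==> \<psi> y : X i|] ==>
   tconv A (%x. x +.A (-1) .*A conv_unit A A x) \<psi> (comult A x) : X n"
  and x: "x : X n"
 shows "inv_seq A A (%y. y) m x : X n"
 using x
proof (induction m arbitrary: n x)
 case 0 then show ?case using X[of n] submodule_iff[OF ba_simps(1)[OF A]] by auto
next
 case (Suc m)
 have "tconv A (%x. x +.A (-1) .*A conv_unit A A x) (inv_seq A A (%y. y) m) (comult A x) : X n"
  by (rule c[OF Suc.prems inv_seq_linear[OF D A kl_id] Suc.IH])
 then show ?case using u[OF Suc.prems] X[of n] submodule_iff[OF ba_simps(1)[OF A]] by auto
qed

lemma ahomD:
 assumes "algebra_hom G A B f"
 shows "crossed_hom G A B f" "f 1@A = 1@B" "x .: A ==> y .: A ==> f (x *.A y) = f x *.B f y"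
  "klinear A B f"
 using assms chomD(1) by (auto simp: algebra_hom_def)

lemma cohomD:
 assumes "coalgebra_hom G C D f"
 shows "crossed_hom G C D f" "x .: C ==> comult D (f x) = tmap D D f f (comult C x)"
  "x .: C ==> counit D (f x) = counit C x"
 using assms by (auto simp: coalgebra_hom_def)

text \<open>As maps from A to B, f after s is a left and t after f a right convolution inverse of
  f.\<close>

lemma hom_antipode:
 assumes A: "braided_bialgebra G A" and B: "braided_bialgebra G B" and f: "algebra_hom G A B f" "coalgebra_hom G A B f"
  and s: "is_antipode G A s" and t: "is_antipode G B t" and x: "x .: A"
 shows "f (s x) = t (f x)"
proof -
 note aA = bialgD(1)[OF A] and cA = bialgD(2)[OF A]
 note aB = bialgD(1)[OF B] and cB = bialgD(2)[OF B]
 note kA = ba_simps(1)[OF aA] and kB = ba_simps(1)[OF aB]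
 note fl = ahomD(4)[OF f(1)]
 have sl: "klinear A A s" and tl: "klinear B B t" using s t by (auto simp: is_antipode_iff dest: chomD(1))
 note fs = kl_comp[OF sl fl] and tf = kl_comp[OF fl tl]
 show ?thesis
 proof (rule conv_inverse_unique[OF cA aB fs fl tf _ _ x])
  fix x assume x: "x .: A"
  note dx = coalgD(8)[OF cA x]
  have "tconv B (%x. f (s x)) f (comult A x) = f (tconv A s (%y. y) (comult A x))"
   by (rule tensor_eq[OF kA kA tconv_props(1)[OF aB kA kA fs fl] kl_comp[OF tconv_props(1)[OF aA kA kA sl kl_id] fl] _ dx])
    (simp add: tconv_props[OF aB kA kA fs fl] tconv_props[OF aA kA kA sl kl_id] ahomD(3)[OF f(1)] klD(1)[OF sl])
  also have "\<dots> = f (conv_unit A A x)" using s x by (simp add: is_antipode_iff)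
  also have "\<dots> = conv_unit A B x" using aA by (simp add: conv_unit_def klD(3)[OF fl] ahomD(2)[OF f(1)])
  finally show "tconv B (%x. f (s x)) f (comult A x) = conv_unit A B x" .
  have "tconv B f (%x. t (f x)) (comult A x) = tconv B (%y. y) t (tmap B B f f (comult A x))"
   by (rule tensor_eq[OF kA kA tconv_props(1)[OF aB kA kA fl tf]
      kl_comp[OF kl_tmap[OF kA kA kB kB fl fl] tconv_props(1)[OF aB kB kB kl_id tl]] _ dx])
    (simp add: tconv_props[OF aB kA kA fl tf] tconv_props[OF aB kB kB kl_id tl] tmap_pure[OF kA kA kB kB fl fl] klD(1)[OF fl])
  also have "\<dots> = tconv B (%y. y) t (comult B (f x))" by (simp add: cohomD(2)[OF f(2) x])
  also have "\<dots> = conv_unit B B (f x)"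
   using t klD(1)[OF fl x] by (simp add: is_antipode_iff)
  also have "\<dots> = conv_unit A B x" by (simp add: conv_unit_def cohomD(3)[OF f(2) x])
  finally show "tconv B f (%x. t (f x)) (comult A x) = conv_unit A B x" .
 qed
qed

text \<open>With v of degree g, the summand 1\<otimes>v has to pass a, which is where g acts on a.
  The second claim is associativity of the braided product with v\<otimes>1 + 1\<otimes>v in front;
  through it the coproduct of the free algebra becomes multiplicative by induction on
  letters.\<close>

lemma prim_mult:
 assumes A: "braided_algebra G A" and v: "homog A g v"
 shows "[|a .: A; b .: A|] ==>
   (pure A A v 1@A +.(A ** A) pure A A 1@A v) *.(tensor_algebra G A A) pure A A a b =
   pure A A (v *.A a) b +.(A ** A) pure A A (act A g a) (v *.A b)"
  and "[|s .: (A ** A); t .: (A ** A)|] ==>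
   (pure A A v 1@A +.(A ** A) pure A A 1@A v) *.(tensor_algebra G A A) (s *.(tensor_algebra G A A) t) =
   ((pure A A v 1@A +.(A ** A) pure A A 1@A v) *.(tensor_algebra G A A) s) *.(tensor_algebra G A A) t"
proof -
 note [simp] = A
 let ?T = "A ** A" and ?m = "%s t. s *.(tensor_algebra G A A) t"
 let ?p = "pure A A v 1@A +.?T pure A A 1@A v"
 note vD = homogD[OF v]
 note m = ta_mult[OF A]
 note ml = kbilD(1)[OF m(1)] and mr = kbilD(2)[OF m(1)]
 have p: "?p .: ?T" using vD by simp
 have 1: "?m ?p (pure A A a b) = pure A A (v *.A a) b +.?T pure A A (act A g a) (v *.A b)"
  if "a .: A" "b .: A" for a b
  using that vD v ba_crossed(4)[OF A]
  by (simp add: klD(2)[OF mr] m(2)[where g = \<one>] m(2)[where g = g] crossedD(4))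
 then show "[|a .: A; b .: A|] ==> ?m ?p (pure A A a b) = pure A A (v *.A a) b +.?T pure A A (act A g a) (v *.A b)" .
 assume s: "s .: ?T" and t: "t .: ?T"
 have mc [simp]: "?m s t .: ?T" if "s .: ?T" "t .: ?T" for s t
  using klD(1)[OF ml] that by simp
 have pp: "?m ?p (?m (pure A A a b) (pure A A c d)) = ?m (?m ?p (pure A A a b)) (pure A A c d)"
  if b: "homog A h b" and a: "a .: A" and cd: "c .: A" "d .: A" for a b c d h
 proof -
  note bD = homogD[OF b]
  have "?m (?m ?p (pure A A a b)) (pure A A c d) =
   ?m (pure A A (v *.A a) b +.?T pure A A (act A g a) (v *.A b)) (pure A A c d)"
   by (simp only: 1[OF a bD(2)])
  also have "\<dots> = ?m (pure A A (v *.A a) b) (pure A A c d) +.?T ?m (pure A A (act A g a) (v *.A b)) (pure A A c d)"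
   using bD a cd vD by (intro klD(2)[OF mr]) simp_all
  finally show ?thesis
   using bD a cd vD b v ba_crossed(2)[OF A v b]
   by (simp add: 1 m(2)[where g = h] m(2)[where g = "g \<otimes> h"] crossedD(5) ba_crossed(1) ba_ring[OF A])
 qed
 show "?m ?p (?m s t) = ?m (?m ?p s) t"
 proof (rule tensor_eq[OF _ _ kl_comp[OF ml[OF s] ml[OF p]] ml[OF mc[OF p s]] _ t])
  fix c d assume cd: "c .: A" "d .: A"
  show "?m ?p (?m s (pure A A c d)) = ?m (?m ?p s) (pure A A c d)"
   by (rule tensor_homog_eq[OF _ _ kl_comp[OF mr ml[OF p]] kl_comp[OF ml[OF p] mr] pp s])
    (use cd in \<open>auto dest: homogD(2)\<close>)
 qed simp_all
qed

section \<open>The tensor algebra\<close>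

end

section \<open>Words and multilinear maps\<close>

lemma word_rel_keys:
 assumes "kspace V"
 shows "\<forall>r\<in>word_rel V. Poly_Mapping.keys r \<subseteq> lists (carrier V)"
proof
 fix r assume r: "r : word_rel V"
 have *: "Poly_Mapping.keys (Poly_Mapping.single (xs @ [v] @ ys) a) \<subseteq> lists (carrier V)"
  if "xs .:: V" "v .: V" "ys .:: V" for xs v ys and a :: 'a
  using that by auto
 show "Poly_Mapping.keys r \<subseteq> lists (carrier V)"
  using r unfolding word_rel_def diff_fscale
  by (elim UnE CollectE exE conjE; simp only:)
   (intro keys_add_sub keys_fscale_sub * ks_closed assms; assumption)+
qed

text \<open>One letter varies between two fixed words; in this form words of all lengths are treated
  at once.\<close>

definition kmultilinear :: "('k::field, 'v, 'm) vect => ('k, 'b, 'n) vect => ('v list => 'b) => bool" where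
 "kmultilinear V M f \<longleftrightarrow> (\<forall>vs\<in>lists (carrier V). f vs .: M) \<and>
  (\<forall>xs\<in>lists (carrier V). \<forall>ys\<in>lists (carrier V). klinear V M (%v. f (xs @ [v] @ ys)))"

context
 fixes V :: "('k::field, 'v, 'm) vect"
 assumes V: "kspace V"
begin

lemma kspace_word_mod: "kspace (word_mod V)"
 unfolding word_mod_def by (rule kspace_presented[OF word_rel_keys[OF V]])

lemma kmultilinear_word: "kmultilinear V (word_mod V) (word V)"
proof -
 note ops = presented_ops[OF word_rel_keys[OF V]]
 note eqI = pcls_eq_iff[OF word_rel_keys[OF V], THEN iffD2, OF fs.span_base]
 have c: "word V vs .: (word_mod V)" if "vs .:: V" for vs
  unfolding word_mod_def word_def by (rule pcls_carrier[OF word_rel_keys[OF V]]) (use that in auto)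
 show ?thesis
  unfolding kmultilinear_def
 proof (intro conjI ballI klI)
  fix xs ys v v' a assume *: "xs .:: V" "ys .:: V" "v .: V" "v' .: V"
  show "word V (xs @ [v +.V v'] @ ys) = word V (xs @ [v] @ ys) +.(word_mod V) word V (xs @ [v'] @ ys)"
   unfolding word_def word_mod_def ops
   by (rule eqI, unfold diff_diff_eq[symmetric] word_rel_def) (use * in blast)
 next
  fix xs ys v a assume *: "xs .:: V" "ys .:: V" "v .: V"
  show "word V (xs @ [a .*V v] @ ys) = a .*(word_mod V) word V (xs @ [v] @ ys)"
   unfolding word_def word_mod_def ops
   by (rule eqI, unfold fscale_single mult_1_right word_rel_def) (use * in blast)
 qed (use c in simp_all)
qed

lemma word_mod_induct [consumes 1, case_names word add]:
 assumes "t .: (word_mod V)"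
  and word: "!!a vs. vs .:: V ==> P (a .*(word_mod V) word V vs)"
  and add: "!!s t. [|s .: (word_mod V); t .: (word_mod V); P s; P t|] ==> P (s +.(word_mod V) t)"
 shows "P t"
 using assms(1) unfolding word_mod_def
proof (induction rule: presented_induct[OF word_rel_keys[OF V], consumes 1])
 case 1
 have "P (0 .*(word_mod V) word V [])" by (rule word) simp
 moreover have "word V [] .: (word_mod V)" using kmultilinear_word by (simp add: kmultilinear_def)
 ultimately show ?case by (simp add: kspace_word_mod word_mod_def[symmetric])
next
 case (2 a x c)
 have "word V x .: (word_mod V)" using kmultilinear_word 2 by (simp add: kmultilinear_def)
 then have "P (a .*(word_mod V) word V x +.(word_mod V) c)"
  using 2 by (intro add word) (simp_all add: kspace_word_mod word_mod_def[symmetric])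
 then show ?case by (simp add: word_mod_def[symmetric] word_def[symmetric])
qed

text \<open>Linearity in each letter is exactly what makes a function on words kill
  \<open>word_rel\<close>.\<close>

lemma word_lin_ext:
 assumes M: "kspace M" and f: "kmultilinear V M f"
 shows "klinear (word_mod V) M (lin_ext M f)" (is ?g1)
  and "vs .:: V ==> lin_ext M f (word V vs) = f vs" (is "PROP ?g2")
proof -
 have c: "\<forall>x\<in>lists (carrier V). f x .: M" using f by (simp add: kmultilinear_def)
 then have fX: "f : lists (carrier V) \<rightarrow> carrier M" by auto
 have fl: "klinear V M (%v. f (xs @ [v] @ ys))" if "xs .:: V" "ys .:: V" for xs ys
  using f that by (simp add: kmultilinear_def)
 note fD = klD[OF fl]
 have ev: "lin_eval M f (p - q) = lin_eval M f p +.M (-1) .*M lin_eval M f q"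
  "Poly_Mapping.keys (p - q) \<subseteq> lists (carrier V)"
  if "Poly_Mapping.keys p \<subseteq> lists (carrier V)" "Poly_Mapping.keys q \<subseteq> lists (carrier V)" for p q
  using lin_eval_add[OF M fX that(1) keys_fscale_sub[OF that(2), of "-1"]] lin_eval_scale[OF M fX that(2)]
   keys_add_sub[OF that(1) keys_fscale_sub[OF that(2), of "-1"]]
  unfolding diff_fscale[of p q] by (simp_all only:)
 have sgl: "lin_eval M f (Poly_Mapping.single (xs @ [v] @ ys) a) = a .*M f (xs @ [v] @ ys)"
  "Poly_Mapping.keys (Poly_Mapping.single (xs @ [v] @ ys) a) \<subseteq> lists (carrier V)"
  if "xs .:: V" "v .: V" "ys .:: V" for xs v ys a
  using that by (auto simp: lin_eval_single[OF M fX])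
 have *: "((x +.M y) +.M (-1) .*M x) +.M (-1) .*M y = 0@M"
  if "x .: M" "y .: M" for x y
  using M that by (simp add: ks_ac(2)[OF M that] ks_ac(1) ks_neg)
 have **: "a .*M x +.M (- a) .*M x = 0@M" if "x .: M" for a x
  using ks_neg[OF M ks_closed(3)[OF M that]] M that by simp
 have resp: "lin_eval M f r = 0@M" if "r : word_rel V" for r
  using that unfolding word_rel_def Un_iff
 proof (elim disjE CollectE exE conjE)
  fix xs v v' ys assume r: "r = Poly_Mapping.single (xs @ [v +.V v'] @ ys) 1 - Poly_Mapping.single (xs @ [v] @ ys) 1 - Poly_Mapping.single (xs @ [v'] @ ys) 1"
   "xs .:: V" "v .: V" "v' .: V" "ys .:: V"
  have "v +.V v' .: V" using r V by simp
  note s = sgl[OF r(2,3,5)] sgl[OF r(2,4,5)] sgl[OF r(2) this r(5)]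
  show ?thesis
   unfolding r(1) ev(1)[OF ev(2)[OF s(6) s(2)] s(4)] ev(1)[OF s(6) s(2)] s(1,3,5) fD(2)[OF r(2,5,3,4)]
   using * fD(1)[OF r(2,5,3)] fD(1)[OF r(2,5,4)] M by simp
 next
  fix xs a v ys assume r: "r = Poly_Mapping.single (xs @ [a .*V v] @ ys) 1 - Poly_Mapping.single (xs @ [v] @ ys) a"
   "xs .:: V" "v .: V" "ys .:: V"
  have "a .*V v .: V" using r V by simp
  note s = sgl[OF r(2,3,4)] sgl[OF r(2) this r(4)]
  show ?thesis
   unfolding r(1) ev(1)[OF s(4) s(2)] s(1,3) fD(3)[OF r(2,4,3)]
   using ** fD(1)[OF r(2,4,3)] M by simp
 qed
 show ?g1
  unfolding word_mod_def by (rule klinear_lin_ext[OF word_rel_keys[OF V] M c ballI[OF resp]])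
 show "PROP ?g2"
  unfolding word_def using lin_ext_gen[OF word_rel_keys[OF V] M c ballI[OF resp]] by simp
qed

text \<open>The source of the recursion principle \<open>TV_rec\<close>: the letters act one after
  another on a start value.\<close>

lemma kmultilinear_foldr:
 assumes "kbilinear V M M op" "e .: M"
 shows "kmultilinear V M (%vs. foldr op vs e)"
proof -
 have c: "foldr op vs y .: M" if "vs .:: V" "y .: M" for vs y
  using that by (induction vs) (auto simp: klD(1)[OF kbilD(1)[OF assms(1)]])
 have l: "klinear M M (foldr op vs)" if "vs .:: V" for vs
  using that
 proof (induction vs)
  case Nil then show ?case by (simp add: klinear_def)
 next
  case (Cons v vs)
  then have "klinear M M (%y. op v (foldr op vs y))" by (intro kl_comp[OF _ kbilD(1)[OF assms(1)]]) auto
  then show ?case by (simp add: klinear_def)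
 qed
 show ?thesis
  unfolding kmultilinear_def using assms(2)
  by (auto intro!: c kl_comp[OF kbilD(2)[OF assms(1)] l])
qed

end

section \<open>T(V) as a braided algebra, and recursion along letters\<close>

context finite_comm_group
begin

lemma same_space_TV: "same_space (word_mod V) (TV G V)"
 by (simp add: same_space_def TV_def Let_def)

lemmas TV_simps = same_space_simps[OF same_space_TV] same_space_TV[unfolded same_space_def]

definition gprod :: "'g list => 'g" where
 "gprod gs = foldr (%g g'. g \<otimes> g') gs \<one>"

lemma gprod_simps [simp]: "gprod [] = \<one>" "gprod (g # gs) = g \<otimes> gprod gs"
 by (simp_all add: gprod_def)

lemma gprod_closed [simp]: "set gs \<subseteq> carrier G ==> gprod gs .: G"
 by (induction gs) auto

lemma gprod_append: "set gs \<subseteq> carrier G ==> set hs \<subseteq> carrier G ==> gprod (gs @ hs) = gprod gs \<otimes> gprod hs"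
 by (induction gs) (auto simp: m_assoc)

context
 fixes V :: "('k::field, 'g, 'v, 'm) cmod"
 assumes V: "crossed_module G V"
begin

lemma kspace_V: "kspace V" by (rule cm_kspace[OF V])

lemma kspace_TV [simp]: "kspace (TV G V)"
 using kspace_word_mod[OF kspace_V] by (simp add: TV_simps)

lemma kmultilinear_word_TV: "kmultilinear V (TV G V) (word V)"
 using kmultilinear_word[OF kspace_V] by (simp add: kmultilinear_def TV_simps)

lemma word_closed [simp]: "vs .:: V ==> word V vs .: (TV G V)"
 using kmultilinear_word_TV by (simp add: kmultilinear_def)

lemma word_linear: "xs .:: V ==> ys .:: V ==> klinear V (TV G V) (%v. word V (xs @ [v] @ ys))"
 using kmultilinear_word_TV by (simp add: kmultilinear_def)

lemma TV_word_induct [consumes 1, case_names word add]: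
 assumes "t .: (TV G V)"
  and "!!a vs. vs .:: V ==> P (a .*(TV G V) word V vs)"
  and "!!s t. [|s .: (TV G V); t .: (TV G V); P s; P t|] ==> P (s +.(TV G V) t)"
 shows "P t"
proof -
 have eqs: "carrier (word_mod V) = carrier (TV G V)" "add (word_mod V) = add (TV G V)" "module.smult (word_mod V) = module.smult (TV G V)"
  using same_space_TV[of V] by (simp_all add: same_space_def)
 show ?thesis by (rule word_mod_induct[OF kspace_V, unfolded eqs, of t P, OF assms(1)]) (use assms in blast)+
qed

lemma TV_lin_ext:
 assumes "kspace M" "kmultilinear V M f"
 shows "klinear (TV G V) M (lin_ext M f)" "vs .:: V ==> lin_ext M f (word V vs) = f vs"
 using word_lin_ext[OF kspace_V assms] by (simp_all add: TV_simps)

lemma TV_eq: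
 assumes "klinear (TV G V) M f" "klinear (TV G V) M g" "!!vs. vs .:: V ==> f (word V vs) = g (word V vs)"
  "t .: (TV G V)"
 shows "f t = g t"
 using assms(4)
 by (induction rule: TV_word_induct) (simp_all add: assms(3) klD[OF assms(1)] klD[OF assms(2)])

lemma TV_fields:
 "1@(TV G V) = word V []"
 "s *.(TV G V) t = lin_ext (TV G V) (%xs. lin_ext (TV G V) (%ys. word V (xs @ ys)) t) s"
 "act (TV G V) g = lin_ext (TV G V) (%vs. word V (map (act V g) vs))"
 "coact (TV G V) h = lin_ext (TV G V) (%vs.
   \<Oplus>\<^bsub>TV G V\<^esub>gs\<in>{gs. set gs \<subseteq> carrier G \<and> length gs = length vs \<and> gprod gs = h}. word V (map2 (coact V) gs vs))"
 unfolding same_space_lin_ext[OF same_space_TV, symmetric] same_space_finsum[OF same_space_TV, symmetric]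
 by (simp_all add: TV_def Let_def gprod_def)

text \<open>Concatenation is first extended linearly in the second word; an induction over the
  second tensor then gives multilinearity in the first word.\<close>

lemma TV_mult:
 "kbilinear (TV G V) (TV G V) (TV G V) (%s t. s *.(TV G V) t)"
 "xs .:: V ==> ys .:: V ==> word V xs *.(TV G V) word V ys = word V (xs @ ys)"
proof -
 let ?T = "TV G V"
 let ?h = "%xs. lin_ext ?T (%ys. word V (xs @ ys))"
 have m1: "kmultilinear V ?T (%ys. word V (xs @ ys))" if "xs .:: V" for xs
  unfolding kmultilinear_def
 proof (intro conjI ballI)
  fix as bs assume "as .:: V" "bs .:: V"
  then show "klinear V ?T (%v. word V (xs @ as @ [v] @ bs))"
   using word_linear[of "xs @ as" bs] that by simp
 qed (use that in auto)
 note h = TV_lin_ext[OF kspace_TV m1]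
 have m2: "kmultilinear V ?T (%xs. ?h xs t)" if "t .: ?T" for t
  unfolding kmultilinear_def
 proof (intro conjI ballI)
  show "?h vs t .: ?T" if "vs .:: V" for vs
   using klD(1)[OF h(1)[OF that] \<open>t .: ?T\<close>] .
  fix as bs assume ab: "as .:: V" "bs .:: V"
  show "klinear V ?T (%v. ?h (as @ [v] @ bs) t)"
   using that
  proof (induction rule: TV_word_induct)
   case (word a vs)
   have "klinear V ?T (%v. a .*?T word V (as @ [v] @ (bs @ vs)))"
    using ab word by (intro kl_scale word_linear kspace_TV) auto
   then show ?case
   proof (rule kl_cong[OF _ kspace_V])
    fix v assume "v .: V"
    then have L: "as @ [v] @ bs .:: V" using ab by simp
    show "?h (as @ [v] @ bs) (a .*?T word V vs) = a .*?T word V (as @ [v] @ (bs @ vs))"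
     unfolding klD(3)[OF h(1)[OF L] word_closed[OF word]] h(2)[OF L word] by simp
   qed
  next
   case (add s t)
   show ?case
   proof (rule kl_cong[OF kl_add[OF add(3,4) kspace_TV] kspace_V])
    fix v assume "v .: V"
    then have L: "as @ [v] @ bs .:: V" using ab by simp
    show "?h (as @ [v] @ bs) (s +.?T t) = ?h (as @ [v] @ bs) s +.?T ?h (as @ [v] @ bs) t"
     by (rule klD(2)[OF h(1)[OF L] add(1,2)])
   qed
  qed
 qed
 note H = TV_lin_ext[OF kspace_TV m2]
 show 1: "xs .:: V ==> ys .:: V ==> word V xs *.?T word V ys = word V (xs @ ys)" for xs ys
  by (simp add: TV_fields H(2) h(2))
 show "kbilinear ?T ?T ?T (%s t. s *.?T t)"
 proof (rule kbilI)
  show "klinear ?T ?T (%s. s *.?T t)" if "t .: ?T" for t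
   using H(1)[OF that] by (simp add: TV_fields)
  show "klinear ?T ?T (%t. s *.?T t)" if "s .: ?T" for s
   using that
  proof (induction rule: TV_word_induct)
   case (word a vs)
   show ?case
    by (rule kl_cong[OF kl_scale[OF h(1)[OF word] kspace_TV, of a] kspace_TV])
     (use word in \<open>simp add: TV_fields klD[OF H(1)] H(2)\<close>)
  next
   case (add s t)
   show ?case
    by (rule kl_cong[OF kl_add[OF add(3,4) kspace_TV] kspace_TV])
     (use add in \<open>simp add: TV_fields klD[OF H(1)]\<close>)
  qed
 qed
qed

lemmas TV_mult_l = kbilD(2)[OF TV_mult(1)]
lemmas TV_mult_r = kbilD(1)[OF TV_mult(1)]

lemma TV_mult_closed [simp]: "s .: (TV G V) ==> t .: (TV G V) ==> s *.(TV G V) t .: (TV G V)"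
 using klD(1)[OF TV_mult_l] .

lemma TV_one [simp]: "1@(TV G V) .: (TV G V)" by (simp add: TV_fields)

lemma ring_TV: "ring (TV G V)"
proof (rule ringI)
 let ?T = "TV G V"
 show "abelian_group ?T" by (simp add: ks_abelian)
 show "Group.monoid ?T"
 proof (rule monoidI)
  fix x y z assume xyz: "x .: ?T" "y .: ?T" "z .: ?T"
  have w3: "(word V us *.?T word V vs) *.?T word V ws = word V us *.?T (word V vs *.?T word V ws)"
   if "us .:: V" "vs .:: V" "ws .:: V" for us vs ws
  proof -
   have "us @ vs .:: V" "vs @ ws .:: V" using that by auto
   then show ?thesis using that by (simp add: TV_mult(2))
  qed
  have w2: "(word V us *.?T word V vs) *.?T z = word V us *.?T (word V vs *.?T z)"
   if "us .:: V" "vs .:: V" for us vs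
   by (rule TV_eq[OF TV_mult_r kl_comp[OF TV_mult_r TV_mult_r] w3 xyz(3)]) (use that in simp_all)
  have w1: "(word V us *.?T y) *.?T z = word V us *.?T (y *.?T z)" if "us .:: V" for us
   by (rule TV_eq[OF kl_comp[OF TV_mult_r TV_mult_l] kl_comp[OF TV_mult_l TV_mult_r] w2 xyz(2)])
    (use that xyz in simp_all)
  show "(x *.?T y) *.?T z = x *.?T (y *.?T z)"
   by (rule TV_eq[OF kl_comp[OF TV_mult_l TV_mult_l] TV_mult_l w1 xyz(1)])
    (use xyz in simp_all)
 next
  fix x assume x: "x .: ?T"
  show "1@?T *.?T x = x"
   by (rule TV_eq[OF TV_mult_r kl_id _ x]) (simp_all add: TV_fields(1) TV_mult(2))
  show "x *.?T 1@?T = x"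
   by (rule TV_eq[OF TV_mult_l kl_id _ x]) (simp_all add: TV_fields(1) TV_mult(2))
 qed simp_all
qed (simp_all add: klD[OF TV_mult_l] klD[OF TV_mult_r])

lemma TV_act:
 assumes g: "g .: G"
 shows "klinear (TV G V) (TV G V) (act (TV G V) g)" (is ?g1)
  "vs .:: V ==> act (TV G V) g (word V vs) = word V (map (act V g) vs)" (is "PROP ?g2")
proof -
 have "kmultilinear V (TV G V) (%vs. word V (map (act V g) vs))"
  unfolding kmultilinear_def
 proof (intro conjI ballI)
  fix xs ys assume "xs .:: V" "ys .:: V"
  then have "map (act V g) xs .:: V" "map (act V g) ys .:: V"
   using V g by (auto simp: lists_eq_set)
  from kl_comp[OF crossedD(2)[OF V g] word_linear[OF this]]
  show "klinear V (TV G V) (%v. word V (map (act V g) (xs @ [v] @ ys)))" by simp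
 next
  fix vs assume "vs .:: V"
  then show "word V (map (act V g) vs) .: (TV G V)" using V g by (intro word_closed) (auto simp: lists_eq_set)
 qed
 from TV_lin_ext[OF kspace_TV this]
 show ?g1
  "PROP ?g2"
  by (simp_all add: TV_fields)
qed

lemma word_zero:
 assumes "vs .:: V" "0@V : set vs" shows "word V vs = 0@(TV G V)"
proof -
 obtain xs ys where vs: "vs = xs @ 0@V # ys" using split_list[OF assms(2)] by blast
 then have "klinear V (TV G V) (%v. word V (xs @ [v] @ ys))" using assms(1) by (intro word_linear) auto
 from klD(4)[OF this kspace_V kspace_TV] show ?thesis by (simp add: vs)
qed

lemma list_all2_homogD:
 assumes "list_all2 (homog V) gs vs"
 shows "vs .:: V" "set gs \<subseteq> carrier G" "length gs = length vs"
 using assms by (induction) (auto dest: homogD)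

lemma map2_coact_lists:
 "set gs \<subseteq> carrier G ==> vs .:: V ==> map2 (coact V) gs vs .:: V"
 using V by (auto simp: lists_eq_set in_set_zip subset_iff)

text \<open>The coaction sums over all lists of group elements with product h. On a word of
  homogeneous letters every list other than the actual list of degrees kills some letter.\<close>

lemma TV_coact:
 assumes h: "h .: G"
 shows "klinear (TV G V) (TV G V) (coact (TV G V) h)"
  "list_all2 (homog V) gs vs ==> coact (TV G V) h (word V vs) = (if h = gprod gs then word V vs else 0@(TV G V))"
proof -
 let ?T = "TV G V"
 let ?S = "%n. {gs. set gs \<subseteq> carrier G \<and> length gs = n \<and> gprod gs = h}"
 have fin: "finite (?S n)" for n
  by (rule finite_subset[OF _ finite_lists_length_eq[OF finite_carrier, of n]]) auto
 have "kmultilinear V ?T (%vs. \<Oplus>\<^bsub>?T\<^esub>gs\<in>?S (length vs). word V (map2 (coact V) gs vs))"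
  unfolding kmultilinear_def
 proof (intro conjI ballI)
  fix vs assume "vs .:: V"
  then show "(\<Oplus>\<^bsub>?T\<^esub>gs\<in>?S (length vs). word V (map2 (coact V) gs vs)) .: ?T"
   by (intro ks_finsum_closed kspace_TV Pi_I word_closed map2_coact_lists) auto
 next
  fix xs ys assume xy: "xs .:: V" "ys .:: V"
  have *: "klinear V ?T (%v. word V (map2 (coact V) gs (xs @ [v] @ ys)))"
   \<comment> \<open>\<open>undefined\<close> stands for an arbitrary letter: only the length of the
     word matters for the index set.\<close>
   if gs: "gs : ?S (length (xs @ [undefined] @ ys))" for gs
  proof -
   have n: "length xs < length gs" using gs by simp
   obtain as b bs where e: "gs = as @ b # bs" "length as = length xs"
    using id_take_nth_drop[OF n] n by (metis length_take min.absorb4)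
   have eq: "map2 (coact V) gs (xs @ [v] @ ys) = map2 (coact V) as xs @ [coact V b v] @ map2 (coact V) bs ys" for v
    using e by simp
   have "set as \<subseteq> carrier G" "set bs \<subseteq> carrier G" "b .: G"
    using gs e by auto
   then show ?thesis
    unfolding eq
    by (intro kl_comp[OF crossedD(3)[OF V] word_linear] map2_coact_lists xy)
  qed
  show "klinear V ?T (%v. \<Oplus>\<^bsub>?T\<^esub>gs\<in>?S (length (xs @ [v] @ ys)). word V (map2 (coact V) gs (xs @ [v] @ ys)))"
   using klinear_finsum_fun[of "?S (length (xs @ [undefined] @ ys))", OF * kspace_V kspace_TV fin] by simp
 qed
 note L = TV_lin_ext[OF kspace_TV this]
 show "klinear ?T ?T (coact ?T h)" using L(1) by (simp add: TV_fields)
 assume hv: "list_all2 (homog V) gs vs"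
 note D = list_all2_homogD[OF hv]
 have val: "word V (map2 (coact V) ks vs) = (if ks = gs then word V vs else 0@?T)"
  if "set ks \<subseteq> carrier G" "length ks = length vs" for ks
 proof (cases "ks = gs")
  case True
  have "map2 (coact V) gs vs = vs" using hv by (induction) (auto simp: homog_def)
  then show ?thesis using True by simp
 next
  case False
  have "\<exists>i<length vs. ks ! i \<noteq> gs ! i"
   by (rule ccontr) (use nth_equalityI[of ks gs] False that D in auto)
  then obtain i where i: "i < length vs" "ks ! i \<noteq> gs ! i" by blast
  have "homog V (gs ! i) (vs ! i)" using hv i D by (simp add: list_all2_conv_all_nth)
  moreover have "ks ! i .: G" using i that by (metis nth_mem subsetD)
  ultimately have "map2 (coact V) ks vs ! i = 0@V"
   using i that by (simp add: homog_coact[OF V])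
  then have "0@V : set (map2 (coact V) ks vs)"
   using i that by (metis length_map length_zip min.idem nth_mem)
  then show ?thesis using False word_zero[OF map2_coact_lists[OF that(1) D(1)]] by simp
 qed
 have "coact ?T h (word V vs) = (\<Oplus>\<^bsub>?T\<^esub>ks\<in>?S (length vs). word V (map2 (coact V) ks vs))"
  using L(2)[OF D(1)] by (simp add: TV_fields)
 also have "\<dots> = (if h = gprod gs then word V vs else 0@?T)"
 proof (cases "h = gprod gs")
  case True
  then show ?thesis using D fin by (simp, intro ks_finsum_single[where i = gs]) (auto simp: val)
 next
  case False
  then show ?thesis by (simp, intro ks_finsum_zero) (auto simp: val)
 qed
 finally show "coact ?T h (word V vs) = (if h = gprod gs then word V vs else 0@?T)" .
qed

text \<open>Letters are split into homogeneous components from left to right; the inner induction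
  carries a prefix that is homogeneous already.\<close>

lemma TV_homog_word_induct [consumes 1, case_names word add]:
 assumes t: "t .: (TV G V)"
  and word: "!!a gs vs. list_all2 (homog V) gs vs ==> P (a .*(TV G V) word V vs)"
  and add: "!!s t. [|s .: (TV G V); t .: (TV G V); P s; P t|] ==> P (s +.(TV G V) t)"
 shows "P t"
 using t
proof (induction rule: TV_word_induct)
 case (word a vs)
 have "P (a .*(TV G V) word V (us @ vs))" if "list_all2 (homog V) gs us" "vs .:: V" for gs us vs
  using that
 proof (induction vs arbitrary: gs us)
  case Nil then show ?case using assms(2) by simp
 next
  case (Cons v vs)
  note us = list_all2_homogD(1)[OF Cons.prems(1)]
  have v: "v .: V" and vs: "vs .:: V" using Cons.prems by auto
  show ?case using V v
  proof (induction rule: homog_induct)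
   case (homog g v)
   have "list_all2 (homog V) (gs @ [g]) (us @ [v])" using Cons.prems homog by (intro list_all2_appendI) auto
   from Cons.IH[OF this vs] show ?case by simp
  next
   case (add v w)
   note l = word_linear[OF us vs]
   show ?case using assms(3)[OF _ _ add(3,4)] add(1,2) us vs klD(2)[OF l add(1,2)]
    by (simp add: ks_distrib)
  qed
 qed
 from this[of "[]" "[]"] word show ?case by simp
qed (rule add)

lemma crossed_module_TV [simp]: "crossed_module G (TV G V)"
proof (rule crossed_moduleI[where X = "{a .*(TV G V) word V vs |a gs vs. list_all2 (homog V) gs vs}"])
 let ?T = "TV G V"
 fix P t assume t: "t .: ?T" and P: "!!x. x : {a .*?T word V vs |a gs vs. list_all2 (homog V) gs vs} ==> P x"
  "!!v w. [|v .: ?T; w .: ?T; P v; P w|] ==> P (v +.?T w)"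
 show "P t" using t by (rule TV_homog_word_induct) (rule P(1), blast, rule P(2))
next
 let ?T = "TV G V"
 fix x assume "x : {a .*?T word V vs |a gs vs. list_all2 (homog V) gs vs}"
 then obtain a gs vs where x: "x = a .*?T word V vs" and vs: "list_all2 (homog V) gs vs" by blast
 note D = list_all2_homogD[OF vs]
 have mp: "map (act V g) vs .:: V" if "g .: G" for g using that D V by (auto simp: lists_eq_set)
 have "map (act V \<one>) vs = vs" using D(1) V by (induction vs) (auto simp: crossedD(4))
 then show "act ?T \<one> x = x" using D by (simp add: x klD[OF TV_act(1)] TV_act(2))
 show "act ?T (g \<otimes> h) x = act ?T g (act ?T h x)" if "g .: G" "h .: G" for g h
 proof -
  have "word V (map (act V (g \<otimes> h)) vs) = word V (map (act V g \<circ> act V h) vs)"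
   using D(1) V that by (intro arg_cong[of _ _ "word V"]) (auto simp: crossedD(5))
  then show ?thesis using D that mp by (simp add: x klD[OF TV_act(1)] TV_act(2))
 qed
 show "\<exists>g\<in>carrier G. \<forall>k\<in>carrier G. \<forall>h\<in>carrier G. coact ?T h (act ?T k x) = (if h = g then act ?T k x else 0@?T)"
 proof (rule bexI[of _ "gprod gs"], intro ballI)
  fix k h assume kh: "k .: G" "h .: G"
  have "list_all2 (homog V) gs (map (act V k) vs)" using vs kh by (induction) (auto intro: homog_intros(2)[OF V])
  note c = TV_coact(2)[OF kh(2) this]
  show "coact ?T h (act ?T k x) = (if h = gprod gs then act ?T k x else 0@?T)"
   using D kh mp by (simp add: x klD[OF TV_act(1)] TV_act(2) klD[OF TV_coact(1)] c)
 qed (use D in simp)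
qed (auto simp: TV_act TV_coact list_all2_homogD)

lemma homog_word: "list_all2 (homog V) gs vs ==> homog (TV G V) (gprod gs) (word V vs)"
 using list_all2_homogD[of gs vs] by (simp add: homog_def TV_coact(2))

text \<open>\<open>coact (TV G V) h\<close> fixes elements of degree h and annihilates homogeneous
  words of any other degree, so applying it to a decomposition into words leaves only those of
  degree h.\<close>

lemma homog_TV_induct [consumes 1, case_names zero word add]:
 assumes t: "homog (TV G V) h t" and zero: "P 0@(TV G V)"
  and word: "!!a gs vs. list_all2 (homog V) gs vs ==> gprod gs = h ==> P (a .*(TV G V) word V vs)"
  and add: "!!s t. [|s .: (TV G V); t .: (TV G V); P s; P t|] ==> P (s +.(TV G V) t)"
 shows "P t"
proof -
 note h = homogD[OF t]
 have "P (coact (TV G V) h s)" if "s .: (TV G V)" for s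
  using that
 proof (induction rule: TV_homog_word_induct)
  case (word a gs vs)
  then show ?case using assms(2,3) h(1) list_all2_homogD[OF word]
   by (simp add: klD[OF TV_coact(1)] TV_coact(2)[OF h(1) word])
 next
  case (add s t)
  then show ?case using assms(4) h(1) klD(1)[OF TV_coact(1)[OF h(1)]]
   by (simp add: klD(2)[OF TV_coact(1)])
 qed
 from this[OF h(2)] show ?thesis using t by (simp add: homog_def)
qed

lemma braided_algebra_TV [simp]: "braided_algebra G (TV G V)"
proof (rule braided_algebraI[OF crossed_module_TV ring_TV])
 let ?T = "TV G V"
 note l = klD[OF TV_mult_l] and r = klD[OF TV_mult_r]
 show "!!a x y. x .: ?T ==> y .: ?T ==> (a .*?T x) *.?T y = a .*?T (x *.?T y)"
  "!!a x y. x .: ?T ==> y .: ?T ==> x *.?T (a .*?T y) = a .*?T (x *.?T y)"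
  by (simp_all add: l r)
 show "act ?T g 1@?T = 1@?T" if "g .: G" for g using that by (simp add: TV_fields(1) TV_act(2))
 show "homog ?T \<one> 1@?T" using homog_word[of "[]" "[]"] by (simp add: TV_fields(1))
 fix g h k x y assume x: "homog ?T g x" and y: "homog ?T h y"
 note xc = homogD[OF x] and yc = homogD[OF y]
 show "act ?T k (x *.?T y) = act ?T k x *.?T act ?T k y" if k: "k .: G"
 proof -
  note a = TV_act(1)[OF k]
  note [simp] = klD(1)[OF a]
  have w2: "act ?T k (word V us *.?T word V vs) = act ?T k (word V us) *.?T act ?T k (word V vs)"
   if "us .:: V" "vs .:: V" for us vs
  proof -
   have "us @ vs .:: V" "map (act V k) us .:: V" "map (act V k) vs .:: V"
    using that k V by (auto simp: lists_eq_set)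
   then show ?thesis using that k by (simp add: TV_act(2) TV_mult(2))
  qed
  have w1: "act ?T k (word V us *.?T y) = act ?T k (word V us) *.?T act ?T k y" if "us .:: V" for us
   by (rule TV_eq[OF kl_comp[OF TV_mult_r a] kl_comp[OF a TV_mult_r] w2 yc(2)]) (use that in simp_all)
  show ?thesis
   by (rule TV_eq[OF kl_comp[OF TV_mult_l a] kl_comp[OF a TV_mult_l] w1 xc(2)]) (use yc in simp_all)
 qed
 note hz = homog_intros[OF crossed_module_TV]
 have 1: "homog ?T (g \<otimes> h) (word V us *.?T y)" if us: "list_all2 (homog V) gs us" "gprod gs = g" for gs us
  using y
 proof (induction rule: homog_TV_induct)
  case zero then show ?case using xc yc list_all2_homogD[OF us(1)] hz(5) by (simp add: klD(4)[OF TV_mult_r])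
 next
  case (word a hs vs)
  note D = list_all2_homogD[OF us(1)] list_all2_homogD[OF word(1)]
  have "homog ?T (gprod (gs @ hs)) (word V (us @ vs))" by (rule homog_word) (use us word in \<open>simp add: list_all2_appendI\<close>)
  then have "homog ?T (g \<otimes> h) (a .*?T word V (us @ vs))" using us word D by (intro hz(4)) (simp add: gprod_append)
  then show ?case using D by (simp add: r TV_mult(2))
 next
  case (add s t)
  then show ?case using list_all2_homogD[OF us(1)] hz(3) by (simp add: r)
 qed
 show "homog ?T (g \<otimes> h) (x *.?T y)"
  using x
 proof (induction rule: homog_TV_induct)
  case zero then show ?case using xc yc hz(5) by (simp add: klD(4)[OF TV_mult_l])
 next
  case (word a gs us)
  then show ?case using hz(4)[OF 1[OF word]] list_all2_homogD[OF word(1)] yc by (simp add: l)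
 next
  case (add s t)
  then show ?case using yc hz(3) by (simp add: l)
 qed
qed

lemma letter:
 shows "klinear V (TV G V) (%v. word V [v])" "v .: V ==> word V [v] .: (TV G V)"
  "homog V g v ==> homog (TV G V) g (word V [v])"
  "g .: G ==> v .: V ==> act (TV G V) g (word V [v]) = word V [act V g v]"
  "v .: V ==> vs .:: V ==> word V [v] *.(TV G V) word V vs = word V (v # vs)"
 using word_linear[of "[]" "[]"] homog_word[of "[g]" "[v]"] homogD(1)[of V g v] TV_mult(2)[of "[v]" vs] by (simp_all add: TV_act(2))

lemma letter_crossed: "crossed_hom G V (TV G V) (%v. word V [v])"
 by (rule crossed_homI[OF V crossed_module_TV letter(1)]) (auto simp: letter homogD(2))

text \<open>Both the new letter and the tensor behind it may be taken homogeneous, so that the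
  closed forms of the braiding and of braided products are available in the step.\<close>

lemma TV_letter_induct [consumes 1, case_names one letter add scale]:
 assumes t: "t .: (TV G V)" and one: "P 1@(TV G V)"
  and step: "!!g h v t. [|homog V g v; homog (TV G V) h t; P t|] ==> P (word V [v] *.(TV G V) t)"
  and add: "!!s t. [|s .: (TV G V); t .: (TV G V); P s; P t|] ==> P (s +.(TV G V) t)"
  and scale: "!!a t. [|t .: (TV G V); P t|] ==> P (a .*(TV G V) t)"
 shows "P t"
 using t
proof (induction rule: TV_homog_word_induct)
 case (word a gs vs)
 have "P (word V vs)" using word
 proof (induction)
  case Nil then show ?case using one by (simp add: TV_fields(1))
 next
  case (Cons g gs v vs)
  from step[OF Cons(1) homog_word[OF Cons(2)] Cons(3)] show ?case
   using homogD[OF Cons(1)] list_all2_homogD[OF Cons(2)] by (simp add: letter(5))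
 qed
 then show ?case using list_all2_homogD[OF word] by (intro scale) simp_all
qed (rule add)

lemma TV_recI:
 assumes f: "klinear (TV G V) M f" and f': "klinear (TV G V) M f'" and "f 1@(TV G V) = f' 1@(TV G V)"
  and "!!g h v t. [|homog V g v; homog (TV G V) h t; f t = f' t|] ==> f (word V [v] *.(TV G V) t) = f' (word V [v] *.(TV G V) t)"
  and "t .: (TV G V)"
 shows "f t = f' t"
 using assms(5)
 by (induction rule: TV_letter_induct) (simp_all add: assms(3,4) klD[OF f] klD[OF f'])

lemma TV_rec:
 assumes M: "kspace M" and op: "kbilinear V M M op" and e: "e .: M"
 defines "F \<equiv> lin_ext M (%vs. foldr op vs e)"
 shows "klinear (TV G V) M F" "F 1@(TV G V) = e" (is ?g1)
  "[|v .: V; t .: (TV G V)|] ==> F (word V [v] *.(TV G V) t) = op v (F t)"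
  "vs .:: V ==> F (word V vs) = foldr op vs e" (is "PROP ?g2")
proof -
 note L = TV_lin_ext[OF M kmultilinear_foldr[OF kspace_V op e], folded F_def]
 show "klinear (TV G V) M F" ?g1 "PROP ?g2"
  using L by (simp_all add: TV_fields(1))
 show "F (word V [v] *.(TV G V) t) = op v (F t)" if "v .: V" "t .: (TV G V)"
  by (rule TV_eq[OF kl_comp[OF TV_mult_r L(1)] kl_comp[OF L(1) kbilD(1)[OF op]] _ that(2)])
   (use that in \<open>simp_all add: letter L(2)\<close>)
qed

lemma TV_rec_crossed:
 assumes M: "crossed_module G M" and op: "kbilinear V M M op" and F: "klinear (TV G V) M F"
  and one: "homog M \<one> (F 1@(TV G V))" "!!g. g .: G ==> act M g (F 1@(TV G V)) = F 1@(TV G V)"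
  and step: "!!v t. [|v .: V; t .: (TV G V)|] ==> F (word V [v] *.(TV G V) t) = op v (F t)"
  and op1: "!!g h v y. [|homog V g v; homog M h y|] ==> homog M (g \<otimes> h) (op v y)"
  and op2: "!!g h k v y. [|homog V g v; homog M h y; k .: G|] ==> act M k (op v y) = op (act V k v) (act M k y)"
 shows "crossed_hom G (TV G V) M F"
proof -
 let ?T = "TV G V"
 have w: "homog M (gprod gs) (F (word V vs)) \<and> (\<forall>k\<in>carrier G. F (act ?T k (word V vs)) = act M k (F (word V vs)))"
  if "list_all2 (homog V) gs vs" for gs vs
  using that
 proof (induction)
  case Nil
  then show ?case using one by (simp add: TV_fields(1) TV_act(2))
 next
  case (Cons g gs v vs)
  note D = homogD[OF Cons(1)] list_all2_homogD[OF Cons(2)]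
  have eq: "F (word V (v # vs)) = op v (F (word V vs))" using step[of v "word V vs"] D by (simp add: letter)
  have "F (act ?T k (word V (v # vs))) = act M k (F (word V (v # vs)))" if k: "k .: G" for k
  proof -
   have m: "map (act V k) vs .:: V" using D k V by (auto simp: lists_eq_set)
   have "F (act ?T k (word V (v # vs))) = F (word V [act V k v] *.?T act ?T k (word V vs))"
    using D k V m by (simp add: TV_act(2) letter)
   also have "\<dots> = op (act V k v) (act M k (F (word V vs)))"
    using D k V Cons(3) m by (simp add: step TV_act(2))
   finally show ?thesis using op2[OF Cons(1) conjunct1[OF Cons(3)] k] by (simp add: eq)
  qed
  then show ?case using op1[OF Cons(1)] Cons(3) by (simp add: eq)
 qed
 show ?thesis
 proof (rule crossed_homI_gen[OF crossed_module_TV M F, where X = "{a .*?T word V vs |a gs vs. list_all2 (homog V) gs vs}"])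
  fix P t assume t: "t .: ?T" and P: "!!x. x : {a .*?T word V vs |a gs vs. list_all2 (homog V) gs vs} ==> P x"
   "!!v w. [|v .: ?T; w .: ?T; P v; P w|] ==> P (v +.?T w)"
  show "P t" using t by (rule TV_homog_word_induct) (rule P(1), blast, rule P(2))
 next
  fix x assume "x : {a .*?T word V vs |a gs vs. list_all2 (homog V) gs vs}"
  then obtain a gs vs where x: "x = a .*?T word V vs" and vs: "list_all2 (homog V) gs vs" by blast
  note D = list_all2_homogD[OF vs]
  show "\<exists>g. homog ?T g x \<and> homog M g (F x)"
   using homog_intros(4)[OF crossed_module_TV homog_word[OF vs]] homog_intros(4)[OF M conjunct1[OF w[OF vs]]] D
   by (intro exI[of _ "gprod gs"]) (simp add: x klD[OF F])
  show "F (act ?T g x) = act M g (F x)" if "g .: G" for g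
   using that w[OF vs] D klD(1)[OF TV_act(1)[OF that]]
   by (simp add: x klD[OF F] klD(3)[OF TV_act(1)] klD(3)[OF crossedD(2)[OF M]])
 qed
qed

text \<open>The universal property of the tensor algebra: recursion with left multiplication by
  \<open>\<phi> v\<close>. Multiplicativity is an induction on the letters of the first
  factor.\<close>

lemma TV_hom:
 fixes R :: "('k, 'g, 'r, 'n) cmod"
 assumes R: "braided_algebra G R" and \<phi>: "crossed_hom G V R \<phi>"
 defines "F \<equiv> lin_ext R (%vs. foldr (%v y. \<phi> v *.R y) vs 1@R)"
 shows "algebra_hom G (TV G V) R F" "v .: V ==> F (word V [v]) = \<phi> v" (is "PROP ?g1")
proof -
 let ?T = "TV G V"
 note [simp] = R
 note p = chomD[OF \<phi>]
 have b: "kbilinear V R R (%v y. \<phi> v *.R y)"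
  by (intro kbilI kl_comp[OF p(1) ba_mult_linear(2)[OF R]] ba_mult_linear(1)[OF R]) (simp_all add: klD(1)[OF p(1)])
 note F = TV_rec[OF ba_simps(1)[OF R] b ba_simps(3)[OF R], folded F_def]
 have c: "crossed_hom G ?T R F"
 proof (rule TV_rec_crossed[OF ba_simps(2)[OF R] b F(1) _ _ F(3)])
  fix g h k v y assume *: "homog V g v" "homog R h y" "k .: G"
  show "act R k (\<phi> v *.R y) = \<phi> (act V k v) *.R act R k y"
   using * homogD[OF *(1)] homogD[OF *(2)] klD(1)[OF p(1)] by (simp add: ba_crossed(1)[OF R] p(2))
 qed (simp_all add: F(2) ba_crossed[OF R] p(4))
 have "F (x *.?T y) = F x *.R F y" if x: "x .: ?T" and y: "y .: ?T" for x y
 proof (rule TV_recI[OF kl_comp[OF TV_mult_l[OF y] F(1)] kl_comp[OF F(1) ba_mult_linear(2)[OF R]] _ _ x])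
  show "F y .: R" using y klD(1)[OF F(1)] by simp
  show "F (1@?T *.?T y) = F 1@?T *.R F y" using y klD(1)[OF F(1)] by (simp add: F(2))
  fix g h v t assume *: "homog V g v" "homog ?T h t" "F (t *.?T y) = F t *.R F y"
  note [simp] = klD(1)[OF F(1)] klD(1)[OF p(1)] homogD(2)[OF *(1)] homogD(2)[OF *(2)]
  show "F ((word V [v] *.?T t) *.?T y) = F (word V [v] *.?T t) *.R F y"
   using y *(3) by (simp add: ba_ring(1)[OF braided_algebra_TV] ba_ring(1)[OF R] letter F(3))
 qed
 with c show "algebra_hom G ?T R F" by (simp add: algebra_hom_def F(2))
 show "PROP ?g1" using F(4)[of "[v]"] klD(1)[OF p(1)] by simp
qed

end

text \<open>Extends \<open>same_space\<close> by the G-structure; \<open>same_algebra\<close> adds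
  product and unit, and \<open>same_bialgebra\<close> the coalgebra maps. The notions defined for
  records depend on these fields alone, hence are invariant.\<close>

definition same_crossed :: "('k::field, 'g, 'a, 'm) cmod => ('k, 'g, 'a, 'n) cmod => bool" where
 "same_crossed A B \<longleftrightarrow> same_space A B \<and> act A = act B \<and> coact A = coact B"

definition same_algebra :: "('k::field, 'g, 'a, 'm) cmod => ('k, 'g, 'a, 'n) cmod => bool" where
 "same_algebra A B \<longleftrightarrow> same_crossed A B \<and> monoid.mult A = monoid.mult B \<and> one A = one B"

lemma same_crossed_space: "same_crossed A B ==> same_space A B"
 by (simp add: same_crossed_def)

lemma same_crossed_fields:
 assumes "same_crossed A B"
 shows "carrier A = carrier B" "add A = add B" "zero A = zero B" "module.smult A = module.smult B" "act A = act B" "coact A = coact B"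
 using assms by (simp_all add: same_crossed_def same_space_def)

lemma same_crossed_module: "same_crossed A B ==> crossed_module G A = crossed_module G B"
 unfolding crossed_module_def
 by (simp only: same_crossed_fields same_space_simps[OF same_crossed_space])

lemma same_crossed_hom:
 "same_crossed A B ==> crossed_hom G A X f = crossed_hom G B X f"
 "same_crossed A B ==> crossed_hom G X' A f' = crossed_hom G X' B f'"
 unfolding crossed_hom_def by (simp_all only: same_crossed_fields same_space_simps[OF same_crossed_space])

lemma same_crossed_homog: "same_crossed A B ==> homog A = homog B"
 by (intro ext) (simp add: homog_def same_crossed_fields)

lemma same_crossed_tensor: "same_crossed A B ==> tensor G A X = tensor G B X" "same_crossed A B ==> tensor G X A = tensor G X B"
 unfolding tensor_def by (simp_all only: same_crossed_fields same_space_simps[OF same_crossed_space])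

lemma same_crossed_mid: "same_crossed A B ==> mid_braiding G A A A A = mid_braiding G B B B B"
 unfolding mid_braiding_def braiding_def by (simp only: same_crossed_fields same_space_simps[OF same_crossed_space])

lemma same_crossed_tassoc: "same_crossed A B ==> tassoc A A A = tassoc B B B"
 unfolding tassoc_def by (simp only: same_space_simps[OF same_crossed_space])

lemmas same_crossed_s = same_crossed_fields same_space_simps[OF same_crossed_space] same_crossed_module same_crossed_hom
 same_crossed_homog same_crossed_tensor same_crossed_mid same_crossed_tassoc

lemma same_algebra_crossed: "same_algebra A B ==> same_crossed A B"
 by (simp add: same_algebra_def)

lemma same_algebra_fields: "same_algebra A B ==> monoid.mult A = monoid.mult B" "same_algebra A B ==> one A = one B"
 by (simp_all add: same_algebra_def)

lemma same_algebra_mult_map: "same_algebra A B ==> mult_map A = mult_map B"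
 unfolding mult_map_def by (simp only: same_algebra_fields same_crossed_s[OF same_algebra_crossed])

lemma same_algebra_tensor_algebra: "same_algebra A B ==> tensor_algebra G A A = tensor_algebra G B B"
 unfolding tensor_algebra_def
 by (simp only: same_algebra_fields same_algebra_mult_map same_crossed_s[OF same_algebra_crossed])

lemma same_algebra_ring: "same_algebra A B ==> ring A = ring B"
 unfolding ring_def abelian_group_def abelian_monoid_def abelian_group_axioms_def comm_group_def comm_monoid_def
  comm_monoid_axioms_def group_def group_axioms_def monoid_def Units_def ring_axioms_def
 by (simp add: same_algebra_fields same_crossed_fields[OF same_algebra_crossed])

lemma same_algebra_braided: "same_algebra A B ==> braided_algebra G A = braided_algebra G B"
 unfolding braided_algebra_def
 by (simp only: same_algebra_fields same_algebra_mult_map same_crossed_s[OF same_algebra_crossed] same_algebra_ring)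

lemma same_algebra_hom:
 "same_algebra A B ==> algebra_hom G A X f = algebra_hom G B X f"
 "same_algebra A B ==> algebra_hom G X' A f' = algebra_hom G X' B f'"
 unfolding algebra_hom_def by (simp_all only: same_algebra_fields same_crossed_s[OF same_algebra_crossed])

lemmas same_algebra_simps = same_algebra_fields same_algebra_mult_map same_crossed_s[OF same_algebra_crossed]
 same_algebra_tensor_algebra same_algebra_ring same_algebra_braided same_algebra_hom

section \<open>Left multiplication by v\<otimes>1 + 1\<otimes>v\<close>

definition prim_elt :: "('k::field, 'a, 'm) vect => 'a => ('k, 'a, 'a) tens" where
 "prim_elt A v = pure A A v 1@A +.(A ** A) pure A A 1@A v"

lemma prim_linear:
 assumes A: "braided_algebra G A"
 shows "klinear A (A ** A) (prim_elt A)"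
 unfolding prim_elt_def[abs_def] using A by (intro kl_add kl_pure) simp_all

lemmas prim_mult' = prim_mult[folded prim_elt_def]

text \<open>Provides the equivariance that \<open>TV_rec_crossed\<close> asks of the recursion step
  for the coproduct of A(V).\<close>

lemma prim_mult_crossed:
 assumes A: "braided_algebra G A" and v: "homog A g v"
 shows "homog (tensor G A A) h y ==> homog (tensor G A A) (g \<otimes> h) (prim_elt A v *.(tensor_algebra G A A) y)"
  and "k .: G ==> y .: (A ** A) ==> act (tensor G A A) k (prim_elt A v *.(tensor_algebra G A A) y) =
   prim_elt A (act A k v) *.(tensor_algebra G A A) act (tensor G A A) k y"
proof -
 note C = ba_simps(2)[OF A]
 note [simp] = A homogD[OF v]
 note T = crossed_module_tensor[OF C C]
 let ?p = "prim_elt A v" and ?m = "%s t. s *.(tensor_algebra G A A) t"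
 note p [simp] = klD(1)[OF prim_linear[OF A]]
 note ml = kbilD(1)[OF ta_mult(1)[OF A]]
 note pl = ml[OF p[OF homogD(2)[OF v]]]
 have 1: "homog (tensor G A A) (g \<otimes> h) (?m ?p (coact (tensor G A A) h y))" if h: "h .: G" and y: "y .: (A ** A)" for y h
  using C C y
 proof (induction rule: tensor_homog_induct)
  case (pure a b x y)
  note D [simp] = homogD[OF pure(1)] homogD[OF pure(2)]
  have eq: "?m ?p (pure A A x y) = pure A A (v *.A x) y +.(A ** A) pure A A (act A g x) (v *.A y)"
   using prim_mult'(1)[OF A v] by simp
  have "homog (tensor G A A) (g \<otimes> a \<otimes> b) (pure A A (v *.A x) y)"
   by (rule homog_pure[OF C C ba_crossed(2)[OF A v pure(1)] pure(2)])
  moreover have "homog (tensor G A A) (a \<otimes> (g \<otimes> b)) (pure A A (act A g x) (v *.A y))"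
   by (rule homog_pure[OF C C homog_intros(2)[OF C pure(1)] ba_crossed(2)[OF A v pure(2)]]) simp
  \<comment> \<open>The two summands have degrees g a b and a g b, equal because G is
    commutative.\<close>
  moreover have "a \<otimes> (g \<otimes> b) = g \<otimes> a \<otimes> b" using m_comm[of a g] by (simp add: m_assoc[symmetric])
  ultimately have "homog (tensor G A A) (g \<otimes> a \<otimes> b) (?m ?p (pure A A x y))"
   unfolding eq using homog_intros(3)[OF T] by simp
  then show ?case using homog_intros(5)[OF T] h
   by (simp add: tensor_coact(2)[OF C C h pure] m_assoc klD(4)[OF pl])
 next
  case (add s t)
  note [simp] = klD(1)[OF tensor_coact(1)[OF C C h]]
  show ?case using add homog_intros(3)[OF T add(3,4)]
   by (simp add: klD(2)[OF tensor_coact(1)[OF C C h]] klD(2)[OF pl])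
 qed
 show "homog (tensor G A A) (g \<otimes> h) (?m ?p y)" if "homog (tensor G A A) h y" for h y
  using 1[of h y] homogD[OF that] that by (simp add: homog_def)
 assume k: "k .: G" and y: "y .: (A ** A)"
 have v': "homog A g (act A k v)" by (rule homog_intros(2)[OF C v k])
 show "act (tensor G A A) k (?m ?p y) = ?m (prim_elt A (act A k v)) (act (tensor G A A) k y)"
 proof (rule tensor_eq[OF _ _ kl_comp[OF pl tensor_act(1)[OF C C k]] kl_comp[OF tensor_act(1)[OF C C k] ml] _ y])
  fix a b assume ab: "a .: A" "b .: A"
  have "act A k (act A g a) = act A g (act A k a)"
   using ab k crossedD(5)[OF C, of k g a] crossedD(5)[OF C, of g k a] m_comm[of k g] by simp
  then show "act (tensor G A A) k (?m ?p (pure A A a b)) = ?m (prim_elt A (act A k v)) (act (tensor G A A) k (pure A A a b))"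
   using ab k by (simp add: prim_mult'(1)[OF A v] prim_mult'(1)[OF A v'] tensor_act[OF C C]
     klD(2)[OF tensor_act(1)[OF C C]] ba_crossed(1)[OF A])
 qed (use k in simp_all)
qed

text \<open>The projection of T(V) onto the sum of the degrees n with \<open>P n\<close>.\<close>

definition TV_filter :: "('k::field, 'g, 'v, 'm) cmod => (nat => bool) => ('k, 'v) tens_pow => ('k, 'v) tens_pow" where
 "TV_filter V P = lin_ext (TV G V) (%vs. if P (length vs) then word V vs else 0@(TV G V))"

text \<open>The increasing filtration belonging to the grading \<open>tens_degree\<close>, in the
  form that \<open>antipode_exists\<close> takes.\<close>

definition TV_filtration :: "('k::field, 'g, 'v, 'm) cmod => nat => ('k, 'v) tens_pow set" where
 "TV_filtration V n = lspan (TV G V) {word V vs |vs. vs .:: V \<and> length vs \<le> n}"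

context
 fixes V :: "('k::field, 'g, 'v, 'm) cmod"
 assumes V: "crossed_module G V"
begin

subsection \<open>The grading by length\<close>

lemmas kV = kspace_V[OF V] and kT = kspace_TV[OF V] and cT = crossed_module_TV[OF V] and aT = braided_algebra_TV[OF V]

lemma words_closed: "{word V vs |vs. vs .:: V \<and> P vs} \<subseteq> carrier (TV G V)"
 using word_closed[OF V] by blast

lemma tens_degree_TV: "tens_degree V n = lspan (TV G V) {word V vs |vs. vs .:: V \<and> length vs = n}"
proof -
 have "submodule H scalars (word_mod V) = submodule H scalars (TV G V)" for H
  by (rule same_space_submodule[OF same_space_TV kspace_word_mod[OF kV]])
 then show ?thesis by (simp add: tens_degree_def lspan_def)
qed

lemma degree_submodule: "submodule (tens_degree V n) scalars (TV G V)"
 unfolding tens_degree_TV by (rule submodule_lspan[OF kT words_closed])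

lemma degree_closed:
 "tens_degree V n \<subseteq> carrier (TV G V)" "0@(TV G V) : tens_degree V n"
 "x : tens_degree V n ==> y : tens_degree V n ==> x +.(TV G V) y : tens_degree V n"
 "x : tens_degree V n ==> a .*(TV G V) x : tens_degree V n"
 using degree_submodule[of n] by (simp_all add: submodule_iff[OF kT])

lemma word_degree: "vs .:: V ==> length vs = n ==> word V vs : tens_degree V n"
 unfolding tens_degree_TV by (rule lspan_base) blast

lemma klinear_degree_eq:
 assumes "klinear (TV G V) M f" "klinear (TV G V) M f'" "kspace M"
  "!!vs. vs .:: V ==> length vs = n ==> f (word V vs) = f' (word V vs)" "t : tens_degree V n"
 shows "f t = f' t"
 by (rule klinear_lspan_eq[OF assms(1,2) kT words_closed[of "%vs. length vs = n"] assms(5)[unfolded tens_degree_TV] _ assms(3)])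
  (use assms(4) in blast)

lemma klinear_degree_mem:
 assumes f: "klinear (TV G V) M f" and H: "submodule H scalars M" and M: "kspace M"
  and "!!vs. vs .:: V ==> length vs = n ==> f (word V vs) : H" "t : tens_degree V n"
 shows "f t : H"
 using assms(5) unfolding tens_degree_TV
 by (induction rule: lspan_induct[OF kT words_closed[of "%vs. length vs = n"], consumes 1])
  (use H[unfolded submodule_iff[OF M]] assms(4) M in \<open>auto simp: klD[OF f] klD(4)[OF f kT]\<close>)

lemma TV_filter:
 shows "klinear (TV G V) (TV G V) (TV_filter V P)" (is ?g1)
  "vs .:: V ==> TV_filter V P (word V vs) = (if P (length vs) then word V vs else 0@(TV G V))" (is "PROP ?g2")
proof -
 have "kmultilinear V (TV G V) (%vs. if P (length vs) then word V vs else 0@(TV G V))"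
  unfolding kmultilinear_def
 proof (intro conjI ballI)
  fix xs ys assume "xs .:: V" "ys .:: V"
  then show "klinear V (TV G V) (%v. if P (length (xs @ [v] @ ys)) then word V (xs @ [v] @ ys) else 0@(TV G V))"
   by (cases "P (Suc (length xs + length ys))") (simp_all add: word_linear[OF V, simplified] kl_zero kT)
 qed (simp add: kT V)
 from TV_lin_ext[OF V kT this] show ?g1
  "PROP ?g2"
  by (simp_all add: TV_filter_def)
qed

lemma TV_filter_crossed: "crossed_hom G (TV G V) (TV G V) (TV_filter V P)"
proof (rule crossed_homI_gen[OF cT cT TV_filter(1), where X = "{a .*(TV G V) word V vs |a gs vs. list_all2 (homog V) gs vs}"])
 let ?T = "TV G V"
 fix P t assume t: "t .: ?T" and P: "!!x. x : {a .*?T word V vs |a gs vs. list_all2 (homog V) gs vs} ==> P x"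
  "!!v w. [|v .: ?T; w .: ?T; P v; P w|] ==> P (v +.?T w)"
 show "P t" by (rule TV_homog_word_induct[OF V t]) (rule P(1), blast, rule P(2))
next
 let ?T = "TV G V"
 fix x assume "x : {a .*?T word V vs |a gs vs. list_all2 (homog V) gs vs}"
 then obtain a gs vs where x: "x = a .*?T word V vs" and vs: "list_all2 (homog V) gs vs" by blast
 note D = list_all2_homogD[OF V vs]
 note w = word_closed[OF V D(1)]
 have h: "homog ?T (gprod gs) x" unfolding x by (rule homog_intros(4)[OF cT homog_word[OF V vs]])
 have f: "TV_filter V P x = (if P (length vs) then x else 0@?T)"
  by (simp add: x klD(3)[OF TV_filter(1) w] TV_filter(2)[OF D(1)] kT)
 show "\<exists>g. homog ?T g x \<and> homog ?T g (TV_filter V P x)"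
  using h homog_intros(5)[OF cT homogD(1)[OF h]] by (auto simp: f)
 fix g assume g: "g .: G"
 have m: "map (act V g) vs .:: V" using D g V by (auto simp: lists_eq_set)
 have "act ?T g x = a .*?T word V (map (act V g) vs)"
  by (simp add: x klD(3)[OF TV_act(1)[OF V g] w] TV_act(2)[OF V g D(1)])
 then show "TV_filter V P (act ?T g x) = act ?T g (TV_filter V P x)"
  using m word_closed[OF V m] klD(4)[OF TV_act(1)[OF V g] kT kT]
  by (simp add: f klD(3)[OF TV_filter(1)] TV_filter(2) kT)
qed

lemma TV_filter_degree:
 assumes "t : tens_degree V n" shows "TV_filter V P t = (if P n then t else 0@(TV G V))"
proof -
 have "klinear (TV G V) (TV G V) (%t. if P n then t else 0@(TV G V))"
  by (cases "P n") (simp_all add: kl_id kl_zero kT)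
 from klinear_degree_eq[OF TV_filter(1) this kT _ assms] show ?thesis by (simp add: TV_filter(2))
qed

lemma TV_filter_in_degree: "t .: (TV G V) ==> TV_filter V (%m. m = n) t : tens_degree V n"
proof (induction rule: TV_word_induct[OF V, consumes 1])
 case (1 a vs)
 then show ?case using degree_closed(2)[of n] degree_closed(4)[of "word V vs" n a] word_degree[OF 1, of n]
  by (auto simp: klD(3)[OF TV_filter(1) word_closed[OF V 1]] TV_filter(2) kT)
next
 case (2 s t)
 then show ?case using degree_closed(3)[of _ n] by (simp add: klD(2)[OF TV_filter(1)])
qed

text \<open>The part of degree n consists of the fixed points of a projection that commutes with
  action and coaction.\<close>

lemma tens_degree_crossed: "crossed_submodule G (TV G V) (tens_degree V n)"
 unfolding crossed_submodule_def
proof (intro conjI ballI degree_submodule)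
 fix g t assume g: "g .: G" and t: "t : tens_degree V n"
 then have tT: "t .: (TV G V)" using degree_closed(1) by blast
 note c = chomD(2,3)[OF TV_filter_crossed[of "%m. m = n"] g tT]
 show "act (TV G V) g t : tens_degree V n"
  using TV_filter_in_degree[OF act_closed[OF cT g tT], of n] by (simp add: c TV_filter_degree[OF t])
 show "coact (TV G V) g t : tens_degree V n"
  using TV_filter_in_degree[OF coact_closed[OF cT g tT], of n] by (simp add: c TV_filter_degree[OF t])
qed

lemma degree_mult:
 assumes "s : tens_degree V m" "t : tens_degree V n"
 shows "s *.(TV G V) t : tens_degree V (m + n)"
proof (rule klinear_degree_mem[OF TV_mult_l[OF V] degree_submodule kT _ assms(1)])
 show tT: "t .: (TV G V)" using assms degree_closed(1) by blast
 fix us assume us: "us .:: V" "length us = m"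
 show "word V us *.(TV G V) t : tens_degree V (m + n)"
  by (rule klinear_degree_mem[OF TV_mult_r[OF V] degree_submodule kT _ assms(2)])
   (use us in \<open>simp_all add: TV_mult(2)[OF V] word_degree V\<close>)
qed

lemma TV_finite_support:
 assumes "t .: (TV G V)"
 shows "\<exists>N. (\<forall>n\<ge>N. TV_filter V (%m. m = n) t = 0@(TV G V)) \<and> TV_filter V (%m. m < N) t = t"
proof -
 \<comment> \<open>Stated for all predicates that avoid the degrees below N, so that for a sum the
   maximum of the two bounds works.\<close>
 have "\<exists>N. \<forall>P. (\<forall>n<N. \<not> P n) \<longrightarrow> TV_filter V P t = 0@(TV G V) \<and> TV_filter V (%n. \<not> P n) t = t"
  using assms
 proof (induction rule: TV_word_induct[OF V, consumes 1])
  case (1 a vs)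
  show ?case
   by (rule exI[of _ "Suc (length vs)"])
    (use 1 word_closed[OF V 1] in \<open>simp add: klD(3)[OF TV_filter(1) word_closed[OF V 1]] TV_filter(2) kT\<close>)
 next
  case (2 s t)
  then obtain N M where N: "\<forall>P. (\<forall>n<N. \<not> P n) \<longrightarrow> TV_filter V P s = 0@(TV G V) \<and> TV_filter V (%n. \<not> P n) s = s"
   "\<forall>P. (\<forall>n<M. \<not> P n) \<longrightarrow> TV_filter V P t = 0@(TV G V) \<and> TV_filter V (%n. \<not> P n) t = t" by blast
  show ?case
   by (rule exI[of _ "max N M"]) (use N 2 in \<open>simp add: klD(2)[OF TV_filter(1)] kT\<close>)
 qed
 then obtain N where N: "!!P. (\<forall>n<N. \<not> P n) ==> TV_filter V P t = 0@(TV G V) \<and> TV_filter V (%n. \<not> P n) t = t" by blast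
 show ?thesis
  by (rule exI[of _ N]) (use N[of "%m. m \<ge> N"] N[of "%m. m = n" for n] in \<open>auto simp: not_le\<close>)
qed

lemma TV_filter_sum:
 assumes "t .: (TV G V)"
 shows "TV_filter V (%m. m < N) t = (\<Oplus>\<^bsub>TV G V\<^esub>n\<in>{..<N}. TV_filter V (%m. m = n) t)"
proof (rule TV_eq[OF V TV_filter(1) klinear_finsum_fun[OF TV_filter(1) kT kT] _ assms])
 fix vs assume vs: "vs .:: V"
 note w = word_closed[OF V vs]
 show "TV_filter V (%m. m < N) (word V vs) = (\<Oplus>\<^bsub>TV G V\<^esub>n\<in>{..<N}. TV_filter V (%m. m = n) (word V vs))"
 proof (cases "length vs < N")
  case True
  have "(\<Oplus>\<^bsub>TV G V\<^esub>n\<in>{..<N}. TV_filter V (%m. m = n) (word V vs)) = word V vs"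
   by (rule ks_finsum_single[OF kT, where i = "length vs"]) (use True vs w in \<open>simp_all add: TV_filter(2)\<close>)
  then show ?thesis using True vs by (simp add: TV_filter(2))
 next
  case False
  have "(\<Oplus>\<^bsub>TV G V\<^esub>n\<in>{..<N}. TV_filter V (%m. m = n) (word V vs)) = 0@(TV G V)"
   by (rule ks_finsum_zero[OF kT]) (use False vs in \<open>auto simp: TV_filter(2)\<close>)
  then show ?thesis using False vs by (simp add: TV_filter(2))
 qed
qed simp

lemma TV_filtration:
 "submodule (TV_filtration V n) scalars (TV G V)" "TV_filtration V n \<subseteq> TV_filtration V (Suc n)"
 "x .: (TV G V) ==> \<exists>n. x : TV_filtration V n" "m \<le> n ==> tens_degree V m \<subseteq> TV_filtration V n"
proof -
 have sub: "submodule (TV_filtration V n) scalars (TV G V)" for n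
  unfolding TV_filtration_def by (rule submodule_lspan[OF kT words_closed])
 show "submodule (TV_filtration V n) scalars (TV G V)" by (rule sub)
 have mono: "m \<le> n ==> TV_filtration V m \<subseteq> TV_filtration V n" for m n unfolding TV_filtration_def by (intro lspan_mono) auto
 show "TV_filtration V n \<subseteq> TV_filtration V (Suc n)" by (rule mono) simp
 show "m \<le> n ==> tens_degree V m \<subseteq> TV_filtration V n" unfolding TV_filtration_def tens_degree_TV by (intro lspan_mono) auto
 note cl = sub[unfolded submodule_iff[OF kT]]
 show "\<exists>n. x : TV_filtration V n" if "x .: (TV G V)"
  using that
 proof (induction rule: TV_word_induct[OF V, consumes 1])
  case (1 a vs)
  have "word V vs : TV_filtration V (length vs)" unfolding TV_filtration_def using 1 by (intro lspan_base) blast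
  then show ?case using cl[of "length vs"] by blast
 next
  case (2 s t)
  then obtain n m where "s : TV_filtration V n" "t : TV_filtration V m" by blast
  then have "s : TV_filtration V (max n m)" "t : TV_filtration V (max n m)" using mono[of n "max n m"] mono[of m "max n m"] by auto
  then show ?case using cl[of "max n m"] by blast
 qed
qed

lemma TV_counit:
 shows "klinear (TV G V) (unit_object G) (TV_counit G V)" (is ?g1)
  "vs .:: V ==> TV_counit G V (word V vs) = (if vs = [] then 1 else 0)" (is "PROP ?g2")
proof -
 have "kmultilinear V (unit_object G) (%vs. if vs = [] then 1 else 0 :: 'k)"
  unfolding kmultilinear_def klinear_def by simp
 from TV_lin_ext[OF V kspace_unit this] show ?g1
  "PROP ?g2"
  by (simp_all add: TV_counit_def)
qed

lemma counit_facts: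
 shows "TV_counit G V 1@(TV G V) = 1"
  "[|v .: V; t .: (TV G V)|] ==> TV_counit G V (word V [v] *.(TV G V) t) = 0"
  "algebra_hom G (TV G V) (unit_object G) (TV_counit G V)"
  "t : tens_degree V n ==> n > 0 ==> TV_counit G V t = 0"
  "t : TV_filtration V 0 ==> t = TV_counit G V t .*(TV G V) 1@(TV G V)"
proof -
 let ?T = "TV G V" and ?e = "TV_counit G V"
 note e = TV_counit
 note ed = klD[OF e(1)]
 show one: "?e 1@?T = 1" by (simp add: TV_fields(1)[OF V] e(2))
 show lm: "?e (word V [v] *.?T t) = 0" if "v .: V" "t .: ?T" for v t
  using TV_eq[OF V kl_comp[OF TV_mult_r[OF V] e(1)] kl_zero[OF kspace_unit] _ that(2), of "word V [v]"] that
  by (simp add: letter[OF V] e(2))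
 have "kbilinear V (unit_object G) (unit_object G) (%v y. 0 :: 'k)"
  by (intro kbilI klI) auto
 have "crossed_hom G ?T (unit_object G) ?e"
 proof (rule TV_rec_crossed[OF V crossed_module_unit _ e(1), where op = "%v y. 0"])
  show "kbilinear V (unit_object G) (unit_object G) (%v y. 0 :: 'k)"
   by (intro kbilI klI) auto
  show "homog (unit_object G) \<one> (?e 1@?T)" by (simp add: homog_def one)
  show "homog (unit_object G) (g \<otimes> h) (0::'k)" if "homog V g v" "homog (unit_object G) h y" for g h v and y :: 'k
   using homogD(1)[OF that(1)] homogD(1)[OF that(2)] by (simp add: homog_def)
 qed (simp_all add: lm)
 moreover have "?e (x *.?T y) = ?e x * ?e y" if x: "x .: ?T" and y: "y .: ?T" for x y
 proof -
  have "klinear ?T (unit_object G) (%x. ?e x * ?e y)" by (rule klI) (simp_all add: ed algebra_simps)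
  from TV_recI[OF V kl_comp[OF TV_mult_l[OF V y] e(1)] this _ _ x] show ?thesis
   using y V kT by (simp add: one ba_simps[OF aT] homogD(2) ba_ring(1)[OF aT] letter[OF V])
    (metis (no_types, lifting) TV_mult_closed[OF V] ba_ring(1)[OF aT] homogD(2) letter(2)[OF V] lm mult_zero_left)
 qed
 ultimately show "algebra_hom G ?T (unit_object G) ?e" by (simp add: algebra_hom_def one)
 show "?e t = 0" if "t : tens_degree V n" "n > 0"
 proof -
  have "?e t = 0@(unit_object G)"
   by (rule klinear_degree_eq[OF e(1) kl_zero[OF kspace_unit] kspace_unit _ that(1)]) (use that(2) in \<open>auto simp: e(2)\<close>)
  then show ?thesis by simp
 qed
 have l: "klinear ?T ?T (%t. ?e t .*?T 1@?T)"
  by (rule klI) (simp_all add: ed kT V ks_distrib)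
 assume "t : TV_filtration V 0"
 then have t: "t : tens_degree V 0" by (simp add: TV_filtration_def tens_degree_TV)
 show "t = ?e t .*?T 1@?T"
  by (rule klinear_degree_eq[OF kl_id l kT _ t]) (simp add: e(2) TV_fields(1)[OF V] kT V)
qed

end

section \<open>Maps that agree on the carrier, units, and attaching an antipode\<close>

lemma crossed_hom_cong:
 assumes "crossed_hom G A B f" "crossed_module G A" "!!x. x .: A ==> f' x = f x"
 shows "crossed_hom G A B f'"
 unfolding crossed_hom_def
proof (intro conjI ballI)
 note f = chomD[OF assms(1)]
 show "klinear A B f'" by (rule kl_cong[OF f(1) _ assms(3)]) (use assms(2) in simp_all)
 fix g v assume gv: "g .: G" "v .: A"
 show "f' (act A g v) = act B g (f' v)" "f' (coact A g v) = coact B g (f' v)"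
  using gv assms(2) by (simp_all add: assms(3) f)
qed

lemma algebra_hom_cong:
 assumes "algebra_hom G A B f" "braided_algebra G A" "!!x. x .: A ==> f' x = f x"
 shows "algebra_hom G A B f'"
 using assms(1) crossed_hom_cong[of A B f f'] assms(2,3) by (simp add: algebra_hom_def)

lemma tmap_cong:
 assumes U: "kspace U" and W: "kspace W" and U': "kspace U'" and W': "kspace W'"
  and f: "klinear U U' f" "klinear W W' g" and eq: "!!x. x .: U ==> f' x = f x" "!!x. x .: W ==> g' x = g x"
  and t: "t .: (U ** W)"
 shows "tmap U' W' f' g' t = tmap U' W' f g t"
proof -
 note f' = kl_cong[OF f(1) U eq(1)] and g' = kl_cong[OF f(2) W eq(2)]
 show ?thesis
  by (rule tensor_eq[OF U W kl_tmap[OF U W U' W' f' g'] kl_tmap[OF U W U' W' f] _ t])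
   (simp_all add: tmap_pure[OF U W U' W' f' g'] tmap_pure[OF U W U' W' f] eq)
qed

lemma coalgebra_hom_cong:
 assumes f: "coalgebra_hom G C D f" and C: "braided_coalgebra G C" and D: "crossed_module G D" and eq: "!!x. x .: C ==> f' x = f x"
 shows "coalgebra_hom G C D f'"
 unfolding coalgebra_hom_def
proof (intro conjI ballI)
 note cC = coalgD(1)[OF C]
 note kC = cm_kspace[OF cC] and kD = cm_kspace[OF D]
 show "crossed_hom G C D f'" by (rule crossed_hom_cong[OF cohomD(1)[OF f] cC eq])
 fix x assume x: "x .: C"
 note fl = chomD(1)[OF cohomD(1)[OF f]]
 show "comult D (f' x) = tmap D D f' f' (comult C x)"
  using cohomD(2)[OF f x] tmap_cong[OF kC kC kD kD fl fl eq eq coalgD(8)[OF C x]] by (simp add: eq[OF x])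
 show "counit D (f' x) = counit C x" using cohomD(3)[OF f x] by (simp add: eq[OF x])
qed

lemma tensor_algebra_units:
 assumes A: "braided_algebra G A" and t: "t .: (A ** A)"
 shows "pure A A 1@A 1@A *.(tensor_algebra G A A) t = t" (is ?g1) "t *.(tensor_algebra G A A) pure A A 1@A 1@A = t" (is ?g2)
proof -
 note C = ba_simps(2)[OF A] and k = ba_simps(1)[OF A]
 note m = ta_mult[OF A] and ml = kbilD(1)[OF ta_mult(1)[OF A]] and mr = kbilD(2)[OF ta_mult(1)[OF A]]
 have p: "pure A A 1@A 1@A .: (A ** A)" using A by simp
 show ?g1
  by (rule tensor_eq[OF k k ml[OF p] kl_id _ t])
   (use A ba_crossed(4)[OF A] in \<open>simp add: m(2)[where g = \<one>] crossedD(4)\<close>)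
 show ?g2
 proof (rule tensor_homog_eq[OF C C mr[OF p] kl_id _ t])
  fix g h u w assume *: "homog A g u" "homog A h w"
  then show "pure A A u w *.(tensor_algebra G A A) pure A A 1@A 1@A = pure A A u w"
   using homogD[OF *(1)] homogD[OF *(2)] A by (simp add: m(2)[where g = h] ba_crossed(3))
 qed
qed

text \<open>The left counit axiom applied to x\<otimes>1 + 1\<otimes>x reads x = counit(x) 1 +
  x.\<close>

lemma counit_primitive:
 assumes R: "braided_bialgebra G R" and x: "x .: R" and p: "comult R x = prim_elt R x"
 shows "counit R x = 0"
proof -
 note A = bialgD(1)[OF R] and C = bialgD(2)[OF R]
 note [simp] = A
 have k: "kspace R" by simp
 have e1: "counit R 1@R = 1" using ahomD(2)[OF bialgD(4)[OF R]] by simp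
 have "x = lin_ext R (%(y, z). counit R y .*R z) (prim_elt R x)" using coalgD(5)[OF C x] p by simp
 also have "\<dots> = counit R x .*R 1@R +.R x"
  using x by (simp add: prim_elt_def klD(2)[OF counit_lin_ext(1)[OF C]] counit_lin_ext(2)[OF C] e1)
 finally have "counit R x .*R 1@R +.R x = 0@R +.R x" using x by simp
 then have "counit R x .*R 1@R = 0@R" using x ks_cancel(2)[OF k x, of "counit R x .*R 1@R" "0@R"] by simp
 then have "counit R (counit R x .*R 1@R) = 0" using counit_props(3)[OF C] by simp
 then show ?thesis by (simp add: counit_props(2)[OF C] e1)
qed

definition same_bialgebra :: "('k::field, 'g, 'a, 'm) bcoalg => ('k, 'g, 'a, 'n) bcoalg => bool" where
 "same_bialgebra A B \<longleftrightarrow> same_algebra A B \<and> comult A = comult B \<and> counit A = counit B"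

lemma same_coalgebra:
 assumes "same_crossed A B" "comult A = comult B" "counit A = counit B"
 shows "braided_coalgebra G A = braided_coalgebra G B"
 unfolding braided_coalgebra_def by (simp only: same_crossed_s[OF assms(1)] assms(2,3))

lemma same_bialgebra:
 assumes "same_bialgebra A B"
 shows "braided_bialgebra G A = braided_bialgebra G B" (is ?g1) "is_antipode G A = is_antipode G B" (is ?g2)
  "coalgebra_hom G A X f = coalgebra_hom G B X f" (is ?g3) "coalgebra_hom G X' A f' = coalgebra_hom G X' B f'" (is ?g4)
proof -
 have s: "same_algebra A B" "comult A = comult B" "counit A = counit B" using assms by (simp_all add: same_bialgebra_def)
 show ?g1
  unfolding braided_bialgebra_def same_coalgebra[OF same_algebra_crossed[OF s(1)] s(2,3)]
  by (simp only: same_algebra_simps[OF s(1)] s(2,3))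
 show ?g2
  by (rule ext, unfold is_antipode_def, simp only: same_algebra_simps[OF s(1)] s(2,3))
 show ?g3 ?g4
  unfolding coalgebra_hom_def by (simp_all only: same_algebra_simps[OF s(1)] s(2,3))
qed

text \<open>The definite description ranges over maps that are \<open>undefined\<close> off the
  carrier. The restriction of s is such a map, and antipodes agree on the carrier.\<close>

lemma add_antipode:
 fixes A :: "('k::field, 'g, 'a) braided_coalgebra"
 assumes A: "braided_bialgebra G A" and s: "is_antipode G A s"
 shows "same_bialgebra (add_antipode G A) A" "braided_hopf_algebra G (add_antipode G A)"
  "x .: A ==> antipode (add_antipode G A) x = s x"
proof -
 note aA = bialgD(1)[OF A] and cA = bialgD(2)[OF A]
 let ?H = "add_antipode G A" and ?s = "restrict s (carrier A)"
 show same: "same_bialgebra ?H A"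
  by (simp add: same_bialgebra_def same_algebra_def same_crossed_def same_space_def add_antipode_def
    braided_coalgebra.defs)
 have rl: "klinear A A s" using s by (auto simp: is_antipode_iff dest: chomD(1))
 have rs: "is_antipode G A ?s"
  unfolding is_antipode_iff
 proof (intro conjI ballI)
  show "crossed_hom G A A ?s" by (rule crossed_hom_cong[where f = s]) (use s aA in \<open>simp_all add: is_antipode_iff\<close>)
  fix x assume x: "x .: A"
  note dx = coalgD(8)[OF cA x]
  note k = ba_simps(1)[OF aA]
  show "tconv A ?s (%y. y) (comult A x) = conv_unit A A x" "tconv A (%y. y) ?s (comult A x) = conv_unit A A x"
   using tmap_cong[OF k k k k rl kl_id _ _ dx, of ?s "%y. y"] tmap_cong[OF k k k k kl_id rl _ _ dx, of "%y. y" ?s] s x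
   by (simp_all add: is_antipode_iff tconv_def)
 qed
 have "antipode ?H = (THE s. s : extensional (carrier A) \<and> is_antipode G A s)"
  by (simp add: add_antipode_def braided_coalgebra.defs braided_hopf_algebra.defs)
 also have "\<dots> = ?s"
 proof (rule the_equality)
  fix s' assume s': "s' : extensional (carrier A) \<and> is_antipode G A s'"
  show "s' = ?s"
   by (rule extensionalityI[of _ "carrier A"]) (use s' antipode_unique[OF cA aA _ rs] in auto)
 qed (use rs in auto)
 finally have ant: "antipode ?H = ?s" .
 then show "x .: A ==> antipode ?H x = s x" by simp
 show "braided_hopf_algebra G ?H"
  using A rs by (simp add: braided_hopf_algebra_def same_bialgebra[OF same] ant)
qed

section \<open>The free braided Hopf algebra\<close>

context
 fixes V :: "('k::field, 'g, 'v, 'm) cmod"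
 assumes V: "crossed_module G V"
begin

lemmas T_facts = kspace_V[OF V] kspace_TV[OF V] crossed_module_TV[OF V] braided_algebra_TV[OF V]

lemma letter_mult_linear:
 "kbilinear V (TT V) (TT V)
  (%v t. prim_elt (TV G V) (word V [v]) *.(tensor_algebra G (TV G V) (TV G V)) t)"
proof (rule kbilI)
 note m = ta_mult(1)[OF T_facts(4)] and p = prim_linear[OF T_facts(4)]
 show "klinear (TT V) (TT V)
   (%t. prim_elt (TV G V) (word V [v]) *.(tensor_algebra G (TV G V) (TV G V)) t)" if "v .: V" for v
  using kbilD(1)[OF m klD(1)[OF p letter(2)[OF V that]]] .
 show "klinear V (TT V)
   (%v. prim_elt (TV G V) (word V [v]) *.(tensor_algebra G (TV G V) (TV G V)) t)"
  if "t .: (TT V)" for t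
  by (rule kl_comp[OF kl_comp[OF letter(1)[OF V] p] kbilD(2)[OF m that]])
qed

text \<open>Recursion with the step t -> (v\<otimes>1 + 1\<otimes>v) t, started at 1\<otimes>1. It
  is multiplicative by induction on the first factor, where the second part of
  \<open>prim_mult\<close> shifts the bracket.\<close>

lemma free_comult_exists:
 "\<exists>d. algebra_hom G (TV G V) (tensor_algebra G (TV G V) (TV G V)) d \<and>
  (\<forall>v\<in>carrier V. d (word V [v]) = prim_elt (TV G V) (word V [v]))"
proof -
 let ?T = "TV G V"
 let ?A = "tensor_algebra G ?T ?T"
 let ?TT = "?T ** ?T"
 note [simp] = T_facts
 have kTT: "kspace ?TT" by simp
 note op = letter_mult_linear
 have e: "pure ?T ?T 1@?T 1@?T .: ?TT" by simp
 define F where "F = lin_ext ?TT (%vs. foldr (%v t. prim_elt ?T (word V [v]) *.?A t) vs (pure ?T ?T 1@?T 1@?T))"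
 note F = TV_rec[OF V kTT op e, folded F_def]
 have Fc [simp]: "F x .: ?TT" if "x .: ?T" for x using klD(1)[OF F(1) that] .
 have h1: "homog (tensor G ?T ?T) \<one> (pure ?T ?T 1@?T 1@?T)"
  using homog_pure[OF T_facts(3,3) ba_crossed(4)[OF T_facts(4)] ba_crossed(4)[OF T_facts(4)]] by simp
 have c: "crossed_hom G ?T (tensor G ?T ?T) F"
 proof (rule TV_rec_crossed[OF V crossed_module_tensor[OF T_facts(3,3)], where op = "%v t. prim_elt ?T (word V [v]) *.?A t"])
  show "homog (tensor G ?T ?T) \<one> (F 1@?T)" unfolding F(2) by (rule h1)
  show "act (tensor G ?T ?T) g (F 1@?T) = F 1@?T" if "g .: G" for g
   using that by (simp add: F(2) tensor_act[OF T_facts(3,3)] ba_crossed(3)[OF T_facts(4)])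
  fix g h k v y assume *: "homog V g v" "homog (tensor G ?T ?T) h y"
  show "homog (tensor G ?T ?T) (g \<otimes> h) (prim_elt ?T (word V [v]) *.?A y)"
   by (rule prim_mult_crossed(1)[OF T_facts(4) letter(3)[OF V *(1)] *(2)])
  show "act (tensor G ?T ?T) k (prim_elt ?T (word V [v]) *.?A y) = prim_elt ?T (word V [act V k v]) *.?A act (tensor G ?T ?T) k y"
   if k: "k .: G"
   using prim_mult_crossed(2)[OF T_facts(4) letter(3)[OF V *(1)] k] homogD(2)[OF *(2)] letter(4)[OF V k homogD(2)[OF *(1)]] by simp
 qed (use F(1,3) op in \<open>simp_all add: kbilinear_def\<close>)
 have "F (x *.?T y) = F x *.?A F y" if x: "x .: ?T" and y: "y .: ?T" for x y
 proof (rule TV_recI[OF V kl_comp[OF TV_mult_l[OF V y] F(1)]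
    kl_comp[OF F(1) kbilD(2)[OF ta_mult(1)[OF T_facts(4)] Fc[OF y]]] _ _ x])
  show "F (1@?T *.?T y) = F 1@?T *.?A F y"
   using y by (simp add: F(2) tensor_algebra_units(1)[OF T_facts(4)])
  fix g h v t assume *: "homog V g v" "homog ?T h t" "F (t *.?T y) = F t *.?A F y"
  note [simp] = homogD(2)[OF *(1)] homogD(2)[OF *(2)]
  show "F ((word V [v] *.?T t) *.?T y) = F (word V [v] *.?T t) *.?A F y"
   using y *(3) prim_mult'(2)[OF T_facts(4) letter(3)[OF V *(1)]]
   by (simp add: ba_ring(1)[OF T_facts(4)] letter[OF V] F(3))
 qed
 with c have "algebra_hom G ?T ?A F" by (simp add: algebra_hom_def F(2) ta_mult(3))
 moreover have "F (word V [v]) = prim_elt ?T (word V [v])" if "v .: V" for v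
  using F(4)[of "[v]"] that tensor_algebra_units(2)[OF T_facts(4) klD(1)[OF prim_linear[OF T_facts(4)] letter(2)[OF V that]]] by simp
 ultimately show ?thesis by blast
qed

text \<open>An algebra map out of T(V) is determined by its values on letters, so the definite
  description denotes the map of \<open>free_comult_exists\<close>, restricted to the
  carrier.\<close>

lemma free_comult:
 shows "algebra_hom G (TV G V) (tensor_algebra G (TV G V) (TV G V)) (free_comult G V)"
  "v .: V ==> free_comult G V (word V [v]) = prim_elt (TV G V) (word V [v])"
proof -
 let ?T = "TV G V"
 let ?A = "tensor_algebra G ?T ?T"
 obtain d where d: "algebra_hom G ?T ?A d" "\<forall>v\<in>carrier V. d (word V [v]) = prim_elt ?T (word V [v])"
  using free_comult_exists by blast
 note [simp] = T_facts
 let ?P = "%d. d : extensional (carrier ?T) \<and> algebra_hom G ?T ?A d \<and>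
  (\<forall>v\<in>carrier V. d (word V [v]) = prim_elt ?T (word V [v]))"
 have "?P (restrict d (carrier ?T))"
  using d letter(2)[OF V] algebra_hom_cong[OF d(1) T_facts(4), of "restrict d (carrier ?T)"] by simp
 moreover have "d' = d''" if "?P d'" "?P d''" for d' d''
 proof (rule extensionalityI[of _ "carrier ?T"])
  fix x assume x: "x .: ?T"
  have a: "algebra_hom G ?T ?A d'" "algebra_hom G ?T ?A d''" using that by auto
  have l: "klinear ?T (?T ** ?T) d'" "klinear ?T (?T ** ?T) d''"
   using ahomD(4)[OF a(1)] ahomD(4)[OF a(2)] by simp_all
  show "d' x = d'' x"
  proof (rule TV_recI[OF V l _ _ x])
   show "d' 1@?T = d'' 1@?T" by (simp add: ahomD(2)[OF a(1)] ahomD(2)[OF a(2)])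
   fix g h v t assume "homog V g v" "homog ?T h t" and eq: "d' t = d'' t"
   then have v: "v .: V" "t .: ?T" by (auto dest: homogD(2))
   show "d' (word V [v] *.?T t) = d'' (word V [v] *.?T t)"
    using that v letter(2)[OF V v(1)] by (simp add: ahomD(3)[OF a(1)] ahomD(3)[OF a(2)] eq)
  qed
 qed (use that in auto)
 ultimately have "\<exists>!d. ?P d" by blast
 from theI'[OF this] have "?P (free_comult G V)" unfolding free_comult_def Let_def prim_elt_def .
 then show "algebra_hom G ?T ?A (free_comult G V)"
  "v .: V ==> free_comult G V (word V [v]) = prim_elt ?T (word V [v])" by auto
qed

lemma free_comult_rec:
 shows "klinear (TV G V) (TT V) (free_comult G V)"
  "free_comult G V 1@(TV G V) = tpure V 1@(TV G V) 1@(TV G V)"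
  "[|v .: V; t .: (TV G V)|] ==> free_comult G V (word V [v] *.(TV G V) t) =
   prim_elt (TV G V) (word V [v]) *.(tensor_algebra G (TV G V) (TV G V)) free_comult G V t"
  "[|g .: G; t .: (TV G V)|] ==> free_comult G V (act (TV G V) g t) = act (tensor G (TV G V) (TV G V)) g (free_comult G V t)"
 using ahomD[OF free_comult(1)] free_comult(2) letter(2)[OF V] ta_mult(3)[OF T_facts(4)]
  chomD(2)[OF ahomD(1)[OF free_comult(1), simplified]] by simp_all

lemma free_comult_degree:
 assumes "t : tens_degree V n"
 shows "free_comult G V t : lspan (TT V)
  {tpure V y z |y z. \<exists>i j. i + j = n \<and> y : tens_degree V i \<and> z : tens_degree V j}"
proof -
 let ?T = "TV G V"
 let ?A = "tensor_algebra G ?T ?T"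
 let ?TT = "?T ** ?T"
 let ?X = "%n. {pure ?T ?T y z |y z. \<exists>i j. i + j = n \<and> y : tens_degree V i \<and> z : tens_degree V j}"
 note [simp] = T_facts
 have kTT: "kspace ?TT" by simp
 have sub: "?X n \<subseteq> carrier ?TT" for n using degree_closed(1)[OF V] by (auto intro!: pure_closed)
 note L = lspan_closed[OF kTT sub]
 have step: "prim_elt ?T (word V [v]) *.?A t : lspan ?TT (?X (Suc n))" if v: "v .: V" and t: "t : lspan ?TT (?X n)" for v t n
  using V v
 proof (induction rule: homog_induct)
  case (homog g v)
  note v = homogD[OF homog]
  have wv: "word V [v] : tens_degree V 1" by (rule word_degree[OF V]) (use v in simp_all)
  show ?case
  proof (rule klinear_lspan[OF kbilD(1)[OF letter_mult_linear v(2)] kTT kTT sub sub _ t])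
   fix x assume "x : ?X n"
   then obtain y z i j where x: "x = pure ?T ?T y z" "i + j = n" "y : tens_degree V i" "z : tens_degree V j" by blast
   have yz: "y .: ?T" "z .: ?T" using x degree_closed(1)[OF V] by auto
   have "act ?T g y : tens_degree V i" using tens_degree_crossed[OF V, of i] x v by (simp add: crossed_submodule_def)
   moreover have "word V [v] *.?T y : tens_degree V (Suc i)" "word V [v] *.?T z : tens_degree V (Suc j)"
    using degree_mult[OF V wv x(3)] degree_mult[OF V wv x(4)] by simp_all
   ultimately have "pure ?T ?T (word V [v] *.?T y) z : ?X (Suc n)" "pure ?T ?T (act ?T g y) (word V [v] *.?T z) : ?X (Suc n)"
    using x by (blast intro: add_Suc add_Suc_right)+
   then show "prim_elt ?T (word V [v]) *.?A x : lspan ?TT (?X (Suc n))"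
    unfolding x(1) prim_mult'(1)[OF T_facts(4) letter(3)[OF V homog] yz] by (intro L(3) lspan_base)
  qed
 next
  case (add v w)
  have tT: "t .: ?TT" using that L(1) by blast
  show ?case unfolding klD(2)[OF kbilD(2)[OF letter_mult_linear tT] add(1,2)] using add by (intro L(3))
 qed
 have "free_comult G V (word V vs) : lspan ?TT (?X (length vs))" if "vs .:: V" for vs
  using that
 proof (induction vs)
  case Nil
  have "1@?T : tens_degree V 0" using word_degree[OF V, of "[]"] by (simp add: TV_fields(1)[OF V])
  then have "pure ?T ?T 1@?T 1@?T : ?X 0" by blast
  then show ?case using free_comult_rec(2) by (simp add: TV_fields(1)[OF V] lspan_base)
 next
  case (Cons v vs)
  then show ?case using free_comult_rec(3)[of v "word V vs"] step[of v _ "length vs"] by (simp add: letter[OF V] V)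
 qed
 note w = this
 show ?thesis
 proof (rule klinear_degree_mem[OF V free_comult_rec(1) submodule_lspan[OF kTT sub] kTT _ assms])
  fix vs assume vs: "vs .:: V" "length vs = n"
  show "free_comult G V (word V vs) : lspan ?TT (?X n)" using w[OF vs(1)] unfolding vs(2) .
 qed
qed

text \<open>Prepending the letter v changes both iterated coproducts by one operator on
  T\<otimes>(T\<otimes>T), left multiplication in the braided sense by v\<otimes>1\<otimes>1 +
  1\<otimes>v\<otimes>1 + 1\<otimes>1\<otimes>v. Agreement follows by induction on letters.\<close>

lemma free_comult_coassoc:
 assumes x: "x .: (TV G V)"
 shows "tassoc (TV G V) (TV G V) (TV G V) (tmap (TT V) (TV G V) (free_comult G V) (%y. y) (free_comult G V x)) =
  tmap (TV G V) (TT V) (%y. y) (free_comult G V) (free_comult G V x)"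
proof -
 let ?T = "TV G V"
 let ?A = "tensor_algebra G ?T ?T"
 let ?TT = "?T ** ?T"
 let ?T3 = "?T ** ?TT"
 let ?D = "free_comult G V"
 note [simp] = T_facts
 note k = T_facts(2)
 have kTT [simp]: "kspace ?TT" by simp
 note D = free_comult_rec
 note [simp] = klD(1)[OF D(1)]
 note as = tassoc_tensor[OF k k k]
 note l1 = kl_tmap[OF k k kTT k D(1) kl_id] and p1 = tmap_pure[OF k k kTT k D(1) kl_id]
 note l2 = kl_tmap[OF k k k kTT kl_id D(1)] and p2 = tmap_pure[OF k k k kTT kl_id D(1)]
 show ?thesis
 proof (rule TV_recI[OF V kl_comp[OF kl_comp[OF D(1) l1] as(1)] kl_comp[OF D(1) l2] _ _ x])
  show "tassoc ?T ?T ?T (tmap ?TT ?T ?D (%y. y) (?D 1@?T)) = tmap ?T ?TT (%y. y) ?D (?D 1@?T)"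
   by (simp add: D(2) p1 p2 as)
  fix g h v t assume v: "homog V g v" and t: "homog ?T h t"
   and IH: "tassoc ?T ?T ?T (tmap ?TT ?T ?D (%y. y) (?D t)) = tmap ?T ?TT (%y. y) ?D (?D t)"
  note vD = homogD[OF v] and tT = homogD(2)[OF t]
  note lv = letter(3)[OF V v]
  have wT [simp]: "word V [v] .: ?T" using letter(2)[OF V vD(2)] .
  let ?m = "%s. prim_elt ?T (word V [v]) *.?A s"
  note m = kbilD(1)[OF letter_mult_linear vD(2)] and mp = prim_mult'(1)[OF T_facts(4) lv]
  note wl = TV_mult_r[OF V wT] and al = TV_act(1)[OF V vD(1)] and at = tensor_act[OF T_facts(3,3) vD(1)]
  note [simp] = klD(1)[OF m] klD(1)[OF al] klD(1)[OF wl] klD(1)[OF at(1)]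
  \<comment> \<open>The last two summands of the operator are grouped: v either multiplies the first
    factor, or passes it through the action of g and multiplies the remaining pair by its own
    coproduct.\<close>
  define E where "E = (%s. tmap ?T ?TT (%y. word V [v] *.?T y) (%y. y) s +.?T3 tmap ?T ?TT (act ?T g) ?m s)"
  have El: "klinear ?T3 ?T3 E"
   unfolding E_def by (intro kl_add kl_tmap wl kl_id al m) simp_all
  have Ep: "E (pure ?T ?TT a s) = pure ?T ?TT (word V [v] *.?T a) s +.?T3 pure ?T ?TT (act ?T g a) (?m s)"
   if "a .: ?T" "s .: ?TT" for a s
   unfolding E_def using that
   by (simp add: tmap_pure[OF k kTT k kTT wl kl_id] tmap_pure[OF k kTT k kTT al m])
  have r: "tmap ?T ?TT (%y. y) ?D (?m s) = E (tmap ?T ?TT (%y. y) ?D s)" if s: "s .: ?TT" for s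
  proof (rule tensor_eq[OF k k kl_comp[OF m l2] kl_comp[OF l2 El] _ s])
   fix a b assume "a .: ?T" "b .: ?T"
   then show "tmap ?T ?TT (%y. y) ?D (?m (pure ?T ?T a b)) = E (tmap ?T ?TT (%y. y) ?D (pure ?T ?T a b))"
    using vD by (simp add: mp klD(2)[OF l2] p2 Ep D(3))
  qed
  \<comment> \<open>The last factor b is kept fixed here. To reach b, the letter v passes both
    components of s, hence the diagonal action of g on s.\<close>
  have l3: "tassoc ?T ?T ?T (pure ?TT ?T (?m s) b) +.?T3 tassoc ?T ?T ?T (pure ?TT ?T (act (tensor G ?T ?T) g s) (word V [v] *.?T b)) =
    E (tassoc ?T ?T ?T (pure ?TT ?T s b))" if s: "s .: ?TT" and b: "b .: ?T" for s b
  proof (rule tensor_eq[OF k k _ _ _ s])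
   note pb = kl_comp[OF kl_pure(2)[OF kTT k] as(1)]
   have wb: "word V [v] *.?T b .: ?T" using b by simp
   show "klinear ?TT ?T3 (%s. tassoc ?T ?T ?T (pure ?TT ?T (?m s) b) +.?T3
     tassoc ?T ?T ?T (pure ?TT ?T (act (tensor G ?T ?T) g s) (word V [v] *.?T b)))"
    by (rule kl_add[OF kl_comp[OF m pb[OF b]] kl_comp[OF at(1) pb[OF wb]]]) simp
   show "klinear ?TT ?T3 (%s. E (tassoc ?T ?T ?T (pure ?TT ?T s b)))"
    by (rule kl_comp[OF pb[OF b] El])
   fix x y assume xy: "x .: ?T" "y .: ?T"
   have "E (tassoc ?T ?T ?T (pure ?TT ?T (pure ?T ?T x y) b)) =
     pure ?T ?TT (word V [v] *.?T x) (pure ?T ?T y b) +.?T3 (pure ?T ?TT (act ?T g x) (pure ?T ?T (word V [v] *.?T y) b) +.?T3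
     pure ?T ?TT (act ?T g x) (pure ?T ?T (act ?T g y) (word V [v] *.?T b)))"
    using xy b by (simp add: as Ep mp pure_bilinear)
   then show "tassoc ?T ?T ?T (pure ?TT ?T (?m (pure ?T ?T x y)) b) +.?T3
     tassoc ?T ?T ?T (pure ?TT ?T (act (tensor G ?T ?T) g (pure ?T ?T x y)) (word V [v] *.?T b)) =
     E (tassoc ?T ?T ?T (pure ?TT ?T (pure ?T ?T x y) b))"
    using xy b wb by (simp add: mp at(2) pure_bilinear klD(2)[OF as(1)] as(2) ks_ac(1))
  qed
  have l: "tassoc ?T ?T ?T (tmap ?TT ?T ?D (%y. y) (?m s)) = E (tassoc ?T ?T ?T (tmap ?TT ?T ?D (%y. y) s))" if s: "s .: ?TT" for s
  proof (rule tensor_eq[OF k k kl_comp[OF m kl_comp[OF l1 as(1)]] kl_comp[OF kl_comp[OF l1 as(1)] El] _ s])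
   fix a b assume "a .: ?T" "b .: ?T"
   then show "tassoc ?T ?T ?T (tmap ?TT ?T ?D (%y. y) (?m (pure ?T ?T a b))) =
     E (tassoc ?T ?T ?T (tmap ?TT ?T ?D (%y. y) (pure ?T ?T a b)))"
    using vD by (simp add: mp klD(2)[OF l1] klD(2)[OF as(1)] p1 D(3,4) l3)
  qed
  show "tassoc ?T ?T ?T (tmap ?TT ?T ?D (%y. y) (?D (word V [v] *.?T t))) = tmap ?T ?TT (%y. y) ?D (?D (word V [v] *.?T t))"
   using tT vD by (simp add: D(3) l r IH)
 qed
qed

text \<open>The counit vanishes on v t and is invariant under G. Therefore contracting either factor
  with it turns left multiplication by the coproduct of v into left multiplication by v.\<close>

lemma free_counit:
 assumes x: "x .: (TV G V)"
 shows "lin_ext (TV G V) (%(y, z). TV_counit G V y .*(TV G V) z) (free_comult G V x) = x"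
  "lin_ext (TV G V) (%(y, z). TV_counit G V z .*(TV G V) y) (free_comult G V x) = x"
proof -
 let ?T = "TV G V" and ?e = "TV_counit G V"
 let ?A = "tensor_algebra G ?T ?T"
 note [simp] = T_facts
 note k = T_facts(2)
 note e = klD[OF TV_counit(1)[OF V]] and ep = counit_facts(1,2)[OF V]
 note ec = chomD(2)[OF ahomD(1)[OF counit_facts(3)[OF V]]]
 have b: "kbilinear ?T ?T ?T (%y z. ?e y .*?T z)" "kbilinear ?T ?T ?T (%y z. ?e z .*?T y)"
  by (intro kbilI klI; simp add: e ks_distrib mult.commute)+
 note L = tens_ext[OF k k b(1) k] and R = tens_ext[OF k k b(2) k]
 note D = free_comult_rec
 note DT = klD(1)[OF D(1)]
 have st: "lin_ext ?T (%(y, z). ?e y .*?T z) (prim_elt ?T (word V [v]) *.?A s) = word V [v] *.?T lin_ext ?T (%(y, z). ?e y .*?T z) s"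
  "lin_ext ?T (%(y, z). ?e z .*?T y) (prim_elt ?T (word V [v]) *.?A s) = word V [v] *.?T lin_ext ?T (%(y, z). ?e z .*?T y) s"
  if v: "homog V g v" and s: "s .: (?T ** ?T)" for g v s
 proof -
  note vD = homogD[OF v]
  have wT [simp]: "word V [v] .: ?T" using letter(2)[OF V vD(2)] .
  note m = kbilD(1)[OF letter_mult_linear vD(2)] and mp = prim_mult'(1)[OF T_facts(4) letter(3)[OF V v]]
  note [simp] = klD(1)[OF TV_act(1)[OF V vD(1)]]
  show "lin_ext ?T (%(y, z). ?e y .*?T z) (prim_elt ?T (word V [v]) *.?A s) = word V [v] *.?T lin_ext ?T (%(y, z). ?e y .*?T z) s"
   by (rule tensor_eq[OF k k kl_comp[OF m L(1)] kl_comp[OF L(1) TV_mult_r[OF V wT]] _ s])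
    (use vD in \<open>simp add: mp klD(2)[OF L(1)] L(2) ep ec\<close>)
  show "lin_ext ?T (%(y, z). ?e z .*?T y) (prim_elt ?T (word V [v]) *.?A s) = word V [v] *.?T lin_ext ?T (%(y, z). ?e z .*?T y) s"
   by (rule tensor_eq[OF k k kl_comp[OF m R(1)] kl_comp[OF R(1) TV_mult_r[OF V wT]] _ s])
    (use vD in \<open>simp add: mp klD(2)[OF R(1)] R(2) ep ec\<close>)
 qed
 show "lin_ext ?T (%(y, z). ?e y .*?T z) (free_comult G V x) = x"
  by (rule TV_recI[OF V kl_comp[OF D(1) L(1)] kl_id _ _ x])
   (simp add: D(2) L(2) ep, simp add: D(3) st(1) DT homogD(2))
 show "lin_ext ?T (%(y, z). ?e z .*?T y) (free_comult G V x) = x"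
  by (rule TV_recI[OF V kl_comp[OF D(1) R(1)] kl_id _ _ x])
   (simp add: D(2) R(2) ep, simp add: D(3) st(2) DT homogD(2))
qed

end

end

section \<open>Antipode, universal property and functoriality of A(V)\<close>

lemma lspan_mem:
 assumes f: "klinear M N f" and M: "kspace M" and N: "kspace N" and X: "X \<subseteq> carrier M" and H: "submodule H scalars N"
  and "!!x. x : X ==> f x : H" "t : lspan M X"
 shows "f t : H"
 using assms(7)
 by (induction rule: lspan_induct[OF M X, consumes 1])
  (use H[unfolded submodule_iff[OF N]] assms(6) in \<open>simp_all add: klD[OF f] klD(4)[OF f M N]\<close>)

context finite_comm_group
begin

text \<open>\<open>free_hopf\<close> before the antipode is attached.\<close>

definition free_bialgebra :: "('k::field, 'g, 'v, 'm) cmod => ('k, 'g, ('k, 'v) tens_pow) braided_coalgebra" where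
 "free_bialgebra V = crossed_module.extend (TV G V) (braided_coalgebra.fields (free_comult G V) (TV_counit G V))"

context
 fixes V :: "('k::field, 'g, 'v, 'm) cmod"
 assumes V: "crossed_module G V"
begin

text \<open>Serves A(V) and C(V) alike: product and coproduct are only assumed to respect length,
  with the unit and counit of T(V). The length filtration feeds \<open>antipode_exists\<close>. That
  the antipode is pointwise an iterate of \<open>inv_seq\<close> yields stability of the degrees
  here, and later stability of the ideal in \<open>primitive_hopf_ideal\<close>.\<close>

lemma TV_antipode:
 fixes A :: "('k, 'g, ('k, 'v) tens_pow, 'z) bcoalg"
 assumes A: "braided_bialgebra G A" and same: "same_crossed A (TV G V)" and one: "1@A = 1@(TV G V)"
  and e: "counit A = TV_counit G V"
  and m: "!!i j x y. x : tens_degree V i ==> y : tens_degree V j ==> x *.A y : tens_degree V (i + j)"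
  and d: "!!n x. x : tens_degree V n ==> comult A x : lspan (A ** A)
   {pure A A y z |y z. \<exists>i j. i + j = n \<and> y : tens_degree V i \<and> z : tens_degree V j}"
 shows "\<exists>s. is_antipode G A s \<and> (\<forall>n. \<forall>x\<in>tens_degree V n. s x : tens_degree V n) \<and>
  (\<forall>x\<in>carrier A. \<exists>n. s x = inv_seq A A (%y. y) n x)"
proof -
 let ?T = "TV G V"
 note aA = bialgD(1)[OF A] and cA = bialgD(2)[OF A]
 note kA = ba_simps(1)[OF aA]
 note s = same_crossed_fields[OF same]
 have subA: "submodule H scalars ?T ==> submodule H scalars A" for H
  using same_space_submodule[OF same_crossed_space[OF same] kA] by simp
 have kAA: "kspace (A ** A)" using kA by simp
 have dc: "x .: A" if "x : tens_degree V i" for x i using that degree_closed(1)[OF V] s by auto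
 have fc: "x .: A" if "x : TV_filtration V i" for x i using that TV_filtration(1)[OF V, of i] s
  by (auto simp: submodule_iff[OF T_facts(2)[OF V]])
 have FD: "comult A x : lspan (A ** A) {pure A A y z |y z. \<exists>i j. i + j \<le> n \<and> y : TV_filtration V i \<and> z : TV_filtration V j}"
  if x: "x : TV_filtration V n" for n x
 proof -
  let ?X = "{pure A A y z |y z. \<exists>i j. i + j \<le> n \<and> y : TV_filtration V i \<and> z : TV_filtration V j}"
  have X: "?X \<subseteq> carrier (A ** A)" using fc kA by auto
  have l: "klinear ?T (A ** A) (comult A)" using coalgD(7)[OF cA] same_space_klinear(1)[OF same_crossed_space[OF same]] by blast
  show ?thesis
  proof (rule lspan_mem[OF l T_facts(2)[OF V] kAA words_closed[OF V] submodule_lspan[OF kAA X] _ x[unfolded TV_filtration_def]])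
   fix w assume "w : {word V vs |vs. vs .:: V \<and> length vs \<le> n}"
   then obtain vs where w: "w = word V vs" "vs .:: V" "length vs \<le> n" by blast
   have "{pure A A y z |y z. \<exists>i j. i + j = length vs \<and> y : tens_degree V i \<and> z : tens_degree V j} \<subseteq> ?X"
   proof
    fix t assume "t : {pure A A y z |y z. \<exists>i j. i + j = length vs \<and> y : tens_degree V i \<and> z : tens_degree V j}"
    then obtain y z i j where "t = pure A A y z" "i + j = length vs" "y : tens_degree V i" "z : tens_degree V j" by blast
    moreover from this have "y : TV_filtration V i" "z : TV_filtration V j" "i + j \<le> n"
     using w(3) TV_filtration(4)[OF V order_refl, of i] TV_filtration(4)[OF V order_refl, of j] by auto
    ultimately show "t : ?X" by blast
   qed
   from subsetD[OF lspan_mono[OF this] d[OF word_degree[OF V w(2) refl]]]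
   show "comult A w : lspan (A ** A) ?X" unfolding w(1) .
  qed
 qed
 have F0: "x = counit A x .*A 1@A" if "x : TV_filtration V 0" for x
  using counit_facts(5)[OF V that] by (simp add: e one s)
 have ex: "\<exists>n. x : TV_filtration V n" if "x .: A" for x using TV_filtration(3)[OF V] that s by simp
 obtain S where S: "is_antipode G A S" "\<forall>n. \<forall>x\<in>TV_filtration V n. S x = inv_seq A A (%y. y) (Suc n) x"
  using antipode_exists[OF cA aA subA[OF TV_filtration(1)[OF V]] TV_filtration(2)[OF V] ex FD F0] by blast
 have "S x : tens_degree V n" if x: "x : tens_degree V n" for x n
 proof -
  have u: "conv_unit A A x : tens_degree V n" if "x : tens_degree V n" for x n
  proof (cases "n = 0")
   case True
   have "1@?T : tens_degree V 0" using word_degree[OF V, of "[]"] by (simp add: TV_fields(1)[OF V])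
   then show ?thesis using degree_closed(4)[OF V, of "1@?T" 0] True by (simp add: conv_unit_def one s)
  next
   case False
   then show ?thesis using counit_facts(4)[OF V that] degree_closed(2)[OF V, of n] dc aA ks_simps(4)[OF kA]
    by (simp add: conv_unit_def e) (simp add: s)
  qed
  have "inv_seq A A (%y. y) (Suc n) x : tens_degree V n"
  proof (rule inv_seq_preserve[where X = "tens_degree V", OF cA aA subA[OF degree_submodule[OF V]] u _ x])
   fix n x \<psi> assume x: "x : tens_degree V n" and p: "klinear A A \<psi>" "!!i y. y : tens_degree V i ==> \<psi> y : tens_degree V i"
   let ?J = "%x. x +.A (-1) .*A conv_unit A A x"
   have J: "klinear A A ?J" by (intro kl_add kl_id kl_scale chomD(1)[OF conv_unit_crossed[OF cA aA]] kA)
   show "tconv A ?J \<psi> (comult A x) : tens_degree V n"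
   proof (rule lspan_mem[OF tconv_props(1)[OF aA kA kA J p(1)] kAA kA _ subA[OF degree_submodule[OF V]] _ d[OF x]])
    show "{pure A A y z |y z. \<exists>i j. i + j = n \<and> y : tens_degree V i \<and> z : tens_degree V j} \<subseteq> carrier (A ** A)"
     using dc kA by auto
    fix t assume "t : {pure A A y z |y z. \<exists>i j. i + j = n \<and> y : tens_degree V i \<and> z : tens_degree V j}"
    then obtain y z i j where t: "t = pure A A y z" "i + j = n" "y : tens_degree V i" "z : tens_degree V j" by blast
    have "?J y : tens_degree V i"
     using degree_closed(3)[OF V t(3) degree_closed(4)[OF V u[OF t(3)], of "-1"]] by (simp add: s)
    then show "tconv A ?J \<psi> t : tens_degree V n"
     using m[OF _ p(2)[OF t(4)], of "?J y" i] t dc by (simp add: tconv_props(2)[OF aA kA kA J p(1)])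
   qed
  qed
  moreover have "x : TV_filtration V n" using TV_filtration(4)[OF V order_refl] x by blast
  ultimately show ?thesis using S(2) by simp
 qed
 moreover have "\<exists>n. S x = inv_seq A A (%y. y) n x" if "x .: A" for x using ex[OF that] S(2) by blast
 ultimately show ?thesis using S(1) by blast
qed

lemma free_bialgebra:
 shows "same_algebra (free_bialgebra V) (TV G V)" "comult (free_bialgebra V) = free_comult G V" "counit (free_bialgebra V) = TV_counit G V"
  "braided_bialgebra G (free_bialgebra V)"
proof -
 let ?A = "free_bialgebra V"
 show s: "same_algebra ?A (TV G V)" and c: "comult ?A = free_comult G V" and e: "counit ?A = TV_counit G V"
  by (simp_all add: same_algebra_def same_crossed_def same_space_def free_bialgebra_def
    crossed_module.defs braided_coalgebra.defs)
 note ss = same_algebra_simps[OF s]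
 have "crossed_hom G (TV G V) (tensor G (TV G V) (TV G V)) (free_comult G V)"
  using ahomD(1)[OF free_comult(1)[OF V]] by simp
 then have "braided_coalgebra G ?A"
  unfolding braided_coalgebra_def ss c e
  using T_facts[OF V] ahomD(1)[OF counit_facts(3)[OF V]] free_comult_coassoc[OF V] free_counit[OF V] by simp
 then show "braided_bialgebra G ?A"
  unfolding braided_bialgebra_def ss c e
  using T_facts[OF V] free_comult(1)[OF V] counit_facts(3)[OF V] by simp
qed

lemma free_hopf:
 shows "same_algebra (free_hopf G V) (TV G V)" (is ?g1) "comult (free_hopf G V) = free_comult G V" (is ?g2) "counit (free_hopf G V) = TV_counit G V" (is ?g3)
  "braided_hopf_algebra G (free_hopf G V)" (is ?g4) "x : tens_degree V n ==> antipode (free_hopf G V) x : tens_degree V n" (is "PROP ?g5")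
proof -
 note f = free_bialgebra
 note ss = same_algebra_simps[OF f(1)]
 have eq: "free_hopf G V = add_antipode G (free_bialgebra V)"
  by (simp add: free_hopf_def free_bialgebra_def)
 obtain s where s: "is_antipode G (free_bialgebra V) s" "\<forall>n. \<forall>x\<in>tens_degree V n. s x : tens_degree V n"
  using TV_antipode[OF f(4) same_algebra_crossed[OF f(1)]] by (simp add: ss f(2,3) degree_mult[OF V] free_comult_degree[OF V]) blast
 note a = add_antipode[OF f(4) s(1), folded eq]
 show ?g1 ?g2 ?g3
  using a(1) f(1-3) by (simp_all add: same_bialgebra_def same_algebra_def same_crossed_def same_space_def)
 show ?g4 by (rule a(2))
 show "PROP ?g5"
  using a(3)[of x] s(2) degree_closed(1)[OF V, of n] by (auto simp: ss)
qed

lemmas free_simps = same_algebra_simps[OF free_hopf(1)] free_hopf(2,3)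

text \<open>The universal property of A(V). The algebra map comes from \<open>TV_hom\<close>. Since
  the image of a letter is primitive, prepending a letter multiplies both sides of the coproduct
  identity by the same element \<open>prim_elt R (\<phi> v)\<close>; the counits agree because a
  primitive has counit 0.\<close>

lemma free_hom:
 fixes R :: "('k, 'g, 'r, 'n) bcoalg"
 assumes R: "braided_bialgebra G R" and \<phi>: "crossed_hom G V R \<phi>"
  and prim: "!!v. v .: V ==> comult R (\<phi> v) = prim_elt R (\<phi> v)"
 shows "\<exists>F. algebra_hom G (free_hopf G V) R F \<and> coalgebra_hom G (free_hopf G V) R F \<and> (\<forall>v\<in>carrier V. F (word V [v]) = \<phi> v)"
proof -
 let ?T = "TV G V"
 note aR = bialgD(1)[OF R] and cR = bialgD(2)[OF R]
 note [simp] = T_facts[OF V] aR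
 note kR = ba_simps(1)[OF aR] and kT = T_facts(2)[OF V]
 obtain F where F: "algebra_hom G ?T R F" "!!v. v .: V ==> F (word V [v]) = \<phi> v"
  using TV_hom[OF V aR \<phi>] by blast
 note Fl = ahomD(4)[OF F(1)]
 have Fc [simp]: "F x .: R" if "x .: ?T" for x using klD(1)[OF Fl that] .
 have pc: "\<phi> v .: R" if "v .: V" for v using klD(1)[OF chomD(1)[OF \<phi>] that] .
 note D = free_comult_rec[OF V]
 note tl = kl_tmap[OF kT kT kR kR Fl Fl] and tp = tmap_pure[OF kT kT kR kR Fl Fl]
 note dR = coalgD(7)[OF cR] and dRh = bialgD(3)[OF R]
 note Fm = ahomD(3)[OF F(1)] letter(2)[OF V] F(2)
 have st: "tmap R R F F (prim_elt ?T (word V [v]) *.(tensor_algebra G ?T ?T) s) = prim_elt R (\<phi> v) *.(tensor_algebra G R R) tmap R R F F s"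
  if v: "homog V g v" and s: "s .: (?T ** ?T)" for g v s
 proof (rule tensor_eq[OF kT kT kl_comp[OF kbilD(1)[OF letter_mult_linear[OF V]] tl]
    kl_comp[OF tl kbilD(1)[OF ta_mult(1)[OF aR]]] _ s])
  note vD [simp] = homogD[OF v]
  show "prim_elt R (\<phi> v) .: (R ** R)" by (rule klD(1)[OF prim_linear[OF aR] pc]) simp
  fix a b assume "a .: ?T" "b .: ?T"
  then show "tmap R R F F (prim_elt ?T (word V [v]) *.(tensor_algebra G ?T ?T) pure ?T ?T a b) =
    prim_elt R (\<phi> v) *.(tensor_algebra G R R) tmap R R F F (pure ?T ?T a b)"
   by (simp add: prim_mult'(1)[OF T_facts(4)[OF V] letter(3)[OF V v]] prim_mult'(1)[OF aR chomD(4)[OF \<phi> v]]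
     klD(2)[OF tl] tp Fm chomD(2)[OF ahomD(1)[OF F(1)]])
 qed (rule homogD(2)[OF v])
 have c: "comult R (F t) = tmap R R F F (free_comult G V t)" if t: "t .: ?T" for t
 proof (rule TV_recI[OF V kl_comp[OF Fl dR] kl_comp[OF D(1) tl] _ _ t])
  show "comult R (F 1@?T) = tmap R R F F (free_comult G V 1@?T)"
   by (simp add: D(2) tp ahomD(2)[OF F(1)] ahomD(2)[OF dRh] ta_mult(3))
  fix g h v t assume *: "homog V g v" "homog ?T h t" "comult R (F t) = tmap R R F F (free_comult G V t)"
  note [simp] = homogD(2)[OF *(1)] homogD(2)[OF *(2)]
  show "comult R (F (word V [v] *.?T t)) = tmap R R F F (free_comult G V (word V [v] *.?T t))"
   using *(3) by (simp add: Fm pc ahomD(3)[OF dRh] prim D(3) st[OF *(1)] klD(1)[OF D(1)])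
 qed
 have e: "counit R (F t) = TV_counit G V t" if t: "t .: ?T" for t
 proof (rule TV_recI[OF V kl_comp[OF Fl coalgD(9)[OF cR]] TV_counit(1)[OF V] _ _ t])
  show "counit R (F 1@?T) = TV_counit G V 1@?T"
   using ahomD(2)[OF bialgD(4)[OF R]] by (simp add: ahomD(2)[OF F(1)] counit_facts(1)[OF V])
  fix g h v t assume *: "homog V g v" "homog ?T h t"
  note [simp] = homogD(2)[OF *(1)] homogD(2)[OF *(2)]
  show "counit R (F (word V [v] *.?T t)) = TV_counit G V (word V [v] *.?T t)"
   using counit_primitive[OF R pc prim, of v] by (simp add: Fm pc ahomD(3)[OF bialgD(4)[OF R]] counit_facts(2)[OF V])
 qed
 have "coalgebra_hom G (free_hopf G V) R F"
  using c e ahomD(1)[OF F(1)] by (simp add: coalgebra_hom_def free_simps)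
 moreover have "algebra_hom G (free_hopf G V) R F" using F(1) by (simp add: free_simps)
 ultimately show ?thesis using F(2) by blast
qed

lemma free_hom_unique:
 assumes R: "braided_algebra G R" and f: "algebra_hom G (free_hopf G V) R f" and f': "algebra_hom G (free_hopf G V) R f'"
  and "!!v. v .: V ==> f (word V [v]) = f' (word V [v])" "t .: (TV G V)"
 shows "f t = f' t"
proof -
 have F: "algebra_hom G (TV G V) R f" "algebra_hom G (TV G V) R f'" using f f' by (simp_all add: free_simps)
 show ?thesis
 proof (rule TV_recI[OF V ahomD(4)[OF F(1)] ahomD(4)[OF F(2)] _ _ assms(5)])
  show "f 1@(TV G V) = f' 1@(TV G V)" by (simp add: ahomD(2)[OF F(1)] ahomD(2)[OF F(2)])
  fix g h v t assume "homog V g v" "homog (TV G V) h t" "f t = f' t"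
  then show "f (word V [v] *.(TV G V) t) = f' (word V [v] *.(TV G V) t)"
   using homogD(2)[of V g v] homogD(2)[of "TV G V" h t] assms(4)[of v] letter(2)[OF V, of v]
   by (simp add: ahomD(3)[OF F(1)] ahomD(3)[OF F(2)])
 qed
qed

text \<open>The formula on words is matched with the algebra map of \<open>TV_hom\<close>, from
  which it inherits multiplicativity and compatibility with G.\<close>

lemma TV_map:
 fixes W :: "('k, 'g, 'w, 'n) cmod"
 assumes W: "crossed_module G W" and f: "crossed_hom G V W f"
 shows "klinear (TV G V) (TV G W) (TV_map V W f)" (is ?g1) "vs .:: V ==> TV_map V W f (word V vs) = word W (map f vs)"
  "algebra_hom G (TV G V) (TV G W) (TV_map V W f)" (is ?g2)
  "[|v .: V; t .: (TV G V)|] ==> TV_map V W f (word V [v] *.(TV G V) t) = word W [f v] *.(TV G W) TV_map V W f t" (is "PROP ?g3")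
proof -
 note fl = chomD(1)[OF f]
 have ml: "map f vs .:: W" if "vs .:: V" for vs using that klD(1)[OF fl] by (auto simp: lists_eq_set)
 have "kmultilinear V (TV G W) (%vs. word W (map f vs))"
  unfolding kmultilinear_def
 proof (intro conjI ballI)
  fix xs ys assume xy: "xs .:: V" "ys .:: V"
  show "klinear V (TV G W) (%v. word W (map f (xs @ [v] @ ys)))"
   using kl_comp[OF fl word_linear[OF W ml[OF xy(1)] ml[OF xy(2)]]] by simp
 qed (rule word_closed[OF W ml])
 from TV_lin_ext[OF V T_facts(2)[OF W] this]
 show l: ?g1 and w: "!!vs. vs .:: V ==> TV_map V W f (word V vs) = word W (map f vs)"
  by (simp_all add: TV_map_def TV_simps)
 obtain F where F: "algebra_hom G (TV G V) (TV G W) F" "!!v. v .: V ==> F (word V [v]) = word W [f v]"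
  using TV_hom[OF V T_facts(4)[OF W] crossed_hom_comp[OF f letter_crossed[OF W]]] by blast
 have "F (word V vs) = word W (map f vs)" if "vs .:: V" for vs
  using that
 proof (induction vs)
  case Nil
  then show ?case using ahomD(2)[OF F(1)] by (simp add: TV_fields(1)[OF V] TV_fields(1)[OF W])
 next
  case (Cons v vs)
  then show ?case using ahomD(3)[OF F(1), of "word V [v]" "word V vs"] F(2)[of v] ml[of vs] klD(1)[OF fl, of v]
   by (simp add: letter[OF V] letter[OF W] word_closed[OF V])
 qed
 then have "TV_map V W f x = F x" if "x .: (TV G V)" for x
  using TV_eq[OF V l ahomD(4)[OF F(1)] _ that] by (simp add: w)
 then show a: ?g2
  by (rule algebra_hom_cong[OF F(1) T_facts(4)[OF V]])
 show "PROP ?g3"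
  using ahomD(3)[OF a, of "word V [v]" t] w[of "[v]"] letter(2)[OF V, of v] by simp
qed

end

lemma free_hopf_map:
 fixes V :: "('k::field, 'g, 'v, 'm) cmod" and W :: "('k, 'g, 'w, 'n) cmod"
 assumes V: "crossed_module G V" and W: "crossed_module G W" and f: "crossed_hom G V W f"
 shows "hopf_hom G (free_hopf G V) (free_hopf G W) (TV_map V W f)"
proof -
 note R = free_hopf(4)[OF W]
 then have bW: "braided_bialgebra G (free_hopf G W)" by (simp add: braided_hopf_algebra_def)
 have bV: "braided_bialgebra G (free_hopf G V)" using free_hopf(4)[OF V] by (simp add: braided_hopf_algebra_def)
 have c: "crossed_hom G V (free_hopf G W) (%v. word W [f v])"
  using crossed_hom_comp[OF f letter_crossed[OF W]] by (simp add: free_simps[OF W])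
 have fW: "f v .: W" if "v .: V" for v using klD(1)[OF chomD(1)[OF f] that] .
 have pe: "prim_elt (free_hopf G W) = prim_elt (TV G W)" by (rule ext) (simp add: prim_elt_def free_simps[OF W])
 obtain F where F: "algebra_hom G (free_hopf G V) (free_hopf G W) F" "coalgebra_hom G (free_hopf G V) (free_hopf G W) F"
   "\<forall>v\<in>carrier V. F (word V [v]) = word W [f v]"
  using free_hom[OF V bW c] free_comult(2)[OF W fW] by (auto simp: pe free_simps[OF W])
 have a: "algebra_hom G (free_hopf G V) (free_hopf G W) (TV_map V W f)"
  using TV_map(3)[OF V W f] by (simp add: free_simps[OF V] free_simps[OF W])
 have eq: "TV_map V W f x = F x" if "x .: (free_hopf G V)" for x
  by (rule free_hom_unique[OF V bialgD(1)[OF bW] a F(1)])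
   (use that F(3) TV_map(2)[OF V W f, of "[v]" for v] in \<open>simp_all add: free_simps[OF V]\<close>)
 show ?thesis
  using free_hopf(4)[OF V] R a coalgebra_hom_cong[OF F(2) bialgD(2)[OF bV] ba_simps(2)[OF bialgD(1)[OF bW]] eq]
  by (simp add: hopf_hom_def)
qed

section \<open>The cofree coalgebra\<close>

text \<open>Prepends v to the first tensor factor; deconcatenation recurses through this
  operation.\<close>

definition lmult :: "('k::field, 'g, 'v, 'm) cmod => 'v => ('k, ('k, 'v) tens_pow, ('k, 'v) tens_pow) tens => ('k, ('k, 'v) tens_pow, ('k, 'v) tens_pow) tens" where
 "lmult V v = tmap (TV G V) (TV G V) (%x. word V [v] *.(TV G V) x) (%y. y)"

context
 fixes V :: "('k::field, 'g, 'v, 'm) cmod"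
 assumes V: "crossed_module G V"
begin

lemma deconcatenation_eq:
 "deconcatenation V = lin_ext (TT V) (%vs. \<Oplus>\<^bsub>TT V\<^esub>i\<in>{..length vs}.
  tpure V (word V (take i vs)) (word V (drop i vs)))"
 by (simp add: deconcatenation_def Let_def TV_simps)

lemma dec_word:
 shows "klinear (TV G V) (TT V) (deconcatenation V)"
  "vs .:: V ==> deconcatenation V (word V vs) = (\<Oplus>\<^bsub>TT V\<^esub>i\<in>{..length vs}.
  tpure V (word V (take i vs)) (word V (drop i vs)))"
proof -
 let ?T = "TV G V"
 let ?TT = "?T ** ?T"
 note [simp] = T_facts[OF V]
 have kTT: "kspace ?TT" by simp
 have tl: "take i vs .:: V" "drop i vs .:: V" if "vs .:: V" for vs i
  using that by (auto dest: in_set_takeD in_set_dropD)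
 have "kmultilinear V ?TT (%vs. \<Oplus>\<^bsub>?TT\<^esub>i\<in>{..length vs}. pure ?T ?T (word V (take i vs)) (word V (drop i vs)))"
  unfolding kmultilinear_def
 proof (intro conjI ballI)
  fix vs assume "vs .:: V"
  then show "(\<Oplus>\<^bsub>?TT\<^esub>i\<in>{..length vs}. pure ?T ?T (word V (take i vs)) (word V (drop i vs))) .: ?TT"
   using tl by (intro ks_finsum_closed kTT Pi_I pure_closed) (simp_all add: word_closed[OF V])
 next
  fix xs ys assume xy: "xs .:: V" "ys .:: V"
  have "klinear V ?TT (%v. pure ?T ?T (word V (take i (xs @ [v] @ ys))) (word V (drop i (xs @ [v] @ ys))))" for i
  proof (cases "i \<le> length xs")
   case True
   then show ?thesis
    using kl_comp[OF word_linear[OF V tl(2)[OF xy(1), of i] xy(2)] kl_pure(1)[OF T_facts(2)[OF V] T_facts(2)[OF V] word_closed[OF V tl(1)[OF xy(1), of i]]]]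
    by simp
  next
   case False
   then obtain j where i: "i = length xs + Suc j" by (metis add_Suc_right less_iff_Suc_add not_le)
   show ?thesis
    using kl_comp[OF word_linear[OF V xy(1) tl(1)[OF xy(2), of j]] kl_pure(2)[OF T_facts(2)[OF V] T_facts(2)[OF V] word_closed[OF V tl(2)[OF xy(2), of j]]]]
    by (simp add: i)
  qed
  from klinear_finsum_fun[OF this T_facts(1)[OF V] kTT, of "{..length (xs @ [undefined] @ ys)}"]
  show "klinear V ?TT (%v. \<Oplus>\<^bsub>?TT\<^esub>i\<in>{..length (xs @ [v] @ ys)}.
    pure ?T ?T (word V (take i (xs @ [v] @ ys))) (word V (drop i (xs @ [v] @ ys))))" by simp
 qed
 from TV_lin_ext[OF V kTT this]
 show "klinear ?T ?TT (deconcatenation V)"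
  "vs .:: V ==> deconcatenation V (word V vs) = (\<Oplus>\<^bsub>?TT\<^esub>i\<in>{..length vs}. pure ?T ?T (word V (take i vs)) (word V (drop i vs)))"
  by (simp_all add: deconcatenation_eq)
qed

lemma lmult:
 assumes "v .: V"
 shows "klinear (TT V) (TT V) (lmult V v)" (is ?g1)
  "[|a .: (TV G V); b .: (TV G V)|] ==> lmult V v (tpure V a b) =
   tpure V (word V [v] *.(TV G V) a) b" (is "PROP ?g2")
proof -
 note k = T_facts(2)[OF V]
 note w = TV_mult_r[OF V letter(2)[OF V assms]]
 show ?g1
  "PROP ?g2"
  unfolding lmult_def using kl_tmap[OF k k k k w kl_id] tmap_pure[OF k k k k w kl_id] by simp_all
qed

text \<open>Cutting before the first letter gives 1\<otimes>v t. Every other cut has v at the start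
  of its left part, and removing v leaves a cut of t.\<close>

lemma dec_rec:
 shows "deconcatenation V 1@(TV G V) = tpure V 1@(TV G V) 1@(TV G V)"
  "[|v .: V; t .: (TV G V)|] ==> deconcatenation V (word V [v] *.(TV G V) t) =
   tpure V 1@(TV G V) (word V [v] *.(TV G V) t) +.(TT V) lmult V v (deconcatenation V t)"
proof -
 let ?T = "TV G V"
 let ?TT = "?T ** ?T"
 note [simp] = T_facts[OF V]
 have kTT: "kspace ?TT" by simp
 note d = dec_word
 have tl: "take i vs .:: V" "drop i vs .:: V" if "vs .:: V" for vs i
  using that by (auto dest: in_set_takeD in_set_dropD)
 show "deconcatenation V 1@?T = pure ?T ?T 1@?T 1@?T"
  using d(2)[of "[]"] ks_finsum_single[OF kTT, of "{0::nat}" 0 "%_. pure ?T ?T (word V []) (word V [])"]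
  by (simp add: TV_fields(1)[OF V] word_closed[OF V])
 assume v: "v .: V" and t: "t .: ?T"
 note w = TV_mult_r[OF V letter(2)[OF V v]]
 have l: "klinear ?T ?TT (%t. pure ?T ?T 1@?T (word V [v] *.?T t) +.?TT lmult V v (deconcatenation V t))"
  by (intro kl_add[OF kl_comp[OF w kl_pure(1)] kl_comp[OF d(1) lmult(1)[OF v]]]) simp_all
 show "deconcatenation V (word V [v] *.?T t) =
   pure ?T ?T 1@?T (word V [v] *.?T t) +.?TT lmult V v (deconcatenation V t)"
 proof (rule TV_eq[OF V kl_comp[OF w d(1)] l _ t])
  fix vs assume vs: "vs .:: V"
  then have vvs: "v # vs .:: V" using v by simp
  let ?f = "%i. pure ?T ?T (word V (take i (v # vs))) (word V (drop i (v # vs)))"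
  have fc: "?f i .: ?TT" for i using tl[OF vvs, of i] word_closed[OF V] by simp
  interpret TT: abelian_group ?TT by (rule ks_abelian[OF kTT])
  have "deconcatenation V (word V (v # vs)) = finsum ?TT ?f (insert 0 (Suc ` {..length vs}))"
   using d(2)[OF vvs] by (simp add: atMost_Suc_eq_insert_0)
  also have "\<dots> = ?f 0 +.?TT finsum ?TT ?f (Suc ` {..length vs})"
   by (rule ks_finsum_insert[OF kTT]) (simp, simp, rule Pi_I, rule fc, rule fc)
  also have "finsum ?TT ?f (Suc ` {..length vs}) = finsum ?TT (%i. ?f (Suc i)) {..length vs}"
   by (rule TT.finsum_reindex) (use fc in auto)
  also have "\<dots> = finsum ?TT (%i. lmult V v (pure ?T ?T (word V (take i vs)) (word V (drop i vs)))) {..length vs}"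
  proof (rule ks_finsum_cong[OF kTT refl])
   fix i
   have "word V (take i vs) .: ?T" "word V (drop i vs) .: ?T" using tl[OF vs, of i] word_closed[OF V] by simp_all
   then show "?f (Suc i) = lmult V v (pure ?T ?T (word V (take i vs)) (word V (drop i vs)))"
    using tl[OF vs, of i] v by (simp add: lmult(2)[OF v] letter(5)[OF V])
  qed (use tl[OF vs] word_closed[OF V] klD(1)[OF lmult(1)[OF v]] in simp)
  also have "\<dots> = lmult V v (deconcatenation V (word V vs))"
   unfolding d(2)[OF vs]
   by (rule kl_finsum[OF lmult(1)[OF v] kTT kTT, symmetric]) (use tl[OF vs] word_closed[OF V] in simp_all)
  finally show "deconcatenation V (word V [v] *.?T word V vs) =
    pure ?T ?T 1@?T (word V [v] *.?T word V vs) +.?TT lmult V v (deconcatenation V (word V vs))"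
   using v vs by (simp add: letter(5)[OF V] TV_fields(1)[OF V])
 qed
qed

lemma deconcatenation_crossed: "crossed_hom G (TV G V) (tensor G (TV G V) (TV G V)) (deconcatenation V)"
proof (rule crossed_homI_gen[where X = "{a .*(TV G V) word V vs |a gs vs. list_all2 (homog V) gs vs}"])
 let ?T = "TV G V"
 let ?TT = "?T ** ?T" and ?C = "tensor G ?T ?T"
 note [simp] = T_facts[OF V]
 show cTT: "crossed_module G ?C" "crossed_module G ?T" by simp_all
 show "klinear ?T ?C (deconcatenation V)" using dec_word(1) by simp
 fix P t assume t: "t .: ?T" and P: "!!x. x : {a .*?T word V vs |a gs vs. list_all2 (homog V) gs vs} ==> P x"
  "!!v w. [|v .: ?T; w .: ?T; P v; P w|] ==> P (v +.?T w)"
 show "P t" by (rule TV_homog_word_induct[OF V t]) (rule P(1), blast, rule P(2))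
next
 let ?T = "TV G V"
 let ?TT = "?T ** ?T" and ?C = "tensor G ?T ?T"
 note [simp] = T_facts[OF V]
 have kTT: "kspace ?TT" by simp
 note d = klD[OF dec_word(1)]
 note cTT = crossed_module_tensor[OF T_facts(3)[OF V] T_facts(3)[OF V]]
 fix x assume "x : {a .*?T word V vs |a gs vs. list_all2 (homog V) gs vs}"
 then obtain a gs vs where x: "x = a .*?T word V vs" and vs: "list_all2 (homog V) gs vs" by blast
 note D = list_all2_homogD[OF V vs]
 note w = word_closed[OF V D(1)]
 have tl: "take i us .:: V" "drop i us .:: V" if "us .:: V" for i us
  using that by (auto dest: in_set_takeD in_set_dropD)
 have pc: "pure ?T ?T (word V (take i vs)) (word V (drop i vs)) .: ?TT" for i
  using tl[OF D(1)] word_closed[OF V] by simp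
 have "homog ?C (gprod gs) (deconcatenation V (word V vs))"
 proof -
  have h: "homog ?C (gprod gs) (pure ?T ?T (word V (take i vs)) (word V (drop i vs)))" for i
  proof -
   have "set (take i gs) \<subseteq> carrier G" "set (drop i gs) \<subseteq> carrier G" using D by (auto dest: in_set_takeD in_set_dropD)
   then have "gprod gs = gprod (take i gs) \<otimes> gprod (drop i gs)" using gprod_append[of "take i gs" "drop i gs"] by simp
   then show ?thesis
    using homog_pure[OF T_facts(3)[OF V] T_facts(3)[OF V] homog_word[OF V list_all2_takeI[OF vs]] homog_word[OF V list_all2_dropI[OF vs]]] by simp
  qed
  have g: "gprod gs .: G" using D by simp
  have "coact ?C (gprod gs) (\<Oplus>\<^bsub>?TT\<^esub>i\<in>{..length vs}. pure ?T ?T (word V (take i vs)) (word V (drop i vs))) =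
   (\<Oplus>\<^bsub>?TT\<^esub>i\<in>{..length vs}. pure ?T ?T (word V (take i vs)) (word V (drop i vs)))"
   using kl_finsum[OF tensor_coact(1)[OF T_facts(3)[OF V] T_facts(3)[OF V] g] kTT kTT, of "%i. pure ?T ?T (word V (take i vs)) (word V (drop i vs))"] pc h
   by (simp add: homog_def)
  then show ?thesis using g d(1)[OF w] by (simp add: homog_def dec_word(2)[OF D(1)])
 qed
 then have "homog ?C (gprod gs) (deconcatenation V x)"
  unfolding x d(3)[OF w] using homog_intros(4)[OF cTT] by simp
 moreover have "homog ?T (gprod gs) x" unfolding x by (rule homog_intros(4)[OF T_facts(3)[OF V] homog_word[OF V vs]])
 ultimately show "\<exists>g. homog ?T g x \<and> homog ?C g (deconcatenation V x)" by blast
 fix g assume g: "g .: G"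
 note at = tensor_act[OF T_facts(3)[OF V] T_facts(3)[OF V] g]
 have m: "map (act V g) us .:: V" if "us .:: V" for us using that g V by (auto simp: lists_eq_set)
 have "deconcatenation V (act ?T g (word V vs)) = (\<Oplus>\<^bsub>?TT\<^esub>i\<in>{..length vs}. act ?C g (pure ?T ?T (word V (take i vs)) (word V (drop i vs))))"
  unfolding TV_act(2)[OF V g D(1)] dec_word(2)[OF m[OF D(1)]] length_map
 proof (rule ks_finsum_cong[OF kTT refl])
  fix i
  show "pure ?T ?T (word V (take i (map (act V g) vs))) (word V (drop i (map (act V g) vs))) =
    act ?C g (pure ?T ?T (word V (take i vs)) (word V (drop i vs)))"
   using tl[OF D(1), of i] word_closed[OF V] g by (simp add: at TV_act(2)[OF V g] take_map drop_map)
 qed (use pc klD(1)[OF at(1)] in simp)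
 also have "\<dots> = act ?C g (deconcatenation V (word V vs))"
  unfolding dec_word(2)[OF D(1)]
  by (rule kl_finsum[OF at(1) kTT kTT, symmetric]) (use pc in simp_all)
 finally show "deconcatenation V (act ?T g x) = act ?C g (deconcatenation V x)"
  using w g d(1)[OF w] klD(1)[OF TV_act(1)[OF V g] w]
  by (simp add: x d(3) klD(3)[OF TV_act(1)[OF V g]] klD(3)[OF at(1)])
qed

lemmas TV_counit_left = counit_ext[OF T_facts(2)[OF V] TV_counit(1)[OF V]]

lemma lmult_counit:
 assumes v: "v .: V" and s: "s .: (TT V)"
 shows "lin_ext (TV G V) (%(y, z). TV_counit G V y .*(TV G V) z) (lmult V v s) = 0@(TV G V)" (is ?g1)
  "lin_ext (TV G V) (%(y, z). TV_counit G V z .*(TV G V) y) (lmult V v s) =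
   word V [v] *.(TV G V) lin_ext (TV G V) (%(y, z). TV_counit G V z .*(TV G V) y) s" (is ?g2)
proof -
 note [simp] = T_facts[OF V]
 note k = T_facts(2)[OF V] and c = TV_counit_left and w = letter(2)[OF V v]
 note wl = TV_mult_r[OF V w]
 show ?g1
  by (rule tensor_eq[OF k k kl_comp[OF lmult(1)[OF v] c(1)] kl_zero[OF k] _ s])
   (use w v in \<open>simp add: lmult(2) c(2) counit_facts(2)[OF V]\<close>)
 show ?g2
  by (rule tensor_eq[OF k k kl_comp[OF lmult(1)[OF v] c(3)] kl_comp[OF c(3) wl] _ s])
   (use w v in \<open>simp add: lmult(2) c(4)\<close>)
qed

lemma deconcatenation_counit:
 assumes x: "x .: (TV G V)"
 shows "lin_ext (TV G V) (%(y, z). TV_counit G V y .*(TV G V) z) (deconcatenation V x) = x" (is ?g1)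
  "lin_ext (TV G V) (%(y, z). TV_counit G V z .*(TV G V) y) (deconcatenation V x) = x" (is ?g2)
proof -
 note [simp] = T_facts[OF V]
 note k = T_facts(2)[OF V] and c = TV_counit_left and d = dec_word(1)
 note e = counit_facts(1,2)[OF V]
 note [simp] = klD(1)[OF d] klD(1)[OF lmult(1)]
 show ?g1
  by (rule TV_recI[OF V kl_comp[OF d c(1)] kl_id _ _ x])
   (simp add: dec_rec c e, simp add: dec_rec homogD(2) klD(2)[OF c(1)] c e lmult_counit letter(2)[OF V])
 show ?g2
  by (rule TV_recI[OF V kl_comp[OF d c(3)] kl_id _ _ x])
   (simp add: dec_rec c e, simp add: dec_rec homogD(2) klD(2)[OF c(3)] c e lmult_counit letter(2)[OF V])
qed

text \<open>On v t either iterated coproduct is the sum of 1\<otimes>1\<otimes>v t, of 1 tensored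
  with \<open>lmult V v\<close> of the coproduct of t, and of its value at t with v prepended to the
  first factor. So equality passes from t to v t.\<close>

lemma deconcatenation_coassoc:
 assumes x: "x .: (TV G V)"
 shows "tassoc (TV G V) (TV G V) (TV G V) (tmap (TT V) (TV G V) (deconcatenation V) (%y. y) (deconcatenation V x)) =
  tmap (TV G V) (TT V) (%y. y) (deconcatenation V) (deconcatenation V x)"
proof -
 let ?T = "TV G V"
 let ?TT = "?T ** ?T"
 let ?T3 = "?T ** ?TT"
 let ?D = "deconcatenation V"
 note [simp] = T_facts[OF V]
 note k = T_facts(2)[OF V]
 have kTT [simp]: "kspace ?TT" by simp
 note D = dec_word(1) and Dr = dec_rec
 note [simp] = klD(1)[OF D]
 note as = tassoc_tensor[OF k k k]
 note l1 = kl_tmap[OF k k kTT k D kl_id] and p1 = tmap_pure[OF k k kTT k D kl_id]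
 note l2 = kl_tmap[OF k k k kTT kl_id D] and p2 = tmap_pure[OF k k k kTT kl_id D]
 note [simp] = klD(1)[OF l1] klD(1)[OF l2] klD(1)[OF as(1)]
 show ?thesis
 proof (rule TV_recI[OF V kl_comp[OF kl_comp[OF D l1] as(1)] kl_comp[OF D l2] _ _ x])
  show "tassoc ?T ?T ?T (tmap ?TT ?T ?D (%y. y) (?D 1@?T)) = tmap ?T ?TT (%y. y) ?D (?D 1@?T)"
   by (simp add: Dr(1) p1 p2 as)
  fix g h v t assume v': "homog V g v" and t': "homog ?T h t"
   and IH: "tassoc ?T ?T ?T (tmap ?TT ?T ?D (%y. y) (?D t)) = tmap ?T ?TT (%y. y) ?D (?D t)"
  note v = homogD(2)[OF v'] and t = homogD(2)[OF t']
  have wT [simp]: "word V [v] .: ?T" using letter(2)[OF V v] .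
  note L = lmult[OF v]
  note [simp] = klD(1)[OF L(1)]
  note wl = TV_mult_r[OF V wT]
  let ?L3 = "tmap ?T ?TT (%y. word V [v] *.?T y) (%y. y)"
  note l3 = kl_tmap[OF k kTT k kTT wl kl_id] and p3 = tmap_pure[OF k kTT k kTT wl kl_id]
  have p1': "klinear ?TT ?T3 (pure ?T ?TT 1@?T)" by (rule kl_pure(1)) simp_all
  have r: "tmap ?T ?TT (%y. y) ?D (lmult V v s) = ?L3 (tmap ?T ?TT (%y. y) ?D s)" if s: "s .: ?TT" for s
   by (rule tensor_eq[OF k k kl_comp[OF L(1) l2] kl_comp[OF l2 l3] _ s]) (simp add: L(2) p2 p3)
  have a: "tassoc ?T ?T ?T (pure ?TT ?T (lmult V v s) b) = ?L3 (tassoc ?T ?T ?T (pure ?TT ?T s b))"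
   if s: "s .: ?TT" and b: "b .: ?T" for s b
   by (rule tensor_eq[OF k k kl_comp[OF L(1) kl_comp[OF kl_pure(2)[OF kTT k b] as(1)]]
      kl_comp[OF kl_comp[OF kl_pure(2)[OF kTT k b] as(1)] l3] _ s])
    (use b in \<open>simp add: L(2) as(2) p3\<close>)
  have l: "tassoc ?T ?T ?T (tmap ?TT ?T ?D (%y. y) (lmult V v s)) =
    pure ?T ?TT 1@?T (lmult V v s) +.?T3 ?L3 (tassoc ?T ?T ?T (tmap ?TT ?T ?D (%y. y) s))" if s: "s .: ?TT" for s
  proof (rule tensor_eq[OF k k kl_comp[OF L(1) kl_comp[OF l1 as(1)]]
     kl_add[OF kl_comp[OF L(1) p1'] kl_comp[OF kl_comp[OF l1 as(1)] l3]] _ s])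
   fix y z assume "y .: ?T" "z .: ?T"
   then show "tassoc ?T ?T ?T (tmap ?TT ?T ?D (%y. y) (lmult V v (pure ?T ?T y z))) =
    pure ?T ?TT 1@?T (lmult V v (pure ?T ?T y z)) +.?T3 ?L3 (tassoc ?T ?T ?T (tmap ?TT ?T ?D (%y. y) (pure ?T ?T y z)))"
    using v by (simp add: L(2) p1 Dr(2) pure_bilinear klD(2)[OF as(1)] as(2) a)
  qed simp
  have c: "tassoc ?T ?T ?T (tmap ?TT ?T ?D (%y. y) (?D t)) .: ?T3"
   using t klD(1)[OF as(1) klD(1)[OF l1]] by simp
  show "tassoc ?T ?T ?T (tmap ?TT ?T ?D (%y. y) (?D (word V [v] *.?T t))) = tmap ?T ?TT (%y. y) ?D (?D (word V [v] *.?T t))"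
   using t v c klD(1)[OF l3 c]
   by (simp add: Dr klD(2)[OF l1] klD(2)[OF l2] klD(2)[OF as(1)] l r p1 p2 as(2) pure_bilinear ks_ac(1) IH[symmetric])
 qed
qed

lemma deconcatenation_degree:
 assumes "t : tens_degree V n"
 shows "deconcatenation V t : lspan (TT V)
  {tpure V y z |y z. \<exists>i j. i + j = n \<and> y : tens_degree V i \<and> z : tens_degree V j}"
proof -
 let ?T = "TV G V"
 let ?TT = "?T ** ?T"
 let ?X = "%n. {pure ?T ?T y z |y z. \<exists>i j. i + j = n \<and> y : tens_degree V i \<and> z : tens_degree V j}"
 note [simp] = T_facts[OF V]
 have kTT: "kspace ?TT" by simp
 have sub: "?X n \<subseteq> carrier ?TT" for n using degree_closed(1)[OF V] by (auto intro!: pure_closed)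
 have one: "1@?T : tens_degree V 0" using word_degree[OF V, of "[]"] by (simp add: TV_fields(1)[OF V])
 have w: "deconcatenation V (word V vs) : lspan ?TT (?X (length vs))" if "vs .:: V" for vs
  using that
 proof (induction vs)
  case Nil
  have "pure ?T ?T 1@?T 1@?T : ?X 0" using one by blast
  then show ?case using dec_rec(1) by (simp add: TV_fields(1)[OF V] lspan_base)
 next
  case (Cons v vs)
  then have v: "v .: V" and vs: "vs .:: V" by auto
  have "word V (v # vs) : tens_degree V (Suc (length vs))" by (rule word_degree[OF V]) (use v vs in simp_all)
  then have 1: "pure ?T ?T 1@?T (word V (v # vs)) : lspan ?TT (?X (Suc (length vs)))" using one by (intro lspan_base) force
  have "lmult V v (deconcatenation V (word V vs)) : lspan ?TT (?X (Suc (length vs)))"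
  proof (rule klinear_lspan[OF lmult(1)[OF v] kTT kTT sub sub _ Cons.IH])
   fix x assume "x : ?X (length vs)"
   then obtain y z i j where x: "x = pure ?T ?T y z" "i + j = length vs" "y : tens_degree V i" "z : tens_degree V j" by blast
   have "word V [v] *.?T y : tens_degree V (Suc i)" using degree_mult[OF V word_degree[OF V, of "[v]" 1] x(3)] v by simp
   then have "pure ?T ?T (word V [v] *.?T y) z : ?X (Suc (length vs))"
    using x(2,4) by (intro CollectI exI[of _ "word V [v] *.?T y"] exI[of _ z] conjI refl exI[of _ "Suc i"] exI[of _ j]) simp_all
   then show "lmult V v x : lspan ?TT (?X (Suc (length vs)))"
    using x degree_closed(1)[OF V] by (simp add: lmult(2)[OF v] subset_iff lspan_base)
  qed
  with 1 show ?case using dec_rec(2)[OF v, of "word V vs"] v vs lspan_closed(3)[OF kTT sub]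
   by (simp add: letter(5)[OF V] word_closed[OF V])
 qed
 show ?thesis
 proof (rule klinear_degree_mem[OF V dec_word(1) submodule_lspan[OF kTT sub] kTT _ assms])
  fix vs assume vs: "vs .:: V" "length vs = n"
  show "deconcatenation V (word V vs) : lspan ?TT (?X n)" using w[OF vs(1)] unfolding vs(2) .
 qed
qed

lemma cofree_coalgebra:
 shows "same_crossed (cofree_coalgebra G V) (TV G V)" "comult (cofree_coalgebra G V) = deconcatenation V"
  "counit (cofree_coalgebra G V) = TV_counit G V" "braided_coalgebra G (cofree_coalgebra G V)"
  "1@(cofree_coalgebra G V) = 1@(TV G V)"
proof -
 let ?C = "cofree_coalgebra G V"
 show s: "same_crossed ?C (TV G V)" and c: "comult ?C = deconcatenation V" and e: "counit ?C = TV_counit G V"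
  and "1@?C = 1@(TV G V)"
  by (simp_all add: same_crossed_def same_space_def cofree_coalgebra_def crossed_module.defs braided_coalgebra.defs)
 show "braided_coalgebra G ?C"
  unfolding braided_coalgebra_def same_crossed_s[OF s] c e
  using T_facts[OF V] deconcatenation_crossed ahomD(1)[OF counit_facts(3)[OF V]]
   deconcatenation_coassoc deconcatenation_counit by simp
qed

text \<open>By the third item, projection to V followed by the embedding as letters is the
  projection onto degree one. That one commutes with G and letters embed injectively, whence the
  last item.\<close>

lemma TV_proj:
 shows "klinear (TV G V) V (TV_proj V)" "vs .:: V ==> TV_proj V (word V vs) = (if length vs = 1 then hd vs else 0@V)"
  "x .: (TV G V) ==> word V [TV_proj V x] = TV_filter V (%m. m = 1) x"
  "crossed_hom G (TV G V) V (TV_proj V)" (is ?g1)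
proof -
 note k = T_facts(1)[OF V]
 have "kmultilinear V V (%vs. if length vs = 1 then hd vs else 0@V)"
  unfolding kmultilinear_def
 proof (intro conjI ballI)
  show "(if length vs = 1 then hd vs else 0@V) .: V" if "vs .:: V" for vs
   using that k by (cases vs) auto
  fix xs ys assume "xs .:: V" "ys .:: V"
  show "klinear V V (%v. if length (xs @ [v] @ ys) = 1 then hd (xs @ [v] @ ys) else 0@V)"
   by (cases "xs = [] \<and> ys = []") (auto simp: kl_id kl_zero[OF k])
 qed
 from TV_lin_ext[OF V k this] show l: "klinear (TV G V) V (TV_proj V)"
  and w: "!!vs. vs .:: V ==> TV_proj V (word V vs) = (if length vs = 1 then hd vs else 0@V)"
  by (simp_all add: TV_proj_def)
 have wz: "word V [0@V] = 0@(TV G V)" using k by (intro word_zero[OF V]) simp_all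
 show f: "word V [TV_proj V x] = TV_filter V (%m. m = 1) x" if x: "x .: (TV G V)" for x
 proof (rule TV_eq[OF V kl_comp[OF l letter(1)[OF V]] TV_filter(1)[OF V] _ x])
  fix vs assume "vs .:: V"
  then show "word V [TV_proj V (word V vs)] = TV_filter V (%m. m = 1) (word V vs)"
   by (cases vs) (auto simp: w TV_filter(2)[OF V] wz)
 qed
 have inj: "TV_proj V (word V [v]) = v" if "v .: V" for v using that by (simp add: w)
 have injD: "p = q" if "word V [p] = word V [q]" "p .: V" "q .: V" for p q
  using inj[OF that(2)] inj[OF that(3)] unfolding that(1) by simp
 note pl = klD(1)[OF l]
 show ?g1
  unfolding crossed_hom_def
 proof (intro conjI l ballI)
  fix g x assume g: "g .: G" and x: "x .: (TV G V)"
  note c = chomD(2,3)[OF TV_filter_crossed[OF V, of "%m. m = 1"] g x]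
  note lc = chomD(2,3)[OF letter_crossed[OF V] g pl[OF x]]
  have "word V [TV_proj V (act (TV G V) g x)] = word V [act V g (TV_proj V x)]"
   using g x T_facts(3)[OF V] by (simp add: f c lc del: One_nat_def)
  then show "TV_proj V (act (TV G V) g x) = act V g (TV_proj V x)"
   by (rule injD[OF _ pl[OF act_closed[OF T_facts(3)[OF V] g x]] act_closed[OF V g pl[OF x]]])
  have "word V [TV_proj V (coact (TV G V) g x)] = word V [coact V g (TV_proj V x)]"
   using g x T_facts(3)[OF V] by (simp add: f c lc del: One_nat_def)
  then show "TV_proj V (coact (TV G V) g x) = coact V g (TV_proj V x)"
   by (rule injD[OF _ pl[OF coact_closed[OF T_facts(3)[OF V] g x]] coact_closed[OF V g pl[OF x]]])
 qed
qed

end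

section \<open>The braided shuffle multiplication\<close>

text \<open>The coproduct of the tensor product coalgebra T(V)\<otimes>T(V); \<open>counit2\<close>
  is its counit.\<close>

definition dec2 :: "('k::field, 'g, 'v, 'm) cmod => ('k, ('k, 'v) tens_pow, ('k, 'v) tens_pow) tens =>
  ('k, ('k, ('k, 'v) tens_pow, ('k, 'v) tens_pow) tens, ('k, ('k, 'v) tens_pow, ('k, 'v) tens_pow) tens) tens" where
 "dec2 V t = mid_braiding G (TV G V) (TV G V) (TV G V) (TV G V)
  (tmap (TT V) (TT V) (deconcatenation V) (deconcatenation V) t)"

definition counit2 :: "('k::field, 'g, 'v, 'm) cmod => ('k, ('k, 'v) tens_pow, ('k, 'v) tens_pow) tens => 'k" where
 "counit2 V = lin_ext (unit_object G) (%(x, y). TV_counit G V x * TV_counit G V y)"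

text \<open>The prescribed composite of the multiplication of C(V) with the projection to V, written
  as a letter so that it can be multiplied inside T(V).\<close>

definition proj2 :: "('k::field, 'g, 'v, 'm) cmod => ('k, ('k, 'v) tens_pow, ('k, 'v) tens_pow) tens => ('k, 'v) tens_pow" where
 "proj2 V = lin_ext (TV G V) (%(x, y). TV_counit G V y .*(TV G V) word V [TV_proj V x] +.(TV G V)
  TV_counit G V x .*(TV G V) word V [TV_proj V y])"

text \<open>Convolution with \<open>proj2\<close> on T(V)\<otimes>T(V). The target product is
  concatenation, although the map sought is the shuffle product: a tensor is reassembled from its
  first letter and its rest.\<close>

definition shuffle_step :: "('k::field, 'g, 'v, 'm) cmod => (('k, ('k, 'v) tens_pow, ('k, 'v) tens_pow) tens => ('k, 'v) tens_pow) =>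
  ('k, ('k, 'v) tens_pow, ('k, 'v) tens_pow) tens => ('k, 'v) tens_pow" where
 "shuffle_step V H t = tconv (TV G V) (proj2 V) H (dec2 V t)"

text \<open>A multiplication \<open>m\<close> which is a morphism of coalgebras with \<open>TV_proj \<circ> m = proj2\<close> is a fixed point of
 \<open>H \<mapsto> counit2 + shuffle_step H\<close>; on words of total length \<open>n\<close> its value is that of the \<open>(n + 1)\<close>-st iterate.\<close>

fun shuffle_seq :: "('k::field, 'g, 'v, 'm) cmod => nat => ('k, ('k, 'v) tens_pow, ('k, 'v) tens_pow) tens => ('k, 'v) tens_pow" where
 "shuffle_seq V 0 t = 0@(TV G V)"
| "shuffle_seq V (Suc n) t = counit2 V t .*(TV G V) 1@(TV G V) +.(TV G V) shuffle_step V (shuffle_seq V n) t"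

text \<open>The braided shuffle recursion. The first letter of a product comes from the left or the
  right factor; in the second case w has to pass all of v u, an element of degree g k.\<close>

definition is_shuffle :: "('k::field, 'g, 'v, 'm) cmod => (('k, ('k, 'v) tens_pow, ('k, 'v) tens_pow) tens => ('k, 'v) tens_pow) => bool" where
 "is_shuffle V m \<longleftrightarrow> klinear (TT V) (TV G V) m \<and>
  (\<forall>y\<in>carrier (TV G V). m (tpure V 1@(TV G V) y) = y) \<and>
  (\<forall>x\<in>carrier (TV G V). m (tpure V x 1@(TV G V)) = x) \<and>
  (\<forall>g k v u w y. homog V g v \<longrightarrow> homog (TV G V) k u \<longrightarrow> w .: V \<longrightarrow> y .: (TV G V) \<longrightarrow>
   m (tpure V (word V [v] *.(TV G V) u) (word V [w] *.(TV G V) y)) =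
   word V [v] *.(TV G V) m (tpure V u (word V [w] *.(TV G V) y)) +.(TV G V)
   word V [act V (g \<otimes> k) w] *.(TV G V) m (tpure V (word V [v] *.(TV G V) u) y))"

context
 fixes V :: "('k::field, 'g, 'v, 'm) cmod"
 assumes V: "crossed_module G V"
begin

lemma TV_proj_rec:
 shows "TV_proj V 1@(TV G V) = 0@V" (is ?g1) "v .: V ==> TV_proj V (word V [v]) = v" (is "PROP ?g2")
  "[|v .: V; t .: (TV G V)|] ==> TV_proj V (word V [v] *.(TV G V) t) = TV_counit G V t .*V v"
proof -
 note k = T_facts(1)[OF V]
 show ?g1 "PROP ?g2"
  by (simp_all add: TV_fields(1)[OF V] TV_proj(2)[OF V])
 assume v: "v .: V" and t: "t .: (TV G V)"
 have l: "klinear (TV G V) V (%t. TV_counit G V t .*V v)"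
  by (rule klI) (simp_all add: k v klD[OF TV_counit(1)[OF V]] ks_distrib)
 show "TV_proj V (word V [v] *.(TV G V) t) = TV_counit G V t .*V v"
  by (rule TV_eq[OF V kl_comp[OF TV_mult_r[OF V letter(2)[OF V v]] TV_proj(1)[OF V]] l _ t])
   (use v k in \<open>simp add: letter(5)[OF V] TV_proj(2)[OF V] TV_counit(2)[OF V]\<close>)
qed

lemma letter_proj: "klinear (TV G V) (TV G V) (%x. word V [TV_proj V x])"
 by (rule kl_comp[OF TV_proj(1)[OF V] letter(1)[OF V]])

lemma letter_zero: "word V [0@V] = 0@(TV G V)"
 using klD(4)[OF letter(1)[OF V] T_facts(1)[OF V] T_facts(2)[OF V]] .

lemma counit2:
 shows "klinear (TT V) (unit_object G) (counit2 V)" (is ?g1)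
  "[|x .: (TV G V); y .: (TV G V)|] ==> counit2 V (tpure V x y) = TV_counit G V x * TV_counit G V y" (is "PROP ?g2")
proof -
 note e = klD[OF TV_counit(1)[OF V]]
 have b: "kbilinear (TV G V) (TV G V) (unit_object G) (%x y. TV_counit G V x * TV_counit G V y)"
  by (intro kbilI klI) (simp_all add: e algebra_simps)
 show ?g1
  "PROP ?g2"
  unfolding counit2_def using tens_ext[OF T_facts(2)[OF V] T_facts(2)[OF V] b kspace_unit] by simp_all
qed

lemma proj2:
 shows "klinear (TT V) (TV G V) (proj2 V)" (is ?g1)
  "[|x .: (TV G V); y .: (TV G V)|] ==> proj2 V (tpure V x y) =
   TV_counit G V y .*(TV G V) word V [TV_proj V x] +.(TV G V) TV_counit G V x .*(TV G V) word V [TV_proj V y]" (is "PROP ?g2")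
proof -
 note k = T_facts(2)[OF V]
 note e = klD[OF TV_counit(1)[OF V]] and p = klD[OF letter_proj]
 have b: "kbilinear (TV G V) (TV G V) (TV G V) (%x y. TV_counit G V y .*(TV G V) word V [TV_proj V x] +.(TV G V)
  TV_counit G V x .*(TV G V) word V [TV_proj V y])"
  by (intro kbilI klI) (simp_all add: e p k ks_distrib ks_ac mult.commute)
 show ?g1
  "PROP ?g2"
  unfolding proj2_def using tens_ext[OF k k b k] by simp_all
qed

lemma dec2:
 shows "klinear (TT V) ((TT V) ** (TT V)) (dec2 V)" (is ?g1)
  "[|x .: (TV G V); y .: (TV G V)|] ==> dec2 V (tpure V x y) =
   mid_braiding G (TV G V) (TV G V) (TV G V) (TV G V)
    (pure (TT V) (TT V) (deconcatenation V x) (deconcatenation V y))" (is "PROP ?g2")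
proof -
 note k = T_facts(2)[OF V] and c = T_facts(3)[OF V]
 note kTT = kspace_tensor[OF k k]
 note d = dec_word(1)[OF V]
 show ?g1
  unfolding dec2_def[abs_def] by (rule kl_comp[OF kl_tmap[OF k k kTT kTT d d] mid_braiding_props(1)[OF c c c c]])
 show "PROP ?g2"
  by (simp add: dec2_def tmap_pure[OF k k kTT kTT d d])
qed

text \<open>Each coproduct is split by \<open>dec_rec\<close> into the cut before the first letter
  and the remaining cuts; \<open>M1\<close> to \<open>M4\<close> treat the four combinations. Since
  \<open>proj2\<close> vanishes at 1\<otimes>1 and on pairs that both start with a letter,
  \<open>M1\<close> and \<open>M4\<close> are zero. The other two contribute w, moved past the left
  factor, and v.\<close>

lemma shuffle_step_rec:
 assumes H: "klinear (TT V) (TV G V) H"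
 shows "klinear (TT V) (TV G V) (shuffle_step V H)"
  "[|homog V g v; homog (TV G V) k u; w .: V; y .: (TV G V)|] ==>
   shuffle_step V H (tpure V (word V [v] *.(TV G V) u) (word V [w] *.(TV G V) y)) =
   word V [v] *.(TV G V) H (tpure V u (word V [w] *.(TV G V) y)) +.(TV G V)
   word V [act V (g \<otimes> k) w] *.(TV G V) H (tpure V (word V [v] *.(TV G V) u) y)"
  "[|w .: V; y .: (TV G V)|] ==>
   shuffle_step V H (tpure V 1@(TV G V) (word V [w] *.(TV G V) y)) =
   word V [w] *.(TV G V) H (tpure V 1@(TV G V) y)"
  "[|v .: V; u .: (TV G V)|] ==>
   shuffle_step V H (tpure V (word V [v] *.(TV G V) u) 1@(TV G V)) =
   word V [v] *.(TV G V) H (tpure V u 1@(TV G V))"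
  "shuffle_step V H (tpure V 1@(TV G V) 1@(TV G V)) = 0@(TV G V)"
proof -
 let ?T = "TV G V" and ?D = "deconcatenation V" and ?e = "TV_counit G V"
 let ?TT = "?T ** ?T"
 let ?p = "pure ?T ?T"
 let ?pp = "pure ?TT ?TT"
 let ?L = "lin_ext ?T (%(y, z). ?e y .*?T z)"
 note [simp] = T_facts[OF V]
 note k = T_facts(2)[OF V] and c = T_facts(3)[OF V] and A = T_facts(4)[OF V]
 have kTT [simp]: "kspace ?TT" by simp
 note d = dec_word(1)[OF V] and dr = dec_rec[OF V]
 note mid = mid_braiding_props[OF c c c c]
 note tc = tconv_props[OF A kTT kTT proj2(1) H]
 note Hd = klD[OF H] and L = TV_counit_left(1,2)[OF V]
 note e = counit_facts(1,2)[OF V] and ea = chomD(2)[OF ahomD(1)[OF counit_facts(3)[OF V]]]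
 note [simp] = klD(1)[OF d] klD(1)[OF lmult(1)[OF V]] Hd(1) klD(1)[OF L(1)] klD(1)[OF proj2(1)]
  klD(1)[OF letter_proj] letter(2)[OF V]
 show sl: "klinear ?TT ?T (shuffle_step V H)"
  unfolding shuffle_step_def[abs_def] by (rule kl_comp[OF dec2(1) tc(1)])
 define M where "M = (%s t. tconv ?T (proj2 V) H (mid_braiding G ?T ?T ?T ?T (?pp s t)))"
 have Ml: "klinear ?TT ?T (%s. M s t)" if "t .: ?TT" for t
  unfolding M_def by (rule kl_comp[OF kl_comp[OF kl_pure(2)[OF kTT kTT that] mid(1)] tc(1)])
 have Mr: "klinear ?TT ?T (M s)" if "s .: ?TT" for s
  unfolding M_def by (rule kl_comp[OF kl_comp[OF kl_pure(1)[OF kTT kTT that] mid(1)] tc(1)])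
 have Mp: "M (?p a b) (?p x y) = proj2 V (?p a (act ?T l x)) *.?T H (?p b y)"
  if "a .: ?T" "homog ?T l b" "x .: ?T" "y .: ?T" for a b x y l
  unfolding M_def using that homogD[OF that(2)] by (simp add: mid(2) tc(2))
 have st: "shuffle_step V H (?p x y) = M (?D x) (?D y)" if "x .: ?T" "y .: ?T" for x y
  unfolding shuffle_step_def M_def using that by (simp add: dec2(2))
 have q1: "proj2 V (?p 1@?T 1@?T) = 0@?T"
  by (simp add: proj2(2) TV_proj_rec(1) letter_zero)
 have lw: "word V [?e a .*V w] = ?e a .*?T word V [w]" if "w .: V" for a w
  using klD(3)[OF letter(1)[OF V] that] .
 have q2: "proj2 V (?p 1@?T (word V [w] *.?T a)) = ?e a .*?T word V [w]" if "w .: V" "a .: ?T" for w a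
  using that by (simp add: proj2(2) TV_proj_rec letter_zero e lw)
 have q3: "proj2 V (?p (word V [w] *.?T a) 1@?T) = ?e a .*?T word V [w]" if "w .: V" "a .: ?T" for w a
  using that by (simp add: proj2(2) TV_proj_rec letter_zero e lw)
 have q4: "proj2 V (?p (word V [v] *.?T a) (word V [w] *.?T b)) = 0@?T"
  if "v .: V" "w .: V" "a .: ?T" "b .: ?T" for v w a b
  using that by (simp add: proj2(2) e TV_proj_rec V)
 have aw: "act ?T l (word V [w] *.?T a) = word V [act V l w] *.?T act ?T l a"
  if "l .: G" "w .: V" "a .: ?T" for l w a
  using that by (simp add: ba_crossed(1)[OF A] letter(4)[OF V])
 have a1: "act ?T l 1@?T = 1@?T" if "l .: G" for l by (rule ba_crossed(3)[OF A that])
 have M1: "M (?p 1@?T x) (?p 1@?T z) = 0@?T" if x: "x .: ?T" and z: "z .: ?T" for x z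
  using c x
 proof (induction rule: homog_induct)
  case (homog h x)
  then show ?case using z homogD[OF homog] by (simp add: Mp[OF _ homog] a1 q1)
 next
  case (add x y)
  then show ?case using z by (simp add: pure_bilinear klD(2)[OF Ml])
 qed
 \<comment> \<open>The left factor x stays whole, so w passes it and is acted on by the degree h of
   x. The counit contraction then removes everything in front of the rest of the right
   factor.\<close>
 have M2: "M (?p 1@?T x) (lmult V w s) = word V [act V h w] *.?T H (?p x (?L s))"
  if x: "homog ?T h x" and w: "w .: V" and s: "s .: ?TT" for x h w s
 proof -
  note xD [simp] = homogD[OF x]
  have wT: "word V [act V h w] .: ?T" using w V by simp
  show ?thesis
  proof (rule tensor_eq[OF k k kl_comp[OF lmult(1)[OF V w] Mr]
     kl_comp[OF L(1) kl_comp[OF kl_comp[OF kl_pure(1)[OF k k xD(2)] H] TV_mult_r[OF V wT]]] _ s])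
   fix a b assume ab: "a .: ?T" "b .: ?T"
   have ha: "act ?T h a .: ?T" using ab by simp
   show "M (?p 1@?T x) (lmult V w (?p a b)) = word V [act V h w] *.?T H (?p x (?L (?p a b)))"
    using ab w ha V by (simp add: lmult(2)[OF V] Mp[OF _ x] aw q2 ea L(2) pure_bilinear Hd(3))
  qed simp
 qed
 have M3: "M (lmult V v r) (?p 1@?T z) = word V [v] *.?T H (?p (?L r) z)"
  if v: "v .: V" and z: "z .: ?T" and r: "r .: ?TT" for v z r
 proof (rule tensor_homog_eq[OF c c kl_comp[OF lmult(1)[OF V v] Ml]
    kl_comp[OF L(1) kl_comp[OF kl_comp[OF kl_pure(2)[OF k k z] H] TV_mult_r[OF V letter(2)[OF V v]]]] _ r])
  fix g h a b assume "homog ?T g a" and b: "homog ?T h b"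
  then have ab: "a .: ?T" "b .: ?T" "h .: G" by (auto dest: homogD)
  show "M (lmult V v (?p a b)) (?p 1@?T z) = word V [v] *.?T H (?p (?L (?p a b)) z)"
   using ab v z by (simp add: lmult(2)[OF V] Mp[OF _ b] a1 q3 L(2) pure_bilinear Hd(3))
 qed (simp add: z)
 have M4: "M (lmult V v r) (lmult V w s) = 0@?T"
  if v: "v .: V" and w: "w .: V" and r: "r .: ?TT" and s: "s .: ?TT" for v w r s
 proof (rule tensor_homog_eq[OF c c kl_comp[OF lmult(1)[OF V v] Ml] kl_zero[OF k] _ r])
  fix g h a b assume "homog ?T g a" and b: "homog ?T h b"
  then have ab [simp]: "a .: ?T" "b .: ?T" "h .: G" by (auto dest: homogD)
  show "M (lmult V v (?p a b)) (lmult V w s) = 0@?T"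
  proof (rule tensor_eq[OF k k kl_comp[OF lmult(1)[OF V w] Mr] kl_zero[OF k] _ s])
   fix x y assume "x .: ?T" "y .: ?T"
   then show "M (lmult V v (?p a b)) (lmult V w (?p x y)) = 0@?T"
    using v w V by (simp add: lmult(2)[OF V] Mp[OF _ b] aw q4)
  qed (simp add: v)
 qed (simp add: w s)
 have LD: "?L (?D x) = x" if "x .: ?T" for x by (rule deconcatenation_counit(1)[OF V that])
 have Mc [simp]: "M s t .: ?T" if "s .: ?TT" "t .: ?TT" for s t using klD(1)[OF Ml] that by simp
 show "shuffle_step V H (?p (word V [v] *.?T u) (word V [w] *.?T y)) =
   word V [v] *.?T H (?p u (word V [w] *.?T y)) +.?T word V [act V (g \<otimes> k) w] *.?T H (?p (word V [v] *.?T u) y)"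
  if v: "homog V g v" and u: "homog ?T k u" and w: "w .: V" and y: "y .: ?T" for g k
 proof -
  note [simp] = homogD[OF v] homogD[OF u] w y
  have h: "homog ?T (g \<otimes> k) (word V [v] *.?T u)" by (rule ba_crossed(2)[OF A letter(3)[OF V v] u])
  have wg: "word V [act V (g \<otimes> k) w] .: ?T" using V by simp
  show ?thesis
   using wg by (simp add: st dr klD(2)[OF Ml] klD(2)[OF Mr] M1 M2[OF h] M3 M4 LD ks_ac(2)[OF k])
 qed
 show "shuffle_step V H (?p 1@?T (word V [w] *.?T y)) = word V [w] *.?T H (?p 1@?T y)"
  if "w .: V" "y .: ?T"
  using that by (simp add: st dr klD(2)[OF Mr] M1 M2[OF ba_crossed(4)[OF A]] LD crossedD(4)[OF V])
 show "shuffle_step V H (?p (word V [v] *.?T u) 1@?T) = word V [v] *.?T H (?p u 1@?T)"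
  if "v .: V" "u .: ?T"
  using that by (simp add: st dr klD(2)[OF Ml] M1 M3 LD)
 show "shuffle_step V H (?p 1@?T 1@?T) = 0@?T" by (simp add: st dr M1)
qed

text \<open>A function of two words is extended in one variable at a time; induction over the other
  variable gives bilinearity of the iterated extension.\<close>

lemma TV_bilinear_ext:
 assumes M: "kspace M" and f1: "!!xs. xs .:: V ==> kmultilinear V M (f xs)"
  and f2: "!!ys. ys .:: V ==> kmultilinear V M (%xs. f xs ys)"
 shows "\<exists>b. klinear (TT V) M b \<and>
  (\<forall>xs\<in>lists (carrier V). \<forall>ys\<in>lists (carrier V). b (tpure V (word V xs) (word V ys)) = f xs ys)"
proof -
 let ?T = "TV G V"
 note k = T_facts(2)[OF V]
 let ?h = "%xs. lin_ext M (f xs)"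
 note h = TV_lin_ext[OF V M f1]
 have m2: "kmultilinear V M (%xs. ?h xs t)" if t: "t .: ?T" for t
  unfolding kmultilinear_def
 proof (intro conjI ballI)
  show "?h vs t .: M" if "vs .:: V" for vs using klD(1)[OF h(1)[OF that] t] .
  fix as bs assume ab: "as .:: V" "bs .:: V"
  have L: "as @ [v] @ bs .:: V" if "v .: V" for v using ab that by simp
  show "klinear V M (%v. ?h (as @ [v] @ bs) t)"
   using t
  proof (induction rule: TV_word_induct[OF V, consumes 1])
   case (1 a vs)
   have "klinear V M (%v. a .*M f (as @ [v] @ bs) vs)"
    using f2[OF 1] ab by (intro kl_scale M) (simp add: kmultilinear_def)
   then show ?case
    by (rule kl_cong[OF _ T_facts(1)[OF V]]) (simp only: klD(3)[OF h(1)[OF L] word_closed[OF V 1]] h(2)[OF L 1])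
  next
   case (2 s t)
   show ?case
    by (rule kl_cong[OF kl_add[OF 2(3,4) M] T_facts(1)[OF V]]) (rule klD(2)[OF h(1)[OF L] 2(1,2)])
  qed
 qed
 note H = TV_lin_ext[OF V M m2]
 have b: "kbilinear ?T ?T M (%x y. lin_ext M (%xs. ?h xs y) x)"
 proof (rule kbilI)
  show "klinear ?T M (%x. lin_ext M (%xs. ?h xs y) x)" if "y .: ?T" for y using H(1)[OF that] .
  show "klinear ?T M (%y. lin_ext M (%xs. ?h xs y) x)" if "x .: ?T" for x
   using that
  proof (induction rule: TV_word_induct[OF V, consumes 1])
   case (1 a vs)
   show ?case
    by (rule kl_cong[OF kl_scale[OF h(1)[OF 1] M, of a] k])
     (simp only: klD(3)[OF H(1) word_closed[OF V 1]] H(2)[OF _ 1])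
  next
   case (2 s t)
   show ?case by (rule kl_cong[OF kl_add[OF 2(3,4) M] k]) (rule klD(2)[OF H(1) 2(1,2)])
  qed
 qed
 have "lin_ext M (%(x, y). lin_ext M (%xs. ?h xs y) x) (pure ?T ?T (word V xs) (word V ys)) = f xs ys"
  if "xs .:: V" "ys .:: V" for xs ys
  using tens_ext(2)[OF k k b M word_closed[OF V that(1)] word_closed[OF V that(2)]] H(2)[OF word_closed[OF V that(2)] that(1)]
   h(2)[OF that] by simp
 with tens_ext(1)[OF k k b M] show ?thesis by blast
qed

lemma shuffle_seq_linear: "klinear (TT V) (TV G V) (shuffle_seq V n)"
proof (induction n)
 case 0
 have "shuffle_seq V 0 = (%_. 0@(TV G V))" by (rule ext) simp
 then show ?case using kl_zero[OF T_facts(2)[OF V]] by simp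
next
 case (Suc n)
 note k = T_facts(2)[OF V]
 have "klinear (TT V) (TV G V) (%t. counit2 V t .*(TV G V) 1@(TV G V))"
  by (rule klI) (simp_all add: T_facts[OF V] klD[OF counit2(1)] ks_distrib)
 from kl_add[OF this shuffle_step_rec(1)[OF Suc] k]
 have "klinear (TT V) (TV G V)
  (%t. counit2 V t .*(TV G V) 1@(TV G V) +.(TV G V) shuffle_step V (shuffle_seq V n) t)" .
 moreover have "shuffle_seq V (Suc n) = (%t. counit2 V t .*(TV G V) 1@(TV G V) +.(TV G V) shuffle_step V (shuffle_seq V n) t)"
  by (rule ext) simp
 ultimately show ?case by simp
qed

text \<open>On words of total length n the value is that of iterate n + 1 of
  \<open>shuffle_seq\<close>. This index depends on lengths alone, so multilinearity survives. One
  step lowers both the total length and the index by one, so the recursion of the iterates becomes a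
  recursion of a single map.\<close>

lemma shuffle_exists: "\<exists>m. is_shuffle V m"
proof -
 let ?T = "TV G V"
 let ?TT = "?T ** ?T"
 let ?p = "pure ?T ?T"
 note [simp] = T_facts[OF V]
 note k = T_facts(2)[OF V]
 note S = shuffle_seq_linear and stp = shuffle_step_rec[OF shuffle_seq_linear]
 have "\<exists>m. klinear ?TT ?T m \<and> (\<forall>xs\<in>lists (carrier V). \<forall>ys\<in>lists (carrier V). m (?p (word V xs) (word V ys)) =
   shuffle_seq V (Suc (length xs + length ys)) (?p (word V xs) (word V ys)))"
 proof (rule TV_bilinear_ext[OF k])
  show "kmultilinear V ?T (%ys. shuffle_seq V (Suc (length xs + length ys)) (?p (word V xs) (word V ys)))"
   if xs: "xs .:: V" for xs
   unfolding kmultilinear_def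
  proof (intro conjI ballI)
   fix as bs assume ab: "as .:: V" "bs .:: V"
   show "klinear V ?T (%v. shuffle_seq V (Suc (length xs + length (as @ [v] @ bs))) (?p (word V xs) (word V (as @ [v] @ bs))))"
    using kl_comp[OF kl_comp[OF word_linear[OF V ab] kl_pure(1)[OF k k word_closed[OF V xs]]] S] by (simp del: shuffle_seq.simps)
  qed (use klD(1)[OF S] xs word_closed[OF V] in \<open>simp del: shuffle_seq.simps\<close>)
  show "kmultilinear V ?T (%xs. shuffle_seq V (Suc (length xs + length ys)) (?p (word V xs) (word V ys)))"
   if ys: "ys .:: V" for ys
   unfolding kmultilinear_def
  proof (intro conjI ballI)
   fix as bs assume ab: "as .:: V" "bs .:: V"
   show "klinear V ?T (%v. shuffle_seq V (Suc (length (as @ [v] @ bs) + length ys)) (?p (word V (as @ [v] @ bs)) (word V ys)))"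
    using kl_comp[OF kl_comp[OF word_linear[OF V ab] kl_pure(2)[OF k k word_closed[OF V ys]]] S] by (simp del: shuffle_seq.simps)
  qed (use klD(1)[OF S] ys word_closed[OF V] in \<open>simp del: shuffle_seq.simps\<close>)
 qed
 then obtain m where m: "klinear ?TT ?T m" and mw: "!!xs ys. xs .:: V ==> ys .:: V ==>
   m (?p (word V xs) (word V ys)) = shuffle_seq V (Suc (length xs + length ys)) (?p (word V xs) (word V ys))" by blast
 note [simp] = klD(1)[OF m] klD(1)[OF S] klD(1)[OF stp(1)] word_closed[OF V] letter(2)[OF V]
 have step: "m (?p (word V xs) (word V ys)) = (if xs = [] \<and> ys = [] then 1@?T else 0@?T) +.?T
   shuffle_step V (shuffle_seq V (length xs + length ys)) (?p (word V xs) (word V ys))"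
  if "xs .:: V" "ys .:: V" for xs ys
  using that by (simp add: mw counit2(2) TV_counit(2)[OF V])
 have w1: "word V [] = 1@?T" by (simp add: TV_fields(1)[OF V])
 have m00: "m (?p 1@?T 1@?T) = 1@?T" using step[of "[]" "[]"] stp(5)[of 0] by (simp add: w1)
 have ml: "m (?p 1@?T (word V ys)) = word V ys" if "ys .:: V" for ys
  using that
 proof (induction ys)
  case Nil then show ?case by (simp add: w1 m00)
 next
  case (Cons y ys)
  have "m (?p 1@?T (word V (y # ys))) = word V [y] *.?T shuffle_seq V (Suc (length ys)) (?p 1@?T (word V ys))"
   using step[of "[]" "y # ys"] stp(3)[of y "word V ys" "Suc (length ys)"] Cons
   by (simp add: w1 letter(5)[OF V] del: shuffle_seq.simps)
  also have "shuffle_seq V (Suc (length ys)) (?p 1@?T (word V ys)) = word V ys"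
   using mw[of "[]" ys] Cons by (simp add: w1 del: shuffle_seq.simps)
  finally show ?case using Cons by (simp add: letter(5)[OF V])
 qed
 have mr: "m (?p (word V xs) 1@?T) = word V xs" if "xs .:: V" for xs
  using that
 proof (induction xs)
  case Nil then show ?case by (simp add: w1 m00)
 next
  case (Cons x xs)
  have "m (?p (word V (x # xs)) 1@?T) = word V [x] *.?T shuffle_seq V (Suc (length xs)) (?p (word V xs) 1@?T)"
   using step[of "x # xs" "[]"] stp(4)[of x "word V xs" "Suc (length xs)"] Cons
   by (simp add: w1 letter(5)[OF V] del: shuffle_seq.simps)
  also have "shuffle_seq V (Suc (length xs)) (?p (word V xs) 1@?T) = word V xs"
   using mw[of xs "[]"] Cons by (simp add: w1 del: shuffle_seq.simps)
  finally show ?case using Cons by (simp add: letter(5)[OF V])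
 qed
 have rec: "m (?p (word V [v] *.?T u) (word V [w] *.?T y)) =
   word V [v] *.?T m (?p u (word V [w] *.?T y)) +.?T word V [act V (g \<otimes> h) w] *.?T m (?p (word V [v] *.?T u) y)"
  if v: "homog V g v" and u: "homog ?T h u" and w: "w .: V" and y: "y .: ?T" for g h v u w y
 proof -
  note vD [simp] = homogD[OF v] and hG [simp] = homogD(1)[OF u]
  note [simp] = w y
  let ?w' = "word V [act V (g \<otimes> h) w]"
  have w' [simp]: "?w' .: ?T" using V by simp
  note wl = TV_mult_r[OF V letter(2)[OF V vD(2)]] and wl' = TV_mult_r[OF V w'] and ww = TV_mult_r[OF V letter(2)[OF V w]]
  have ws: "m (?p (word V [v] *.?T word V us) (word V [w] *.?T y)) =
   word V [v] *.?T m (?p (word V us) (word V [w] *.?T y)) +.?T ?w' *.?T m (?p (word V [v] *.?T word V us) y)"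
   if us: "list_all2 (homog V) gs us" "gprod gs = h" for gs us
  proof -
   note usL [simp] = list_all2_homogD(1)[OF V us(1)]
   have vus [simp]: "v # us .:: V" by simp
   show ?thesis
   proof (rule TV_eq[OF V kl_comp[OF kl_comp[OF ww kl_pure(1)[OF k k]] m]
      kl_add[OF kl_comp[OF kl_comp[OF kl_comp[OF ww kl_pure(1)[OF k k]] m] wl]
       kl_comp[OF kl_comp[OF kl_pure(1)[OF k k] m] wl'] k] _ y])
    fix ys assume ys: "ys .:: V"
    then have wys: "w # ys .:: V" by simp
    \<comment> \<open>The total length of \<open>v # us\<close> and \<open>w # ys\<close>. The map m
      uses iterate \<open>Suc ?N\<close> on this pair and iterate \<open>?N\<close> on the two pairs
      with one letter removed.\<close>
    let ?N = "Suc (Suc (length us + length ys))"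
    have "m (?p (word V (v # us)) (word V (w # ys))) = shuffle_step V (shuffle_seq V ?N) (?p (word V (v # us)) (word V (w # ys)))"
     using step[OF vus wys] ys by (simp del: shuffle_seq.simps)
    also have "\<dots> = word V [v] *.?T shuffle_seq V ?N (?p (word V us) (word V (w # ys))) +.?T
      ?w' *.?T shuffle_seq V ?N (?p (word V (v # us)) (word V ys))"
     using stp(2)[OF v homog_word[OF V us(1), unfolded us(2)] w word_closed[OF V ys], of ?N] ys
     by (simp add: letter(5)[OF V] del: shuffle_seq.simps)
    also have "shuffle_seq V ?N (?p (word V us) (word V (w # ys))) = m (?p (word V us) (word V (w # ys)))"
     using mw[OF usL wys] by (simp del: shuffle_seq.simps)
    also have "shuffle_seq V ?N (?p (word V (v # us)) (word V ys)) = m (?p (word V (v # us)) (word V ys))"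
     using mw[OF vus ys] by (simp del: shuffle_seq.simps)
    finally show "m (?p (word V [v] *.?T word V us) (word V [w] *.?T word V ys)) =
     word V [v] *.?T m (?p (word V us) (word V [w] *.?T word V ys)) +.?T
     ?w' *.?T m (?p (word V [v] *.?T word V us) (word V ys))"
     using ys by (simp add: letter(5)[OF V])
   qed simp_all
  qed
  note ml' = klD[OF kl_comp[OF kl_pure(2)[OF k k] m]] and wr = klD[OF wl]
  show ?thesis
   using u
  proof (induction rule: homog_TV_induct[OF V, consumes 1])
   case 1
   then show ?case by (simp add: klD(4)[OF wl] klD(4)[OF m] klD(4)[OF wl'])
  next
   case (2 a gs vs)
   note [simp] = list_all2_homogD(1)[OF V 2(1)]
   show ?case using ws[OF 2] by (simp add: wr ml' klD(3)[OF wl'] ks_distrib)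
  next
   case (3 s t)
   have sw [simp]: "word V [v] *.?T m (?p s (word V [w] *.?T y)) .: ?T" "word V [v] *.?T m (?p t (word V [w] *.?T y)) .: ?T"
    using 3 by simp_all
   show ?case using 3 by (simp add: wr ml' klD(2)[OF wl'] ks_ac[OF k])
  qed
 qed
 have "is_shuffle V m"
  unfolding is_shuffle_def
 proof (intro conjI ballI allI impI m rec)
  show "m (?p 1@?T y) = y" if "y .: ?T" for y
   by (rule TV_eq[OF V kl_comp[OF kl_pure(1)[OF k k] m] kl_id ml that]) simp_all
  show "m (?p x 1@?T) = x" if "x .: ?T" for x
   by (rule TV_eq[OF V kl_comp[OF kl_pure(2)[OF k k] m] kl_id mr that]) simp_all
 qed
 then show ?thesis by blast
qed

end

section \<open>Uniqueness and structure of the braided shuffle product\<close>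

context
 fixes V :: "('k::field, 'g, 'v, 'm) cmod"
 assumes V: "crossed_module G V"
begin

text \<open>Double induction on letters, outer on x and inner on y, fitted to
  \<open>is_shuffle\<close>: the two hypotheses of the step concern the pairs with v removed and
  with w removed.\<close>

lemma shuffle_eqI:
 assumes F: "!!y. y .: (TV G V) ==> klinear (TV G V) M (%x. F x y)" "!!x. x .: (TV G V) ==> klinear (TV G V) M (F x)"
  and F': "!!y. y .: (TV G V) ==> klinear (TV G V) M (%x. F' x y)" "!!x. x .: (TV G V) ==> klinear (TV G V) M (F' x)"
  and one: "!!y. y .: (TV G V) ==> F 1@(TV G V) y = F' 1@(TV G V) y"
   "!!x. x .: (TV G V) ==> F x 1@(TV G V) = F' x 1@(TV G V)"
  and step: "!!g k h l v u w y. [|homog V g v; homog (TV G V) k u; homog V h w; homog (TV G V) l y;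
   F u (word V [w] *.(TV G V) y) = F' u (word V [w] *.(TV G V) y);
   F (word V [v] *.(TV G V) u) y = F' (word V [v] *.(TV G V) u) y|] ==>
   F (word V [v] *.(TV G V) u) (word V [w] *.(TV G V) y) = F' (word V [v] *.(TV G V) u) (word V [w] *.(TV G V) y)"
  and x: "x .: (TV G V)" and y: "y .: (TV G V)"
 shows "F x y = F' x y"
proof -
 let ?T = "TV G V"
 have "\<forall>y\<in>carrier ?T. F x y = F' x y"
  using x
 proof (induction rule: TV_letter_induct[OF V, consumes 1])
  case 1 then show ?case using one by blast
 next
  case (2 g k v u)
  have c: "word V [v] *.?T u .: ?T" using homogD(2)[OF 2(1)] homogD(2)[OF 2(2)] letter(2)[OF V] TV_mult_closed[OF V] by blast
  show ?case
  proof
   fix y assume "y .: ?T"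
   then show "F (word V [v] *.?T u) y = F' (word V [v] *.?T u) y"
   proof (induction rule: TV_letter_induct[OF V, consumes 1])
    case 1 then show ?case using one(2)[OF c] .
   next
    case (2 h l w y)
    have "word V [w] *.?T y .: ?T" using homogD(2)[OF 2(1)] homogD(2)[OF 2(2)] letter(2)[OF V] TV_mult_closed[OF V] by blast
    then show ?case using step[OF \<open>homog V g v\<close> \<open>homog ?T k u\<close> 2(1,2)] 2(3) \<open>\<forall>y\<in>carrier ?T. F u y = F' u y\<close> by blast
   next
    case (3 s t)
    then show ?case by (simp add: klD(2)[OF F(2)[OF c]] klD(2)[OF F'(2)[OF c]])
   next
    case (4 a t)
    then show ?case by (simp add: klD(3)[OF F(2)[OF c]] klD(3)[OF F'(2)[OF c]])
   qed
  qed
 next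
  case (3 s t)
  then show ?case by (simp add: klD(2)[OF F(1)] klD(2)[OF F'(1)])
 next
  case (4 a t)
  then show ?case by (simp add: klD(3)[OF F(1)] klD(3)[OF F'(1)])
 qed
 with y show ?thesis by blast
qed

lemma shuffleD:
 assumes "is_shuffle V m"
 shows "klinear (TT V) (TV G V) m" "y .: (TV G V) ==> m (tpure V 1@(TV G V) y) = y"
  "x .: (TV G V) ==> m (tpure V x 1@(TV G V)) = x"
  "[|homog V g v; homog (TV G V) k u; w .: V; y .: (TV G V)|] ==>
   m (tpure V (word V [v] *.(TV G V) u) (word V [w] *.(TV G V) y)) =
   word V [v] *.(TV G V) m (tpure V u (word V [w] *.(TV G V) y)) +.(TV G V)
   word V [act V (g \<otimes> k) w] *.(TV G V) m (tpure V (word V [v] *.(TV G V) u) y)"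
 using assms by (simp_all add: is_shuffle_def)

lemma shuffle_bilinear:
 assumes "klinear (TT V) M m"
 shows "y .: (TV G V) ==> klinear (TV G V) M (%x. m (tpure V x y))" (is "PROP ?g1")
  "x .: (TV G V) ==> klinear (TV G V) M (%y. m (tpure V x y))" (is "PROP ?g2")
proof -
 note k = T_facts(2)[OF V]
 show "PROP ?g1"
  using kl_comp[OF kl_pure(2)[OF k k] assms] .
 show "PROP ?g2"
  using kl_comp[OF kl_pure(1)[OF k k] assms] .
qed

lemma shuffle_unique:
 assumes S: "is_shuffle V m" and S': "is_shuffle V m'" and t: "t .: (TT V)"
 shows "m t = m' t"
proof (rule tensor_eq[OF T_facts(2)[OF V] T_facts(2)[OF V] shuffleD(1)[OF S] shuffleD(1)[OF S'] _ t])
 note b = shuffle_bilinear[OF shuffleD(1)[OF S]] and b' = shuffle_bilinear[OF shuffleD(1)[OF S']]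
 fix x y assume xy: "x .: (TV G V)" "y .: (TV G V)"
 show "m (tpure V x y) = m' (tpure V x y)"
  by (rule shuffle_eqI[OF b b' _ _ _ xy])
   (simp_all add: shuffleD(2,3)[OF S] shuffleD(2,3)[OF S'] shuffleD(4)[OF S] shuffleD(4)[OF S'] homogD(2))
qed

lemma tens_degree_homog_induct [consumes 1, case_names zero word add]:
 assumes t: "t : tens_degree V n" and zero: "P 0@(TV G V)"
  and word: "!!a gs vs. list_all2 (homog V) gs vs ==> length vs = n ==> P (a .*(TV G V) word V vs)"
  and add: "!!s t. [|s .: (TV G V); t .: (TV G V); P s; P t|] ==> P (s +.(TV G V) t)"
 shows "P t"
proof -
 note f = klD[OF TV_filter(1)[OF V]]
 have "P (TV_filter V (%m. m = n) s)" if "s .: (TV G V)" for s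
  using that
 proof (induction rule: TV_homog_word_induct[OF V, consumes 1])
  case (1 a gs vs)
  note D = list_all2_homogD(1)[OF V 1]
  show ?case using word[OF 1] zero word_closed[OF V D] by (simp add: f(3) TV_filter(2)[OF V D] T_facts(2)[OF V])
 next
  case (2 s t) then show ?case by (simp add: f add)
 qed
 moreover have "t .: (TV G V)" using t degree_closed(1)[OF V] by blast
 ultimately show ?thesis using TV_filter_degree[OF V t, of "%m. m = n"] by metis
qed

context
 fixes m assumes S: "is_shuffle V m"
begin

lemma shuffle_act:
 assumes g: "g .: G" and x: "x .: (TV G V)" and y: "y .: (TV G V)"
 shows "act (TV G V) g (m (tpure V x y)) = m (tpure V (act (TV G V) g x) (act (TV G V) g y))"
proof -
 let ?T = "TV G V"
 note [simp] = T_facts[OF V]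
 note m = shuffleD[OF S] and A = T_facts(4)[OF V] and b = shuffle_bilinear[OF shuffleD(1)[OF S]]
 note a = TV_act(1)[OF V g]
 note [simp] = klD(1)[OF m(1)] letter(2)[OF V] V
 show ?thesis
 proof (rule shuffle_eqI[OF kl_comp[OF b(1) a] kl_comp[OF b(2) a] kl_comp[OF a b(1)] kl_comp[OF a b(2)] _ _ _ x y])
  fix f k h l v u w y assume v: "homog V f v" and u: "homog ?T k u" and w: "homog V h w" and y: "homog ?T l y"
   and IH: "act ?T g (m (pure ?T ?T u (word V [w] *.?T y))) = m (pure ?T ?T (act ?T g u) (act ?T g (word V [w] *.?T y)))"
    "act ?T g (m (pure ?T ?T (word V [v] *.?T u) y)) = m (pure ?T ?T (act ?T g (word V [v] *.?T u)) (act ?T g y))"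
  note [simp] = homogD[OF v] homogD[OF u] homogD[OF w] homogD[OF y] g
  have c: "act V g (act V (f \<otimes> k) w) = act V (f \<otimes> k) (act V g w)"
   using crossedD(5)[OF V, of g "f \<otimes> k" w] crossedD(5)[OF V, of "f \<otimes> k" g w] m_comm[of g "f \<otimes> k"] by simp
  show "act ?T g (m (pure ?T ?T (word V [v] *.?T u) (word V [w] *.?T y))) =
   m (pure ?T ?T (act ?T g (word V [v] *.?T u)) (act ?T g (word V [w] *.?T y)))"
   using m(4)[OF homog_intros(2)[OF V v g] homog_intros(2)[OF T_facts(3)[OF V] u g], of "act V g w" "act ?T g y"] IH
   by (simp add: m(4)[OF v u] klD(2)[OF a] ba_crossed(1)[OF A] letter(4)[OF V] c)
 qed (simp_all add: m ba_crossed(3)[OF A g] g)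
qed

text \<open>Length and degree in G are followed together in a double induction on the words. Acting
  on w does not change its degree, and commutativity of G absorbs moving w to the front.\<close>

lemma shuffle_words:
 assumes "list_all2 (homog V) gs us" "list_all2 (homog V) hs ws"
 shows "m (tpure V (word V us) (word V ws)) : tens_degree V (length us + length ws) \<and>
  homog (TV G V) (gprod gs \<otimes> gprod hs) (m (tpure V (word V us) (word V ws)))"
 using assms
proof (induction arbitrary: hs ws)
 case Nil
 note D = list_all2_homogD[OF V Nil]
 show ?case using shuffleD(2)[OF S word_closed[OF V D(1)]] word_degree[OF V D(1) refl] homog_word[OF V Nil] D
  by (simp add: TV_fields(1)[OF V])
next
 case (Cons g gs v us)
 let ?T = "TV G V"
 note m = shuffleD[OF S]
 note T_facts[OF V, simp]
 note vD = homogD[OF Cons(1)] and usD = list_all2_homogD[OF V Cons(2)]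
 have vus: "list_all2 (homog V) (g # gs) (v # us)" using Cons by simp
 have lw: "word V [x] *.?T t : tens_degree V (Suc n)" if "x .: V" "t : tens_degree V n" for x t n
  using degree_mult[OF V word_degree[OF V, of "[x]" 1] that(2)] that(1) by simp
 show ?case
  using Cons.prems
 proof (induction)
  case Nil
  note D = list_all2_homogD[OF V vus]
  show ?case using m(3)[OF word_closed[OF V D(1)]] word_degree[OF V D(1) refl] homog_word[OF V vus] D
   by (simp add: TV_fields(1)[OF V])
 next
  case (Cons h hs w ws)
  note wD = homogD[OF Cons(1)] and wsD = list_all2_homogD[OF V Cons(2)]
  have wws: "list_all2 (homog V) (h # hs) (w # ws)" using Cons by simp
  have eq: "m (pure ?T ?T (word V (v # us)) (word V (w # ws))) =
   word V [v] *.?T m (pure ?T ?T (word V us) (word V (w # ws))) +.?T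
   word V [act V (g \<otimes> gprod gs) w] *.?T m (pure ?T ?T (word V (v # us)) (word V ws))"
   using m(4)[OF \<open>homog V g v\<close> homog_word[OF V \<open>list_all2 (homog V) gs us\<close>] wD(2) word_closed[OF V wsD(1)]] vD usD wD wsD
   by (simp add: letter(5)[OF V])
  note IH1 = \<open>!!hs ws. list_all2 (homog V) hs ws ==> m (pure ?T ?T (word V us) (word V ws)) : tens_degree V (length us + length ws) \<and>
   homog ?T (gprod gs \<otimes> gprod hs) (m (pure ?T ?T (word V us) (word V ws)))\<close>[OF wws]
  have gG: "g \<otimes> gprod gs .: G" using vD usD by simp
  note hc = ba_crossed(2)[OF T_facts(4)[OF V]]
  have 1: "homog ?T (g \<otimes> (gprod gs \<otimes> gprod (h # hs))) (word V [v] *.?T m (pure ?T ?T (word V us) (word V (w # ws))))"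
   by (rule hc[OF letter(3)[OF V \<open>homog V g v\<close>] conjunct2[OF IH1]])
  have 2: "homog ?T (h \<otimes> (gprod (g # gs) \<otimes> gprod hs)) (word V [act V (g \<otimes> gprod gs) w] *.?T m (pure ?T ?T (word V (v # us)) (word V ws)))"
   by (rule hc[OF letter(3)[OF V homog_intros(2)[OF V Cons(1) gG]] conjunct2[OF Cons(3)]])
  have e: "g \<otimes> (gprod gs \<otimes> gprod (h # hs)) = gprod (g # gs) \<otimes> gprod (h # hs)" "h \<otimes> (gprod (g # gs) \<otimes> gprod hs) = gprod (g # gs) \<otimes> gprod (h # hs)"
   using vD usD wD wsD by (simp_all add: m_ac)
  have "word V [v] *.?T m (pure ?T ?T (word V us) (word V (w # ws))) : tens_degree V (length (v # us) + length (w # ws))"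
   using lw[OF vD(2) conjunct1[OF IH1]] by simp
  moreover have "word V [act V (g \<otimes> gprod gs) w] *.?T m (pure ?T ?T (word V (v # us)) (word V ws)) : tens_degree V (length (v # us) + length (w # ws))"
   using lw[OF act_closed[OF V gG wD(2)] conjunct1[OF Cons(3)]] by simp
  ultimately show ?case
   unfolding eq using degree_closed(3)[OF V] homog_intros(3)[OF T_facts(3)[OF V] 1[unfolded e] 2[unfolded e]] by blast
 qed
qed

lemma shuffle_homog:
 assumes x: "homog (TV G V) g x" and y: "homog (TV G V) h y"
 shows "homog (TV G V) (g \<otimes> h) (m (tpure V x y))"
proof -
 let ?T = "TV G V"
 note [simp] = T_facts[OF V]
 note m = shuffleD[OF S]
 note [simp] = homogD[OF x] homogD[OF y]
 note b = shuffle_bilinear[OF m(1)]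
 note hz = homog_intros[OF T_facts(3)[OF V]]
 have 1: "homog ?T (g \<otimes> h) (m (pure ?T ?T (word V us) y))" if us: "list_all2 (homog V) gs us" "gprod gs = g" for gs us
  using y
 proof (induction rule: homog_TV_induct[OF V, consumes 1])
  case 1 then show ?case using list_all2_homogD[OF V us(1)] hz(5) word_closed[OF V] by (simp add: klD(4)[OF m(1)])
 next
  case (2 a hs vs)
  then show ?case using hz(4)[OF conjunct2[OF shuffle_words[OF us(1) 2(1)]]] list_all2_homogD(1)[OF V us(1)] list_all2_homogD(1)[OF V 2(1)] us
   by (simp add: klD(3)[OF b(2)] word_closed[OF V])
 next
  case (3 s t)
  then show ?case using list_all2_homogD(1)[OF V us(1)] hz(3) by (simp add: klD(2)[OF b(2)] word_closed[OF V])
 qed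
 show ?thesis
  using x
 proof (induction rule: homog_TV_induct[OF V, consumes 1])
  case 1 then show ?case using hz(5) by (simp add: klD(4)[OF m(1)])
 next
  case (2 a gs us)
  then show ?case using hz(4)[OF 1[OF 2]] list_all2_homogD(1)[OF V 2(1)] by (simp add: klD(3)[OF b(1)] word_closed[OF V])
 next
  case (3 s t)
  then show ?case using hz(3) by (simp add: klD(2)[OF b(1)])
 qed
qed

lemma shuffle_degree:
 assumes x: "x : tens_degree V i" and y: "y : tens_degree V j"
 shows "m (tpure V x y) : tens_degree V (i + j)"
proof -
 let ?T = "TV G V"
 note [simp] = T_facts[OF V]
 note m = shuffleD[OF S]
 note b = shuffle_bilinear[OF m(1)]
 note cl = degree_closed[OF V]
 have [simp]: "x .: ?T" "y .: ?T" using x y cl(1) by auto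
 have 1: "m (pure ?T ?T (word V us) y) : tens_degree V (i + j)" if us: "list_all2 (homog V) gs us" "length us = i" for gs us
  using y
 proof (induction rule: tens_degree_homog_induct)
  case zero then show ?case using list_all2_homogD[OF V us(1)] cl(2) word_closed[OF V] by (simp add: klD(4)[OF m(1)])
 next
  case (word a hs vs)
  then show ?case using cl(4)[OF conjunct1[OF shuffle_words[OF us(1) word(1)]]] list_all2_homogD(1)[OF V us(1)] list_all2_homogD(1)[OF V word(1)] us
   by (simp add: klD(3)[OF b(2)] word_closed[OF V])
 next
  case (add s t)
  then show ?case using list_all2_homogD(1)[OF V us(1)] cl(3) by (simp add: klD(2)[OF b(2)] word_closed[OF V])
 qed
 show ?thesis
  using x
 proof (induction rule: tens_degree_homog_induct)
  case zero then show ?case using cl(2) by (simp add: klD(4)[OF m(1)])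
 next
  case (word a gs us)
  then show ?case using cl(4)[OF 1[OF word]] list_all2_homogD(1)[OF V word(1)] by (simp add: klD(3)[OF b(1)] word_closed[OF V])
 next
  case (add s t)
  then show ?case using cl(3) by (simp add: klD(2)[OF b(1)])
 qed
qed

lemma shuffle_counit:
 assumes x: "x .: (TV G V)" and y: "y .: (TV G V)"
 shows "TV_counit G V (m (tpure V x y)) = TV_counit G V x * TV_counit G V y"
proof -
 note [simp] = T_facts[OF V] klD(1)[OF shuffleD(1)[OF S]] letter(2)[OF V] V
 note m = shuffleD[OF S] and e = TV_counit(1)[OF V] and b = shuffle_bilinear[OF shuffleD(1)[OF S]]
 have l: "klinear (TV G V) (unit_object G) (%x. TV_counit G V x * c)" "klinear (TV G V) (unit_object G) (%x. c * TV_counit G V x)" for c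
  by (rule klI; simp add: klD[OF e] algebra_simps)+
 show ?thesis
  by (rule shuffle_eqI[OF kl_comp[OF b(1) e] kl_comp[OF b(2) e] l(1) l(2) _ _ _ x y])
   (simp_all add: m counit_facts(1,2)[OF V] homogD klD(2)[OF e])
qed

text \<open>The first letter of a summand survives in V only up to the counit of what follows it.
  When both factors start with a letter, what follows still contains one of these letters and has
  counit 0.\<close>

lemma shuffle_proj:
 assumes x: "x .: (TV G V)" and y: "y .: (TV G V)"
 shows "TV_proj V (m (tpure V x y)) = TV_counit G V y .*V TV_proj V x +.V TV_counit G V x .*V TV_proj V y"
proof -
 note [simp] = T_facts[OF V] klD(1)[OF shuffleD(1)[OF S]] letter(2)[OF V] V klD(1)[OF TV_proj(1)[OF V]]
 note m = shuffleD[OF S] and b = shuffle_bilinear[OF shuffleD(1)[OF S]] and p = TV_proj(1)[OF V]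
 note k = T_facts(1)[OF V] and e = klD[OF TV_counit(1)[OF V]]
 have l: "klinear (TV G V) V (%x. TV_counit G V y .*V TV_proj V x +.V TV_counit G V x .*V TV_proj V y)"
  "klinear (TV G V) V (%x. TV_counit G V x .*V TV_proj V y +.V TV_counit G V y .*V TV_proj V x)" if "y .: (TV G V)" for y
  using that by (intro klI; simp add: e klD[OF p] ks_distrib[OF k] ks_ac[OF k] mult.commute)+
 have cs: "TV_counit G V (m (tpure V x y)) = TV_counit G V x * TV_counit G V y"
  if "x .: (TV G V)" "y .: (TV G V)" for x y by (rule shuffle_counit[OF that])
 show ?thesis
  by (rule shuffle_eqI[OF kl_comp[OF b(1) p] kl_comp[OF b(2) p] l(1) l(2) _ _ _ x y])
   (simp_all add: m counit_facts(1,2)[OF V] homogD klD(2)[OF p] TV_proj_rec[OF V] cs)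
qed

text \<open>\<open>N s t\<close> is the product of s and t in T(V)\<otimes>T(V), with respect to the
  shuffle product. \<open>Na\<close> to \<open>Nd\<close> are its rules on the two parts that
  \<open>dec_rec\<close> produces, \<open>Nd\<close> being the shuffle recursion in the first tensor
  factor. Expanded by these rules, both sides consist of the same five terms.\<close>

lemma shuffle_deconcatenation:
 assumes x: "x .: (TV G V)" and y: "y .: (TV G V)"
 shows "deconcatenation V (m (tpure V x y)) = tmap (TV G V) (TV G V) m m (dec2 V (tpure V x y))"
proof -
 let ?T = "TV G V" and ?D = "deconcatenation V"
 let ?TT = "?T ** ?T"
 let ?p = "pure ?T ?T"
 let ?pp = "pure ?TT ?TT"
 note [simp] = T_facts[OF V]
 note k = T_facts(2)[OF V] and c = T_facts(3)[OF V] and A = T_facts(4)[OF V]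
 have kTT [simp]: "kspace ?TT" by simp
 note d = dec_word(1)[OF V] and dr = dec_rec[OF V]
 note m = shuffleD[OF S] and b = shuffle_bilinear[OF shuffleD(1)[OF S]]
 note mid = mid_braiding_props[OF c c c c]
 note tm = kl_tmap[OF kTT kTT k k m(1) m(1)] tmap_pure[OF kTT kTT k k m(1) m(1)]
 note [simp] = klD(1)[OF d] klD(1)[OF lmult(1)[OF V]] klD(1)[OF m(1)] letter(2)[OF V]
 define N where "N = (%s t. tmap ?T ?T m m (mid_braiding G ?T ?T ?T ?T (?pp s t)))"
 have Nl: "klinear ?TT ?TT (%s. N s t)" if "t .: ?TT" for t
  unfolding N_def by (rule kl_comp[OF kl_comp[OF kl_pure(2)[OF kTT kTT that] mid(1)] tm(1)])
 have Nr: "klinear ?TT ?TT (N s)" if "s .: ?TT" for s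
  unfolding N_def by (rule kl_comp[OF kl_comp[OF kl_pure(1)[OF kTT kTT that] mid(1)] tm(1)])
 have Nc [simp]: "N s t .: ?TT" if "s .: ?TT" "t .: ?TT" for s t using klD(1)[OF Nl] that by simp
 have Np: "N (?p a b) (?p x y) = ?p (m (?p a (act ?T l x))) (m (?p b y))"
  if "a .: ?T" "homog ?T l b" "x .: ?T" "y .: ?T" for a b x y l
  unfolding N_def using that homogD[OF that(2)] by (simp add: mid(2) tm(2))
 have a1: "act ?T l 1@?T = 1@?T" if "l .: G" for l by (rule ba_crossed(3)[OF A that])
 have aw: "act ?T l (word V [w] *.?T a) = word V [act V l w] *.?T act ?T l a"
  if "l .: G" "w .: V" "a .: ?T" for l w a
  using that by (simp add: ba_crossed(1)[OF A] letter(4)[OF V])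
 have N0l: "N (?p 1@?T 1@?T) s = s" if s: "s .: ?TT" for s
 proof (rule tensor_eq[OF k k Nr kl_id _ s])
  fix a b assume "a .: ?T" "b .: ?T"
  then show "N (?p 1@?T 1@?T) (?p a b) = ?p a b" by (simp add: Np[OF _ ba_crossed(4)[OF A]] m crossedD(4)[OF c])
 qed simp
 have N0r: "N s (?p 1@?T 1@?T) = s" if s: "s .: ?TT" for s
 proof (rule tensor_homog_eq[OF c c Nl kl_id _ s])
  fix g h a b assume "homog ?T g a" "homog ?T h b"
  then show "N (?p a b) (?p 1@?T 1@?T) = ?p a b" using homogD[of ?T g a] homogD[of ?T h b] by (simp add: Np[of _ h] m a1)
 qed simp
 have Na: "N (?p 1@?T x) (?p 1@?T z) = ?p 1@?T (m (?p x z))" if "homog ?T h x" "z .: ?T" for x z h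
  using homogD[OF that(1)] that(2) by (simp add: Np[OF _ that(1)] a1 m)
 have Nb: "N (lmult V v r) (?p 1@?T z) = lmult V v (N r (?p 1@?T z))"
  if v: "v .: V" and z: "z .: ?T" and r: "r .: ?TT" for v z r
 proof (rule tensor_homog_eq[OF c c kl_comp[OF lmult(1)[OF V v] Nl] kl_comp[OF Nl lmult(1)[OF V v]] _ r])
  fix g h a b assume "homog ?T g a" and hb: "homog ?T h b"
  then have ab: "a .: ?T" "b .: ?T" "h .: G" by (auto dest: homogD)
  show "N (lmult V v (?p a b)) (?p 1@?T z) = lmult V v (N (?p a b) (?p 1@?T z))"
   using ab v z by (simp add: lmult(2)[OF V] Np[OF _ hb] a1 m)
 qed (use z in simp_all)
 have Nc': "N (?p 1@?T x) (lmult V w s) = lmult V (act V h w) (N (?p 1@?T x) s)"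
  if x: "homog ?T h x" and w: "w .: V" and s: "s .: ?TT" for x h w s
 proof -
  note xD [simp] = homogD[OF x]
  have hw: "act V h w .: V" using w V by simp
  show ?thesis
  proof (rule tensor_eq[OF k k kl_comp[OF lmult(1)[OF V w] Nr] kl_comp[OF Nr lmult(1)[OF V hw]] _ s])
   fix a b assume "a .: ?T" "b .: ?T"
   then show "N (?p 1@?T x) (lmult V w (?p a b)) = lmult V (act V h w) (N (?p 1@?T x) (?p a b))"
    using w hw by (simp add: lmult(2)[OF V] Np[OF _ x] aw m)
  qed simp_all
 qed
 have Nd: "N (lmult V v r) (lmult V w s) = lmult V v (N r (lmult V w s)) +.?TT lmult V (act V (g \<otimes> h) w) (N (lmult V v r) s)"
  if v: "homog V g v" and r: "homog (tensor G ?T ?T) h r" and w: "w .: V" and s: "s .: ?TT" for v g r h w s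
 proof -
  note [simp] = homogD[OF v] w s
  have hG [simp]: "h .: G" and rT: "r .: ?TT" using homogD[OF r] by simp_all
  have w' [simp]: "act V (g \<otimes> h) w .: V" using V by simp
  note co = tensor_coact[OF c c hG]
  note lv = lmult[OF V homogD(2)[OF v]] and lw = lmult[OF V w] and lw' = lmult[OF V w']
  \<comment> \<open>The projection onto degree h is inserted so that the identity is meaningful on
    every homogeneous pure tensor: those of another degree contribute 0, and r itself is
    fixed.\<close>
  have "N (lmult V v (coact (tensor G ?T ?T) h r)) (lmult V w s) = lmult V v (N (coact (tensor G ?T ?T) h r) (lmult V w s)) +.?TT
    lmult V (act V (g \<otimes> h) w) (N (lmult V v (coact (tensor G ?T ?T) h r)) s)"
  proof (rule tensor_homog_eq[OF c c kl_comp[OF kl_comp[OF co(1) lv(1)] Nl]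
     kl_add[OF kl_comp[OF kl_comp[OF co(1) Nl] lv(1)] kl_comp[OF kl_comp[OF kl_comp[OF co(1) lv(1)] Nl] lw'(1)]] _ rT])
   fix \<alpha> \<beta> a b assume a: "homog ?T \<alpha> a" and hb: "homog ?T \<beta> b"
   note [simp] = homogD[OF a] homogD[OF hb]
   show "N (lmult V v (coact (tensor G ?T ?T) h (?p a b))) (lmult V w s) = lmult V v (N (coact (tensor G ?T ?T) h (?p a b)) (lmult V w s)) +.?TT
    lmult V (act V (g \<otimes> h) w) (N (lmult V v (coact (tensor G ?T ?T) h (?p a b))) s)"
   proof (cases "h = \<alpha> \<otimes> \<beta>")
    case False
    then show ?thesis using klD(4)[OF lv(1) kTT kTT] klD(4)[OF lw'(1) kTT kTT] klD(4)[OF Nl kTT kTT]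
     by (simp add: co(2)[OF a hb])
   next
    case True
    have "N (lmult V v (?p a b)) (lmult V w s) = lmult V v (N (?p a b) (lmult V w s)) +.?TT lmult V (act V (g \<otimes> h) w) (N (lmult V v (?p a b)) s)"
    proof (rule tensor_eq[OF k k kl_comp[OF lw(1) Nr] kl_add[OF kl_comp[OF kl_comp[OF lw(1) Nr] lv(1)] kl_comp[OF Nr lw'(1)]] _ s])
     fix x y assume xy: "x .: ?T" "y .: ?T"
     have e: "act V (g \<otimes> \<alpha>) (act V \<beta> w) = act V (g \<otimes> h) w" using crossedD(5)[OF V, of "g \<otimes> \<alpha>" \<beta> w] by (simp add: True m_assoc)
     show "N (lmult V v (?p a b)) (lmult V w (?p x y)) = lmult V v (N (?p a b) (lmult V w (?p x y))) +.?TT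
       lmult V (act V (g \<otimes> h) w) (N (lmult V v (?p a b)) (?p x y))"
      using xy V by (simp add: lmult(2)[OF V] Np[OF _ hb] aw m(4)[OF v a] e pure_bilinear)
    qed simp_all
    moreover have "coact (tensor G ?T ?T) h (?p a b) = ?p a b" using co(2)[OF a hb] True by simp
    ultimately show ?thesis by (simp only:)
   qed
  qed simp_all
  then show ?thesis using r by (simp add: homog_def)
 qed
 have rhs: "tmap ?T ?T m m (dec2 V (?p x y)) = N (?D x) (?D y)" if "x .: ?T" "y .: ?T" for x y
  unfolding N_def using that by (simp add: dec2(2)[OF V])
 have "?D (m (?p x y)) = N (?D x) (?D y)"
 proof (rule shuffle_eqI[OF kl_comp[OF b(1) d] kl_comp[OF b(2) d] kl_comp[OF d Nl] kl_comp[OF d Nr] _ _ _ x y])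
  fix g h k' l v u w y assume v: "homog V g v" and u: "homog ?T h u" and w: "homog V k' w" and y: "homog ?T l y"
   and IH: "?D (m (?p u (word V [w] *.?T y))) = N (?D u) (?D (word V [w] *.?T y))"
    "?D (m (?p (word V [v] *.?T u) y)) = N (?D (word V [v] *.?T u)) (?D y)"
  note [simp] = homogD[OF v] homogD[OF u] homogD[OF w] homogD[OF y] V
  have w' [simp]: "act V (g \<otimes> h) w .: V" by simp
  have vu: "homog ?T (g \<otimes> h) (word V [v] *.?T u)" by (rule ba_crossed(2)[OF A letter(3)[OF V v] u])
  have du: "homog (tensor G ?T ?T) h (?D u)" by (rule chomD(4)[OF deconcatenation_crossed[OF V] u])
  let ?wy = "word V [w] *.?T y" and ?vu = "word V [v] *.?T u" and ?w' = "act V (g \<otimes> h) w"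
  note Lv = klD(2)[OF lmult(1)[OF V homogD(2)[OF v]]] and Lw = klD(2)[OF lmult(1)[OF V w']]
  have "?D (m (?p ?vu ?wy)) = (?p 1@?T (word V [v] *.?T m (?p u ?wy)) +.?TT lmult V v (N (?D u) (?D ?wy))) +.?TT
    (?p 1@?T (word V [?w'] *.?T m (?p ?vu y)) +.?TT lmult V ?w' (N (?D ?vu) (?D y)))"
   unfolding m(4)[OF v u homogD(2)[OF w] homogD(2)[OF y]] IH[symmetric] by (simp add: klD(2)[OF d] dr(2))
  also have "\<dots> = ?p 1@?T (m (?p ?vu ?wy)) +.?TT (lmult V v (N (?D u) (?D ?wy)) +.?TT lmult V ?w' (N (?D ?vu) (?D y)))"
   unfolding m(4)[OF v u homogD(2)[OF w] homogD(2)[OF y]] by (simp add: pure_bilinear ks_ac[OF kTT])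
  also have "lmult V v (N (?D u) (?D ?wy)) = lmult V v (N (?D u) (?p 1@?T ?wy)) +.?TT lmult V v (N (?D u) (lmult V w (?D y)))"
   by (simp add: dr(2) klD(2)[OF Nr] Lv)
  also have "lmult V ?w' (N (?D ?vu) (?D y)) = lmult V ?w' (N (?p 1@?T ?vu) (?D y)) +.?TT lmult V ?w' (N (lmult V v (?D u)) (?D y))"
   by (simp add: dr(2) klD(2)[OF Nl] Lw)
  also have "?p 1@?T (m (?p ?vu ?wy)) +.?TT ((lmult V v (N (?D u) (?p 1@?T ?wy)) +.?TT lmult V v (N (?D u) (lmult V w (?D y)))) +.?TT
    (lmult V ?w' (N (?p 1@?T ?vu) (?D y)) +.?TT lmult V ?w' (N (lmult V v (?D u)) (?D y)))) = N (?D ?vu) (?D ?wy)"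
   by (simp add: dr(2) klD(2)[OF Nl] klD(2)[OF Nr] Na[OF vu] Nb Nc'[OF vu] Nd[OF v du] ks_ac[OF kTT])
  finally show "?D (m (?p ?vu ?wy)) = N (?D ?vu) (?D ?wy)" .
 qed (simp_all add: m dr(1) N0l N0r)
 then show ?thesis using rhs x y by simp
qed

end

end

section \<open>The cofree braided Hopf algebra\<close>

text \<open>\<open>cofree_hopf\<close> before the antipode is attached.\<close>

definition cofree_bialgebra :: "('k::field, 'g, 'v, 'm) cmod => ('k, 'g, ('k, 'v) tens_pow) braided_coalgebra" where
 "cofree_bialgebra V = (cofree_coalgebra G V)\<lparr>monoid.mult := %x y. cofree_mult G V (pure (cofree_coalgebra G V) (cofree_coalgebra G V) x y)\<rparr>"

context
 fixes V :: "('k::field, 'g, 'v, 'm) cmod"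
 assumes V: "crossed_module G V"
begin

lemma cofree_tensor_coalgebra:
 "comult (tensor_coalgebra G (cofree_coalgebra G V) (cofree_coalgebra G V)) = dec2 V"
 "counit (tensor_coalgebra G (cofree_coalgebra G V) (cofree_coalgebra G V)) = counit2 V"
 unfolding tensor_coalgebra_def
 by (simp_all add: fun_eq_iff crossed_module.defs braided_coalgebra.defs dec2_def counit2_def cofree_coalgebra(2,3)[OF V] same_crossed_s[OF cofree_coalgebra(1)[OF V]])

text \<open>Deconcatenation followed by the projection to V reads off the first letter, and
  concatenation puts it back; only the constant term is lost in this and is added separately.
  Prepending v leaves, by the counit axiom, just v times the old tensor.\<close>

lemma TV_reconstruct:
 assumes y: "y .: (TV G V)"
 shows "TV_counit G V y .*(TV G V) 1@(TV G V) +.(TV G V)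
  tconv (TV G V) (%x. word V [TV_proj V x]) (%x. x) (deconcatenation V y) = y"
proof -
 let ?T = "TV G V"
 note k = T_facts(2)[OF V]
 note [simp] = T_facts[OF V] letter(2)[OF V]
 note tc = tconv_props[OF T_facts(4)[OF V] k k letter_proj[OF V] kl_id]
 have o: "1@?T .: ?T" by simp
 have e: "klinear ?T ?T (%y. TV_counit G V y .*?T 1@?T)"
  by (rule klI) (simp_all add: klD[OF TV_counit(1)[OF V]] ks_distrib)
 have lm: "tconv ?T (%x. word V [TV_proj V x]) (%x. x) (lmult V v s) =
   word V [v] *.?T lin_ext ?T (%(y, z). TV_counit G V y .*?T z) s"
  if v: "v .: V" and s: "s .: (?T ** ?T)" for v s
  by (rule tensor_eq[OF k k kl_comp[OF lmult(1)[OF V v] tc(1)]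
     kl_comp[OF TV_counit_left(1)[OF V] TV_mult_r[OF V letter(2)[OF V v]]] _ s])
   (use v in \<open>simp add: lmult(2)[OF V] tc(2) TV_counit_left(2)[OF V] TV_proj_rec[OF V] klD(3)[OF letter(1)[OF V]] ba_simps\<close>)
 show ?thesis
 proof (rule TV_recI[OF V kl_add[OF e kl_comp[OF dec_word(1)[OF V] tc(1)] k] kl_id _ _ y])
  show "TV_counit G V 1@?T .*?T 1@?T +.?T tconv ?T (%x. word V [TV_proj V x]) (%x. x) (deconcatenation V 1@?T) = 1@?T"
   by (simp add: dec_rec[OF V] tc(2) TV_proj_rec[OF V] letter_zero[OF V] counit_facts(1)[OF V])
  fix g h v t assume "homog V g v" "homog ?T h t"
  then have [simp]: "v .: V" "t .: ?T" by (simp_all add: homog_def)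
  show "TV_counit G V (word V [v] *.?T t) .*?T 1@?T +.?T
    tconv ?T (%x. word V [TV_proj V x]) (%x. x) (deconcatenation V (word V [v] *.?T t)) = word V [v] *.?T t"
   using klD(1)[OF dec_word(1)[OF V], of t] klD(1)[OF lmult(1)[OF V], of v]
   by (simp add: dec_rec[OF V] tc(2) TV_proj_rec[OF V] letter_zero[OF V] counit_facts(2)[OF V]
     klD(2)[OF tc(1)] lm deconcatenation_counit[OF V])
 qed
qed

text \<open>Links the characterisation of the product of C(V) to the recursion. From left to right
  it collects the properties of shuffles. Conversely, \<open>TV_reconstruct\<close> at
  \<open>m t\<close> expresses \<open>m t\<close> through \<open>counit2\<close> and
  \<open>shuffle_step V m\<close>, since m respects coproducts and has projection
  \<open>proj2\<close>; then \<open>shuffle_step_rec\<close> is the recursion.\<close>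

lemma is_shuffle_iff:
 "is_shuffle V m \<longleftrightarrow> coalgebra_hom G (tensor_coalgebra G (cofree_coalgebra G V) (cofree_coalgebra G V)) (cofree_coalgebra G V) m \<and>
  (\<forall>x\<in>carrier (TV G V). \<forall>y\<in>carrier (TV G V). TV_proj V (m (tpure V x y)) =
    TV_counit G V y .*V TV_proj V x +.V TV_counit G V x .*V TV_proj V y)" (is "_ \<longleftrightarrow> ?hom \<and> ?proj")
proof -
 let ?T = "TV G V" let ?TT = "?T ** ?T"
 note k = T_facts(2)[OF V] and c = T_facts(3)[OF V] and A = T_facts(4)[OF V]
 note kTT = kspace_tensor[OF k k]
 note [simp] = k c A letter(2)[OF V]
 note d = dec_word(1)[OF V]
 have hom: "?hom \<longleftrightarrow> crossed_hom G (tensor G ?T ?T) ?T m \<and>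
   (\<forall>t\<in>carrier ?TT. deconcatenation V (m t) = tmap ?T ?T m m (dec2 V t) \<and> TV_counit G V (m t) = counit2 V t)"
  by (simp add: coalgebra_hom_def cofree_tensor_coalgebra cofree_coalgebra(2,3)[OF V] same_crossed_s[OF cofree_coalgebra(1)[OF V]])
 show ?thesis
 proof
  assume S: "is_shuffle V m"
  note ml = shuffleD(1)[OF V S]
  have "crossed_hom G (tensor G ?T ?T) ?T m"
   by (rule crossed_hom_tensorI[OF c c c ml])
    (simp_all add: homogD(2) shuffle_act[OF V S] shuffle_homog[OF V S])
  moreover have "deconcatenation V (m t) = tmap ?T ?T m m (dec2 V t)" if t: "t .: ?TT" for t
   by (rule tensor_eq[OF k k kl_comp[OF ml d] kl_comp[OF dec2(1)[OF V] kl_tmap[OF kTT kTT k k ml ml]]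
     shuffle_deconcatenation[OF V S] t])
  moreover have "TV_counit G V (m t) = counit2 V t" if t: "t .: ?TT" for t
   by (rule tensor_eq[OF k k kl_comp[OF ml TV_counit(1)[OF V]] counit2(1)[OF V] _ t])
    (simp add: shuffle_counit[OF V S] counit2(2)[OF V])
  ultimately show "?hom \<and> ?proj" unfolding hom using shuffle_proj[OF V S] by simp
 next
  assume "?hom \<and> ?proj"
  then have m: "crossed_hom G (tensor G ?T ?T) ?T m" "!!t. t .: ?TT ==> deconcatenation V (m t) = tmap ?T ?T m m (dec2 V t)"
   "!!t. t .: ?TT ==> TV_counit G V (m t) = counit2 V t" and p: ?proj unfolding hom by simp_all
  have ml: "klinear ?TT ?T m" using chomD(1)[OF m(1)] by simp
  note [simp] = klD(1)[OF ml]
  note l = letter_proj[OF V]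
  have pm: "word V [TV_proj V (m t)] = proj2 V t" if t: "t .: ?TT" for t
   by (rule tensor_eq[OF k k kl_comp[OF ml l] proj2(1)[OF V] _ t])
    (simp add: p proj2(2)[OF V] klD[OF letter(1)[OF V]] klD(1)[OF TV_proj(1)[OF V]] T_facts(1)[OF V])
  have st: "m t = counit2 V t .*?T 1@?T +.?T shuffle_step V m t" if t: "t .: ?TT" for t
  proof -
   note D2 = klD(1)[OF dec2(1)[OF V] t]
   note c1 = tconv_props[OF A k k l kl_id] and c2 = tconv_props[OF A kTT kTT proj2(1)[OF V] ml]
   have "tconv ?T (%x. word V [TV_proj V x]) (%x. x) (tmap ?T ?T m m (dec2 V t)) = shuffle_step V m t"
    unfolding shuffle_step_def
    by (rule tensor_eq[OF kTT kTT kl_comp[OF kl_tmap[OF kTT kTT k k ml ml] c1(1)] c2(1) _ D2])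
     (simp add: tmap_pure[OF kTT kTT k k ml ml] c1(2) c2(2) pm)
   then show ?thesis using TV_reconstruct[of "m t"] m(2,3)[OF t] t by simp
  qed
  note sr = shuffle_step_rec[OF V ml] and e = counit_facts(1,2)[OF V]
  note mb = shuffle_bilinear[OF V ml]
  have m1: "m (pure ?T ?T 1@?T 1@?T) = 1@?T" using st[of "pure ?T ?T 1@?T 1@?T"] by (simp add: sr counit2(2)[OF V] e)
  show "is_shuffle V m"
   unfolding is_shuffle_def
  proof (intro conjI ml ballI allI impI)
   fix y assume y: "y .: ?T"
   show "m (pure ?T ?T 1@?T y) = y"
   proof (rule TV_recI[OF V mb(2) kl_id m1 _ y])
    fix g h v t assume "homog V g v" "homog ?T h t" and IH: "m (pure ?T ?T 1@?T t) = t"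
    then have "v .: V" "t .: ?T" by (simp_all add: homog_def)
    then show "m (pure ?T ?T 1@?T (word V [v] *.?T t)) = word V [v] *.?T t"
     using st[of "pure ?T ?T 1@?T (word V [v] *.?T t)"] by (simp add: sr counit2(2)[OF V] e IH)
   qed simp
   show "m (pure ?T ?T y 1@?T) = y"
   proof (rule TV_recI[OF V mb(1) kl_id m1 _ y])
    fix g h v t assume "homog V g v" "homog ?T h t" and IH: "m (pure ?T ?T t 1@?T) = t"
    then have "v .: V" "t .: ?T" by (simp_all add: homog_def)
    then show "m (pure ?T ?T (word V [v] *.?T t) 1@?T) = word V [v] *.?T t"
     using st[of "pure ?T ?T (word V [v] *.?T t) 1@?T"] by (simp add: sr counit2(2)[OF V] e IH)
   qed simp
  next
   fix g k v u w y assume v: "homog V g v" and u: "homog ?T k u" and w: "w .: V" and y: "y .: ?T"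
   note [simp] = homogD[OF v] homogD[OF u] w y
   have gw: "act V (g \<otimes> k) w .: V" using V by simp
   show "m (pure ?T ?T (word V [v] *.?T u) (word V [w] *.?T y)) =
   word V [v] *.?T m (pure ?T ?T u (word V [w] *.?T y)) +.?T
   word V [act V (g \<otimes> k) w] *.?T m (pure ?T ?T (word V [v] *.?T u) y)"
    using st[of "pure ?T ?T (word V [v] *.?T u) (word V [w] *.?T y)"] gw
    by (simp add: sr(2)[OF v u] counit2(2)[OF V] e)
  qed
 qed
qed

text \<open>By \<open>is_shuffle_iff\<close> the definite description speaks of shuffle products.
  These exist and agree on the carrier, so a restricted one is the unique witness.\<close>

lemma cofree_mult: "is_shuffle V (cofree_mult G V)"
proof -
 let ?T = "TV G V" let ?TT = "?T ** ?T"
 note k = T_facts(2)[OF V]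
 note [simp] = k T_facts(4)[OF V] letter(2)[OF V]
 obtain m where m: "is_shuffle V m" using shuffle_exists[OF V] by blast
 let ?m = "restrict m (carrier ?TT)"
 note ml = shuffleD(1)[OF V m]
 have ac: "act V g w .: V" if "g .: G" "w .: V" for g w using that V by simp
 have rm: "is_shuffle V ?m"
  unfolding is_shuffle_def
 proof (intro conjI ballI allI impI)
  show "klinear ?TT ?T ?m" by (rule kl_cong[OF ml]) simp_all
 qed (auto simp: shuffleD(2,3)[OF V m] shuffleD(4)[OF V m] homog_def)
 have "cofree_mult G V = (THE m. m : extensional (carrier ?TT) \<and> is_shuffle V m)"
  unfolding is_shuffle_iff cofree_mult_def Let_def by (simp add: cofree_coalgebra(2,3)[OF V] same_crossed_s[OF cofree_coalgebra(1)[OF V]])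
 also have "\<dots> = ?m"
 proof (rule the_equality)
  fix m' assume m': "m' : extensional (carrier ?TT) \<and> is_shuffle V m'"
  show "m' = ?m"
   by (rule extensionalityI[of _ "carrier ?TT"]) (use m' in \<open>simp_all add: shuffle_unique[OF V _ m]\<close>)
 qed (simp add: rm)
 finally show ?thesis using rm by simp
qed

text \<open>Induction on the letters of all three arguments. Both bracketings of three tensors that
  start with letters are sums of three terms, sorted by which of the letters comes first; each term
  is matched by one of the induction hypotheses.\<close>

lemma shuffle_assoc:
 assumes S: "is_shuffle V m" and "x .: (TV G V)" "y .: (TV G V)" "z .: (TV G V)"
 shows "m (tpure V (m (tpure V x y)) z) = m (tpure V x (m (tpure V y z)))"
proof -
 let ?T = "TV G V"
 define s where "s = (%x y. m (pure ?T ?T x y))"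
 have sd: "m (pure ?T ?T x y) = s x y" for x y by (simp add: s_def)
 note A = T_facts(4)[OF V]
 note [simp] = T_facts[OF V] letter(2)[OF V]
 note sl = shuffle_bilinear[OF V shuffleD(1)[OF V S], unfolded sd]
 have sc [simp]: "s x y .: ?T" if "x .: ?T" "y .: ?T" for x y using klD(1)[OF shuffleD(1)[OF V S]] that by (simp add: s_def)
 note s1 [simp] = shuffleD(2,3)[OF V S, unfolded sd] and ss = shuffleD(4)[OF V S, unfolded sd]
  and sh = shuffle_homog[OF V S, unfolded sd]
 note sa = klD(2)[OF sl(1)] klD(2)[OF sl(2)]
 have "\<forall>y\<in>carrier ?T. \<forall>z\<in>carrier ?T. s (s x y) z = s x (s y z)"
  using assms(2)
 proof (induction rule: TV_letter_induct[OF V, consumes 1, case_names one step add scale])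
  case (step g k v u)
  note v = step(1) and u = step(2)
  note [simp] = homogD[OF v] homogD[OF u]
  let ?vu = "word V [v] *.?T u"
  have vu: "homog ?T (g \<otimes> k) ?vu" by (rule ba_crossed(2)[OF A letter(3)[OF V v] u])
  have [simp]: "?vu .: ?T" by simp
  show ?case
  proof (intro ballI)
   fix y z assume yz: "y .: ?T" "z .: ?T"
   show "s (s ?vu y) z = s ?vu (s y z)"
   proof (rule shuffle_eqI[OF V, where F = "%y z. s (s ?vu y) z" and F' = "%y z. s ?vu (s y z)" and M = ?T, OF _ _ _ _ _ _ _ yz])
    fix a assume a: "a .: ?T"
    show "klinear ?T ?T (%x. s (s ?vu x) a)" by (rule kl_comp[OF sl(2) sl(1)]) (simp_all add: a)
    show "klinear ?T ?T (s (s ?vu a))" by (rule sl(2)) (simp add: a)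
    show "klinear ?T ?T (%x. s ?vu (s x a))" by (rule kl_comp[OF sl(1) sl(2)]) (simp_all add: a)
    show "klinear ?T ?T (%x. s ?vu (s a x))" by (rule kl_comp[OF sl(2) sl(2)]) (simp_all add: a)
   next
    fix h l p q w y x z assume w: "homog V h w" and y: "homog ?T l y" and x: "homog V p x" and z: "homog ?T q z"
     and IH: "s (s ?vu y) (word V [x] *.?T z) = s ?vu (s y (word V [x] *.?T z))"
      "s (s ?vu (word V [w] *.?T y)) z = s ?vu (s (word V [w] *.?T y) z)"
    note [simp] = homogD[OF w] homogD[OF y] homogD[OF x] homogD[OF z]
    let ?wy = "word V [w] *.?T y" and ?xz = "word V [x] *.?T z"
    let ?w = "act V (g \<otimes> k) w"
    let ?x = "act V (g \<otimes> (k \<otimes> (h \<otimes> l))) x"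
    have wy: "homog ?T (h \<otimes> l) ?wy" by (rule ba_crossed(2)[OF A letter(3)[OF V w] y])
    have w': "homog V h ?w" by (rule homog_intros(2)[OF V w]) simp
    have x'': "act V (h \<otimes> l) x .: V" "?x .: V" using V by simp_all
    have xx: "act V (g \<otimes> k) (act V (h \<otimes> l) x) = ?x" "act V (h \<otimes> (g \<otimes> k \<otimes> l)) x = ?x"
     using crossedD(5)[OF V, of "g \<otimes> k" "h \<otimes> l" x] by (simp_all add: m_ac)
    note [simp] = homogD(2)[OF w'] x''
    have 1: "s (word V [v] *.?T s u ?wy) ?xz = word V [v] *.?T s (s u ?wy) ?xz +.?T word V [?x] *.?T s (word V [v] *.?T s u ?wy) z"
     using ss[OF v sh[OF u wy]] by simp
    have 2: "s (word V [?w] *.?T s ?vu y) ?xz = word V [?w] *.?T s (s ?vu y) ?xz +.?T word V [?x] *.?T s (word V [?w] *.?T s ?vu y) z"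
     using ss[OF w' sh[OF vu y]] by (simp add: xx)
    have 3: "s ?vu ?wy = word V [v] *.?T s u ?wy +.?T word V [?w] *.?T s ?vu y" by (rule ss[OF v u]) simp_all
    have 4: "s ?wy ?xz = word V [w] *.?T s y ?xz +.?T word V [act V (h \<otimes> l) x] *.?T s ?wy z" by (rule ss[OF w y]) simp_all
    have 5: "s ?vu (word V [w] *.?T s y ?xz) = word V [v] *.?T s u (word V [w] *.?T s y ?xz) +.?T word V [?w] *.?T s ?vu (s y ?xz)"
     by (rule ss[OF v u]) simp_all
    have 6: "s ?vu (word V [act V (h \<otimes> l) x] *.?T s ?wy z) = word V [v] *.?T s u (word V [act V (h \<otimes> l) x] *.?T s ?wy z) +.?T
      word V [?x] *.?T s ?vu (s ?wy z)"
     using ss[OF v u, of "act V (h \<otimes> l) x"] by (simp add: xx)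
    note lin = klD(2)[OF TV_mult_r[OF V letter(2)[OF V]]]
    \<comment> \<open>The summands starting with v, with the moved w and with the moved x. The first
      is settled by the outer hypothesis on u, the others by the two inner ones.\<close>
    have "s (s ?vu ?wy) ?xz = (word V [v] *.?T s (s u ?wy) ?xz +.?T word V [?w] *.?T s (s ?vu y) ?xz) +.?T word V [?x] *.?T s (s ?vu ?wy) z"
     unfolding 3 by (simp add: sa 1 2 lin ks_ac[of ?T])
    also have "\<dots> = (word V [v] *.?T s u (s ?wy ?xz) +.?T word V [?w] *.?T s ?vu (s y ?xz)) +.?T word V [?x] *.?T s ?vu (s ?wy z)"
     using IH step(3) by simp
    also have "\<dots> = s ?vu (s ?wy ?xz)"
     unfolding 4 by (simp add: sa 5 6 lin ks_ac[of ?T])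
    finally show "s (s ?vu ?wy) ?xz = s ?vu (s ?wy ?xz)" .
   qed simp_all
  qed
 qed (simp_all add: sa klD(3)[OF sl(1)])
 with assms show ?thesis by (simp add: s_def)
qed

lemma cofree_bialgebra:
 shows "same_crossed (cofree_bialgebra V) (TV G V)" "comult (cofree_bialgebra V) = deconcatenation V"
  "counit (cofree_bialgebra V) = TV_counit G V" "1@(cofree_bialgebra V) = 1@(TV G V)"
  "x *.(cofree_bialgebra V) y = cofree_mult G V (tpure V x y)"
  "braided_bialgebra G (cofree_bialgebra V)"
proof -
 let ?C = "cofree_bialgebra V" let ?T = "TV G V" let ?TT = "?T ** ?T" let ?m = "cofree_mult G V"
 note S = cofree_mult
 note k = T_facts(2)[OF V] and c = T_facts(3)[OF V] and A = T_facts(4)[OF V]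
 note kTT = kspace_tensor[OF k k]
 note [simp] = k c A
 show s: "same_crossed ?C ?T" and d: "comult ?C = deconcatenation V" and e: "counit ?C = TV_counit G V" and o: "1@?C = 1@?T"
  using cofree_coalgebra(1,2,3,5)[OF V] by (simp_all add: cofree_bialgebra_def same_crossed_def same_space_def)
 show m: "x *.?C y = ?m (pure ?T ?T x y)" for x y
  by (simp add: cofree_bialgebra_def same_crossed_s[OF cofree_coalgebra(1)[OF V]])
 note ss = same_crossed_s[OF s]
 note ml = shuffleD(1)[OF V S] and mb = shuffle_bilinear[OF V shuffleD(1)[OF V S]]
 note [simp] = klD(1)[OF ml] shuffleD(2,3)[OF V S]
 have r: "ring ?C"
 proof (rule ringI)
  show "abelian_group ?C" using k by (intro ks_abelian) (simp add: ss)
  show "Group.monoid ?C"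
   by (rule monoidI) (simp_all add: ss m o shuffle_assoc[OF S])
 qed (simp_all add: ss m klD(2)[OF mb(1)] klD(2)[OF mb(2)])
 have aC: "braided_algebra G ?C"
  by (rule braided_algebraI[OF _ r])
   (simp_all add: ss m o klD(3)[OF mb(1)] klD(3)[OF mb(2)] shuffle_act[OF V S] homogD(2) shuffle_homog[OF V S] ba_crossed[OF A])
 have mm: "mult_map ?C t = ?m t" if t: "t .: ?TT" for t
  by (rule tensor_eq[OF k k _ ml _ t]) (use mult_map_props[OF aC] in \<open>simp_all add: ss m\<close>)
 have mml: "klinear ?TT ?T (mult_map ?C)" using mult_map_props(1)[OF aC] by (simp add: ss)
 have dh: "algebra_hom G ?C (tensor_algebra G ?C ?C) (comult ?C)"
  unfolding algebra_hom_def
 proof (intro conjI ballI)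
  show "crossed_hom G ?C (tensor_algebra G ?C ?C) (comult ?C)" using deconcatenation_crossed[OF V] by (simp add: ss d)
  show "comult ?C 1@?C = 1@(tensor_algebra G ?C ?C)" by (simp add: d o ss ta_mult(3)[OF aC] dec_rec[OF V])
  fix x y assume "x .: ?C" "y .: ?C"
  then have xy: "x .: ?T" "y .: ?T" by (simp_all add: ss)
  have D: "dec2 V (pure ?T ?T x y) .: (?TT ** ?TT)" by (rule klD(1)[OF dec2(1)[OF V]]) (simp add: xy)
  show "comult ?C (x *.?C y) = comult ?C x *.(tensor_algebra G ?C ?C) comult ?C y"
   using shuffle_deconcatenation[OF V S xy] tmap_cong[OF kTT kTT k k ml ml mm mm D] xy
   by (simp add: tensor_algebra_def ss d m dec2(2)[OF V])
 qed
 have eh: "algebra_hom G ?C (unit_object G) (counit ?C)"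
  using counit_facts(3)[OF V] by (simp add: algebra_hom_def ss d e m o shuffle_counit[OF V S])
 have "braided_coalgebra G ?C"
  using cofree_coalgebra(4)[OF V] same_coalgebra[of ?C "cofree_coalgebra G V"] cofree_coalgebra(1,2,3)[OF V]
  by (simp add: cofree_bialgebra_def same_crossed_def same_space_def)
 with aC dh eh show "braided_bialgebra G ?C" by (simp add: braided_bialgebra_def)
qed

lemma cofree_hopf:
 shows "same_crossed (cofree_hopf G V) (TV G V)" (is ?g1) "comult (cofree_hopf G V) = deconcatenation V" (is ?g2)
  "counit (cofree_hopf G V) = TV_counit G V" (is ?g3) "1@(cofree_hopf G V) = 1@(TV G V)" (is ?g4)
  "x *.(cofree_hopf G V) y = cofree_mult G V (tpure V x y)" (is ?g5) "braided_hopf_algebra G (cofree_hopf G V)" (is ?g6)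
  "t : tens_degree V n ==> antipode (cofree_hopf G V) t : tens_degree V n" (is "PROP ?g7")
proof -
 note f = cofree_bialgebra
 note ss = same_crossed_s[OF f(1)]
 have eq: "cofree_hopf G V = add_antipode G (cofree_bialgebra V)"
  by (simp add: cofree_hopf_def cofree_bialgebra_def Let_def)
 obtain s where s: "is_antipode G (cofree_bialgebra V) s" "\<forall>n. \<forall>x\<in>tens_degree V n. s x : tens_degree V n"
  using TV_antipode[OF V f(6) f(1) f(4) f(3)] by (simp add: ss f(2,5) shuffle_degree[OF V cofree_mult] deconcatenation_degree[OF V]) blast
 note a = add_antipode[OF f(6) s(1), folded eq]
 show ?g1 ?g2
  ?g3 ?g4
  ?g5
  using a(1) f(1-4) f(5)[of x y] by (simp_all add: same_bialgebra_def same_algebra_def same_crossed_def same_space_def)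
 show ?g6 by (rule a(2))
 show "PROP ?g7"
  using a(3)[of t] s(2) degree_closed(1)[OF V, of n] by (auto simp: ss)
qed

lemmas cofree_simps = same_crossed_s[OF cofree_hopf(1)] cofree_hopf(2-5)

text \<open>At x\<otimes>1 + 1\<otimes>x the reconstruction formula collapses: 1 projects to 0 in V
  and x has counit 0, which leaves x equal to its own letter. So primitives of C(V) lie in
  V.\<close>

lemma cofree_primitive:
 assumes x: "x .: (TV G V)" and p: "deconcatenation V x = prim_elt (TV G V) x"
 shows "x = word V [TV_proj V x]" "TV_counit G V x = 0"
proof -
 note k = T_facts(2)[OF V]
 note [simp] = T_facts[OF V] letter(2)[OF V]
 note H = cofree_hopf(6)
 have b: "braided_bialgebra G (cofree_hopf G V)" using H by (simp add: braided_hopf_algebra_def)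
 show e: "TV_counit G V x = 0"
  using counit_primitive[OF b, of x] x p by (simp add: cofree_simps prim_elt_def)
 note tc = tconv_props[OF T_facts(4)[OF V] k k letter_proj[OF V] kl_id]
 note pc = klD(1)[OF TV_proj(1)[OF V] x]
 have "tconv (TV G V) (%x. word V [TV_proj V x]) (%x. x) (prim_elt (TV G V) x) = word V [TV_proj V x]"
  using x pc by (simp add: prim_elt_def klD(2)[OF tc(1)] tc(2) TV_proj_rec[OF V] letter_zero[OF V])
 then show "x = word V [TV_proj V x]" using TV_reconstruct[OF x] x pc unfolding p e by simp
qed

end

text \<open>Coproduct and shuffle product are compared along letters. The moved letter matches
  because f preserves degrees and commutes with the action.\<close>

lemma cofree_hopf_map:
 fixes V :: "('k::field, 'g, 'v, 'm) cmod" and W :: "('k, 'g, 'w, 'n) cmod"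
 assumes V: "crossed_module G V" and W: "crossed_module G W" and f: "crossed_hom G V W f"
 shows "hopf_hom G (cofree_hopf G V) (cofree_hopf G W) (TV_map V W f)"
proof -
 let ?T = "TV G V" and ?U = "TV G W" and ?F = "TV_map V W f"
 note [simp] = T_facts[OF V] T_facts[OF W] letter(2)[OF V] letter(2)[OF W]
 note kT = T_facts(2)[OF V] and kU = T_facts(2)[OF W]
 note F = TV_map[OF V W f]
 note F1 = ahomD(2)[OF F(3)] and Fc = ahomD(1)[OF F(3)]
 note [simp] = klD(1)[OF F(1)]
 have fc [simp]: "f v .: W" if "v .: V" for v using klD(1)[OF chomD(1)[OF f] that] .
 note tl = kl_tmap[OF kT kT kU kU F(1) F(1)] and tp = tmap_pure[OF kT kT kU kU F(1) F(1)]
 have d: "deconcatenation W (?F t) = tmap ?U ?U ?F ?F (deconcatenation V t)" if t: "t .: ?T" for t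
 proof (rule TV_recI[OF V kl_comp[OF F(1) dec_word(1)[OF W]] kl_comp[OF dec_word(1)[OF V] tl] _ _ t])
  show "deconcatenation W (?F 1@?T) = tmap ?U ?U ?F ?F (deconcatenation V 1@?T)"
   by (simp add: dec_rec[OF V] dec_rec[OF W] F1 tp)
  fix g h v t assume "homog V g v" "homog ?T h t" and IH: "deconcatenation W (?F t) = tmap ?U ?U ?F ?F (deconcatenation V t)"
  then have [simp]: "v .: V" "t .: ?T" by (simp_all add: homog_def)
  have lm: "lmult W (f v) (tmap ?U ?U ?F ?F s) = tmap ?U ?U ?F ?F (lmult V v s)" if s: "s .: (?T ** ?T)" for s
   by (rule tensor_eq[OF kT kT kl_comp[OF tl lmult(1)[OF W fc]] kl_comp[OF lmult(1)[OF V] tl] _ s])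
    (simp_all add: tp lmult(2)[OF V] lmult(2)[OF W] F(4))
  show "deconcatenation W (?F (word V [v] *.?T t)) = tmap ?U ?U ?F ?F (deconcatenation V (word V [v] *.?T t))"
   using klD(1)[OF dec_word(1)[OF V], of t] klD(1)[OF lmult(1)[OF V], of v]
   by (simp add: dec_rec[OF V] dec_rec[OF W] F(4) F1 tp klD(2)[OF tl] IH lm)
 qed
 have e: "TV_counit G W (?F t) = TV_counit G V t" if t: "t .: ?T" for t
  by (rule TV_recI[OF V kl_comp[OF F(1) TV_counit(1)[OF W]] TV_counit(1)[OF V] _ _ t])
   (simp_all add: F1 counit_facts(1)[OF V] counit_facts(1)[OF W] F(4) counit_facts(2)[OF V] counit_facts(2)[OF W] homogD(2))
 let ?s = "%x y. cofree_mult G V (pure ?T ?T x y)" and ?s' = "%x y. cofree_mult G W (pure ?U ?U x y)"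
 note S = cofree_mult[OF V] and S' = cofree_mult[OF W]
 note mb = shuffle_bilinear[OF V shuffleD(1)[OF V S]] and mb' = shuffle_bilinear[OF W shuffleD(1)[OF W S']]
 note [simp] = klD(1)[OF shuffleD(1)[OF V S]] klD(1)[OF shuffleD(1)[OF W S']]
 note m = shuffleD(2-4)[OF V S] and m' = shuffleD(2-4)[OF W S']
 have mu: "?F (?s x y) = ?s' (?F x) (?F y)" if x: "x .: ?T" and y: "y .: ?T" for x y
 proof (rule shuffle_eqI[OF V kl_comp[OF mb(1) F(1)] kl_comp[OF mb(2) F(1)] kl_comp[OF F(1) mb'(1)] kl_comp[OF F(1) mb'(2)] _ _ _ x y])
  fix g k h l v u w y
  assume v: "homog V g v" and u: "homog ?T k u" and w: "homog V h w" and y: "homog ?T l y"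
   and IH: "?F (?s u (word V [w] *.?T y)) = ?s' (?F u) (?F (word V [w] *.?T y))"
    "?F (?s (word V [v] *.?T u) y) = ?s' (?F (word V [v] *.?T u)) (?F y)"
  note [simp] = homogD[OF v] homogD[OF u] homogD[OF w] homogD[OF y]
  have [simp]: "act V (g \<otimes> k) w .: V" using V by simp
  show "?F (?s (word V [v] *.?T u) (word V [w] *.?T y)) = ?s' (?F (word V [v] *.?T u)) (?F (word V [w] *.?T y))"
   using IH by (simp add: m(3)[OF v u] m'(3)[OF chomD(4)[OF f v] chomD(4)[OF Fc u]] F(4) klD(2)[OF F(1)] chomD(2)[OF f])
 qed (simp_all add: F1 m(1,2) m'(1,2))
 show ?thesis
  using cofree_hopf(6)[OF V] cofree_hopf(6)[OF W] Fc
  by (simp add: hopf_hom_def algebra_hom_def coalgebra_hom_def cofree_simps[OF V] cofree_simps[OF W] F1 mu d e)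
qed

end

section \<open>Quotients and images\<close>

context
 fixes M :: "('k::field, 'a, 'm) vect" and N :: "('k, 'b, 'n) vect" and p :: "'a => 'b"
 assumes M: "kspace M" and N: "carrier N = p ` carrier M"
begin

lemma kspace_transport:
 assumes pa: "!!x y. [|x .: M; y .: M|] ==> p (x +.M y) = p x +.N p y"
  and ps: "!!a x. x .: M ==> p (a .*M x) = a .*N p x" and p0: "p 0@M = 0@N"
 shows "kspace N" "klinear M N p"
proof -
 note [simp] = M
 show "klinear M N p" by (rule klI) (simp_all add: N pa ps)
 show "kspace N"
  by (rule kspaceI; clarsimp simp: N pa[symmetric] ps[symmetric] p0[symmetric] ks_neg[OF M] ks_distrib)
   (simp_all add: ks_ac[OF M])
qed

lemma kl_descend:
 assumes p: "klinear M N p" and h: "klinear M L h" and f: "!!x. x .: M ==> f (p x) = h x"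
 shows "klinear N L f"
 by (rule klI) (auto simp: N klD(2,3)[OF p, symmetric] klD[OF h] f M)

end

context finite_comm_group
begin

lemma crossed_transport:
 fixes M :: "('k::field, 'g, 'a, 'm) cmod" and N :: "('k, 'g, 'b, 'n) cmod"
 assumes M: "crossed_module G M" and N: "carrier N = p ` carrier M" and p: "kspace N" "klinear M N p"
  and pact: "!!g x. [|g .: G; x .: M|] ==> act N g (p x) = p (act M g x)"
  and pco: "!!g x. [|g .: G; x .: M|] ==> coact N g (p x) = p (coact M g x)"
 shows "crossed_module G N" "crossed_hom G M N p"
proof -
 note [simp] = M
 note k = cm_kspace[OF M]
 show "crossed_hom G M N p" using p pact pco by (simp add: crossed_hom_def)
 have a: "klinear N N (act N g)" if "g .: G" for g
  by (rule kl_descend[OF k N p(2) kl_comp[OF crossedD(2)[OF M that] p(2)]]) (simp add: pact that)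
 have c: "klinear N N (coact N g)" if "g .: G" for g
  by (rule kl_descend[OF k N p(2) kl_comp[OF crossedD(3)[OF M that] p(2)]]) (simp add: pco that)
 have s: "(\<Oplus>\<^bsub>N\<^esub>g\<in>carrier G. coact N g (p x)) = p x" if x: "x .: M" for x
 proof -
  have "(\<Oplus>\<^bsub>N\<^esub>g\<in>carrier G. coact N g (p x)) = (\<Oplus>\<^bsub>N\<^esub>g\<in>carrier G. p (coact M g x))"
   by (rule ks_finsum_cong[OF p(1)]) (use x klD(1)[OF p(2)] in \<open>auto simp: pco\<close>)
  also have "\<dots> = p (\<Oplus>\<^bsub>M\<^esub>g\<in>carrier G. coact M g x)" using kl_finsum[OF p(2) k p(1), of "%g. coact M g x" "carrier G"] x by simp
  finally show ?thesis by (simp add: crossedD(7)[OF M x])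
 qed
 show "crossed_module G N"
  unfolding crossed_module_def
 proof (intro conjI ballI p(1) a c)
  fix g h v assume g: "g .: G" and h: "h .: G" and "v .: N"
  then obtain x where x: "x .: M" "v = p x" by (auto simp: N)
  note [simp] = x g h
  show "act N (g \<otimes> h) v = act N g (act N h v)" by (simp add: pact crossedD(5)[OF M])
  show "coact N g (coact N h v) = (if g = h then coact N g v else 0@N)"
   by (simp add: pco crossedD(6)[OF M] klD(4)[OF p(2) k p(1)])
  show "coact N (g \<otimes> h \<otimes> inv g) (act N g v) = act N g (coact N h v)"
   by (simp add: conj_cancel pact pco crossedD(8)[OF M])
 qed (auto simp: N s pact crossedD(4)[OF M])
qed

lemma crossed_descend:
 assumes M: "crossed_module G M" and p: "crossed_hom G M N p" "carrier N = p ` carrier M" and h: "crossed_hom G M L h"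
  and f: "!!x. x .: M ==> f (p x) = h x"
 shows "crossed_hom G N L f"
 unfolding crossed_hom_def
proof (intro conjI ballI)
 show "klinear N L f" by (rule kl_descend[OF cm_kspace[OF M] p(2) chomD(1)[OF p(1)] chomD(1)[OF h] f])
 fix g v assume g: "g .: G" and "v .: N"
 then obtain x where x: "x .: M" "v = p x" by (auto simp: p(2))
 show "f (act N g v) = act L g (f v)" "f (coact N g v) = coact L g (f v)"
  using x g M by (simp_all add: chomD(2,3)[OF p(1), symmetric] chomD(2,3)[OF h] f)
qed

lemma algebra_hom_descend:
 assumes A: "braided_algebra G A" and p: "algebra_hom G A Q p" "carrier Q = p ` carrier A" and h: "algebra_hom G A L h"
  and f: "!!x. x .: A ==> f (p x) = h x"
 shows "algebra_hom G Q L f"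
 unfolding algebra_hom_def
proof (intro conjI ballI)
 show "crossed_hom G Q L f" by (rule crossed_descend[OF ba_simps(2)[OF A] ahomD(1)[OF p(1)] p(2) ahomD(1)[OF h] f])
 show "f 1@Q = 1@L" using f[of "1@A"] A by (simp add: ahomD(2)[OF p(1)] ahomD(2)[OF h])
 fix x y assume "x .: Q" "y .: Q"
 then obtain a b where ab: "a .: A" "b .: A" "x = p a" "y = p b" by (auto simp: p(2))
 then show "f (x *.Q y) = f x *.L f y"
  using A by (simp add: ahomD(3)[OF p(1), symmetric] ahomD(3)[OF h] f)
qed

lemma coalgebra_hom_descend:
 assumes A: "braided_coalgebra G A" and Q: "crossed_module G Q" and L: "crossed_module G L"
  and p: "coalgebra_hom G A Q p" "carrier Q = p ` carrier A" and h: "coalgebra_hom G A L h"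
  and f: "!!x. x .: A ==> f (p x) = h x"
 shows "coalgebra_hom G Q L f"
 unfolding coalgebra_hom_def
proof (intro conjI ballI)
 note cA = coalgD(1)[OF A]
 note kA = cm_kspace[OF cA] and kQ = cm_kspace[OF Q] and kL = cm_kspace[OF L]
 show c: "crossed_hom G Q L f" by (rule crossed_descend[OF cA cohomD(1)[OF p(1)] p(2) cohomD(1)[OF h] f])
 note pl = chomD(1)[OF cohomD(1)[OF p(1)]] and hl = chomD(1)[OF cohomD(1)[OF h]] and fl = chomD(1)[OF c]
 fix x assume "x .: Q"
 then obtain a where a: "a .: A" "x = p a" by (auto simp: p(2))
 have "tmap L L f f (tmap Q Q p p t) = tmap L L h h t" if t: "t .: (A ** A)" for t
  by (rule tensor_eq[OF kA kA kl_comp[OF kl_tmap[OF kA kA kQ kQ pl pl] kl_tmap[OF kQ kQ kL kL fl fl]]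
     kl_tmap[OF kA kA kL kL hl hl] _ t])
   (simp add: tmap_pure[OF kA kA kQ kQ pl pl] tmap_pure[OF kQ kQ kL kL fl fl] tmap_pure[OF kA kA kL kL hl hl] f klD(1)[OF pl])
 then show "comult L (f x) = tmap L L f f (comult Q x)" "counit L (f x) = counit Q x"
  using a cohomD(2,3)[OF h a(1)] coalgD(8)[OF A a(1)] by (simp_all add: cohomD(2,3)[OF p(1)] f)
qed

lemma hhomD:
 assumes "hopf_hom G A B f"
 shows "braided_hopf_algebra G A" "braided_hopf_algebra G B" "algebra_hom G A B f" "coalgebra_hom G A B f" "crossed_hom G A B f" "klinear A B f"
 using assms chomD(1) by (auto simp: hopf_hom_def algebra_hom_def)

lemma hopfD:
 assumes "braided_hopf_algebra G A"
 shows "braided_bialgebra G A" "braided_algebra G A" "braided_coalgebra G A" "crossed_module G A" "kspace A" "is_antipode G A (antipode A)"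
 using assms ba_simps(1,2) by (auto simp: braided_hopf_algebra_def braided_bialgebra_def)

lemma hopf_hom_antipode:
 assumes f: "hopf_hom G A B f" and x: "x .: A"
 shows "f (antipode A x) = antipode B (f x)"
 by (rule hom_antipode[OF hopfD(1)[OF hhomD(1)[OF f]] hopfD(1)[OF hhomD(2)[OF f]] hhomD(3,4)[OF f]
    hopfD(6)[OF hhomD(1)[OF f]] hopfD(6)[OF hhomD(2)[OF f]] x])

text \<open>Values of f are computed on chosen preimages; the inclusion of kernels makes the choice
  irrelevant, and all structure descends along the surjection p.\<close>

lemma hopf_factor:
 assumes p: "hopf_hom G A Q p" "carrier Q = p ` carrier A" and q: "hopf_hom G A L q"
  and ker: "!!x. [|x .: A; p x = 0@Q|] ==> q x = 0@L"
 shows "\<exists>f. hopf_hom G Q L f \<and> (\<forall>x\<in>carrier A. f (p x) = q x)"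
proof -
 note A = hhomD(1)[OF p(1)] and Q = hhomD(2)[OF p(1)] and L = hhomD(2)[OF q]
 note [simp] = hopfD(5)[OF A] hopfD(5)[OF Q] hopfD(5)[OF L]
 note pl = klD[OF hhomD(6)[OF p(1)]] and ql = klD[OF hhomD(6)[OF q]]
 define f where "f c = q (SOME x. x .: A \<and> p x = c)" for c
 have f: "f (p x) = q x" if x: "x .: A" for x
 proof -
  let ?y = "SOME y. y .: A \<and> p y = p x"
  have y: "?y .: A \<and> p ?y = p x" by (rule someI[of _ x]) (simp add: x)
  then have "q (?y +.A (-1) .*A x) = 0@L" using x by (intro ker) (simp_all add: pl ks_neg)
  then show ?thesis using x y by (simp add: f_def ql ks_diff_zero)
 qed
 have "hopf_hom G Q L f"
  unfolding hopf_hom_def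
  using Q L algebra_hom_descend[OF hopfD(2)[OF A] hhomD(3)[OF p(1)] p(2) hhomD(3)[OF q] f]
   coalgebra_hom_descend[OF hopfD(3)[OF A] hopfD(4)[OF Q] hopfD(4)[OF L] hhomD(4)[OF p(1)] p(2) hhomD(4)[OF q] f] by simp
 with f show ?thesis by blast
qed

lemma algebra_hom_tmap:
 assumes A: "braided_algebra G A" and Q: "braided_algebra G Q" and p: "algebra_hom G A Q p"
  and s: "s .: (A ** A)" and t: "t .: (A ** A)"
 shows "tmap Q Q p p (s *.(tensor_algebra G A A) t) = tmap Q Q p p s *.(tensor_algebra G Q Q) tmap Q Q p p t"
proof -
 note kA = ba_simps(1)[OF A] and kQ = ba_simps(1)[OF Q] and cA = ba_simps(2)[OF A] and pl = ahomD(4)[OF p]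
 note [simp] = A Q klD(1)[OF pl]
 note tl = kl_tmap[OF kA kA kQ kQ pl pl] and tp = tmap_pure[OF kA kA kQ kQ pl pl]
 note bA = ta_mult(1)[OF A] and bQ = ta_mult(1)[OF Q]
 show ?thesis
 proof (rule tensor_homog_eq[OF cA cA kl_comp[OF kbilD(2)[OF bA t] tl] kl_comp[OF tl kbilD(2)[OF bQ klD(1)[OF tl t]]] _ s])
  fix g h a b assume a: "homog A g a" and b: "homog A h b"
  note [simp] = homogD[OF a] homogD[OF b]
  have P: "pure A A a b .: (A ** A)" by simp
  show "tmap Q Q p p (pure A A a b *.(tensor_algebra G A A) t) = tmap Q Q p p (pure A A a b) *.(tensor_algebra G Q Q) tmap Q Q p p t"
  proof (rule tensor_eq[OF kA kA kl_comp[OF kbilD(1)[OF bA P] tl] kl_comp[OF tl kbilD(1)[OF bQ klD(1)[OF tl P]]] _ t])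
   fix x y assume "x .: A" "y .: A"
   then show "tmap Q Q p p (pure A A a b *.(tensor_algebra G A A) pure A A x y) =
     tmap Q Q p p (pure A A a b) *.(tensor_algebra G Q Q) tmap Q Q p p (pure A A x y)"
    using cA by (simp add: ta_mult(2)[OF A _ b] ta_mult(2)[OF Q _ chomD(4)[OF ahomD(1)[OF p] b]]
      tp ahomD(3)[OF p] chomD(2)[OF ahomD(1)[OF p]])
  qed
 qed
qed

text \<open>Each axiom of Q is the image under the surjection p of the same axiom of A. Quotients by
  kernels and images of Hopf maps are both handled this way, by checking compatibility of p with the
  operations.\<close>

lemma hopf_transport:
 fixes A :: "('k::field, 'g, 'a, 'm) bhopf" and Q :: "('k, 'g, 'b, 'n) bhopf"
 assumes A: "braided_hopf_algebra G A" and Q: "carrier Q = p ` carrier A" and pl: "kspace Q" "klinear A Q p"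
  and pact: "!!g x. [|g .: G; x .: A|] ==> act Q g (p x) = p (act A g x)"
  and pco: "!!g x. [|g .: G; x .: A|] ==> coact Q g (p x) = p (coact A g x)"
  and pm: "!!x y. [|x .: A; y .: A|] ==> p x *.Q p y = p (x *.A y)" and p1: "1@Q = p 1@A"
  and pd: "!!x. x .: A ==> comult Q (p x) = tmap Q Q p p (comult A x)"
  and pe: "!!x. x .: A ==> counit Q (p x) = counit A x"
  and ps: "!!x. x .: A ==> antipode Q (p x) = p (antipode A x)"
 shows "hopf_hom G A Q p"
proof -
 note aA = hopfD(2)[OF A] and cA = hopfD(3)[OF A] and mA = hopfD(4)[OF A] and kA = hopfD(5)[OF A] and kQ = pl(1)
 note [simp] = aA kQ klD(1)[OF pl(2)]
 have c: "crossed_module G Q" "crossed_hom G A Q p" by (rule crossed_transport[OF mA Q pl]; simp add: pact pco)+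
 note pd2 = klD(2,3)[OF pl(2), symmetric]
 note tl = kl_tmap[OF kA kA kQ kQ pl(2) pl(2)] and tp = tmap_pure[OF kA kA kQ kQ pl(2) pl(2)]
 \<comment> \<open>Any preimage of an element of degree g may be replaced by its component of degree
   g.\<close>
 have lift: "\<exists>a. homog A g a \<and> x = p a" if x: "homog Q g x" for g x
 proof -
  obtain a where a: "a .: A" "x = p a" using homogD(2)[OF x] by (auto simp: Q)
  have "x = p (coact A g a)" using x a pco[of g a] by (simp add: homog_def)
  then show ?thesis using homog_intros(1)[OF mA _ a(1)] homogD(1)[OF x] by blast
 qed
 have hom: "homog Q g (p a)" if "homog A g a" for g a by (rule chomD(4)[OF c(2) that])
 have r: "ring Q"
 proof (rule ringI)
  show "abelian_group Q" by (rule ks_abelian) simp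
  show "Group.monoid Q"
   by (rule monoidI) (auto simp: Q p1 pm ba_ring[OF aA])
 qed (auto simp: Q pd2 pm ba_ring[OF aA])
 have aQ: "braided_algebra G Q"
 proof (rule braided_algebraI[OF c(1) r])
  fix g h k x y assume k: "k .: G" and x: "homog Q g x" and y: "homog Q h y"
  obtain a b where ab: "homog A g a" "x = p a" "homog A h b" "y = p b" using lift[OF x] lift[OF y] by blast
  show "act Q k (x *.Q y) = act Q k x *.Q act Q k y"
   using ab k homogD(2)[OF ab(1)] homogD(2)[OF ab(3)] by (simp add: pm pact ba_crossed(1)[OF aA])
 next
  fix g h x y assume x: "homog Q g x" and y: "homog Q h y"
  obtain a b where ab: "homog A g a" "x = p a" "homog A h b" "y = p b" using lift[OF x] lift[OF y] by blast
  show "homog Q (g \<otimes> h) (x *.Q y)"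
   using hom[OF ba_crossed(2)[OF aA ab(1,3)]] ab homogD(2)[OF ab(1)] homogD(2)[OF ab(3)] by (simp add: pm)
 next
  show "homog Q \<one> 1@Q" using hom[OF ba_crossed(4)[OF aA]] by (simp add: p1)
 qed (auto simp: Q pd2 pm p1 pact ba_simps[OF aA] ba_crossed[OF aA])
 have ah: "algebra_hom G A Q p" using c(2) by (simp add: algebra_hom_def p1 pm)
 have dA: "comult A x .: (A ** A)" if "x .: A" for x by (rule coalgD(8)[OF cA that])
 have dc: "crossed_hom G Q (tensor G Q Q) (comult Q)"
  by (rule crossed_descend[OF mA c(2) Q crossed_hom_comp[OF coalgD(2)[OF cA] crossed_hom_tmap[OF mA mA c(1) c(1) c(2) c(2)]] pd])
 have dl: "klinear Q (Q ** Q) (comult Q)" using chomD(1)[OF dc] by simp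
 have ec: "crossed_hom G Q (unit_object G) (counit Q)"
  by (rule crossed_descend[OF mA c(2) Q coalgD(3)[OF cA] pe])
 have el: "klinear Q (unit_object G) (counit Q)" by (rule chomD(1)[OF ec])
 note dAl = coalgD(7)[OF cA]
 have kAA: "kspace (A ** A)" and kQQ: "kspace (Q ** Q)" using kA by simp_all
 note iA = kl_id[of A] and iQ = kl_id[of Q]
 let ?p2 = "tmap Q Q p p"
 have 1: "tmap (Q ** Q) Q (comult Q) (%y. y) (?p2 t) = tmap (Q ** Q) Q ?p2 p (tmap (A ** A) A (comult A) (%y. y) t)"
  if t: "t .: (A ** A)" for t
  by (rule tensor_eq[OF kA kA kl_comp[OF tl kl_tmap[OF kQ kQ kQQ kQ dl iQ]]
     kl_comp[OF kl_tmap[OF kA kA kAA kA dAl iA] kl_tmap[OF kAA kA kQQ kQ tl pl(2)]] _ t])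
   (simp add: tp tmap_pure[OF kQ kQ kQQ kQ dl iQ] tmap_pure[OF kA kA kAA kA dAl iA] tmap_pure[OF kAA kA kQQ kQ tl pl(2)] pd dA)
 have 2: "tmap Q (Q ** Q) (%y. y) (comult Q) (?p2 t) = tmap Q (Q ** Q) p ?p2 (tmap A (A ** A) (%y. y) (comult A) t)"
  if t: "t .: (A ** A)" for t
  by (rule tensor_eq[OF kA kA kl_comp[OF tl kl_tmap[OF kQ kQ kQ kQQ iQ dl]]
     kl_comp[OF kl_tmap[OF kA kA kA kAA iA dAl] kl_tmap[OF kA kAA kQ kQQ pl(2) tl]] _ t])
   (simp add: tp tmap_pure[OF kQ kQ kQ kQQ iQ dl] tmap_pure[OF kA kA kA kAA iA dAl] tmap_pure[OF kA kAA kQ kQQ pl(2) tl] pd dA)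
 have 3: "tassoc Q Q Q (tmap (Q ** Q) Q ?p2 p t) = tmap Q (Q ** Q) p ?p2 (tassoc A A A t)"
  if t: "t .: ((A ** A) ** A)" for t
  by (rule klinear_tensor3_eq[OF kA kA kA kl_comp[OF kl_tmap[OF kAA kA kQQ kQ tl pl(2)] tassoc_tensor(1)[OF kQ kQ kQ]]
     kl_comp[OF tassoc_tensor(1)[OF kA kA kA] kl_tmap[OF kA kAA kQ kQQ pl(2) tl]] _ t])
   (simp add: tmap_pure[OF kAA kA kQQ kQ tl pl(2)] tp tassoc_tensor(2)[OF kQ kQ kQ] tassoc_tensor(2)[OF kA kA kA] tmap_pure[OF kA kAA kQ kQQ pl(2) tl])
 note eA = counit_lin_ext[OF cA]
 note eQ = counit_ext[OF kQ el]
 have 4: "lin_ext Q (%(y, z). counit Q y .*Q z) (?p2 t) = p (lin_ext A (%(y, z). counit A y .*A z) t)" if t: "t .: (A ** A)" for t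
  by (rule tensor_eq[OF kA kA kl_comp[OF tl eQ(1)] kl_comp[OF eA(1) pl(2)] _ t]) (simp add: tp eQ(2) eA(2) pe klD(3)[OF pl(2)])
 have 5: "lin_ext Q (%(y, z). counit Q z .*Q y) (?p2 t) = p (lin_ext A (%(y, z). counit A z .*A y) t)" if t: "t .: (A ** A)" for t
  by (rule tensor_eq[OF kA kA kl_comp[OF tl eQ(3)] kl_comp[OF eA(3) pl(2)] _ t]) (simp add: tp eQ(4) eA(4) pe klD(3)[OF pl(2)])
 have cQ: "braided_coalgebra G Q"
  unfolding braided_coalgebra_def
 proof (intro conjI ballI c(1) dc ec)
  fix x assume "x .: Q"
  then obtain a where a: "a .: A" and x: "x = p a" by (auto simp: Q)
  have t1: "tmap (A ** A) A (comult A) (%y. y) (comult A a) .: ((A ** A) ** A)"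
   by (rule klD(1)[OF kl_tmap[OF kA kA kAA kA dAl iA] dA[OF a]])
  show "tassoc Q Q Q (tmap (Q ** Q) Q (comult Q) (%y. y) (comult Q x)) = tmap Q (Q ** Q) (%y. y) (comult Q) (comult Q x)"
   using coalgD(4)[OF cA a] a by (simp add: x pd 1[OF dA] 2[OF dA] 3[OF t1])
  show "lin_ext Q (%(y, z). counit Q y .*Q z) (comult Q x) = x" "lin_ext Q (%(y, z). counit Q z .*Q y) (comult Q x) = x"
   using a by (simp_all add: x pd 4[OF dA] 5[OF dA] coalgD(5,6)[OF cA])
 qed
 note dhA = bialgD(3)[OF hopfD(1)[OF A]] and ehA = bialgD(4)[OF hopfD(1)[OF A]]
 have dh: "algebra_hom G Q (tensor_algebra G Q Q) (comult Q)"
  unfolding algebra_hom_def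
 proof (intro conjI ballI)
  show "crossed_hom G Q (tensor_algebra G Q Q) (comult Q)" using dc by simp
  show "comult Q 1@Q = 1@(tensor_algebra G Q Q)"
   using ahomD(2)[OF dhA] by (simp add: p1 pd ta_mult(3)[OF aQ] ta_mult(3)[OF aA] tp)
  fix x y assume "x .: Q" "y .: Q"
  then obtain a b where ab: "a .: A" "b .: A" "x = p a" "y = p b" by (auto simp: Q)
  then show "comult Q (x *.Q y) = comult Q x *.(tensor_algebra G Q Q) comult Q y"
   using algebra_hom_tmap[OF aA aQ ah dA[OF ab(1)] dA[OF ab(2)]] by (simp add: pm pd ahomD(3)[OF dhA])
 qed
 have eh: "algebra_hom G Q (unit_object G) (counit Q)" by (rule algebra_hom_descend[OF aA ah Q ehA pe])
 note sA = hopfD(6)[OF A, unfolded is_antipode_def]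
 have sAl: "klinear A A (antipode A)" using sA by (simp add: chomD(1))
 have "crossed_hom G A Q (%x. p (antipode A x))" using sA crossed_hom_comp[OF _ c(2)] by blast
 from crossed_descend[OF mA c(2) Q this ps] have sc: "crossed_hom G Q Q (antipode Q)" .
 note sl = chomD(1)[OF sc] and mp = mult_map_props
 have 6: "mult_map Q (tmap Q Q (antipode Q) (%y. y) (?p2 t)) = p (mult_map A (tmap A A (antipode A) (%y. y) t))"
  "mult_map Q (tmap Q Q (%y. y) (antipode Q) (?p2 t)) = p (mult_map A (tmap A A (%y. y) (antipode A) t))" if t: "t .: (A ** A)" for t
  by (rule tensor_eq[OF kA kA kl_comp[OF kl_comp[OF tl kl_tmap[OF kQ kQ kQ kQ sl iQ]] mp(1)[OF aQ]]
     kl_comp[OF kl_comp[OF kl_tmap[OF kA kA kA kA sAl iA] mp(1)[OF aA]] pl(2)] _ t],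
    simp add: tp tmap_pure[OF kQ kQ kQ kQ sl iQ] tmap_pure[OF kA kA kA kA sAl iA] mp(2)[OF aQ] mp(2)[OF aA] ps pm klD(1)[OF sAl],
    rule tensor_eq[OF kA kA kl_comp[OF kl_comp[OF tl kl_tmap[OF kQ kQ kQ kQ iQ sl]] mp(1)[OF aQ]]
     kl_comp[OF kl_comp[OF kl_tmap[OF kA kA kA kA iA sAl] mp(1)[OF aA]] pl(2)] _ t],
    simp add: tp tmap_pure[OF kQ kQ kQ kQ iQ sl] tmap_pure[OF kA kA kA kA iA sAl] mp(2)[OF aQ] mp(2)[OF aA] ps pm klD(1)[OF sAl])
 have "is_antipode G Q (antipode Q)"
  unfolding is_antipode_def
 proof (intro conjI sc ballI)
  fix x assume "x .: Q"
  then obtain a where a: "a .: A" and x: "x = p a" by (auto simp: Q)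
  show "mult_map Q (tmap Q Q (antipode Q) (%y. y) (comult Q x)) = counit Q x .*Q 1@Q"
   "mult_map Q (tmap Q Q (%y. y) (antipode Q) (comult Q x)) = counit Q x .*Q 1@Q"
   using a sA by (simp_all add: x pd pe p1 6[OF dA] klD(3)[OF pl(2)])
 qed
 with aQ cQ dh eh have "braided_hopf_algebra G Q" by (simp add: braided_hopf_algebra_def braided_bialgebra_def)
 with A ah c(2) show ?thesis by (simp add: hopf_hom_def coalgebra_hom_def pd pe)
qed

end

section \<open>Kernels, quotients and images of Hopf maps\<close>

lemma UN_const: "s : S ==> (!!a. a : S ==> F a = c) ==> (\<Union>a\<in>S. F a) = c"
 by auto

lemma UN2_const: "s : S ==> t : T ==> (!!a b. a : S ==> b : T ==> F a b = c) ==> (\<Union>a\<in>S. \<Union>b\<in>T. F a b) = c"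
 by auto

context finite_comm_group
begin

lemma antipode_linear: "braided_hopf_algebra G A ==> klinear A A (antipode A)"
 using hopfD(6)[of A] chomD(1)[of A A "antipode A"] by (simp add: is_antipode_def)

text \<open>Cosets of the kernel are the fibres of f. Hence the operations of
  \<open>crossed_quotient\<close>, unions over representatives, run over equal cosets.\<close>

lemma quotient_kernel:
 fixes M :: "('k::field, 'g, 'a, 'm) cmod" and N :: "('k, 'g, 'b, 'n) cmod"
 assumes M: "crossed_module G M" and N: "kspace N" and f: "crossed_hom G M N f" and U: "U = {x : carrier M. f x = 0@N}"
 shows "carrier (crossed_quotient M U) = (%x. U +>\<^bsub>M\<^esub> x) ` carrier M"
  "x .: M ==> U +>\<^bsub>M\<^esub> x = {y : carrier M. f y = f x}" (is "PROP ?g1")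
  "kspace (crossed_quotient M U)" "crossed_hom G M (crossed_quotient M U) (%x. U +>\<^bsub>M\<^esub> x)" "crossed_module G (crossed_quotient M U)"
  "[|x .: M; y .: M|] ==> U +>\<^bsub>M\<^esub> x = U +>\<^bsub>M\<^esub> y \<longleftrightarrow> f x = f y"
proof -
 let ?Q = "crossed_quotient M U" and ?p = "%x. U +>\<^bsub>M\<^esub> x"
 note [simp] = M N
 note k = cm_kspace[OF M]
 note fl = chomD(1)[OF f]
 note fD = klD[OF fl] and [simp] = klD(1)[OF fl]
 have f0: "f 0@M = 0@N" by (rule fD(4)[OF k N])
 have cs: "?p x = {y : carrier M. f y = f x}" if x: "x .: M" for x
 proof -
  have "y : ?p x" if y: "y .: M" "f y = f x" for y
  proof -
   have "y +.M (-1) .*M x : U" using x y by (simp add: U fD ks_neg)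
   moreover have "y = (y +.M (-1) .*M x) +.M x" using ks_add_diff(2)[OF k y(1) x] by simp
   ultimately show ?thesis unfolding a_r_coset_def' by blast
  qed
  moreover have "?p x \<subseteq> {y : carrier M. f y = f x}" using x by (auto simp: a_r_coset_def' U fD)
  ultimately show ?thesis by blast
 qed
 then show "PROP ?g1" .
 show eq: "?p x = ?p y \<longleftrightarrow> f x = f y" if "x .: M" "y .: M" for x y
  unfolding cs[OF that(1)] cs[OF that(2)] using that by (auto simp: set_eq_iff)
 have un: "(\<Union>v\<in>?p x. ?p (h v)) = ?p (h x)" if x: "x .: M" and h: "!!y. y .: M ==> h y .: M"
   "!!y. y .: M ==> f y = f x ==> f (h y) = f (h x)" for x h
 proof -
  have "?p (h v) = ?p (h x)" if "v : ?p x" for v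
  proof -
   have v: "v .: M" "f v = f x" using that x by (simp_all add: cs)
   show ?thesis using eq[OF h(1)[OF v(1)] h(1)[OF x]] h(2)[OF v] by simp
  qed
  moreover have "x : ?p x" using x by (simp add: cs)
  ultimately show ?thesis by (rule UN_const[rotated])
 qed
 show Q: "carrier ?Q = ?p ` carrier M" by (auto simp: crossed_quotient_def FactRing_def A_RCOSETS_def')
 have z: "0@?Q = ?p 0@M" by (simp add: crossed_quotient_def FactRing_def cs[OF ks_closed(1)[OF k]] f0 flip: U)
 have s: "a .*?Q ?p x = ?p (a .*M x)" if "x .: M" for a x
  using un[OF that, of "%x. a .*M x"] that by (simp add: crossed_quotient_def fD)
 have ac: "act ?Q g (?p x) = ?p (act M g x)" if "g .: G" "x .: M" for g x
  using un[OF that(2), of "act M g"] that by (simp add: crossed_quotient_def chomD(2)[OF f])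
 have co: "coact ?Q g (?p x) = ?p (coact M g x)" if "g .: G" "x .: M" for g x
  using un[OF that(2), of "coact M g"] that by (simp add: crossed_quotient_def chomD(3)[OF f])
 have ad: "?p (x +.M y) = ?p x +.?Q ?p y" if x: "x .: M" and y: "y .: M" for x y
 proof -
  have "?p x +.?Q ?p y = (\<Union>a\<in>?p x. \<Union>b\<in>?p y. {a +.M b})" by (simp add: crossed_quotient_def FactRing_def set_add_def')
  also have "\<dots> = {u : carrier M. f u = f (x +.M y)}"
  proof (intro equalityI subsetI)
   fix u assume u: "u : {u : carrier M. f u = f (x +.M y)}"
   have xp: "x : ?p x" using x by (simp add: cs)
   have "f (u +.M (-1) .*M x) = f y" using u x y ks_ac[OF N, of "f x" "f y"] by (simp add: fD ks_neg ks_ac(1))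
   then have "u +.M (-1) .*M x : ?p y" using u x y by (simp add: cs)
   moreover have "u = x +.M (u +.M (-1) .*M x)" using ks_add_diff(1)[OF k _ x, of u] u by simp
   ultimately show "u : (\<Union>a\<in>?p x. \<Union>b\<in>?p y. {a +.M b})" using xp by blast
  qed (use x y in \<open>auto simp: cs fD\<close>)
  finally show ?thesis using x y by (simp add: cs)
 qed
 note t = kspace_transport[OF k Q ad s[symmetric] z[symmetric]]
 show "kspace ?Q" by (rule t) simp_all
 have pl: "klinear M ?Q ?p" by (rule t) simp_all
 show "crossed_module G ?Q" "crossed_hom G M ?Q ?p" by (rule crossed_transport[OF M Q \<open>kspace ?Q\<close> pl]; simp add: ac co)+
qed

text \<open>The coproduct is the point. Take s from \<open>generalized_inverse\<close> and let e be
  s after f. Each y - e y lies in the kernel K, so t - (e\<otimes>e) t lies in K\<otimes>A +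
  A\<otimes>K for every t. For x in K the image of its coproduct under e\<otimes>e is s\<otimes>s
  applied to the coproduct of f x = 0.\<close>

lemma hopf_ideal_kernel:
 assumes h: "hopf_hom G A C f"
 shows "hopf_ideal G A (a_kernel A C f)"
proof -
 note A = hhomD(1)[OF h] and C = hhomD(2)[OF h] and fl = hhomD(6)[OF h]
 note kA = hopfD(5)[OF A] and kC = hopfD(5)[OF C] and mA = hopfD(4)[OF A] and mC = hopfD(4)[OF C]
 note aA = hopfD(2)[OF A] and aC = hopfD(2)[OF C] and dA = coalgD(8)[OF hopfD(3)[OF A]]
 note [simp] = kA kC mA mC
 note fD = klD[OF fl] and fc = chomD[OF hhomD(5)[OF h]]
 let ?K = "{x : carrier A. f x = 0@C}"
 have K: "a_kernel A C f = ?K" by (rule a_kernel_def')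
 have z: "act C g 0@C = 0@C" "coact C g 0@C = 0@C" if "g .: G" for g
  using klD(4)[OF crossedD(2)[OF mC that] kC kC] klD(4)[OF crossedD(3)[OF mC that] kC kC] .
 have "crossed_submodule G A ?K"
  by (auto simp: crossed_submodule_def submodule_iff[OF kA] fD fc z)
 moreover have "ideal ?K A"
 proof -
  have "ring_hom_ring A C f"
   by (rule ring_hom_ringI)
    (use balgD(2)[OF aA] balgD(2)[OF aC] fD ahomD(2,3)[OF hhomD(3)[OF h]] in auto)
  then show ?thesis using ring_hom_ring.kernel_is_ideal[of A C f] K by simp
 qed
 moreover have "comult A x : lspan (A ** A) ({pure A A y z |y z. y : ?K \<and> z .: A} \<union> {pure A A y z |y z. y .: A \<and> z : ?K})"
  (is "_ : lspan ?AA ?X") if x: "x : ?K" for x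
 proof -
  have kAA: "kspace ?AA" and kCC: "kspace (C ** C)" by simp_all
  have X: "?X \<subseteq> carrier ?AA" by auto
  note L = submodule_lspan[OF kAA X, unfolded submodule_iff[OF kAA]]
  obtain s where s: "klinear C A s" "!!x. x .: A ==> f (s (f x)) = f x" using generalized_inverse[OF kA kC fl] by blast
  note e = kl_comp[OF fl s(1)]
  note te = kl_tmap[OF kA kA kA kA e e] and tep = tmap_pure[OF kA kA kA kA e e]
  have 1: "t +.?AA (-1) .*?AA tmap A A (%x. s (f x)) (%x. s (f x)) t : lspan ?AA ?X" if "t .: ?AA" for t
   using that
  proof (induction rule: tensor_induct[OF kA kA, consumes 1, case_names pure add])
   case (pure y z)
   let ?y = "y +.A (-1) .*A s (f y)" and ?z = "z +.A (-1) .*A s (f z)"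
   note [simp] = pure klD(1)[OF e]
   have "?y : ?K" "?z : ?K" using s(2) by (simp_all add: fD ks_neg[OF kC])
   then have "pure A A ?y z : lspan ?AA ?X" "pure A A (s (f y)) ?z : lspan ?AA ?X"
    using pure(2) klD(1)[OF e pure(1)] by (blast intro: lspan_base)+
   \<comment> \<open>Telescoping: y\<otimes>z - e y\<otimes>e z = (y - e y)\<otimes>z + e
     y\<otimes>(z - e z).\<close>
   moreover have "pure A A y z +.?AA (-1) .*?AA pure A A (s (f y)) (s (f z)) = pure A A ?y z +.?AA pure A A (s (f y)) ?z"
    by (simp add: pure_bilinear ks_ac(1)[OF kAA]) (simp add: ks_ac(3)[OF kAA] ks_neg[OF kAA] ks_ac(1)[OF kAA, symmetric])
   ultimately show ?case using L by (simp add: tep)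
  next
   case (add u t)
   note [simp] = add(1,2) klD(1)[OF te]
   let ?e = "tmap A A (%x. s (f x)) (%x. s (f x))"
   have "(u +.?AA t) +.?AA (-1) .*?AA ?e (u +.?AA t) = (u +.?AA (-1) .*?AA ?e u) +.?AA (t +.?AA (-1) .*?AA ?e t)"
    by (simp add: klD(2)[OF te] ks_distrib(1)[OF kAA] ks_ac[OF kAA])
   then show ?case using add(3,4) L by simp
  qed
  have xA: "x .: A" "f x = 0@C" using x by simp_all
  note ts = kl_tmap[OF kC kC kA kA s(1) s(1)] and tf = kl_tmap[OF kA kA kC kC fl fl]
  have "tmap A A (%x. s (f x)) (%x. s (f x)) (comult A x) = tmap A A s s (tmap C C f f (comult A x))"
   by (rule tensor_eq[OF kA kA te kl_comp[OF tf ts] _ dA[OF xA(1)]])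
    (simp add: tep tmap_pure[OF kA kA kC kC fl fl] tmap_pure[OF kC kC kA kA s(1) s(1)] fD(1))
  also have "\<dots> = tmap A A s s (comult C 0@C)" using cohomD(2)[OF hhomD(4)[OF h] xA(1)] xA(2) by simp
  also have "\<dots> = 0@?AA" using klD(4)[OF coalgD(7)[OF hopfD(3)[OF C]] kC kCC] klD(4)[OF ts kCC kAA] by simp
  finally show ?thesis using 1[OF dA[OF xA(1)]] dA[OF xA(1)] by simp
 qed
 moreover have "counit A x = 0" "antipode A x : ?K" if x: "x : ?K" for x
 proof -
  have xA: "x .: A" "f x = 0@C" using x by simp_all
  show "counit A x = 0" using cohomD(3)[OF hhomD(4)[OF h] xA(1)] xA(2) counit_props(3)[OF hopfD(3)[OF C]] by simp
  note klD(4)[OF antipode_linear[OF C] kC kC] klD(1)[OF antipode_linear[OF A] xA(1)]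
  then show "antipode A x : ?K" using hopf_hom_antipode[OF h xA(1)] xA(2) by simp
 qed
 ultimately show ?thesis unfolding hopf_ideal_def K by blast
qed

text \<open>The coproduct of a coset is well defined since p\<otimes>p factors through f\<otimes>f
  (\<open>fac\<close>, by a generalised inverse), and f\<otimes>f of the coproduct of x depends on f
  x only.\<close>

lemma quotient_hopf:
 assumes h: "hopf_hom G A C f"
 defines "K \<equiv> a_kernel A C f"
 shows "hopf_hom G A (quotient_hopf A K) (%x. K +>\<^bsub>A\<^esub> x)" "carrier (quotient_hopf A K) = (%x. K +>\<^bsub>A\<^esub> x) ` carrier A"
  "x .: A ==> K +>\<^bsub>A\<^esub> x = 0@(quotient_hopf A K) \<longleftrightarrow> f x = 0@C"
proof -
 note A = hhomD(1)[OF h] and C = hhomD(2)[OF h] and fl = hhomD(6)[OF h]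
 note kA = hopfD(5)[OF A] and kC = hopfD(5)[OF C] and mA = hopfD(4)[OF A] and aA = hopfD(2)[OF A]
 note dA = coalgD(8)[OF hopfD(3)[OF A]]
 let ?Q' = "crossed_quotient A K" and ?Q = "quotient_hopf A K" and ?p = "%x. K +>\<^bsub>A\<^esub> x"
 have K: "K = {x : carrier A. f x = 0@C}" unfolding K_def by (rule a_kernel_def')
 note q = quotient_kernel[OF mA kC hhomD(5)[OF h] K]
 have s: "same_algebra ?Q ?Q'" and d: "comult ?Q c = the_elem ((%x. tmap ?Q' ?Q' ?p ?p (comult A x)) ` c)"
  and e: "counit ?Q c = the_elem (counit A ` c)" and an: "antipode ?Q c = the_elem ((%x. ?p (antipode A x)) ` c)" for c
  by (simp_all add: quotient_hopf_def Let_def crossed_module.defs same_algebra_def same_crossed_def same_space_def)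
 note ss = same_algebra_simps[OF s]
 show Q: "carrier ?Q = ?p ` carrier A" using q(1) by (simp add: ss)
 have pl: "kspace ?Q" "klinear A ?Q ?p" using q(3) chomD(1)[OF q(4)] by (simp_all add: ss)
 have pl': "klinear A ?Q' ?p" by (rule chomD(1)[OF q(4)])
 have self: "x : ?p x" if "x .: A" for x using that by (simp add: q(2))
 have im: "the_elem (F ` ?p x) = F x" if x: "x .: A" and F: "!!y. y .: A ==> f y = f x ==> F y = F x" for F :: "_ => 'z" and x
 proof -
  have "F y = F x" if "y : ?p x" for y using that F unfolding q(2)[OF x] by blast
  then have "F ` ?p x = {F x}" using self[OF x] by blast
  then show ?thesis by simp
 qed
 obtain i where i: "klinear C A i" "!!x. x .: A ==> f (i (f x)) = f x" using generalized_inverse[OF kA kC fl] by blast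
 note r = kl_comp[OF i(1) pl']
 have ri: "?p (i (f x)) = ?p x" if "x .: A" for x using that i(2) klD(1)[OF i(1)] klD(1)[OF fl] by (simp add: q(6))
 have fac: "tmap ?Q' ?Q' ?p ?p t = tmap ?Q' ?Q' (%x. ?p (i x)) (%x. ?p (i x)) (tmap C C f f t)" if t: "t .: (A ** A)" for t
  by (rule tensor_eq[OF kA kA kl_tmap[OF kA kA q(3) q(3) pl' pl']
     kl_comp[OF kl_tmap[OF kA kA kC kC fl fl] kl_tmap[OF kC kC q(3) q(3) r r]] _ t])
   (simp add: tmap_pure[OF kA kA q(3) q(3) pl' pl'] tmap_pure[OF kA kA kC kC fl fl] tmap_pure[OF kC kC q(3) q(3) r r] klD(1)[OF fl] ri)
 have ho: "f (antipode A y) = f (antipode A x)" if "x .: A" "y .: A" "f y = f x" for x y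
  using hopf_hom_antipode[OF h that(1)] hopf_hom_antipode[OF h that(2)] that(3) by simp
 have ac: "antipode A x .: A" if "x .: A" for x
  by (rule klD(1)[OF antipode_linear[OF A] that])
 show "hopf_hom G A ?Q ?p"
 proof (rule hopf_transport[OF A Q pl])
  fix x assume x: "x .: A"
  show "comult ?Q (?p x) = tmap ?Q ?Q ?p ?p (comult A x)"
   unfolding d same_space_simps[OF same_crossed_space[OF same_algebra_crossed[OF s]]]
   by (rule im[OF x]) (simp add: fac dA x cohomD(2)[OF hhomD(4)[OF h], symmetric])
  show "counit ?Q (?p x) = counit A x"
   unfolding e by (rule im[OF x]) (simp add: x cohomD(3)[OF hhomD(4)[OF h], symmetric])
  show "antipode ?Q (?p x) = ?p (antipode A x)"
   unfolding an
  proof (rule im[OF x])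
   fix y assume y: "y .: A" "f y = f x"
   show "?p (antipode A y) = ?p (antipode A x)" using ho[OF x y] q(6)[OF ac[OF y(1)] ac[OF x]] by simp
  qed
 next
  fix x y assume xy: "x .: A" "y .: A"
  have "?p (a *.A b) = ?p (x *.A y)" if "a : ?p x" "b : ?p y" for a b
  proof -
   have "a .: A" "f a = f x" "b .: A" "f b = f y" using that by (simp_all add: q(2) xy)
   then show ?thesis using q(6) aA xy by (simp add: ahomD(3)[OF hhomD(3)[OF h]])
  qed
  from UN2_const[OF self[OF xy(1)] self[OF xy(2)] this]
  show "?p x *.?Q ?p y = ?p (x *.A y)"
   unfolding ss by (simp add: crossed_quotient_def FactRing_def rcoset_mult_def)
 next
  show "1@?Q = ?p 1@A" unfolding ss by (simp add: crossed_quotient_def FactRing_def)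
 qed (simp_all add: ss chomD(2,3)[OF q(4)])
 show "?p x = 0@?Q \<longleftrightarrow> f x = 0@C" if x: "x .: A"
  using q(6)[OF x ks_closed(1)[OF kA]] klD(4)[OF pl(2) kA pl(1)] klD(4)[OF fl kA kC] by simp
qed

text \<open>The inclusion of I in C has a linear retraction, so I\<otimes>I embeds in C\<otimes>C
  and the definite description of the coproduct has at most one candidate. A candidate is
  f\<otimes>f applied to the coproduct of a preimage.\<close>

lemma sub_hopf:
 fixes A :: "('k::field, 'g, 'a, 'm) bhopf" and C :: "('k, 'g, 'b, 'n) bhopf"
 assumes h: "hopf_hom G A C f"
 defines "I \<equiv> f ` carrier A"
 shows "hopf_hom G A (sub_hopf C I) f" "carrier (sub_hopf C I) = f ` carrier A" "hopf_hom G (sub_hopf C I) C (%x. x)"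
  "0@(sub_hopf C I) = 0@C" "hopf_subalgebra G C I"
proof -
 note A = hhomD(1)[OF h] and C = hhomD(2)[OF h] and fl = hhomD(6)[OF h]
 note kA = hopfD(5)[OF A] and kC = hopfD(5)[OF C] and mA = hopfD(4)[OF A] and aA = hopfD(2)[OF A]
 note fc = hhomD(5)[OF h] and fa = hhomD(3)[OF h] and fh = hhomD(4)[OF h]
 note dA = coalgD(8)[OF hopfD(3)[OF A]]
 note fD = klD[OF fl] and [simp] = kA kC mA aA
 let ?B = "sub_hopf C I" and ?B' = "C\<lparr>carrier := I\<rparr>"
 have s: "same_algebra ?B ?B'" and d: "comult ?B x = (THE t. t .: (?B' ** ?B') \<and> tmap C C (%y. y) (%y. y) t = comult C x)"
  and e: "counit ?B = counit C" and an: "antipode ?B = antipode C" for x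
  by (simp_all add: sub_hopf_def Let_def same_algebra_def same_crossed_def same_space_def)
 note ss = same_algebra_simps[OF s]
 show B: "carrier ?B = f ` carrier A" and z: "0@?B = 0@C" unfolding ss by (simp_all add: I_def)
 have pl: "kspace ?B" "klinear A ?B f"
  by (rule kspace_transport[OF kA B]; simp add: ss fD)+
 have pl': "kspace ?B'" "klinear A ?B' f" using pl by (simp_all add: ss)
 have incl: "klinear ?B' C (%y. y)" by (rule klI) (auto simp: I_def fD(1))
 note kB = pl'(1)
 have fI: "f x : I" if "x .: A" for x using that by (simp add: I_def)
 note ti = kl_tmap[OF kB kB kC kC incl incl]
 have inj: "t = u" if t: "t .: (?B' ** ?B')" and u: "u .: (?B' ** ?B')"
  and eq: "tmap C C (%y. y) (%y. y) t = tmap C C (%y. y) (%y. y) u" for t u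
 proof -
  obtain i where i: "klinear C ?B' i" "!!x. x .: ?B' ==> i x = x" using generalized_inverse[OF kB kC incl] by blast
  note tr = kl_tmap[OF kC kC kB kB i(1) i(1)]
  have "tmap ?B' ?B' i i (tmap C C (%y. y) (%y. y) t) = t" if t: "t .: (?B' ** ?B')" for t
   by (rule tensor_eq[OF kB kB kl_comp[OF ti tr] kl_id _ t])
    (use klD(1)[OF incl] i(2) in \<open>simp add: tmap_pure[OF kB kB kC kC incl incl] tmap_pure[OF kC kC kB kB i(1) i(1)]\<close>)
  from this[OF t, unfolded eq] this[OF u] show ?thesis by (rule trans[OF sym])
 qed
 note tf = kl_tmap[OF kA kA kB kB pl'(2) pl'(2)]
 have dd: "comult ?B (f x) = tmap ?B' ?B' f f (comult A x)" and di: "tmap C C (%y. y) (%y. y) (comult ?B (f x)) = comult C (f x)"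
  if x: "x .: A" for x
 proof -
  let ?t = "tmap ?B' ?B' f f (comult A x)"
  have t: "?t .: (?B' ** ?B')" by (rule klD(1)[OF tf dA[OF x]])
  have "tmap C C (%y. y) (%y. y) ?t = tmap C C f f (comult A x)"
   by (rule tensor_eq[OF kA kA kl_comp[OF tf ti] kl_tmap[OF kA kA kC kC fl fl] _ dA[OF x]])
    (simp add: tmap_pure[OF kA kA kB kB pl'(2) pl'(2)] tmap_pure[OF kB kB kC kC incl incl] tmap_pure[OF kA kA kC kC fl fl] fI)
  then have te: "tmap C C (%y. y) (%y. y) ?t = comult C (f x)" using cohomD(2)[OF fh x] by simp
  show *: "comult ?B (f x) = ?t"
   unfolding d
  proof (rule the_equality)
   fix u assume "u .: (?B' ** ?B') \<and> tmap C C (%y. y) (%y. y) u = comult C (f x)"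
   with inj[OF _ t] te show "u = ?t" by simp
  qed (use t te in simp)
  show "tmap C C (%y. y) (%y. y) (comult ?B (f x)) = comult C (f x)" unfolding * by (rule te)
 qed
 show hB: "hopf_hom G A ?B f"
 proof (rule hopf_transport[OF A B pl])
  fix x assume x: "x .: A"
  show "comult ?B (f x) = tmap ?B ?B f f (comult A x)"
   using dd[OF x] by (simp add: same_space_simps[OF same_crossed_space[OF same_algebra_crossed[OF s]]])
 qed (simp_all add: ss e an chomD[OF fc] ahomD(2,3)[OF fa] cohomD(3)[OF fh] hopf_hom_antipode[OF h])
 have ia: "algebra_hom G ?B C (%x. x)" by (rule algebra_hom_descend[OF aA hhomD(3)[OF hB] B fa]) simp
 have "crossed_hom G ?B C (%x. x)" by (rule ahomD(1)[OF ia])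
 then have ic: "coalgebra_hom G ?B C (%x. x)" by (auto simp: coalgebra_hom_def B di e)
 with ia show hi: "hopf_hom G ?B C (%x. x)" using C hhomD(2)[OF hB] by (simp add: hopf_hom_def)
 have Ic: "I \<subseteq> carrier C" using fD(1) by (auto simp: I_def)
 have "crossed_submodule G C I"
  unfolding crossed_submodule_def submodule_iff[OF kC]
 proof (intro conjI ballI allI)
  show "0@C : I" using fI[OF ks_closed(1)[OF kA]] fD(4)[OF kA kC] by simp
  show "act C g u : I" "coact C g u : I" if "g .: G" "u : I" for g u
   using that chomD(2,3)[OF fc, symmetric] by (auto simp: I_def)
 qed (use Ic in \<open>auto simp: I_def fD(2,3)[symmetric]\<close>)
 moreover have "1@C : I" using fI[OF ba_simps(3)[OF aA]] ahomD(2)[OF fa] by simp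
 moreover have "x *.C y : I" if "x : I" "y : I" for x y
  using that by (auto simp: I_def ahomD(3)[OF fa, symmetric])
 moreover have "comult C x : lspan (C ** C) {pure C C y z |y z. y : I \<and> z : I}" if x: "x : I" for x
 proof -
  let ?X = "{pure C C y z |y z. y : I \<and> z : I}"
  have kCC: "kspace (C ** C)" by simp
  have X: "?X \<subseteq> carrier (C ** C)" by (auto simp: subsetD[OF Ic])
  note L = submodule_lspan[OF kCC X, unfolded submodule_iff[OF kCC]]
  have "tmap C C f f t : lspan (C ** C) ?X" if "t .: (A ** A)" for t
   using that
  proof (induction rule: tensor_induct[OF kA kA, consumes 1, case_names pure add])
   case (pure u w)
   then have "pure C C (f u) (f w) : ?X" by (auto simp: I_def)
   then show ?case using pure by (simp add: tmap_pure[OF kA kA kC kC fl fl] lspan_base)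
  qed (use L in \<open>simp add: klD(2)[OF kl_tmap[OF kA kA kC kC fl fl]]\<close>)
  then show ?thesis using x cohomD(2)[OF fh] dA by (auto simp: I_def)
 qed
 moreover have "antipode C x : I" if "x : I" for x
  using that klD(1)[OF antipode_linear[OF A]] by (auto simp: I_def hopf_hom_antipode[OF h, symmetric])
 ultimately show "hopf_subalgebra G C I" unfolding hopf_subalgebra_def by blast
qed

section \<open>The quantum symmetrizer\<close>

text \<open>A choice among Hopf maps that fix letters; by \<open>free_hom_unique\<close> all of them
  agree on the carrier.\<close>

definition symmetrizer :: "('k::field, 'g, 'v, 'm) cmod => ('k, 'v) tens_pow => ('k, 'v) tens_pow" where
 "symmetrizer V = (SOME S. hopf_hom G (free_hopf G V) (cofree_hopf G V) S \<and> (\<forall>v\<in>carrier V. S (word V [v]) = word V [v]))"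

lemma hopf_functor_TV_map:
 assumes "!!V :: ('k::field, 'g, 'v) crossed_module. crossed_module G V ==> braided_hopf_algebra G (F V) \<and> carrier (F V) = carrier (TV G V)"
  and h: "!!(V :: ('k, 'g, 'v) crossed_module) W f. [|crossed_module G V; crossed_module G W; crossed_hom G V W f|] ==> hopf_hom G (F V) (F W) (TV_map V W f)"
 shows "hopf_functor G F TV_map"
 unfolding hopf_functor_def
proof (intro conjI allI impI ballI)
 fix V :: "('k, 'g, 'v) crossed_module" and x assume V: "crossed_module G V" and "x .: (F V)"
 then have x: "x .: (TV G V)" using assms(1) by simp
 show "TV_map V V (%v. v) x = x"
  by (rule TV_eq[OF V TV_map(1)[OF V V crossed_hom_id] kl_id _ x]) (simp add: TV_map(2)[OF V V crossed_hom_id])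
next
 fix U V W :: "('k, 'g, 'v) crossed_module" and f g x
 assume *: "crossed_module G U \<and> crossed_module G V \<and> crossed_module G W \<and> crossed_hom G U V f \<and> crossed_hom G V W g" and "x .: (F U)"
 then have U: "crossed_module G U" and V: "crossed_module G V" and W: "crossed_module G W" and f: "crossed_hom G U V f" and g: "crossed_hom G V W g"
  and x: "x .: (TV G U)" using assms(1) by simp_all
 note gf = crossed_hom_comp[OF f g]
 have ml: "map f us .:: V" if "us .:: U" for us
  using that klD(1)[OF chomD(1)[OF f]] by (auto simp: lists_eq_set)
 show "TV_map U W (%u. g (f u)) x = TV_map V W g (TV_map U V f x)"
  by (rule TV_eq[OF U TV_map(1)[OF U W gf] kl_comp[OF TV_map(1)[OF U V f] TV_map(1)[OF V W g]] _ x])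
   (simp add: TV_map(2)[OF U W gf] TV_map(2)[OF U V f] TV_map(2)[OF V W g] ml o_def)
qed (use assms in auto)

context
 fixes V :: "('k::field, 'g, 'v, 'm) cmod"
 assumes V: "crossed_module G V"
begin

text \<open>A word of one letter has only two cuts, so letters are primitive in C(V) and the
  universal property \<open>free_hom\<close> applies.\<close>

lemma symmetrizer:
 shows "hopf_hom G (free_hopf G V) (cofree_hopf G V) (symmetrizer V)" (is ?g1) "v .: V ==> symmetrizer V (word V [v]) = word V [v]" (is "PROP ?g2")
proof -
 note f = free_hopf[OF V] and c = cofree_hopf[OF V]
 note [simp] = T_facts[OF V] letter(2)[OF V]
 have l: "crossed_hom G V (cofree_hopf G V) (%v. word V [v])" using letter_crossed[OF V] by (simp add: cofree_simps[OF V])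
 have "comult (cofree_hopf G V) (word V [v]) = prim_elt (cofree_hopf G V) (word V [v])" if v: "v .: V" for v
  using dec_rec(2)[OF V v, of "1@(TV G V)"] v
  by (simp add: cofree_simps[OF V] prim_elt_def dec_rec(1)[OF V] lmult(2)[OF V] ba_ring[OF T_facts(4)[OF V]] ks_ac(2)[OF kspace_tensor[OF T_facts(2,2)[OF V]]])
 from free_hom[OF V hopfD(1)[OF c(6)] l this]
 have "\<exists>S. hopf_hom G (free_hopf G V) (cofree_hopf G V) S \<and> (\<forall>v\<in>carrier V. S (word V [v]) = word V [v])"
  using f(4) c(6) by (auto simp: hopf_hom_def)
 from someI_ex[OF this, folded symmetrizer_def]
 show ?g1 "PROP ?g2" by simp_all
qed

lemma free_hom_linear: "klinear (free_hopf G V) R h ==> klinear (TV G V) R h"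
 by (simp add: free_simps[OF V])

text \<open>An induction on word length, shared by the symmetrizer and by the map from A(V) onto
  another Nichols algebra.\<close>

lemma hom_degree:
 assumes h: "algebra_hom G (free_hopf G V) R h" and R: "kspace R" and D: "!!n. submodule (D n) scalars R"
  and D1: "1@R : D 0" "!!v. v .: V ==> h (word V [v]) : D 1"
  and Dm: "!!m n x y. x : D m ==> y : D n ==> x *.R y : D (m + n)"
  and t: "t : tens_degree V n"
 shows "h t : D n"
proof (rule klinear_degree_mem[OF V free_hom_linear[OF ahomD(4)[OF h]] D R _ t])
 fix vs assume "vs .:: V" "length vs = n"
 then show "h (word V vs) : D n"
 proof (induction vs arbitrary: n)
  case Nil
  then show ?case using D1(1) ahomD(2)[OF h] by (simp add: free_simps[OF V] TV_fields(1)[OF V])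
 next
  case (Cons v vs)
  then have v: "v .: V" "vs .:: V" by simp_all
  have "h (word V [v]) *.R h (word V vs) : D (1 + length vs)" by (rule Dm[OF D1(2)[OF v(1)] Cons.IH]) simp
  also have "h (word V [v]) *.R h (word V vs) = h (word V (v # vs))"
   using ahomD(3)[OF h, of "word V [v]" "word V vs"] v letter(2)[OF V] word_closed[OF V]
   by (simp add: free_simps[OF V] letter(5)[OF V])
  finally show ?case using Cons.prems by simp
 qed
qed

lemma symmetrizer_degree: "t : tens_degree V n ==> symmetrizer V t : tens_degree V n"
proof (rule hom_degree[OF hhomD(3)[OF symmetrizer(1)] hopfD(5)[OF cofree_hopf(6)[OF V]]])
 show "submodule (tens_degree V n) scalars (cofree_hopf G V)" for n
  using degree_submodule[OF V, of n] by (simp add: submodule_iff[OF hopfD(5)[OF cofree_hopf(6)[OF V]]] submodule_iff[OF T_facts(2)[OF V]] cofree_simps[OF V])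
qed (use word_degree[OF V] shuffle_degree[OF V cofree_mult[OF V]] in \<open>simp_all add: symmetrizer(2) cofree_simps[OF V] TV_fields(1)[OF V]\<close>)

lemma symmetrizer_filter:
 assumes x: "x .: (TV G V)"
 shows "symmetrizer V (TV_filter V P x) = TV_filter V P (symmetrizer V x)"
proof -
 note sl = free_hom_linear[OF hhomD(6)[OF symmetrizer(1)]]
 have sl: "klinear (TV G V) (TV G V) (symmetrizer V)" using sl by (simp add: cofree_simps[OF V])
 show ?thesis
 proof (rule TV_eq[OF V kl_comp[OF TV_filter(1)[OF V] sl] kl_comp[OF sl TV_filter(1)[OF V]] _ x])
  fix vs assume vs: "vs .:: V"
  show "symmetrizer V (TV_filter V P (word V vs)) = TV_filter V P (symmetrizer V (word V vs))"
   unfolding TV_filter_degree[OF V symmetrizer_degree[OF word_degree[OF V vs refl]]]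
   using klD(4)[OF sl] T_facts[OF V] vs by (simp add: TV_filter(2)[OF V])
 qed
qed

text \<open>In the lowest degree \<open>n \<ge> 2\<close> in which \<open>F\<close> does not vanish on the kernel of \<open>\<Phi>\<close>, the elements of the kernel
 are primitive modulo the kernel of \<open>F \<otimes> F\<close>: the restriction of \<open>F\<close> to degrees below \<open>n\<close> factors through \<open>\<Phi>\<close>.\<close>

lemma hom_kernel_mono:
 assumes \<Phi>: "hopf_hom G (free_hopf G V) R \<Phi>" and F: "hopf_hom G (free_hopf G V) D F"
  and grad: "!!k x. [|x .: (TV G V); \<Phi> x = 0@R|] ==> \<Phi> (TV_filter V (%m. m = k) x) = 0@R"
  and inj: "!!v. [|v .: V; \<Phi> (word V [v]) = 0@R|] ==> v = 0@V"
  and prim: "!!n x. [|n \<ge> 2; x : tens_degree V n; F x : primitives D|] ==> F x = 0@D"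
  and x: "x .: (TV G V)" "\<Phi> x = 0@R"
 shows "F x = 0@D"
proof -
 let ?T = "TV G V" let ?TT = "?T ** ?T" let ?e = "TV_counit G V" and ?D = "free_comult G V"
 note kT = T_facts(2)[OF V] and kR = hopfD(5)[OF hhomD(2)[OF \<Phi>]] and kD = hopfD(5)[OF hhomD(2)[OF F]]
 have kDD: "kspace (D ** D)" and kRR: "kspace (R ** R)" and kTT: "kspace ?TT" using kD kR kT by simp_all
 note [simp] = kT kR kD kDD T_facts(1,3)[OF V]
 note \<Phi>l = free_hom_linear[OF hhomD(6)[OF \<Phi>]] and Fl = free_hom_linear[OF hhomD(6)[OF F]]
 note fs = free_simps[OF V]
 note \<Phi>D = klD[OF \<Phi>l] and FD = klD[OF Fl]
 note [simp] = \<Phi>D(1) FD(1)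
 have F0: "F 0@?T = 0@D" by (rule FD(4)) simp_all
 have F1: "F 1@?T = 1@D" using ahomD(2)[OF hhomD(3)[OF F]] by (simp add: fs)
 have o: "1@D .: D" by (rule ba_simps(3)[OF hopfD(2)[OF hhomD(2)[OF F]]])
 note dT = klD(1)[OF free_comult_rec(1)[OF V]]
 \<comment> \<open>The kernel of \<Phi> is graded by \<open>grad\<close>, so vanishing of F on its
   homogeneous elements below N extends to truncations of arbitrary kernel elements.\<close>
 have sum: "F (TV_filter V (%m. m < N) y) = 0@D"
  if y: "y .: ?T" "\<Phi> y = 0@R" and N: "!!k z. [|k < N; z : tens_degree V k; \<Phi> z = 0@R|] ==> F z = 0@D" for y N
 proof -
  have "F (TV_filter V (%m. m < N) y) = (\<Oplus>\<^bsub>D\<^esub>n\<in>{..<N}. F (TV_filter V (%m. m = n) y))"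
   unfolding TV_filter_sum[OF V y(1)] by (rule kl_finsum[OF Fl]) (use klD(1)[OF TV_filter(1)[OF V]] y in auto)
  also have "\<dots> = 0@D"
   by (rule ks_finsum_zero[OF kD]) (use N TV_filter_in_degree[OF V y(1)] grad[OF y] in simp)
  finally show ?thesis .
 qed
 have main: "F y = 0@D" if "y : tens_degree V n" "\<Phi> y = 0@R" for y n
  using that
 proof (induction n arbitrary: y rule: less_induct)
  case (less n)
  note y = less.prems
  have yT [simp]: "y .: ?T" using y(1) degree_closed(1)[OF V] by blast
  consider "n = 0" | "n = 1" | "n \<ge> 2" by linarith
  then show ?case
  proof cases
   \<comment> \<open>In degree 0, y is its counit times 1, and its counit is that of \<Phi> y =
     0.\<close>
   case 1
   have "y : TV_filtration V 0" using y(1) TV_filtration(4)[OF V order_refl, of n] 1 by blast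
   moreover have "?e y = counit R (\<Phi> y)" using cohomD(3)[OF hhomD(4)[OF \<Phi>], of y] by (simp add: fs)
   ultimately have "y = 0@?T"
    using counit_facts(5)[OF V, of y] counit_props(3)[OF hopfD(3)[OF hhomD(2)[OF \<Phi>]]] y(2) T_facts(4)[OF V] by simp
   then show ?thesis by (simp add: F0)
  next
   case 2
   have e: "y = word V [TV_proj V y]" using TV_proj(3)[OF V yT] TV_filter_degree[OF V y(1)[unfolded 2], of "%m. m = 1"] by simp
   then have "TV_proj V y = 0@V" using inj[OF klD(1)[OF TV_proj(1)[OF V] yT]] y(2) by simp
   then show ?thesis using e letter_zero[OF V] F0 by simp
  next
   case 3
   \<comment> \<open>F truncated to degrees below n. By the induction hypothesis it vanishes on the
     kernel of \<Phi>, so with s a generalised inverse of \<Phi> one has h s \<Phi> = h.\<close>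
   define h where "h = (%y. F (TV_filter V (%m. m < n) y))"
   have hl: "klinear ?T D h" unfolding h_def by (rule kl_comp[OF TV_filter(1)[OF V] Fl])
   obtain s where s: "klinear R ?T s" "!!y. y .: ?T ==> \<Phi> (s (\<Phi> y)) = \<Phi> y" using generalized_inverse[OF kT kR \<Phi>l] by blast
   have hs: "h (s (\<Phi> z)) = h z" if z: "z .: ?T" for z
   proof -
    have sz: "s (\<Phi> z) .: ?T" using klD(1)[OF s(1)] z by simp
    have "h (z +.?T (-1) .*?T s (\<Phi> z)) = 0@D"
     unfolding h_def by (rule sum) (use z sz less.IH in \<open>simp_all add: \<Phi>D s(2) ks_neg\<close>)
    then show ?thesis using z sz klD(1)[OF hl] by (simp add: klD(2,3)[OF hl] ks_diff_zero)
   qed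
   note hsl = kl_comp[OF s(1) hl]
   \<comment> \<open>So h\<otimes>h factors through \<Phi>\<otimes>\<Phi>, which sends the coproduct
     of y to the coproduct of \<Phi> y = 0.\<close>
   have "tmap D D h h (?D y) = tmap D D (%z. h (s z)) (%z. h (s z)) (tmap R R \<Phi> \<Phi> (?D y))"
    by (rule tensor_eq[OF kT kT kl_tmap[OF kT kT kD kD hl hl]
       kl_comp[OF kl_tmap[OF kT kT kR kR \<Phi>l \<Phi>l] kl_tmap[OF kR kR kD kD hsl hsl]] _ dT[OF yT]])
     (simp add: tmap_pure[OF kT kT kD kD hl hl] tmap_pure[OF kT kT kR kR \<Phi>l \<Phi>l] tmap_pure[OF kR kR kD kD hsl hsl] hs)
   also have "tmap R R \<Phi> \<Phi> (?D y) = comult R 0@R" using cohomD(2)[OF hhomD(4)[OF \<Phi>], of y] y(2) by (simp add: fs)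
   also have "\<dots> = 0@(R ** R)" by (rule klD(4)[OF coalgD(7)[OF hopfD(3)[OF hhomD(2)[OF \<Phi>]]] kR kRR])
   finally have hh: "tmap D D h h (?D y) = 0@(D ** D)" using klD(4)[OF kl_tmap[OF kR kR kD kD hsl hsl] kRR kDD] by simp
   let ?u = "%z. ?e z .*D 1@D"
   have ul: "klinear ?T D ?u" by (rule klI) (simp_all add: o klD[OF TV_counit(1)[OF V]] ks_distrib)
   note uD = klD(1)[OF ul] and hD = klD(1)[OF hl]
   note tF = kl_tmap[OF kT kT kD kD Fl Fl] and t1 = kl_tmap[OF kT kT kD kD hl hl]
    and t2 = kl_tmap[OF kT kT kD kD Fl ul] and t3 = kl_tmap[OF kT kT kD kD ul Fl]
   note tp = tmap_pure[OF kT kT kD kD Fl Fl] tmap_pure[OF kT kT kD kD hl hl] tmap_pure[OF kT kT kD kD Fl ul] tmap_pure[OF kT kT kD kD ul Fl]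
   have F00: "F z = ?u z" if "z : tens_degree V 0" for z
   proof -
    have "z : TV_filtration V 0" using that TV_filtration(4)[OF V order_refl, of 0] by blast
    then have "F z = F (?e z .*?T 1@?T)" using counit_facts(5)[OF V] by simp
    then show ?thesis using T_facts(4)[OF V] by (simp add: FD(3) F1)
   qed
   \<comment> \<open>In bidegree (i, j) with i + j = n, the term h\<otimes>h equals F\<otimes>F if i
     and j are positive and is 0 otherwise; the terms with \<open>?u\<close> supply the bidegrees
     (n, 0) and (0, n), which are distinct as n > 0.\<close>
   have split: "tmap D D F F (?D y) = tmap D D h h (?D y) +.(D ** D) (tmap D D F ?u (?D y) +.(D ** D) tmap D D ?u F (?D y))"
   proof (rule klinear_lspan_eq[OF tF kl_add[OF t1 kl_add[OF t2 t3 kDD] kDD] kTT _ free_comult_degree[OF V y(1)] _ kDD])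
    show "{pure ?T ?T a b |a b. \<exists>i j. i + j = n \<and> a : tens_degree V i \<and> b : tens_degree V j} \<subseteq> carrier ?TT"
     by (auto simp: subsetD[OF degree_closed(1)[OF V]])
    fix t assume "t : {pure ?T ?T a b |a b. \<exists>i j. i + j = n \<and> a : tens_degree V i \<and> b : tens_degree V j}"
    then obtain a b i j where t: "t = pure ?T ?T a b" "i + j = n" "a : tens_degree V i" "b : tens_degree V j" by blast
    have [simp]: "a .: ?T" "b .: ?T" using t degree_closed(1)[OF V] by blast+
    have ha: "h a = (if i < n then F a else 0@D)" and hb: "h b = (if j < n then F b else 0@D)"
     unfolding h_def TV_filter_degree[OF V t(3)] TV_filter_degree[OF V t(4)] by (simp_all add: F0)
    have ea: "?u a = (if i = 0 then F a else 0@D)" and eb: "?u b = (if j = 0 then F b else 0@D)"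
     using F00[of a] F00[of b] t counit_facts(4)[OF V] o by auto
    have e2: "pure D D (F a) (?u b) = (if j = 0 then pure D D (F a) (F b) else 0@(D ** D))"
     "pure D D (?u a) (F b) = (if i = 0 then pure D D (F a) (F b) else 0@(D ** D))" unfolding ea eb by simp_all
    have "tmap D D F F t = pure D D (F a) (F b)" "tmap D D h h t = pure D D (h a) (h b)"
     "tmap D D F ?u t = pure D D (F a) (?u b)" "tmap D D ?u F t = pure D D (?u a) (F b)" unfolding t(1) by (simp_all only: tp \<open>a .: ?T\<close> \<open>b .: ?T\<close>)
    then show "tmap D D F F t = tmap D D h h t +.(D ** D) (tmap D D F ?u t +.(D ** D) tmap D D ?u F t)"
     unfolding e2 ha hb using t(2) 3 by (cases "i = 0"; cases "j = 0") simp_all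
   qed
   have pl: "klinear D (D ** D) (%z. pure D D z 1@D)" "klinear D (D ** D) (pure D D 1@D)"
    using kl_pure[OF kD kD] o by blast+
   note L = TV_counit_left[OF V]
   have r: "tmap D D F ?u t = pure D D (F (lin_ext ?T (%(y, z). ?e z .*?T y) t)) 1@D"
    and l: "tmap D D ?u F t = pure D D 1@D (F (lin_ext ?T (%(y, z). ?e y .*?T z) t))" if t: "t .: ?TT" for t
    by (rule tensor_eq[OF kT kT t2 kl_comp[OF kl_comp[OF L(3) Fl] pl(1)] _ t],
      simp add: tp L(4) FD(3) pure_bilinear[OF kD kD] o,
      rule tensor_eq[OF kT kT t3 kl_comp[OF kl_comp[OF L(1) Fl] pl(2)] _ t],
      simp add: tp L(2) FD(3) pure_bilinear[OF kD kD] o)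
   \<comment> \<open>The middle part is 0 and the counit axioms evaluate the other two terms, so F y
     is primitive and falls under \<open>prim\<close>.\<close>
   have "comult D (F y) = tmap D D F F (?D y)" using cohomD(2)[OF hhomD(4)[OF F], of y] by (simp add: fs)
   also have "\<dots> = pure D D (F y) 1@D +.(D ** D) pure D D 1@D (F y)"
    unfolding split hh r[OF dT[OF yT]] l[OF dT[OF yT]] free_counit[OF V yT] by (simp add: o)
   finally have "F y : primitives D" by (simp add: primitives_def)
   then show ?thesis by (rule prim[OF 3 y(1)])
  qed
 qed
 obtain N where "TV_filter V (%m. m < N) x = x" using TV_finite_support[OF V x(1)] by blast
 then show ?thesis using sum[OF x main, of N] by simp
qed

end

lemma algebra_hom_comp: "algebra_hom G A B f ==> algebra_hom G B C g ==> algebra_hom G A C (%x. g (f x))"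
 using crossed_hom_comp klD(1)[OF chomD(1)] by (fastforce simp: algebra_hom_def)

text \<open>Both sides are algebra maps out of A(V) that agree on letters.\<close>

lemma symmetrizer_natural:
 fixes V W :: "('k::field, 'g, 'v, 'm) cmod"
 assumes V: "crossed_module G V" and W: "crossed_module G W" and f: "crossed_hom G V W f" and x: "x .: (TV G V)"
 shows "symmetrizer W (TV_map V W f x) = TV_map V W f (symmetrizer V x)"
proof (rule free_hom_unique[OF V hopfD(2)[OF cofree_hopf(6)[OF W]] algebra_hom_comp[OF hhomD(3)[OF free_hopf_map[OF V W f]] hhomD(3)[OF symmetrizer(1)[OF W]]]
   algebra_hom_comp[OF hhomD(3)[OF symmetrizer(1)[OF V]] hhomD(3)[OF cofree_hopf_map[OF V W f]]] _ x])
 fix v assume v: "v .: V"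
 then show "symmetrizer W (TV_map V W f (word V [v])) = TV_map V W f (symmetrizer V (word V [v]))"
  using klD(1)[OF chomD(1)[OF f] v] by (simp add: symmetrizer(2)[OF V] symmetrizer(2)[OF W] TV_map(2)[OF V W f])
qed

lemma symmetrizer_natural_transformation:
 "natural_transformation G (free_hopf G :: ('k::field, 'g, 'v) crossed_module => _) TV_map (cofree_hopf G) TV_map symmetrizer"
 unfolding natural_transformation_def
proof (intro conjI allI impI ballI)
 show "hopf_functor G (free_hopf G :: ('k, 'g, 'v) crossed_module => _) TV_map"
  by (rule hopf_functor_TV_map) (simp_all add: free_hopf(4) free_simps free_hopf_map)
 show "hopf_functor G (cofree_hopf G :: ('k, 'g, 'v) crossed_module => _) TV_map"
  by (rule hopf_functor_TV_map) (simp_all add: cofree_hopf(6) cofree_simps cofree_hopf_map)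
qed (simp_all add: symmetrizer(1) symmetrizer_natural free_simps)

section \<open>Nichols algebras\<close>

lemma crossed_submodule_module:
 assumes M: "crossed_module G M" and J: "crossed_submodule G M J"
 shows "crossed_module G (M\<lparr>carrier := J\<rparr>)"
proof -
 note s = J[unfolded crossed_submodule_def] and k = cm_kspace[OF M]
 have sub: "submodule J scalars M" using s by blast
 note kJ = submodule_kspace[OF k sub] and sJ = sub[unfolded submodule_iff[OF k]]
 have JM [simp]: "x .: M" if "x : J" for x using sJ that by blast
 have l: "klinear (M\<lparr>carrier := J\<rparr>) M (%x. x)" by (simp add: klinear_def)
 have "(\<Oplus>\<^bsub>M\<lparr>carrier := J\<rparr>\<^esub>g\<in>carrier G. coact M g v) = v" if "v : J" for v
  using kl_finsum[OF l kJ k, of "%g. coact M g v" "carrier G"] s that crossedD(7)[OF M] by simp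
 moreover have "klinear (M\<lparr>carrier := J\<rparr>) (M\<lparr>carrier := J\<rparr>) (act M g)" "klinear (M\<lparr>carrier := J\<rparr>) (M\<lparr>carrier := J\<rparr>) (coact M g)"
  if g: "g .: G" for g
  using s g by - (rule klI; simp add: klD[OF crossedD(2)[OF M g]] klD[OF crossedD(3)[OF M g]])+
 ultimately show ?thesis
  unfolding crossed_module_def
 proof (intro conjI ballI kJ)
  fix g h v assume g: "g .: G" and h: "h .: G" and "v .: (M\<lparr>carrier := J\<rparr>)"
  then have v: "v .: M" by simp
  show "act (M\<lparr>carrier := J\<rparr>) (g \<otimes> h) v = act (M\<lparr>carrier := J\<rparr>) g (act (M\<lparr>carrier := J\<rparr>) h v)"
   using crossedD(5)[OF M g h v] by simp
  show "coact (M\<lparr>carrier := J\<rparr>) g (coact (M\<lparr>carrier := J\<rparr>) h v) = (if g = h then coact (M\<lparr>carrier := J\<rparr>) g v else 0@(M\<lparr>carrier := J\<rparr>))"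
   using crossedD(6)[OF M g h v] by simp
  show "coact (M\<lparr>carrier := J\<rparr>) (g \<otimes> h \<otimes> inv g) (act (M\<lparr>carrier := J\<rparr>) g v) = act (M\<lparr>carrier := J\<rparr>) g (coact (M\<lparr>carrier := J\<rparr>) h v)"
   using crossedD(8)[OF M g h v] conj_cancel[OF g h] by simp
 qed (use crossedD(4)[OF M] in simp_all)
qed

lemma crossed_hom_restrict:
 assumes "crossed_hom G M N f"
 shows "U \<subseteq> carrier M ==> crossed_hom G (M\<lparr>carrier := U\<rparr>) N f" "f ` carrier M \<subseteq> U' ==> crossed_hom G M (N\<lparr>carrier := U'\<rparr>) f"
 using assms by (auto simp: crossed_hom_def klinear_def subset_iff)

lemma filter_sum_hom:
 fixes V :: "('k::field, 'g, 'v, 'm) cmod"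
 assumes V: "crossed_module G V" and h: "klinear (TV G V) R h" and R: "kspace R" and x: "x .: (TV G V)"
 defines "f \<equiv> %n. h (TV_filter V (%m. m = n) x)"
 shows "finite {n. f n \<noteq> 0@R}" (is ?g1) "h x = (\<Oplus>\<^bsub>R\<^esub>n\<in>{n. f n \<noteq> 0@R}. f n)" (is ?g2)
proof -
 note k = T_facts(2)[OF V]
 obtain N where N: "\<forall>n\<ge>N. TV_filter V (%m. m = n) x = 0@(TV G V)" "TV_filter V (%m. m < N) x = x"
  using TV_finite_support[OF V x] by blast
 have fc: "f n .: R" for n using klD(1)[OF h klD(1)[OF TV_filter(1)[OF V] x]] by (simp add: f_def)
 have sub: "{n. f n \<noteq> 0@R} \<subseteq> {..<N}" using N(1) klD(4)[OF h k R] by (force simp: f_def not_le[symmetric])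
 then show ?g1 by (rule finite_subset) simp
 have "h x = h (\<Oplus>\<^bsub>TV G V\<^esub>n\<in>{..<N}. TV_filter V (%m. m = n) x)" using TV_filter_sum[OF V x, of N] N(2) by simp
 also have "\<dots> = (\<Oplus>\<^bsub>R\<^esub>n\<in>{..<N}. f n)"
  unfolding f_def by (rule kl_finsum[OF h k R]) (use klD(1)[OF TV_filter(1)[OF V] x] in auto)
 also have "\<dots> = (\<Oplus>\<^bsub>R\<^esub>n\<in>{n. f n \<noteq> 0@R}. f n)" by (rule ks_finsum_mono_neutral[OF R _ sub]) (use fc in auto)
 finally show ?g2 .
qed

section \<open>Hopf algebras Q with S = j p, p onto and ker S in ker p: the common setting of
  A(V)/ker S and im S\<close>

context
 fixes V :: "('k::field, 'g, 'v, 'm) cmod" and Q :: "('k, 'g, 'q, 'n) bhopf"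
  and p :: "('k, 'v) tens_pow => 'q" and j :: "'q => ('k, 'v) tens_pow"
 assumes V: "crossed_module G V" and p: "hopf_hom G (free_hopf G V) Q p" and Q: "carrier Q = p ` carrier (TV G V)"
  and j: "hopf_hom G Q (cofree_hopf G V) j" and jp: "!!x. x .: (TV G V) ==> j (p x) = symmetrizer V x"
  and ker: "!!x. [|x .: (TV G V); symmetrizer V x = 0@(TV G V)|] ==> p x = 0@Q"
begin

text \<open>The fifth item, injectivity of j: a difference killed by j is the image under p of an
  element killed by S, and hence zero by \<open>ker\<close>.\<close>

lemma image_facts:
 shows "klinear (TV G V) Q p" "klinear Q (TV G V) j" "crossed_hom G (TV G V) Q p" "crossed_hom G Q (TV G V) j"
  "[|x .: Q; y .: Q; j x = j y|] ==> x = y"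
  "p 1@(TV G V) = 1@Q" (is ?g1) "[|s .: (TV G V); t .: (TV G V)|] ==> p (s *.(TV G V) t) = p s *.Q p t" (is "PROP ?g2")
  "s .: (TV G V) ==> counit Q (p s) = TV_counit G V s" (is "PROP ?g3") "x .: Q ==> TV_counit G V (j x) = counit Q x" (is "PROP ?g4")
  "v .: V ==> j (p (word V [v])) = word V [v]" (is "PROP ?g5")
proof -
 note k = T_facts(2)[OF V] and kQ = hopfD(5)[OF hhomD(2)[OF p]]
 show pl: "klinear (TV G V) Q p" by (rule free_hom_linear[OF V hhomD(6)[OF p]])
 show pc: "crossed_hom G (TV G V) Q p" using hhomD(5)[OF p] by (simp add: free_simps[OF V])
 show jc: "crossed_hom G Q (TV G V) j" using hhomD(5)[OF j] by (simp add: cofree_simps[OF V])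
 show jl: "klinear Q (TV G V) j" by (rule chomD(1)[OF jc])
 show ?g1 using ahomD(2)[OF hhomD(3)[OF p]] by (simp add: free_simps[OF V])
 show "PROP ?g2"
  using ahomD(3)[OF hhomD(3)[OF p], of s t] by (simp add: free_simps[OF V])
 show "PROP ?g3"
  using cohomD(3)[OF hhomD(4)[OF p], of s] by (simp add: free_simps[OF V])
 show "PROP ?g4"
  using cohomD(3)[OF hhomD(4)[OF j], of x] by (simp add: cofree_simps[OF V])
 show "PROP ?g5" using jp[OF letter(2)[OF V]] symmetrizer(2)[OF V] by simp
 assume xy: "x .: Q" "y .: Q" "j x = j y"
 let ?d = "x +.Q (-1) .*Q y"
 have d: "?d .: Q" using xy kQ by simp
 then obtain a where a: "a .: (TV G V)" "?d = p a" by (auto simp: Q)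
 have "j ?d = 0@(TV G V)" using xy kQ klD(1)[OF jl] by (simp add: klD(2,3)[OF jl] ks_neg[OF k])
 then have "?d = 0@Q" using jp[OF a(1)] ker[OF a(1)] a(2) by simp
 then show "x = y" using ks_diff_zero[OF kQ xy(1,2)] by simp
qed

lemma letter_image: "p ` tens_degree V 1 = (%v. p (word V [v])) ` carrier V"
proof (intro equalityI subsetI)
 fix y assume "y : p ` tens_degree V 1"
 then obtain x where d: "x : tens_degree V 1" and y: "y = p x" by blast
 have x: "x .: (TV G V)" using d degree_closed(1)[OF V] by blast
 have "x = word V [TV_proj V x]" using TV_proj(3)[OF V x] TV_filter_degree[OF V d, of "%m. m = 1"] by simp
 then show "y : (%v. p (word V [v])) ` carrier V"
  unfolding y by (intro image_eqI[OF _ klD(1)[OF TV_proj(1)[OF V] x]]) simp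
next
 fix y assume "y : (%v. p (word V [v])) ` carrier V"
 then obtain v where "v .: V" "y = p (word V [v])" by blast
 then show "y : p ` tens_degree V 1" using word_degree[OF V, of "[v]" 1] by simp
qed

text \<open>Q carries the image of the grading by length. Components are unique because j maps them
  into the degrees of T(V), where \<open>TV_filter\<close> recovers them, and j is
  injective.\<close>

lemma image_connected_graded: "connected_graded_hopf G Q (%n. p ` tens_degree V n)"
proof -
 let ?T = "TV G V"
 note H = hhomD(2)[OF p] and f = image_facts
 note k = T_facts(2)[OF V] and kQ = hopfD(5)[OF H]
 note [simp] = k kQ T_facts(3,4)[OF V]
 note pl = klD[OF f(1)] and jl = klD[OF f(2)]
 note dc = degree_closed[OF V] and dT = subsetD[OF degree_closed(1)[OF V]]
 have jd: "j x : tens_degree V n" if "x : p ` tens_degree V n" for x n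
  using that symmetrizer_degree[OF V] jp dT by auto
 have gc: "p ` tens_degree V n \<subseteq> carrier Q" for n using pl(1)[OF dT] by blast
 have uniq: "j (f k) = TV_filter V (%m. m = k) (j x)"
  if f: "\<forall>n. f n : p ` tens_degree V n" "finite {n. f n \<noteq> 0@Q}" "x = (\<Oplus>\<^bsub>Q\<^esub>n\<in>{n. f n \<noteq> 0@Q}. f n)" for f x k
 proof -
  let ?F = "{n. f n \<noteq> 0@Q}"
  have fc: "f n .: Q" for n by (rule subsetD[OF gc f(1)[rule_format]])
  note l = kl_comp[OF image_facts(2) TV_filter(1)[OF V, of "%m. m = k"]]
  have fd: "TV_filter V (%m. m = k) (j (f n)) = (if n = k then j (f n) else 0@?T)" for n
   using TV_filter_degree[OF V jd[OF f(1)[rule_format, of n]]] by simp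
  have "TV_filter V (%m. m = k) (j x) = (\<Oplus>\<^bsub>?T\<^esub>n\<in>?F. TV_filter V (%m. m = k) (j (f n)))"
   unfolding f(3) by (rule kl_finsum[OF l kQ _ _ f(2)]) (use fc in auto)
  also have "\<dots> = j (f k)"
  proof (cases "k : ?F")
   case True
   show ?thesis
    by (rule ks_finsum_single[OF k f(2) True]) (simp only: fd if_True simp_thms, rule jl(1)[OF fc], simp only: fd if_False)
  next
   case False
   then have "j (f k) = 0@?T" using jl(4) by simp
   moreover have "(\<Oplus>\<^bsub>?T\<^esub>n\<in>?F. TV_filter V (%m. m = k) (j (f n))) = 0@?T"
    by (rule ks_finsum_zero) (use False in \<open>auto simp: fd\<close>)
   ultimately show ?thesis by simp
  qed
  finally show ?thesis by simp
 qed
 show ?thesis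
  unfolding connected_graded_hopf_def
 proof (intro conjI allI ballI impI)
  show "braided_hopf_algebra G Q" by (rule H)
  show "crossed_submodule G Q (p ` tens_degree V n)" for n
   unfolding crossed_submodule_def submodule_iff[OF kQ]
  proof (intro conjI ballI allI)
   show "p ` tens_degree V n \<subseteq> carrier Q" by (rule gc)
   show "0@Q : p ` tens_degree V n" using pl(4) imageI[OF dc(2), of p n] by simp
   fix u v assume "u : p ` tens_degree V n" "v : p ` tens_degree V n"
   then show "u +.Q v : p ` tens_degree V n" by (auto simp: pl(2)[OF dT dT, symmetric] dc(3))
  next
   fix a u assume "u : p ` tens_degree V n"
   then show "a .*Q u : p ` tens_degree V n" by (auto simp: pl(3)[OF dT, symmetric] dc(4))
  next
   fix g u assume g: "g .: G" and "u : p ` tens_degree V n"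
   then obtain a where a: "a : tens_degree V n" "u = p a" by blast
   have "act ?T g a : tens_degree V n" "coact ?T g a : tens_degree V n"
    using tens_degree_crossed[OF V, of n] g a(1) by (simp_all add: crossed_submodule_def)
   then show "act Q g u : p ` tens_degree V n" "coact Q g u : p ` tens_degree V n"
    using chomD(2,3)[OF f(3) g dT[OF a(1)]] a(2) by (metis imageI)+
  qed
  show "\<exists>!f. (\<forall>n. f n : p ` tens_degree V n) \<and> finite {n. f n \<noteq> 0@Q} \<and> x = (\<Oplus>\<^bsub>Q\<^esub>n\<in>{n. f n \<noteq> 0@Q}. f n)"
   if x: "x .: Q" for x
  proof (rule ex_ex1I)
   obtain a where a: "a .: ?T" "x = p a" using x by (auto simp: Q)
   show "\<exists>f. (\<forall>n. f n : p ` tens_degree V n) \<and> finite {n. f n \<noteq> 0@Q} \<and> x = (\<Oplus>\<^bsub>Q\<^esub>n\<in>{n. f n \<noteq> 0@Q}. f n)"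
    by (rule exI[of _ "%n. p (TV_filter V (%m. m = n) a)"]) (use filter_sum_hom[OF V f(1) kQ a(1)] TV_filter_in_degree[OF V a(1)] a(2) in simp)
  next
   fix f f' assume f: "(\<forall>n. f n : p ` tens_degree V n) \<and> finite {n. f n \<noteq> 0@Q} \<and> x = (\<Oplus>\<^bsub>Q\<^esub>n\<in>{n. f n \<noteq> 0@Q}. f n)"
    and f': "(\<forall>n. f' n : p ` tens_degree V n) \<and> finite {n. f' n \<noteq> 0@Q} \<and> x = (\<Oplus>\<^bsub>Q\<^esub>n\<in>{n. f' n \<noteq> 0@Q}. f' n)"
   show "f = f'"
   proof
    fix n
    have c: "f n .: Q" "f' n .: Q" using subsetD[OF gc conjunct1[OF f, rule_format]] subsetD[OF gc conjunct1[OF f', rule_format]] .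
    have "j (f n) = j (f' n)" using uniq[of f x n, OF conjunct1[OF f]] uniq[of f' x n, OF conjunct1[OF f']] conjunct2[OF f] conjunct2[OF f'] by (simp only:)
    then show "f n = f' n" by (rule image_facts(5)[OF c])
   qed
  qed
  show "x *.Q y : p ` tens_degree V (m + n)" if "x : p ` tens_degree V m" "y : p ` tens_degree V n" for m n x y
   using that degree_mult[OF V] by (auto simp: f(7)[OF dT dT, symmetric])
  show "comult Q x : lspan (Q ** Q) {pure Q Q y z |y z. \<exists>i j. i + j = n \<and> y : p ` tens_degree V i \<and> z : p ` tens_degree V j}"
   if x: "x : p ` tens_degree V n" for n x
  proof -
   obtain a where a: "a : tens_degree V n" "x = p a" using x by blast
   have "tmap Q Q p p (free_comult G V a) : lspan (Q ** Q) {pure Q Q y z |y z. \<exists>i j. i + j = n \<and> y : p ` tens_degree V i \<and> z : p ` tens_degree V j}"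
   proof (rule klinear_lspan[OF kl_tmap[OF k k kQ kQ f(1) f(1)] _ _ _ _ _ free_comult_degree[OF V a(1)]])
    fix t assume "t : {pure ?T ?T y z |y z. \<exists>i j. i + j = n \<and> y : tens_degree V i \<and> z : tens_degree V j}"
    then obtain y z i j where t: "t = pure ?T ?T y z" "i + j = n" "y : tens_degree V i" "z : tens_degree V j" by blast
    show "tmap Q Q p p t : lspan (Q ** Q) {pure Q Q y z |y z. \<exists>i j. i + j = n \<and> y : p ` tens_degree V i \<and> z : p ` tens_degree V j}"
     unfolding t(1) tmap_pure[OF k k kQ kQ f(1) f(1) dT[OF t(3)] dT[OF t(4)]] using t(2-4) by (blast intro: lspan_base)
   qed (auto simp: dT pl(1))
   then show ?thesis using cohomD(2)[OF hhomD(4)[OF p], of a] dT[OF a(1)] a(2) by (simp add: free_simps[OF V])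
  qed
  show "counit Q x = 0" if "n > 0" "x : p ` tens_degree V n" for n x
   using that counit_facts(4)[OF V] by (auto simp: f(8)[OF dT])
  show "antipode Q x : p ` tens_degree V n" if "x : p ` tens_degree V n" for n x
   using that hopf_hom_antipode[OF p, symmetric] free_hopf(5)[OF V] dT by (auto simp: free_simps[OF V])
  show "p ` tens_degree V 0 = {a .*Q 1@Q |a. True}"
  proof -
   have o: "1@?T : tens_degree V 0" using word_degree[OF V, of "[]"] by (simp add: TV_fields(1)[OF V])
   have "p x = TV_counit G V x .*Q 1@Q" if "x : tens_degree V 0" for x
   proof -
    have "x : TV_filtration V 0" using that TV_filtration(4)[OF V order_refl, of 0] by blast
    then have "p x = p (TV_counit G V x .*?T 1@?T)" using counit_facts(5)[OF V] by simp
    then show ?thesis by (simp add: pl(3) f(6))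
   qed
   moreover have "a .*Q 1@Q : p ` tens_degree V 0" for a
    using imageI[OF dc(4)[OF o, of a], of p] by (simp add: pl(3) f(6))
   ultimately show ?thesis by blast
  qed
 qed
qed

text \<open>Letters are primitive in A(V), hence so are their images. Conversely j sends a primitive
  of Q to a primitive of C(V), which is a letter by \<open>cofree_primitive\<close>; injectivity of
  j brings this back to Q.\<close>

lemma image_primitives: "primitives Q = p ` tens_degree V 1"
proof -
 note f = image_facts and k = T_facts(2)[OF V] and kQ = hopfD(5)[OF hhomD(2)[OF p]]
 note [simp] = T_facts[OF V] kQ letter(2)[OF V] klD(1)[OF f(1)] klD(1)[OF f(2)]
 have "p (word V [v]) : primitives Q" if v: "v .: V" for v
  using cohomD(2)[OF hhomD(4)[OF p], of "word V [v]"] v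
  by (simp add: primitives_def free_simps[OF V] free_comult(2)[OF V] prim_elt_def klD(2)[OF kl_tmap[OF k k kQ kQ f(1) f(1)]]
    tmap_pure[OF k k kQ kQ f(1) f(1)] f(6))
 moreover have "x : (%v. p (word V [v])) ` carrier V" if x: "x : primitives Q" for x
 proof -
  have xQ: "x .: Q" and xd: "comult Q x = pure Q Q x 1@Q +.(Q ** Q) pure Q Q 1@Q x" using x by (simp_all add: primitives_def)
  have o: "1@Q .: Q" by (rule ba_simps(3)[OF hopfD(2)[OF hhomD(2)[OF p]]])
  have j1: "j 1@Q = 1@(TV G V)" using ahomD(2)[OF hhomD(3)[OF j]] by (simp add: cofree_simps[OF V])
  have "deconcatenation V (j x) = prim_elt (TV G V) (j x)"
   using cohomD(2)[OF hhomD(4)[OF j] xQ] xQ o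
   by (simp add: cofree_simps[OF V] xd prim_elt_def klD(2)[OF kl_tmap[OF kQ kQ k k f(2) f(2)]] tmap_pure[OF kQ kQ k k f(2) f(2)] j1)
  note c = cofree_primitive(1)[OF V _ this]
  have pc: "TV_proj V (j x) .: V" using klD(1)[OF TV_proj(1)[OF V]] xQ by simp
  have "j x = j (p (word V [TV_proj V (j x)]))" using c xQ f(10)[OF pc] by simp
  then have "x = p (word V [TV_proj V (j x)])" using pc xQ by (intro f(5)) simp_all
  with pc show ?thesis by blast
 qed
 ultimately show ?thesis unfolding letter_image by blast
qed

lemma image_generated: "generated_as_algebra_by Q (p ` tens_degree V 1)"
 unfolding generated_as_algebra_by_def
proof (intro allI impI)
 fix B assume B: "submodule B scalars Q \<and> 1@Q : B \<and> (\<forall>x\<in>B. \<forall>y\<in>B. x *.Q y : B) \<and> p ` tens_degree V 1 \<subseteq> B"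
 note f = image_facts
 note s = conjunct1[OF B, unfolded submodule_iff[OF hopfD(5)[OF hhomD(2)[OF p]]]]
 have "p t : B" if "t .: (TV G V)" for t
  using that
 proof (induction rule: TV_letter_induct[OF V, consumes 1, case_names one step add scale])
  case (step g h v t)
  have "p (word V [v]) : B" using B homogD(2)[OF step(1)] unfolding letter_image by blast
  then show ?case using step B homogD(2)[OF step(1)] homogD(2)[OF step(2)] letter(2)[OF V] by (simp add: f(7))
 qed (use B s in \<open>simp_all add: f(6) klD[OF f(1)]\<close>)
 then show "B = carrier Q" using s by (auto simp: Q)
qed

text \<open>The pair of mutually inverse maps between V and the degree-one part of Q that underlies
  the isomorphisms with V.\<close>

lemma proj_image:
 shows "crossed_hom G Q V (%x. TV_proj V (j x))" "v .: V ==> TV_proj V (j (p (word V [v]))) = v"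
  "crossed_hom G V Q (%v. p (word V [v]))"
 using crossed_hom_comp[OF image_facts(4) TV_proj(4)[OF V]] image_facts(10) TV_proj_rec(2)[OF V]
  crossed_hom_comp[OF letter_crossed[OF V] image_facts(3)] by simp_all

lemma image_nichols: "nichols_algebra G V Q (%n. p ` tens_degree V n)"
 unfolding nichols_algebra_def
proof (intro conjI image_connected_graded image_generated image_primitives)
 have sub: "p ` tens_degree V 1 \<subseteq> carrier Q" unfolding letter_image using klD(1)[OF chomD(1)[OF proj_image(3)]] by blast
 show "crossed_iso G (Q\<lparr>carrier := p ` tens_degree V 1\<rparr>) V"
  unfolding crossed_iso_def
 proof (intro exI conjI)
  show "crossed_hom G (Q\<lparr>carrier := p ` tens_degree V 1\<rparr>) V (%x. TV_proj V (j x))"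
   by (rule crossed_hom_restrict(1)[OF proj_image(1) sub])
  show "bij_betw (%x. TV_proj V (j x)) (carrier (Q\<lparr>carrier := p ` tens_degree V 1\<rparr>)) (carrier V)"
   by (rule bij_betw_byWitness[where f' = "%v. p (word V [v])"]) (auto simp: letter_image proj_image(2) simp del: One_nat_def)
 qed
qed

lemma image_primitive_space: "crossed_iso G V (primitive_space Q)"
 unfolding crossed_iso_def primitive_space_def image_primitives
proof (intro exI conjI)
 show "crossed_hom G V (Q\<lparr>carrier := p ` tens_degree V 1\<rparr>) (%v. p (word V [v]))"
  by (rule crossed_hom_restrict(2)[OF proj_image(3)]) (simp only: letter_image)
 show "bij_betw (%v. p (word V [v])) (carrier V) (carrier (Q\<lparr>carrier := p ` tens_degree V 1\<rparr>))"
  by (rule bij_betw_byWitness[where f' = "%x. TV_proj V (j x)"]) (auto simp: letter_image proj_image(2) simp del: One_nat_def)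
qed

text \<open>The square of J is the kernel, inside J, of the projection to V after j. This projection
  kills products of elements of J by \<open>shuffle_proj\<close>, both counits being 0. Conversely p
  t is its counit times 1, plus the image of the letter of t, plus an element of the square
  (\<open>dec\<close>); for an element of J with zero projection only the last term remains.\<close>

lemma image_indecomposables: "crossed_iso G (indecomposables Q) V"
proof -
 let ?J = "augmentation_ideal Q" let ?JJ = "ideal_prod Q ?J ?J" let ?T = "TV G V"
 let ?\<phi> = "%x. TV_proj V (j x)"
 note f = image_facts and H = hhomD(2)[OF p]
 note kQ = hopfD(5)[OF H] and k = T_facts(2)[OF V] and aQ = hopfD(2)[OF H] and cQ = hopfD(3)[OF H] and mQ = hopfD(4)[OF H]
 note [simp] = kQ k T_facts(1,3,4)[OF V] letter(2)[OF V] aQ mQ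
 note pl = klD[OF f(1)] and jl = klD[OF f(2)] and e = klD[OF coalgD(9)[OF cQ]]
 note [simp] = pl(1) jl(1)
 note ehQ = bialgD(4)[OF hopfD(1)[OF H]]
 have e1: "counit Q 1@Q = 1" using ahomD(2)[OF ehQ] by simp
 have JQ: "x .: Q" "counit Q x = 0" if "x : ?J" for x using that by (simp_all add: augmentation_ideal_def)
 have sub: "crossed_submodule G Q ?J"
  using chomD(2,3)[OF coalgD(3)[OF cQ]] e(4)[OF kQ kspace_unit]
  by (simp add: crossed_submodule_def submodule_iff[OF kQ] augmentation_ideal_def subset_iff e unit_object_def)
 note mJ = crossed_submodule_module[OF mQ sub]
 have z: "0@Q : ?J" using e(4)[OF kQ kspace_unit] by (simp add: augmentation_ideal_def unit_object_def)
 have JJc: "x .: Q" if "x : ?JJ" for x using that by induction (use JQ in auto)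
 have JJ0: "0@Q : ?JJ" using ideal_prod.prod[OF z z, of Q] ba_mult_linear(1)[OF aQ, of "0@Q"] klD(4)[of Q Q] by simp
 have JJs: "a .*Q x : ?JJ" if "x : ?JJ" for a x
  using that
 proof induction
  case (prod i i')
  have "a .*Q i : ?J" using JQ[OF prod(1)] by (simp add: augmentation_ideal_def e)
  from ideal_prod.prod[OF this prod(2), of Q] show ?case using JQ[OF prod(1)] JQ[OF prod(2)] by (simp add: ba_simps(5))
 next
  case (sum x y)
  then show ?case using JJc by (simp add: ks_distrib ideal_prod.sum)
 qed
 have wJ: "p (word V [v]) : ?J" if "v .: V" for v
  using that TV_counit(2)[OF V, of "[v]"] by (simp add: augmentation_ideal_def f(8))
 have w0: "p (word V [0@V]) = 0@Q" using letter_zero[OF V] pl(4) by simp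
 note wl = kl_comp[OF letter_proj[OF V] f(1)]
 have dec: "\<exists>w\<in>?JJ. p t = TV_counit G V t .*Q 1@Q +.Q (p (word V [TV_proj V t]) +.Q w)" if "t .: ?T" for t
  using that
 proof (induction rule: TV_letter_induct[OF V, consumes 1, case_names one step add scale])
  case one
  show ?case by (rule bexI[OF _ JJ0]) (simp add: f(6) counit_facts(1)[OF V] TV_proj_rec(1)[OF V] w0)
 next
  case (step g h v t)
  have [simp]: "v .: V" "t .: ?T" using homogD(2)[OF step(1)] homogD(2)[OF step(2)] by simp_all
  \<comment> \<open>The product v t is split as v (t - counit(t) 1) + counit(t) v, and both factors
    of the first product have image in J.\<close>
  let ?w = "p t +.Q (-1) .*Q (TV_counit G V t .*Q 1@Q)"
  have "?w : ?J" by (simp add: augmentation_ideal_def e f(8) e1)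
  from ideal_prod.prod[OF wJ this, of v Q] have w: "p (word V [v]) *.Q ?w : ?JJ" by simp
  note m = klD[OF ba_mult_linear(1)[OF aQ, of "p (word V [v])"]]
  have "p t = ?w +.Q TV_counit G V t .*Q 1@Q" by (rule ks_add_diff(2)[symmetric]) simp_all
  then have "p (word V [v]) *.Q p t = p (word V [v]) *.Q (?w +.Q TV_counit G V t .*Q 1@Q)" by (rule arg_cong)
  also have "\<dots> = p (word V [v]) *.Q ?w +.Q TV_counit G V t .*Q p (word V [v])"
   by (subst m(2)) (simp_all add: m(3) ba_ring[OF aQ])
  also have "\<dots> = TV_counit G V t .*Q p (word V [v]) +.Q p (word V [v]) *.Q ?w" by (rule ks_ac(2)[OF kQ]) simp_all
  finally show ?case
   by (intro bexI[OF _ w])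
    (simp add: f(7) counit_facts(2)[OF V] TV_proj_rec(3)[OF V] klD(3)[OF letter(1)[OF V]] pl(3))
 next
  case (add s t)
  then obtain w w' where w: "w : ?JJ" "p s = TV_counit G V s .*Q 1@Q +.Q (p (word V [TV_proj V s]) +.Q w)"
   and w': "w' : ?JJ" "p t = TV_counit G V t .*Q 1@Q +.Q (p (word V [TV_proj V t]) +.Q w')" by blast
  note [simp] = add(1,2) JJc[OF w(1)] JJc[OF w'(1)] klD(1)[OF wl]
  show ?case
   by (rule bexI[OF _ ideal_prod.sum[OF w(1) w'(1)]])
    (simp add: pl(2) w(2) w'(2) klD(2)[OF TV_counit(1)[OF V]] klD(2)[OF wl] ks_distrib ks_ac[OF kQ])
 next
  case (scale a t)
  then obtain w where w: "w : ?JJ" "p t = TV_counit G V t .*Q 1@Q +.Q (p (word V [TV_proj V t]) +.Q w)" by blast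
  note [simp] = scale(1) JJc[OF w(1)] klD(1)[OF wl]
  show ?case
   by (rule bexI[OF _ JJs[OF w(1), of a]])
    (simp add: pl(3) w(2) klD(3)[OF TV_counit(1)[OF V]] klD(3)[OF wl] ks_distrib)
 qed
 note \<phi>l = klD[OF chomD(1)[OF proj_image(1)]]
 have \<phi>0: "?\<phi> x = 0@V" if "x : ?JJ" for x
  using that
 proof induction
  case (prod i i')
  note i = JQ[OF prod(1)] and i' = JQ[OF prod(2)]
  have "j (i *.Q i') = cofree_mult G V (pure ?T ?T (j i) (j i'))"
   using ahomD(3)[OF hhomD(3)[OF j] i(1) i'(1)] by (simp add: cofree_simps[OF V])
  then show ?case
   using shuffle_proj[OF V cofree_mult[OF V], of "j i" "j i'"] i i' klD(1)[OF TV_proj(1)[OF V]] by (simp add: f(9))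
 next
  case (sum x y)
  then show ?case using JJc \<phi>l(2) by simp
 qed
 have ker: "?JJ = {x : carrier (Q\<lparr>carrier := ?J\<rparr>). ?\<phi> x = 0@V}"
 proof (intro equalityI subsetI)
  fix x assume x: "x : ?JJ"
  have "x : ?J"
   using x
  proof induction
   case (prod i i')
   note i = JQ[OF prod(1)] and i' = JQ[OF prod(2)]
   then show ?case using ahomD(3)[OF ehQ i(1) i'(1)] by (simp add: augmentation_ideal_def)
  next
   case (sum x y)
   then show ?case using e(2)[of x y] by (simp add: augmentation_ideal_def)
  qed
  then show "x : {x : carrier (Q\<lparr>carrier := ?J\<rparr>). ?\<phi> x = 0@V}" using \<phi>0[OF x] by simp
 next
  fix x assume "x : {x : carrier (Q\<lparr>carrier := ?J\<rparr>). ?\<phi> x = 0@V}"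
  then have x: "x : ?J" "?\<phi> x = 0@V" by simp_all
  obtain t where t: "t .: ?T" "x = p t" using JQ(1)[OF x(1)] by (auto simp: Q)
  have S: "symmetrizer V t .: ?T" using jp[OF t(1)] t jl(1)[of "p t"] by simp
  have pt: "TV_proj V t .: V" by (rule klD(1)[OF TV_proj(1)[OF V] t(1)])
  \<comment> \<open>S commutes with the projection onto degree one and fixes letters, so t and S t
    have the same letter.\<close>
  have "word V [TV_proj V (symmetrizer V t)] = word V [TV_proj V t]"
   using symmetrizer_filter[OF V t(1), of "%m. m = 1"] TV_proj(3)[OF V t(1)] TV_proj(3)[OF V S] symmetrizer(2)[OF V pt] by simp
  then have "word V [TV_proj V t] = 0@?T" using x(2) t jp letter_zero[OF V] by simp
  moreover have "TV_counit G V t = 0" using JQ(2)[OF x(1)] t f(8) by simp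
  moreover obtain w where w: "w : ?JJ" "p t = TV_counit G V t .*Q 1@Q +.Q (p (word V [TV_proj V t]) +.Q w)" using dec[OF t(1)] by blast
  ultimately have "p t = w" using JJc[OF w(1)] pl(4) by simp
  then show "x : ?JJ" using w(1) t(2) by simp
 qed
 let ?M = "Q\<lparr>carrier := ?J\<rparr>" let ?c = "%x. ?JJ +>\<^bsub>?M\<^esub> x"
 have \<phi>h: "crossed_hom G ?M V ?\<phi>" by (rule crossed_hom_restrict(1)[OF proj_image(1)]) (use JQ(1) in blast)
 note q = quotient_kernel[OF mJ T_facts(1)[OF V] \<phi>h ker]
 \<comment> \<open>The map induced on cosets, evaluated at a chosen representative; all
   representatives give the same value because cosets are fibres.\<close>
 define F where "F c = ?\<phi> (SOME x. x .: ?M \<and> ?c x = c)" for c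
 have F: "F (?c x) = ?\<phi> x" if x: "x .: ?M" for x
 proof -
  have "(SOME y. y .: ?M \<and> ?c y = ?c x) .: ?M \<and> ?c (SOME y. y .: ?M \<and> ?c y = ?c x) = ?c x"
   by (rule someI[of _ x]) (simp add: x[simplified])
  then show ?thesis unfolding F_def using q(6)[OF _ x] by blast
 qed
 have "crossed_hom G (crossed_quotient ?M ?JJ) V F" by (rule crossed_descend[OF mJ q(4) q(1) \<phi>h F])
 moreover have "bij_betw F (carrier (crossed_quotient ?M ?JJ)) (carrier V)"
 proof (rule bij_betw_byWitness[where f' = "%v. ?c (p (word V [v]))"])
  have v: "p (word V [v]) .: ?M" "?\<phi> (p (word V [v])) = v" if "v .: V" for v using wJ[OF that] proj_image(2)[OF that] by simp_all
  show "\<forall>v\<in>carrier V. F (?c (p (word V [v]))) = v" using F[OF v(1)] v(2) by simp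
  show "(%v. ?c (p (word V [v]))) ` carrier V \<subseteq> carrier (crossed_quotient ?M ?JJ)" unfolding q(1) using v(1) by blast
  have \<phi>c: "?\<phi> x .: V" if "x .: ?M" for x using klD(1)[OF chomD(1)[OF \<phi>h] that] .
  show "\<forall>c\<in>carrier (crossed_quotient ?M ?JJ). ?c (p (word V [F c])) = c"
  proof
   fix c assume "c .: (crossed_quotient ?M ?JJ)"
   then obtain x where x: "x .: ?M" "c = ?c x" unfolding q(1) by blast
   show "?c (p (word V [F c])) = c"
    unfolding x(2) F[OF x(1)] using q(6)[OF v(1)[OF \<phi>c[OF x(1)]] x(1)] v(2)[OF \<phi>c[OF x(1)]] by simp
  qed
  show "F ` carrier (crossed_quotient ?M ?JJ) \<subseteq> carrier V"
  proof
   fix v assume "v : F ` carrier (crossed_quotient ?M ?JJ)"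
   then obtain x where x: "x .: ?M" "v = F (?c x)" unfolding q(1) by blast
   then show "v .: V" using F[OF x(1)] \<phi>c[OF x(1)] by simp
  qed
 qed
 ultimately show ?thesis unfolding crossed_iso_def indecomposables_def Let_def by blast
qed

end

end

section \<open>Uniqueness of the Nichols algebra, and the ideal generated by primitives\<close>

lemma ex1_unique: "\<exists>!x. P x ==> P a ==> P b ==> a = b"
 by blast

lemma ks_finsum_submodule:
 assumes M: "kspace M" and H: "submodule H scalars M" and "finite S" "!!i. i : S ==> f i : H"
 shows "finsum M f S : H"
 using assms(3,4)
proof (induction S)
 case (insert i S)
 note s = H[unfolded submodule_iff[OF M]]
 have "finsum M f (insert i S) = f i +.M finsum M f S"
  by (rule ks_finsum_insert[OF M insert(1,2)]) (use insert(4) s in blast)+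
 then show ?case using insert s by simp
qed (use M H[unfolded submodule_iff[OF M]] in simp)

context finite_comm_group
begin

lemma hom_primitives:
 assumes f: "hopf_hom G A B f" and x: "x : primitives A"
 shows "f x : primitives B"
proof -
 note kA = hopfD(5)[OF hhomD(1)[OF f]] and kB = hopfD(5)[OF hhomD(2)[OF f]] and l = hhomD(6)[OF f]
 note [simp] = kA kB klD(1)[OF l] ba_simps(3)[OF hopfD(2)[OF hhomD(1)[OF f]]]
 show ?thesis
  using x cohomD(2)[OF hhomD(4)[OF f], of x]
  by (simp add: primitives_def klD(2)[OF kl_tmap[OF kA kA kB kB l l]] tmap_pure[OF kA kA kB kB l l] ahomD(2)[OF hhomD(3)[OF f], symmetric])
qed

text \<open>A primitive of C(V) is a letter, and a letter of degree n \<ge> 2 is zero.\<close>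

lemma cofree_primitive_degree:
 assumes V: "crossed_module G V" and "n \<ge> 2" and x: "x : tens_degree V n" and p: "x : primitives (cofree_hopf G V)"
 shows "x = 0@(TV G V)"
proof -
 have xT: "x .: (TV G V)" using x degree_closed(1)[OF V] by blast
 have "x = word V [TV_proj V x]" by (rule cofree_primitive(1)[OF V xT]) (use p in \<open>simp add: primitives_def prim_elt_def cofree_simps[OF V]\<close>)
 also have "\<dots> = 0@(TV G V)" using TV_proj(3)[OF V xT] TV_filter_degree[OF V x, of "%m. m = 1"] assms(2) by simp
 finally show ?thesis .
qed

text \<open>Two quotients of A with equal kernels factor through one another; the gradings
  correspond because both are images of the same family in A.\<close>

lemma kernel_iso:
 assumes p: "hopf_hom G A P p" "carrier P = p ` carrier A" and q: "hopf_hom G A Q q" "carrier Q = q ` carrier A"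
  and ker: "!!x. x .: A ==> p x = 0@P \<longleftrightarrow> q x = 0@Q" and sub: "!!n. D n \<subseteq> carrier A"
 shows "graded_hopf_iso G P (%n. p ` D n) Q (%n. q ` D n)"
proof -
 note kA = hopfD(5)[OF hhomD(1)[OF p(1)]] and kP = hopfD(5)[OF hhomD(2)[OF p(1)]] and kQ = hopfD(5)[OF hhomD(2)[OF q(1)]]
 note pl = klD[OF hhomD(6)[OF p(1)]] and ql = klD[OF hhomD(6)[OF q(1)]]
 obtain f where f: "hopf_hom G P Q f" "!!x. x .: A ==> f (p x) = q x" using hopf_factor[OF p q(1)] ker by blast
 have "inj_on f (carrier P)"
 proof (rule inj_onI)
  fix a b assume "a .: P" "b .: P" and eq: "f a = f b"
  then obtain x y where x: "x .: A" "a = p x" and y: "y .: A" "b = p y" by (auto simp: p(2))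
  have "q (x +.A (-1) .*A y) = 0@Q" using eq f(2) x y kA kQ by (simp add: ql ks_neg[OF kQ])
  then have "p (x +.A (-1) .*A y) = 0@P" using ker x y kA by simp
  then show "a = b" using x y kA pl(1) by (simp add: pl ks_diff_zero[OF kP])
 qed
 moreover have "f ` carrier P = carrier Q" unfolding p(2) q(2) image_image using f(2) by (rule image_cong[OF refl])
 moreover have "f ` p ` D n = q ` D n" for n unfolding image_image using f(2) sub[of n] by (intro image_cong refl) blast
 ultimately show ?thesis using f(1) unfolding graded_hopf_iso_def bij_betw_def by blast
qed

text \<open>The identification of V with degree one of R extends to \<Phi> : A(V) -> R, onto because
  R is generated in degree one. The kernels of \<Phi> and S are graded, both maps are injective on
  V, and on either side a primitive that is the image of an element of degree at least two vanishes.
  So \<open>hom_kernel_mono\<close> applies in both directions, the kernels coincide, and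
  \<open>kernel_iso\<close> concludes.\<close>

lemma nichols_unique:
 fixes R :: "('k::field, 'g, 'r, 'm) bhopf"
 assumes V: "crossed_module G V" and R: "nichols_algebra G V R gR"
  and p: "hopf_hom G (free_hopf G V) Q p" "carrier Q = p ` carrier (TV G V)"
  and ker: "!!x. x .: (TV G V) ==> p x = 0@Q \<longleftrightarrow> symmetrizer V x = 0@(TV G V)"
 shows "graded_hopf_iso G R gR Q (%n. p ` tens_degree V n)"
proof -
 let ?T = "TV G V"
 have cg: "connected_graded_hopf G R gR" and iso: "crossed_iso G (R\<lparr>carrier := gR 1\<rparr>) V"
  and gen: "generated_as_algebra_by R (gR 1)" and pr: "primitives R = gR 1" using R by (simp_all add: nichols_algebra_def)
 have H: "braided_hopf_algebra G R" and sub: "!!n. crossed_submodule G R (gR n)"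
  and ex1: "!!x. x .: R ==> \<exists>!f. (\<forall>n. f n : gR n) \<and> finite {n. f n \<noteq> 0@R} \<and> x = (\<Oplus>\<^bsub>R\<^esub>n\<in>{n. f n \<noteq> 0@R}. f n)"
  and gm: "!!m n x y. x : gR m ==> y : gR n ==> x *.R y : gR (m + n)" and g0: "gR 0 = {a .*R 1@R |a. True}"
  using cg by (simp_all add: connected_graded_hopf_def)
 note kR = hopfD(5)[OF H] and mR = hopfD(4)[OF H] and kT = T_facts(2)[OF V]
 have gs: "submodule (gR n) scalars R" for n using sub[of n] by (simp add: crossed_submodule_def)
 note gs' = gs[unfolded submodule_iff[OF kR]]
 have gc: "gR n \<subseteq> carrier R" and gz: "0@R : gR n" for n using gs'[of n] by simp_all
 \<comment> \<open>An element of \<open>gR m\<close> is its own decomposition; uniqueness of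
   decompositions excludes any other.\<close>
 have uniq: "f n = (if n = m then y else 0@R)"
  if f: "\<forall>n. f n : gR n" "finite {n. f n \<noteq> 0@R}" "y = (\<Oplus>\<^bsub>R\<^esub>n\<in>{n. f n \<noteq> 0@R}. f n)" and y: "y : gR m" for f y m n
 proof -
  let ?f = "%n. if n = m then y else 0@R"
  have yR: "y .: R" using y gc by blast
  have "(\<Oplus>\<^bsub>R\<^esub>n\<in>{n. ?f n \<noteq> 0@R}. ?f n) = (\<Oplus>\<^bsub>R\<^esub>n\<in>{m}. ?f n)"
   by (rule ks_finsum_mono_neutral[OF kR, symmetric]) (use yR kR in auto)
  also have "\<dots> = y" by (rule ks_finsum_single[OF kR]) (use yR in auto)
  finally have s: "y = (\<Oplus>\<^bsub>R\<^esub>n\<in>{n. ?f n \<noteq> 0@R}. ?f n)" by (rule sym)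
  have fin: "finite {n. ?f n \<noteq> 0@R}" by (rule finite_subset[of _ "{m}"]) auto
  have g: "\<forall>n. ?f n : gR n" using y gz by simp
  have "f = ?f" by (rule ex1_unique[OF ex1[OF yR], OF conjI[OF f(1) conjI[OF f(2,3)]] conjI[OF g conjI[OF fin s]]])
  then show ?thesis by (rule fun_cong)
 qed
 obtain \<phi> where \<phi>: "crossed_hom G (R\<lparr>carrier := gR 1\<rparr>) V \<phi>" "bij_betw \<phi> (gR 1) (carrier V)"
  using iso by (auto simp: crossed_iso_def)
 define \<psi> where "\<psi> = inv_into (gR 1) \<phi>"
 have \<psi>: "crossed_hom G V R \<psi>"
 proof (rule crossed_descend[OF crossed_submodule_module[OF mR sub] \<phi>(1)])
  show "carrier V = \<phi> ` carrier (R\<lparr>carrier := gR 1\<rparr>)" using \<phi>(2) by (simp add: bij_betw_def)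
  show "crossed_hom G (R\<lparr>carrier := gR 1\<rparr>) R (%x. x)" by (rule crossed_hom_restrict(1)[OF crossed_hom_id gc])
  show "\<psi> (\<phi> x) = x" if "x .: (R\<lparr>carrier := gR 1\<rparr>)" for x using that \<phi>(2) by (simp add: \<psi>_def bij_betw_def)
 qed
 have \<psi>g: "\<psi> v : gR 1" and \<phi>\<psi>: "\<phi> (\<psi> v) = v" if "v .: V" for v
  using that \<phi>(2) unfolding \<psi>_def by (auto simp: bij_betw_def intro: inv_into_into f_inv_into_f)
 have "comult R (\<psi> v) = prim_elt R (\<psi> v)" if "v .: V" for v
  using \<psi>g[OF that] unfolding pr[symmetric] by (simp add: primitives_def prim_elt_def)
 from free_hom[OF V hopfD(1)[OF H] \<psi> this]
 obtain \<Phi> where \<Phi>: "hopf_hom G (free_hopf G V) R \<Phi>" and \<Phi>w: "!!v. v .: V ==> \<Phi> (word V [v]) = \<psi> v"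
  using free_hopf(4)[OF V] H unfolding hopf_hom_def by blast
 note \<Phi>l = free_hom_linear[OF V hhomD(6)[OF \<Phi>]]
 note \<Phi>D = klD[OF \<Phi>l] and \<Phi>a = hhomD(3)[OF \<Phi>, unfolded free_simps[OF V]]
 have o: "1@R : gR 0" unfolding g0 using ks_simps(3)[OF kR ba_simps(3)[OF hopfD(2)[OF H]]] by (metis (mono_tags, lifting) mem_Collect_eq)
 have \<Phi>g: "\<Phi> x : gR n" if "x : tens_degree V n" for x n
  by (rule hom_degree[OF V hhomD(3)[OF \<Phi>] kR gs o _ gm that]) (simp_all add: \<Phi>w \<psi>g del: One_nat_def)
 have surj: "carrier R = \<Phi> ` carrier ?T"
 proof -
  have "submodule (\<Phi> ` carrier ?T) scalars R"
   unfolding submodule_iff[OF kR]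
  proof (intro conjI ballI allI)
   show "0@R : \<Phi> ` carrier ?T" using imageI[OF ks_closed(1)[OF kT], of \<Phi>] \<Phi>D(4)[OF kT kR] by simp
  qed (use \<Phi>D(1) kT in \<open>auto simp: \<Phi>D(2,3)[symmetric]\<close>)
  moreover have "1@R : \<Phi> ` carrier ?T" using imageI[OF ba_simps(3)[OF T_facts(4)[OF V]], of \<Phi>] ahomD(2)[OF \<Phi>a] by simp
  moreover have "x *.R y : \<Phi> ` carrier ?T" if "x : \<Phi> ` carrier ?T" "y : \<Phi> ` carrier ?T" for x y
   using that ba_simps(4)[OF T_facts(4)[OF V]] by (auto simp: ahomD(3)[OF \<Phi>a, symmetric])
  moreover have "gR 1 \<subseteq> \<Phi> ` carrier ?T"
  proof
   fix x assume x: "x : gR 1"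
   have v: "\<phi> x .: V" using \<phi>(2) x by (auto simp: bij_betw_def)
   have "x = \<Phi> (word V [\<phi> x])" using \<phi>(2) x unfolding \<Phi>w[OF v] by (simp add: \<psi>_def bij_betw_def)
   then show "x : \<Phi> ` carrier ?T" using letter(2)[OF V v] by (rule image_eqI)
  qed
  ultimately show ?thesis using gen unfolding generated_as_algebra_by_def by metis
 qed
 have dec: "\<Phi> (TV_filter V (%m. m = n) x) = (if n = m then \<Phi> x else 0@R)" if x: "x .: ?T" and y: "\<Phi> x : gR m" for x m n
  by (rule uniq[OF _ filter_sum_hom[OF V \<Phi>l kR x] y]) (simp add: \<Phi>g TV_filter_in_degree[OF V x])
 have w0: "v = 0@V" if "v .: V" "\<Phi> (word V [v]) = 0@R" for v
  using \<phi>\<psi>[OF that(1)] that(2) klD(4)[OF chomD(1)[OF \<phi>(1)] submodule_kspace[OF kR gs] T_facts(1)[OF V]] by (simp add: \<Phi>w[OF that(1)])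
 \<comment> \<open>\<Phi> x lies in degree n and, being primitive, in degree 1 of R; as n \<ge> 2
   its components force it to be 0.\<close>
 have Rp: "\<Phi> x = 0@R" if "n \<ge> 2" "x : tens_degree V n" "\<Phi> x : primitives R" for n x
 proof -
  have x: "x .: ?T" using that(2) degree_closed(1)[OF V] by blast
  show ?thesis using dec[OF x \<Phi>g[OF that(2)], of 1] dec[OF x, of 1 1] that pr by simp
 qed
 note S = symmetrizer[OF V]
 have Sl: "klinear ?T ?T (symmetrizer V)" using free_hom_linear[OF V hhomD(6)[OF S(1)]] by (simp add: cofree_simps[OF V])
 have "\<Phi> x = 0@R \<longleftrightarrow> symmetrizer V x = 0@?T" if x: "x .: ?T" for x
 proof
  assume z: "\<Phi> x = 0@R"
  have "symmetrizer V x = 0@(cofree_hopf G V)"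
  proof (rule hom_kernel_mono[OF V \<Phi> S(1) _ w0 _ x z])
   show "\<Phi> (TV_filter V (%m. m = k) y) = 0@R" if y: "y .: ?T" "\<Phi> y = 0@R" for k y
    using dec[OF y(1), of k k] gz[of k] y(2) by simp
   show "symmetrizer V y = 0@(cofree_hopf G V)" if "n \<ge> 2" "y : tens_degree V n" "symmetrizer V y : primitives (cofree_hopf G V)" for n y
    using cofree_primitive_degree[OF V that(1) symmetrizer_degree[OF V that(2)] that(3)] by (simp add: cofree_simps[OF V])
  qed
  then show "symmetrizer V x = 0@?T" by (simp add: cofree_simps[OF V])
 next
  assume z: "symmetrizer V x = 0@?T"
  show "\<Phi> x = 0@R"
  proof (rule hom_kernel_mono[OF V S(1) \<Phi> _ _ Rp x])
   show "symmetrizer V (TV_filter V (%m. m = k) y) = 0@(cofree_hopf G V)" if "y .: ?T" "symmetrizer V y = 0@(cofree_hopf G V)" for k y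
    using that klD(4)[OF TV_filter(1)[OF V] kT kT] by (simp add: symmetrizer_filter[OF V] cofree_simps[OF V])
   show "v = 0@V" if "v .: V" "symmetrizer V (word V [v]) = 0@(cofree_hopf G V)" for v
    using that TV_proj_rec(2)[OF V that(1)] klD(4)[OF TV_proj(1)[OF V] kT T_facts(1)[OF V]] by (simp add: S(2) cofree_simps[OF V])
  qed (use z in \<open>simp_all add: cofree_simps[OF V]\<close>)
 qed
 then have "graded_hopf_iso G R (%n. \<Phi> ` tens_degree V n) Q (%n. p ` tens_degree V n)"
  by (intro kernel_iso[OF \<Phi> _ p(1)]) (simp_all add: surj p(2) ker free_simps[OF V] degree_closed(1)[OF V])
 moreover have "\<Phi> ` tens_degree V n = gR n" for n
 proof (intro equalityI subsetI)
  fix y assume y: "y : gR n"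
  obtain x where x: "x .: ?T" "y = \<Phi> x" using subsetD[OF gc y] unfolding surj by blast
  have "y = \<Phi> (TV_filter V (%m. m = n) x)" using dec[OF x(1), of n n] x(2) y by simp
  then show "y : \<Phi> ` tens_degree V n" using TV_filter_in_degree[OF V x(1)] by (rule image_eqI)
 qed (use \<Phi>g in blast)
 ultimately show ?thesis by simp
qed

text \<open>The span of the products a x b is the ideal generated by X, and primitivity makes it a
  Hopf ideal: each term of the coproduct of a x b keeps the middle factor in one of the two tensor
  slots, the counit kills x, and the antipode preserves the span because it is pointwise an iterate
  of \<open>inv_seq\<close>.\<close>

lemma primitive_hopf_ideal:
 fixes A :: "('k::field, 'g, 'a, 'm) bhopf"
 assumes A: "braided_hopf_algebra G A" and X: "X \<subseteq> primitives A"
  and Xc: "!!g x. g .: G ==> x : X ==> act A g x : X" "!!g x. g .: G ==> x : X ==> coact A g x : X"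
  and an: "!!x. x .: A ==> \<exists>n. antipode A x = inv_seq A A (%y. y) n x"
 shows "\<exists>H. hopf_ideal_generated G A X H"
proof -
 note aA = hopfD(2)[OF A] and cA = hopfD(3)[OF A] and mA = hopfD(4)[OF A] and kA = hopfD(5)[OF A] and bA = hopfD(1)[OF A]
 note [simp] = aA kA mA
 let ?AA = "A ** A"
 have kAA: "kspace ?AA" by simp
 \<comment> \<open>Only homogeneous members of X are used as middle factors, so that coaction and
   braiding can be computed from degrees. As X is stable under the coaction, the components of each
   of its elements are available.\<close>
 define Z where "Z = {x : X. \<exists>g. homog A g x}"
 define Y where "Y = {a *.A x *.A b |a x b. a .: A \<and> x : Z \<and> b .: A}"
 define H where "H = lspan A Y"
 have XA: "x .: A" "comult A x = prim_elt A x" if "x : X" for x using that X by (auto simp: primitives_def prim_elt_def)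
 have ZA [simp]: "x .: A" if "x : Z" for x using that XA(1) by (simp add: Z_def)
 have YI: "a *.A x *.A b : Y" if "a .: A" "x : Z" "b .: A" for a x b using that unfolding Y_def by blast
 have YE: "\<exists>a x b. y = a *.A x *.A b \<and> a .: A \<and> x : Z \<and> b .: A" if "y : Y" for y using that unfolding Y_def by blast
 have YA: "Y \<subseteq> carrier A" unfolding Y_def by auto
 have Hs: "submodule H scalars A" unfolding H_def by (rule submodule_lspan[OF kA YA])
 note hs = Hs[unfolded submodule_iff[OF kA]]
 have HA [simp]: "x .: A" if "x : H" for x using hs that by blast
 have YH: "a *.A x *.A b : H" if "a .: A" "x : Z" "b .: A" for a x b
  unfolding H_def by (rule lspan_base[OF YI[OF that]])
 have mem: "f t : B" if f: "klinear A M f" "kspace M" "submodule B scalars M" and y: "!!a x b. [|a .: A; x : Z; b .: A|] ==> f (a *.A x *.A b) : B"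
   and t: "t : H" for M :: "('k, 'z, 'y) vect" and f B t
  by (rule lspan_mem[OF f(1) kA f(2) YA f(3) _ t[unfolded H_def]]) (use YE y in blast)
 have l: "c *.A t : H" if c: "c .: A" and t: "t : H" for c t
 proof (rule mem[OF ba_mult_linear(1)[OF aA c] kA Hs _ t])
  fix a x b assume *: "a .: A" "x : Z" "b .: A"
  have "c *.A (a *.A x *.A b) = c *.A a *.A x *.A b" using * c by (simp add: ba_ring(1)[OF aA])
  then show "c *.A (a *.A x *.A b) : H" using YH[of "c *.A a" x b] * c by simp
 qed
 have r: "t *.A c : H" if c: "c .: A" and t: "t : H" for c t
 proof (rule mem[OF ba_mult_linear(2)[OF aA c] kA Hs _ t])
  fix a x b assume *: "a .: A" "x : Z" "b .: A"
  then show "a *.A x *.A b *.A c : H" using YH[of a x "b *.A c"] c by (simp add: ba_ring(1)[OF aA])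
 qed
 have Zc: "act A g x : Z" if x: "x : Z" and g: "g .: G" for g x
 proof -
  obtain h where "x : X" and h: "homog A h x" using x by (auto simp: Z_def)
  then show ?thesis using Xc(1)[OF g] homog_intros(2)[OF mA h g] unfolding Z_def by blast
 qed
 have XH: "X \<subseteq> H"
 proof
  fix x assume x: "x : X"
  have "coact A g x : H" if g: "g .: G" for g
  proof -
   have z: "coact A g x : Z" using Xc(2)[OF g x] homog_intros(1)[OF mA g XA(1)[OF x]] by (auto simp: Z_def)
   show ?thesis using YH[OF ba_simps(3)[OF aA] z ba_simps(3)[OF aA]] z by (simp add: ba_ring[OF aA])
  qed
  then have "(\<Oplus>\<^bsub>A\<^esub>g\<in>carrier G. coact A g x) : H" by (intro ks_finsum_submodule[OF kA Hs]) simp_all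
  then show "x : H" by (simp add: crossedD(7)[OF mA XA(1)[OF x]])
 qed
 have "crossed_submodule G A H"
  unfolding crossed_submodule_def
 proof (intro conjI Hs ballI)
  fix g t assume g: "g .: G" and t: "t : H"
  show "act A g t : H"
   by (rule mem[OF crossedD(2)[OF mA g] kA Hs _ t]) (use g Zc YH in \<open>simp add: ba_crossed(1)[OF aA]\<close>)
  show "coact A g t : H"
  proof (rule mem[OF crossedD(3)[OF mA g] kA Hs _ t])
   note cl = klD(2)[OF crossedD(3)[OF mA g]]
   fix a x b assume a: "a .: A" and x: "x : Z" and b: "b .: A"
   then obtain h where h: "homog A h x" by (auto simp: Z_def)
   from mA a have "\<forall>b\<in>carrier A. coact A g (a *.A x *.A b) : H"
   proof (induction rule: homog_induct)
    case a: (homog i a)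
    show ?case
    proof
     fix b assume "b .: A"
     with mA show "coact A g (a *.A x *.A b) : H"
     proof (induction rule: homog_induct)
      case b: (homog k b)
      show ?case
       using homog_coact[OF mA ba_crossed(2)[OF aA ba_crossed(2)[OF aA a h] b] g] YH[OF homogD(2)[OF a] x homogD(2)[OF b]] hs by simp
     next
      case (add b b')
      then show ?case using hs x homogD(2)[OF a] by (simp add: ba_ring[OF aA] cl)
     qed
    qed
   next
    case (add a a')
    then show ?case using hs x by (simp add: ba_ring[OF aA] cl)
   qed
   then show "coact A g (a *.A x *.A b) : H" using b by blast
  qed
 qed
 moreover have "ideal H A"
  by (rule idealI[OF balgD(2)[OF aA] submodule.axioms(1)[OF Hs]]) (use l r in auto)
 moreover have dH: "comult A t : lspan ?AA ({pure A A y z |y z. y : H \<and> z .: A} \<union> {pure A A y z |y z. y .: A \<and> z : H})"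
  (is "_ : lspan ?AA ?X") if t: "t : H" for t
 proof -
  have Xs: "?X \<subseteq> carrier ?AA" by auto
  have Ls: "submodule (lspan ?AA ?X) scalars ?AA" by (rule submodule_lspan[OF kAA Xs])
  note ls = Ls[unfolded submodule_iff[OF kAA]]
  let ?m = "%s t. s *.(tensor_algebra G A A) t"
  note mb = ta_mult(1)[OF aA]
  show ?thesis
  proof (rule mem[OF coalgD(7)[OF cA] kAA Ls _ t])
   fix a x b assume a: "a .: A" and x: "x : Z" and b: "b .: A"
   obtain h where h: "homog A h x" using x by (auto simp: Z_def)
   have pc: "prim_elt A x .: ?AA" by (rule klD(1)[OF prim_linear[OF aA]]) (simp add: x)
   \<comment> \<open>For s = u\<otimes>w with w of degree k, multiplying by x\<otimes>1 +
     1\<otimes>x gives u (k x)\<otimes>w + u\<otimes>w x. Multiplication by t from the right then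
     keeps k x or x inside its slot.\<close>
   have st: "?m (?m s (prim_elt A x)) t : lspan ?AA ?X" if s: "s .: ?AA" and t: "t .: ?AA" for s t
    using mA mA s
   proof (induction rule: tensor_homog_induct)
    case (pure i k u w)
    note [simp] = homogD[OF pure(1)] homogD[OF pure(2)] x
    let ?x = "act A k x"
    have x': "?x : Z" by (rule Zc[OF x]) simp
    note [simp] = ZA[OF x']
    have 1: "?m (pure A A u w) (prim_elt A x) = pure A A (u *.A ?x) w +.?AA pure A A u (w *.A x)"
     by (simp add: prim_elt_def klD(2)[OF kbilD(1)[OF mb]] ta_mult(2)[OF aA _ pure(2)] ba_crossed(3)[OF aA] ba_ring[OF aA])
    from t show ?case
    proof (induction rule: tensor_induct[OF kA kA, consumes 1, case_names pure add])
     case c: (pure c d)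
     have "?m (?m (pure A A u w) (prim_elt A x)) (pure A A c d) =
       pure A A (u *.A ?x *.A act A k c) (w *.A d) +.?AA pure A A (u *.A act A (k \<otimes> h) c) (w *.A x *.A d)"
      unfolding 1 using c by (simp add: klD(2)[OF kbilD(2)[OF mb]] ta_mult(2)[OF aA _ pure(2)]
        ta_mult(2)[OF aA _ ba_crossed(2)[OF aA pure(2) h]])
     moreover have "pure A A (u *.A ?x *.A act A k c) (w *.A d) : ?X"
     proof -
      have "u *.A ?x *.A act A k c : H" "w *.A d .: A" using YH[OF _ x', of u "act A k c"] c by simp_all
      then show ?thesis by blast
     qed
     moreover have "pure A A (u *.A act A (k \<otimes> h) c) (w *.A x *.A d) : ?X"
     proof -
      have "w *.A x *.A d : H" "u *.A act A (k \<otimes> h) c .: A" using YH[OF _ x, of w d] c homogD(1)[OF h] by simp_all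
      then show ?thesis by blast
     qed
     ultimately show ?case using ls by (simp only: lspan_base)
    next
     case (add t t')
     have "?m (pure A A u w) (prim_elt A x) .: ?AA" unfolding 1 by simp
     from klD(2)[OF kbilD(1)[OF mb this] add(1,2)] show ?case using add(3,4) ls by simp
    qed
   next
    case (add s s')
    have p: "?m s (prim_elt A x) .: ?AA" "?m s' (prim_elt A x) .: ?AA"
     using klD(1)[OF kbilD(2)[OF mb pc]] add(1,2) by simp_all
    show ?case using add ls klD(2)[OF kbilD(2)[OF mb pc] add(1,2)] klD(2)[OF kbilD(2)[OF mb t] p] by simp
   qed
   note dh = ahomD(3)[OF bialgD(3)[OF bA]]
   have "comult A (a *.A x *.A b) = ?m (?m (comult A a) (prim_elt A x)) (comult A b)"
    using a x b XA(2)[of x] by (simp add: dh Z_def)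
   then show "comult A (a *.A x *.A b) : lspan ?AA ?X"
    using st[OF coalgD(8)[OF cA a] coalgD(8)[OF cA b]] by simp
  qed
 qed
 moreover have eH: "counit A t = 0" if t: "t : H" for t
 proof -
  have "counit A t : {0}"
  proof (rule mem[OF coalgD(9)[OF cA] kspace_unit _ _ t])
   show "submodule {0} scalars (unit_object G)" by (simp add: submodule_iff)
   fix a x b assume *: "a .: A" "x : Z" "b .: A"
   have "counit A x = 0" using counit_primitive[OF bA XA] *(2) by (simp add: Z_def)
   then show "counit A (a *.A x *.A b) : {0}" using * by (simp add: ahomD(3)[OF bialgD(4)[OF bA]])
  qed
  then show ?thesis by simp
 qed
 moreover have "antipode A t : H" if t: "t : H" for t
 proof -
  obtain n where n: "antipode A t = inv_seq A A (%y. y) n t" using an[OF HA[OF t]] by blast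
  \<comment> \<open>On H the convolution unit vanishes, so subtracting it changes nothing there;
    \<open>inv_seq_preserve\<close> is used with the constant family H.\<close>
  have u: "conv_unit A A y = 0@A" if "y : H" for y using eH[OF that] by (simp add: conv_unit_def)
  show ?thesis
   unfolding n
  proof (rule inv_seq_preserve[where X = "%_. H", OF cA aA Hs _ _ t])
   show "conv_unit A A y : H" if "y : H" for y using hs by (simp add: u[OF that])
   fix y \<psi> assume y: "y : H" and \<psi>: "klinear A A \<psi>" and \<psi>H: "!!i y. y : H ==> \<psi> y : H"
   let ?J = "%x. x +.A (-1) .*A conv_unit A A x"
   have J: "klinear A A ?J" by (intro kl_add kl_id kl_scale chomD(1)[OF conv_unit_crossed[OF cA aA]] kA)
   have JH: "?J z = z" if "z : H" for z using that by (simp add: u)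
   show "tconv A ?J \<psi> (comult A y) : H"
   proof (rule lspan_mem[OF tconv_props(1)[OF aA kA kA J \<psi>] kAA kA _ Hs _ dH[OF y]])
    fix s assume "s : {pure A A y z |y z. y : H \<and> z .: A} \<union> {pure A A y z |y z. y .: A \<and> z : H}"
    then obtain y z where s: "s = pure A A y z" "y .: A" "z .: A" "y : H \<or> z : H" by auto
    have "?J y *.A \<psi> z : H" using s(4)
    proof
     assume "y : H"
     then show ?thesis unfolding JH[OF \<open>y : H\<close>] by (rule r[OF klD(1)[OF \<psi> s(3)]])
    next
     assume "z : H"
     then show ?thesis by (rule l[OF klD(1)[OF J s(2)] \<psi>H])
    qed
    then show "tconv A ?J \<psi> s : H" by (simp add: s(1) tconv_props(2)[OF aA kA kA J \<psi> s(2,3)])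
   qed auto
  qed
 qed
 ultimately have "hopf_ideal G A H" unfolding hopf_ideal_def by blast
 moreover have "H \<subseteq> I" if I: "hopf_ideal G A I" "X \<subseteq> I" for I
 proof -
  have i: "ideal I A" and s: "submodule I scalars A" using I(1) by (simp_all add: hopf_ideal_def crossed_submodule_def)
  have "Y \<subseteq> I"
  proof
   fix y assume "y : Y"
   then obtain a x b where y: "y = a *.A x *.A b" "a .: A" "x : Z" "b .: A" using YE by blast
   have "x : I" using y(3) I(2) by (auto simp: Z_def)
   then show "y : I" unfolding y(1) by (intro ideal.I_r_closed[OF i] ideal.I_l_closed[OF i] y)
  qed
  then show ?thesis unfolding H_def by (rule lspan_minimal[OF s])
 qed
 ultimately show ?thesis using XH unfolding hopf_ideal_generated_def by blast
qed

text \<open>The coproduct and x -> x\<otimes>1 + 1\<otimes>x are both crossed maps, so an equality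
  between them at x passes to the images of x under action and coaction; this is the stability that
  \<open>primitive_hopf_ideal\<close> requires.\<close>

lemma free_primitive_ideal:
 fixes V :: "('k::field, 'g, 'v, 'm) cmod"
 assumes V: "crossed_module G V"
 shows "\<exists>H. hopf_ideal_generated G (free_hopf G V) (primitives (free_hopf G V) \<inter> (\<Union>n\<in>{2..}. tens_degree V n)) H"
proof (rule primitive_hopf_ideal)
 let ?A = "free_hopf G V"
 show A: "braided_hopf_algebra G ?A" by (rule free_hopf(4)[OF V])
 note fs = free_simps[OF V]
 obtain s where s: "is_antipode G ?A s" "\<forall>x\<in>carrier ?A. \<exists>n. s x = inv_seq ?A ?A (%y. y) n x"
  using TV_antipode[OF V hopfD(1)[OF A] same_algebra_crossed[OF free_hopf(1)[OF V]]]
  by (simp add: fs degree_mult[OF V] free_comult_degree[OF V]) blast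
 then show "\<exists>n. antipode ?A x = inv_seq ?A ?A (%y. y) n x" if "x .: ?A" for x
  using antipode_unique[OF hopfD(3)[OF A] hopfD(2)[OF A] hopfD(6)[OF A] s(1) that] that by simp
 note pr = chomD(2,3)[OF crossed_hom_diff]
 fix g x assume g: "g .: G" and x: "x : primitives ?A \<inter> (\<Union>n\<in>{2..}. tens_degree V n)"
 have xA: "x .: ?A" and xp: "comult ?A x = prim_elt ?A x" using x by (simp_all add: primitives_def prim_elt_def)
 note mA = hopfD(4)[OF A] and aA = hopfD(2)[OF A]
 have "crossed_hom G ?A (tensor G ?A ?A) (prim_elt ?A)"
 proof (rule crossed_homI[OF mA crossed_module_tensor[OF mA mA]])
  show "klinear ?A (tensor G ?A ?A) (prim_elt ?A)" using prim_linear[OF aA] by simp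
  fix v g h assume v: "homog ?A h v"
  note vA [simp] = homogD[OF v] aA
  show "prim_elt ?A (act ?A g v) = act (tensor G ?A ?A) g (prim_elt ?A v)" if "g .: G"
   using that mA by (simp add: prim_elt_def klD(2)[OF tensor_act(1)[OF mA mA that]] tensor_act(2)[OF mA mA that] ba_crossed(3)[OF aA])
  show "homog (tensor G ?A ?A) h (prim_elt ?A v)"
   using homog_intros(3)[OF crossed_module_tensor[OF mA mA], of h "pure ?A ?A v 1@?A" "pure ?A ?A 1@?A v"]
    homog_pure[OF mA mA v ba_crossed(4)[OF aA]] homog_pure[OF mA mA ba_crossed(4)[OF aA] v] by (simp add: prim_elt_def)
 qed
 note c = chomD(2,3)[OF this g xA] chomD(2,3)[OF coalgD(2)[OF hopfD(3)[OF A]] g xA]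
 have "comult ?A (act ?A g x) = prim_elt ?A (act ?A g x)" "comult ?A (coact ?A g x) = prim_elt ?A (coact ?A g x)" by (simp_all only: c xp)
 moreover have "act ?A g x : (\<Union>n\<in>{2..}. tens_degree V n)" "coact ?A g x : (\<Union>n\<in>{2..}. tens_degree V n)"
  using x g tens_degree_crossed[OF V] by (auto simp: crossed_submodule_def fs)
 ultimately show "act ?A g x : primitives ?A \<inter> (\<Union>n\<in>{2..}. tens_degree V n)" "coact ?A g x : primitives ?A \<inter> (\<Union>n\<in>{2..}. tens_degree V n)"
  using mA g xA by (simp_all add: primitives_def prim_elt_def)
qed simp

end

theorem theorem1p3:
  fixes G :: "('g, 'x) monoid_scheme"
  assumes "comm_group G" and "finite (carrier G)"
  shows "\<exists>S :: ('k::{alg_closed_field, field_char_0}, 'g, 'v) crossed_module \<Rightarrow>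
              ('k, 'v) tens_pow \<Rightarrow> ('k, 'v) tens_pow.
    natural_transformation G (free_hopf G) TV_map (cofree_hopf G) TV_map S \<and>
    (\<forall>V. crossed_module G V \<longrightarrow>
      (let A = free_hopf G V; C = cofree_hopf G V; K = a_kernel A C (S V); I = S V ` carrier A;
           AK = quotient_hopf A K; gAK = (\<lambda>n. (\<lambda>x. K +>\<^bsub>A\<^esub> x) ` tens_degree V n);
           B = sub_hopf C I; gB = (\<lambda>n. S V ` tens_degree V n)
       in (\<forall>v\<in>carrier V. S V (word V [v]) = word V [v]) \<and>
          hopf_ideal G A K \<and> hopf_subalgebra G C I \<and>
          nichols_algebra G V AK gAK \<and> nichols_algebra G V B gB \<and>
          graded_hopf_iso G AK gAK B gB \<and>
          (\<forall>(R :: ('k, 'g, 'r) braided_hopf_algebra) gR.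
             nichols_algebra G V R gR \<longrightarrow> graded_hopf_iso G R gR AK gAK) \<and>
          crossed_iso G (indecomposables B) V \<and> crossed_iso G V (primitive_space B) \<and>
          (\<exists>H. hopf_ideal_generated G A (primitives A \<inter> (\<Union>n\<in>{2..}. tens_degree V n)) H \<and> H \<subseteq> K)))"
proof -
 interpret finite_comm_group G using assms by (simp add: finite_comm_group_def finite_comm_group_axioms_def)
 show ?thesis
 proof (intro exI conjI allI impI)
  show "natural_transformation G (free_hopf G) TV_map (cofree_hopf G) TV_map symmetrizer"
   by (rule symmetrizer_natural_transformation)
  fix V :: "('k, 'g, 'v) crossed_module"
  assume V: "crossed_module G V"
  let ?A = "free_hopf G V" and ?C = "cofree_hopf G V" and ?S = "symmetrizer V"
  let ?K = "a_kernel ?A ?C ?S" and ?I = "?S ` carrier ?A" and ?gB = "%n. ?S ` tens_degree V n"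
  let ?p = "%x. ?K +>\<^bsub>?A\<^esub> x"
  let ?AK = "quotient_hopf ?A ?K" and ?B = "sub_hopf ?C ?I" and ?gA = "%n. ?p ` tens_degree V n"
  note S = symmetrizer[OF V] and fs = free_simps[OF V] and cs = cofree_simps[OF V]
  note q = quotient_hopf[OF S(1)] and b = sub_hopf[OF S(1)]
  have zC: "0@?C = 0@(TV G V)" and cA: "carrier ?A = carrier (TV G V)" by (simp_all add: fs cs)
  \<comment> \<open>The embedding of A(V)/ker S in C(V) induced by S; together with the coset map it
    provides the factorisation of S for the quotient.\<close>
  have "\<exists>f. hopf_hom G ?AK ?C f \<and> (\<forall>x\<in>carrier ?A. f (?p x) = ?S x)"
   by (rule hopf_factor[OF q(1,2) S(1)]) (simp add: q(3))
  then obtain j where j: "hopf_hom G ?AK ?C j" "\<forall>x\<in>carrier ?A. j (?p x) = ?S x" by (elim exE conjE)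
  have n: "nichols_algebra G V ?AK ?gA"
   by (rule image_nichols[OF V q(1) _ j(1)]) (simp_all add: q(2,3) j(2)[rule_format] zC cA)
  have bb: "carrier ?B = ?S ` carrier (TV G V)" "!!x. x .: (TV G V) ==> ?S x = 0@(TV G V) ==> ?S x = 0@?B"
   using b(2,4) by (simp_all add: zC cA)
  \<comment> \<open>For the image the factorisation is S itself followed by the inclusion, so j is
    the identity function.\<close>
  note nB = image_nichols[OF V b(1) bb(1) b(3) refl bb(2)] image_indecomposables[OF V b(1) bb(1) b(3) refl bb(2)]
   image_primitive_space[OF V b(1) bb(1) b(3) refl bb(2)]
  have iso: "graded_hopf_iso G ?AK ?gA ?B ?gB"
   by (rule kernel_iso[OF q(1,2) b(1,2)]) (simp only: q(3) b(4), simp only: cA degree_closed(1)[OF V])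
  have uniq: "graded_hopf_iso G R gR ?AK ?gA" if "nichols_algebra G V R gR" for R :: "('k, 'g, 'r) braided_hopf_algebra" and gR
   by (rule nichols_unique[OF V that q(1)]) (simp_all add: q(2,3) zC cA)
  obtain H where H: "hopf_ideal_generated G ?A (primitives ?A \<inter> (\<Union>n\<in>{2..}. tens_degree V n)) H"
   using free_primitive_ideal[OF V] by blast
  \<comment> \<open>S maps primitives to primitives and preserves degree, and C(V) has no nonzero
    primitives in degree n \<ge> 2.\<close>
  have "primitives ?A \<inter> (\<Union>n\<in>{2..}. tens_degree V n) \<subseteq> ?K"
  proof
   fix x assume x: "x : primitives ?A \<inter> (\<Union>n\<in>{2..}. tens_degree V n)"
   then obtain n where n: "n \<ge> 2" "x : tens_degree V n" by auto
   have "?S x = 0@(TV G V)"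
    by (rule cofree_primitive_degree[OF V n(1) symmetrizer_degree[OF V n(2)] hom_primitives[OF S(1)]]) (use x in blast)
   then show "x : ?K" using x by (simp add: a_kernel_def' zC primitives_def)
  qed
  with hopf_ideal_kernel[OF S(1)] have HK: "H \<subseteq> ?K"
   by (intro conjunct2[OF conjunct2[OF H[unfolded hopf_ideal_generated_def]], rule_format] conjI)
  show "let A = ?A; C = ?C; K = a_kernel A C ?S; I = ?S ` carrier A;
     AK = quotient_hopf A K; gAK = (\<lambda>n. (\<lambda>x. K +>\<^bsub>A\<^esub> x) ` tens_degree V n);
     B = sub_hopf C I; gB = (\<lambda>n. ?S ` tens_degree V n)
   in (\<forall>v\<in>carrier V. ?S (word V [v]) = word V [v]) \<and>
     hopf_ideal G A K \<and> hopf_subalgebra G C I \<and>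
     nichols_algebra G V AK gAK \<and> nichols_algebra G V B gB \<and>
     graded_hopf_iso G AK gAK B gB \<and>
     (\<forall>(R :: ('k, 'g, 'r) braided_hopf_algebra) gR.
      nichols_algebra G V R gR \<longrightarrow> graded_hopf_iso G R gR AK gAK) \<and>
     crossed_iso G (indecomposables B) V \<and> crossed_iso G V (primitive_space B) \<and>
     (\<exists>H. hopf_ideal_generated G A (primitives A \<inter> (\<Union>n\<in>{2..}. tens_degree V n)) H \<and> H \<subseteq> K)"
   unfolding Let_def
   using S(2) by (intro conjI ballI allI impI exI[of _ H] hopf_ideal_kernel[OF S(1)] b(5) n nB iso uniq H HK)
 qed
qed

end
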